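(* Let $E$ be an elliptic curve defined over a number field $\mathcal{K}$. Let $\mathfrak{p}$ be a good prime of $E$, let $\tilde{E}_{\mathfrak{p}}$ be the reduction of $E$ modulo $\mathfrak{p}$, let $\mathbb{F}_{\mathfrak{p}}(\tilde{E}_{\mathfrak{p}})$ be its function field, with constant field $\mathbb{F}_q=\mathbb{F}_{\mathfrak{p}}$, and let $a_{\mathfrak{p}}\in\mathbb{Z}$ be defined by $\#\tilde{E}_{\mathfrak{p}}(\mathbb{F}_{\mathfrak{p}})=1-a_{\mathfrak{p}}+q$. Then $$a_{\mathfrak{p}}=1-q\cdot\lim_{n\to\infty}\sum_{\substack{2\le\deg D\le n\\ D\in\mathfrak{D}(\mathbb{F}_{\mathfrak{p}}(\tilde{E}_{\mathfrak{p}}),\mathcal{P})}}\frac{\mu(D)}{|D|}.$$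
   Context: A prime ideal $\mathfrak{p}$ of the ring of integers of $\mathcal{K}$ is good for $E$ if it does not divide the discriminant ideal of (a Weierstrass model $Y^2=X^3+aX+b$, $a,b$ integral, of) $E$; then the reduction $\tilde{E}_{\mathfrak{p}}$ is an elliptic curve over the residue field $\mathbb{F}_{\mathfrak{p}}$, of cardinality $q$. For the function field $F=\mathbb{F}_{\mathfrak{p}}(\tilde{E}_{\mathfrak{p}})$: $\mathcal{P}$ is its set of prime divisors (places), $|P|=q^{\deg P}$; effective divisors $D=\sum a_PP$ ($a_P\ge0$), $|D|=q^{\deg D}$; $\mu(D)$ is the Möbius function ($\mu(0)=1$, $(-1)^k$ for a sum of $k$ distinct primes, $0$ otherwise); $D\ne0$ is distinguishable if exactly one prime factor attains the minimal degree among its prime factors; $\mathfrak{D}(F,\mathcal{P})$ is the set of effective distinguishable divisors of $F$. *)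

theory Defs
  imports Complex_Main "HOL-Library.Multiset" "HOL-Algebra.Algebra"
begin

section \<open>Number fields, rings of integers and residue fields\<close>

text \<open>The field generated by the empty set is the prime field, which is a copy of the
  rationals in characteristic 0.\<close>

definition number_field :: "('a, 'm) ring_scheme \<Rightarrow> bool" where
  "number_field K \<longleftrightarrow>
     field K \<and>
     (\<forall>n::nat. n > 0 \<longrightarrow> add_pow K n \<one>\<^bsub>K\<^esub> \<noteq> \<zero>\<^bsub>K\<^esub>) \<and>
     ring.finite_dimension K (generate_field K {}) (carrier K)"

text \<open>Polynomials are coefficient lists, leading coefficient first.\<close>

definition integral_element :: "('a, 'm) ring_scheme \<Rightarrow> 'a \<Rightarrow> bool" where
  "integral_element K x \<longleftrightarrow>
     (\<exists>f. f \<noteq> [] \<and> hd f = \<one>\<^bsub>K\<^esub> \<and>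
          set f \<subseteq> range (\<lambda>n::int. add_pow K n \<one>\<^bsub>K\<^esub>) \<and>
          ring.eval K f x = \<zero>\<^bsub>K\<^esub>)"

definition ring_of_integers :: "('a, 'm) ring_scheme \<Rightarrow> ('a, 'm) ring_scheme" where
  "ring_of_integers K = K \<lparr>carrier := {x \<in> carrier K. integral_element K x}\<rparr>"

definition residue_field :: "('a, 'm) ring_scheme \<Rightarrow> 'a set \<Rightarrow> 'a set ring" where
  "residue_field K p = ring_of_integers K Quot p"

definition reduce :: "('a, 'm) ring_scheme \<Rightarrow> 'a set \<Rightarrow> 'a \<Rightarrow> 'a set" where
  "reduce K p x = p +>\<^bsub>ring_of_integers K\<^esub> x"


section \<open>Elliptic curves in short Weierstrass form\<close>

text \<open>The pair \<open>a\<close>, \<open>b\<close> stands for the curve $Y^2 = X^3 + aX + b$.\<close>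

definition discriminant :: "('a, 'm) ring_scheme \<Rightarrow> 'a \<Rightarrow> 'a \<Rightarrow> 'a" where
  "discriminant R a b =
     \<ominus>\<^bsub>R\<^esub> (add_pow R (16::nat) (add_pow R (4::nat) (a [^]\<^bsub>R\<^esub> (3::nat)) \<oplus>\<^bsub>R\<^esub>
                             add_pow R (27::nat) (b [^]\<^bsub>R\<^esub> (2::nat))))"

definition elliptic_curve :: "('a, 'm) ring_scheme \<Rightarrow> 'a \<Rightarrow> 'a \<Rightarrow> bool" where
  "elliptic_curve K a b \<longleftrightarrow>
     a \<in> carrier K \<and> b \<in> carrier K \<and> discriminant K a b \<noteq> \<zero>\<^bsub>K\<^esub>"

text \<open>The isomorphisms between short Weierstrass equations are
  $(X, Y) \mapsto (u^2 X, u^3 Y)$ with $u \neq 0$.\<close>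

definition integral_model ::
    "('a, 'm) ring_scheme \<Rightarrow> 'a \<Rightarrow> 'a \<Rightarrow> 'a \<Rightarrow> 'a \<Rightarrow> bool" where
  "integral_model K A B a b \<longleftrightarrow>
     a \<in> carrier (ring_of_integers K) \<and> b \<in> carrier (ring_of_integers K) \<and>
     (\<exists>u \<in> carrier K - {\<zero>\<^bsub>K\<^esub>}.
        a = u [^]\<^bsub>K\<^esub> (4::nat) \<otimes>\<^bsub>K\<^esub> A \<and> b = u [^]\<^bsub>K\<^esub> (6::nat) \<otimes>\<^bsub>K\<^esub> B)"

text \<open>An ideal divides another one iff it contains it.\<close>

definition good_prime :: "('a, 'm) ring_scheme \<Rightarrow> 'a \<Rightarrow> 'a \<Rightarrow> 'a set \<Rightarrow> bool" where
  "good_prime K a b p \<longleftrightarrow>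
     primeideal p (ring_of_integers K) \<and> p \<noteq> {\<zero>\<^bsub>K\<^esub>} \<and>
     \<not> PIdl\<^bsub>ring_of_integers K\<^esub> (discriminant (ring_of_integers K) a b) \<subseteq> p"

text \<open>The rational points; \<open>None\<close> is the point at infinity.\<close>

definition ec_points :: "('a, 'm) ring_scheme \<Rightarrow> 'a \<Rightarrow> 'a \<Rightarrow> ('a \<times> 'a) option set" where
  "ec_points k a b = insert None (Some `
     {(x, y). x \<in> carrier k \<and> y \<in> carrier k \<and>
        y [^]\<^bsub>k\<^esub> (2::nat) = x [^]\<^bsub>k\<^esub> (3::nat) \<oplus>\<^bsub>k\<^esub> a \<otimes>\<^bsub>k\<^esub> x \<oplus>\<^bsub>k\<^esub> b})"


section \<open>The function field of an elliptic curve\<close>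

definition frac_rel :: "('a, 'm) ring_scheme \<Rightarrow> (('a \<times> 'a) \<times> ('a \<times> 'a)) set" where
  "frac_rel R = {((a, b), (c, d)).
     a \<in> carrier R \<and> b \<in> carrier R - {\<zero>\<^bsub>R\<^esub>} \<and> c \<in> carrier R \<and> d \<in> carrier R - {\<zero>\<^bsub>R\<^esub>} \<and>
     a \<otimes>\<^bsub>R\<^esub> d = c \<otimes>\<^bsub>R\<^esub> b}"

definition frac_class :: "('a, 'm) ring_scheme \<Rightarrow> 'a \<Rightarrow> 'a \<Rightarrow> ('a \<times> 'a) set" where
  "frac_class R a b = frac_rel R `` {(a, b)}"

definition fraction_field :: "('a, 'm) ring_scheme \<Rightarrow> ('a \<times> 'a) set ring" where
  "fraction_field R =
     \<lparr>carrier = {frac_class R a b | a b. a \<in> carrier R \<and> b \<in> carrier R - {\<zero>\<^bsub>R\<^esub>}},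
      monoid.mult = (\<lambda>S T. \<Union>(a, b)\<in>S. \<Union>(c, d)\<in>T. frac_class R (a \<otimes>\<^bsub>R\<^esub> c) (b \<otimes>\<^bsub>R\<^esub> d)),
      monoid.one = frac_class R \<one>\<^bsub>R\<^esub> \<one>\<^bsub>R\<^esub>,
      ring.zero = frac_class R \<zero>\<^bsub>R\<^esub> \<one>\<^bsub>R\<^esub>,
      ring.add = (\<lambda>S T. \<Union>(a, b)\<in>S. \<Union>(c, d)\<in>T.
               frac_class R (a \<otimes>\<^bsub>R\<^esub> d \<oplus>\<^bsub>R\<^esub> c \<otimes>\<^bsub>R\<^esub> b) (b \<otimes>\<^bsub>R\<^esub> d))\<rparr>"

abbreviation bivariate :: "('a, 'm) ring_scheme \<Rightarrow> 'a list list ring" where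
  "bivariate k \<equiv> univ_poly (univ_poly k (carrier k)) (carrier (univ_poly k (carrier k)))"

text \<open>The ideal generated by $Y^2 - (X^3 + aX + b)$ in $k[X][Y]$.\<close>

definition curve_ideal :: "('a, 'm) ring_scheme \<Rightarrow> 'a \<Rightarrow> 'a \<Rightarrow> 'a list list set" where
  "curve_ideal k a b = PIdl\<^bsub>bivariate k\<^esub>
     [\<one>\<^bsub>univ_poly k (carrier k)\<^esub>, \<zero>\<^bsub>univ_poly k (carrier k)\<^esub>,
      \<ominus>\<^bsub>univ_poly k (carrier k)\<^esub> [\<one>\<^bsub>k\<^esub>, \<zero>\<^bsub>k\<^esub>, a, b]]"

definition coordinate_ring :: "('a, 'm) ring_scheme \<Rightarrow> 'a \<Rightarrow> 'a \<Rightarrow> 'a list list set ring" where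
  "coordinate_ring k a b = bivariate k Quot curve_ideal k a b"

definition function_field ::
    "('a, 'm) ring_scheme \<Rightarrow> 'a \<Rightarrow> 'a \<Rightarrow> ('a list list set \<times> 'a list list set) set ring" where
  "function_field k a b = fraction_field (coordinate_ring k a b)"

text \<open>The copy of \<open>k\<close> inside its function field.\<close>

definition constant_field ::
    "('a, 'm) ring_scheme \<Rightarrow> 'a \<Rightarrow> 'a \<Rightarrow> ('a list list set \<times> 'a list list set) set set" where
  "constant_field k a b =
     (\<lambda>c. frac_class (coordinate_ring k a b)
        (curve_ideal k a b +>\<^bsub>bivariate k\<^esub>
           ring.poly_of_const (univ_poly k (carrier k)) (ring.poly_of_const k c))
        \<one>\<^bsub>coordinate_ring k a b\<^esub>) ` carrier k"


section \<open>Places and effective divisors\<close>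

text \<open>Throughout, \<open>F\<close> is a function field and \<open>C \<subseteq> carrier F\<close> its finite field of constants.\<close>

definition valuation_ring :: "('f, 'm) ring_scheme \<Rightarrow> 'f set \<Rightarrow> 'f set \<Rightarrow> bool" where
  "valuation_ring F C V \<longleftrightarrow>
     subring V F \<and> C \<subset> V \<and> V \<subset> carrier F \<and>
     (\<forall>z \<in> carrier F - {\<zero>\<^bsub>F\<^esub>}. z \<in> V \<or> inv\<^bsub>F\<^esub> z \<in> V)"

definition places :: "('f, 'm) ring_scheme \<Rightarrow> 'f set \<Rightarrow> 'f set set" where
  "places F C = {P. \<exists>V. valuation_ring F C V \<and> maximalideal P (F \<lparr>carrier := V\<rparr>)}"

definition place_ring :: "('f, 'm) ring_scheme \<Rightarrow> 'f set \<Rightarrow> 'f set \<Rightarrow> ('f, 'm) ring_scheme" where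
  "place_ring F C P =
     F \<lparr>carrier := (THE V. valuation_ring F C V \<and> maximalideal P (F \<lparr>carrier := V\<rparr>))\<rparr>"

definition place_degree :: "('f, 'm) ring_scheme \<Rightarrow> 'f set \<Rightarrow> 'f set \<Rightarrow> nat" where
  "place_degree F C P =
     ring.dim (place_ring F C P Quot P)
       ((\<lambda>c. P +>\<^bsub>place_ring F C P\<^esub> c) ` C) (carrier (place_ring F C P Quot P))"

text \<open>An effective divisor is a finite multiset of places.\<close>

definition effective_divisors :: "('f, 'm) ring_scheme \<Rightarrow> 'f set \<Rightarrow> 'f set multiset set" where
  "effective_divisors F C = {D. set_mset D \<subseteq> places F C}"

definition div_degree :: "('f, 'm) ring_scheme \<Rightarrow> 'f set \<Rightarrow> 'f set multiset \<Rightarrow> nat" where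
  "div_degree F C D = (\<Sum>P\<in>#D. place_degree F C P)"

definition div_norm :: "('f, 'm) ring_scheme \<Rightarrow> 'f set \<Rightarrow> 'f set multiset \<Rightarrow> nat" where
  "div_norm F C D = card C ^ div_degree F C D"

definition div_moebius :: "'p multiset \<Rightarrow> int" where
  "div_moebius D = (if \<forall>P. count D P \<le> 1 then (-1) ^ size D else 0)"

definition distinguishable :: "('f, 'm) ring_scheme \<Rightarrow> 'f set \<Rightarrow> 'f set multiset \<Rightarrow> bool" where
  "distinguishable F C D \<longleftrightarrow>
     D \<noteq> {#} \<and>
     (\<exists>!P. P \<in># D \<and> (\<forall>Q. Q \<in># D \<longrightarrow> place_degree F C P \<le> place_degree F C Q))"

definition distinguishable_divisors ::
    "('f, 'm) ring_scheme \<Rightarrow> 'f set \<Rightarrow> 'f set multiset set" where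
  "distinguishable_divisors F C = {D \<in> effective_divisors F C. distinguishable F C D}"

end

theory Submission
  imports Defs "HOL-Decision_Procs.Commutative_Ring" "HOL-Analysis.Uniform_Limit"
    "HOL-Computational_Algebra.Formal_Power_Series"
begin

unbundle fps_syntax
unbundle no vec_syntax
hide_const (open) Commutative_Ring.norm Commutative_Ring.Pow

text \<open>
  Write \<open>q\<close> for the order of the residue field \<open>k\<close> and \<open>N\<close> for the number of points of the curve over \<open>k\<close>.
  Removing the unique prime of least degree \<open>d\<close> from a distinguishable divisor leaves a divisor
  supported in degrees above \<open>d\<close>, so the sum of \<open>\<mu>(D)/|D|\<close> over distinguishable divisors telescopes along
  the partial Euler products; it tends to \<open>-1\<close>, because the product of \<open>1 - |P|\<^sup>-\<^sup>1\<close> over all primes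
  vanishes. The divisors of degree 1 contribute \<open>-N/q\<close>, hence the sum from degree 2 on tends to
  \<open>N/q - 1\<close>.

  The analytic input is that \<open>\<Prod>(1 - t\<^sup>d\<^sup>e\<^sup>g \<^sup>P)\<close> equals \<open>(1 - t)(1 - qt)/L(t)\<close> with
  \<open>L(t) = 1 + (N - 1 - q)t + qt\<^sup>2\<close>, and that \<open>1/L(u/q)\<close> has absolutely summable coefficients, for which
  the trivial bound \<open>|N - 1 - q| \<le> q\<close> suffices. The product is computed from the classification of the
  places: apart from the one at infinity they lie over the monic irreducible \<open>P \<in> k[X]\<close>, and
  their number is governed by whether \<open>f = X\<^sup>3 + aX + b\<close> is a square modulo \<open>P\<close>, that is by a quadratic
  character \<open>\<chi>(P)\<close>. Extended multiplicatively by \<open>\<chi>(g) = \<plusminus> Res(g, f)\<^sup>(\<^sup>q\<^sup>-\<^sup>1\<^sup>)\<^sup>/\<^sup>2\<close>, its sum over the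
  monic polynomials of degree \<open>n\<close> is \<open>N - 1 - q\<close>, \<open>q\<close> and \<open>0\<close> for \<open>n = 1\<close>, \<open>n = 2\<close> and \<open>n \<ge> 3\<close>.
\<close>

section \<open>Power series with summable coefficients\<close>

text \<open>Put \<open>t = u/q\<close>. The Euler product becomes \<open>(1 - u) H(u)\<close> with
  \<open>H(u) = (1 - u/q)/L(u/q)\<close>, and the sum in question belongs to \<open>u = 1\<close>,
  on the boundary of the disc where the divisor sum converges absolutely. So the limit is one of
  partial sums of coefficients. The factor \<open>1 - u\<close> telescopes these, and what remains
  are coefficients of \<open>H\<close>, which tend to 0 once they are absolutely summable; for that
  the reciprocal roots of \<open>L(u/q)\<close> must lie in the open unit disc.

  The resultant enters through Euler's criterion. A root of an irreducible \<open>P\<close> of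
  degree \<open>d\<close> generates the residue field with \<open>q^d\<close> elements, and the
  exponent \<open>(q^d - 1)/2\<close> is \<open>1 + q + ... + q^(d-1)\<close> times
  \<open>(q - 1)/2\<close>. Raising the value of \<open>f\<close> at the root to the first factor is
  taking its norm, and the norm is, up to sign, the product of the values of \<open>P\<close> at the
  three roots of \<open>f\<close>. That product makes sense for every monic polynomial, is
  multiplicative, and depends only on the residue class modulo \<open>f\<close>, which makes the
  sums over high degrees cancel.\<close>

definition l1_bound :: "'a::{real_normed_field,banach} fps \<Rightarrow> real \<Rightarrow> bool" where
  "l1_bound f B \<longleftrightarrow> (\<forall>N. (\<Sum>n<N. norm (f $ n)) \<le> B)"

lemma l1_bound_nonneg: "l1_bound f B \<Longrightarrow> 0 \<le> B"
  unfolding l1_bound_def by (metis lessThan_0 sum.empty)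

lemma l1_bound_coeffs_tendsto_0:
  assumes "l1_bound f B" shows "(\<lambda>n. f $ n) \<longlonglongrightarrow> 0"
proof -
  have "summable (\<lambda>n. norm (f $ n))"
    by (rule summableI_nonneg_bounded[where x = B]) (use assms in \<open>auto simp: l1_bound_def\<close>)
  then show ?thesis by (blast intro: summable_LIMSEQ_zero dest: summable_norm_cancel)
qed

lemma l1_bound_add:
  assumes "l1_bound f B" "l1_bound g C" shows "l1_bound (f + g) (B + C)"
  unfolding l1_bound_def
proof
  fix N
  have "(\<Sum>n<N. norm ((f + g) $ n)) \<le> (\<Sum>n<N. norm (f $ n) + norm (g $ n))"
    by (intro sum_mono) (simp add: norm_triangle_ineq)
  also have "\<dots> \<le> B + C"
    using assms by (auto simp: l1_bound_def sum.distrib intro: add_mono)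
  finally show "(\<Sum>n<N. norm ((f + g) $ n)) \<le> B + C" .
qed

text \<open>The index pairs \<open>i + j < N\<close> of a Cauchy product form a triangle inside the
  square of pairs below \<open>N\<close>, so the total masses multiply. Bounds are carried as
  explicit numbers because one estimate below has to be uniform in a degree
  \<open>d\<close>.\<close>

lemma l1_bound_mult:
  assumes "l1_bound f B" "l1_bound g C" shows "l1_bound (f * g) (B * C)"
  unfolding l1_bound_def
proof
  fix N
  have "(\<Sum>n<N. norm ((f * g) $ n)) \<le> (\<Sum>n<N. \<Sum>i\<in>{0..n}. norm (f $ i) * norm (g $ (n - i)))"
    unfolding fps_mult_nth by (intro sum_mono order.trans[OF norm_sum]) (simp add: norm_mult)
  also have "\<dots> = (\<Sum>(n, i)\<in>(SIGMA n:{..<N}. {0..n}). norm (f $ i) * norm (g $ (n - i)))"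
    by (rule sum.Sigma) auto
  also have "\<dots> = (\<Sum>(i, j)\<in>(\<lambda>(n, i). (i, n - i)) ` (SIGMA n:{..<N}. {0..n}).
      norm (f $ i) * norm (g $ j))"
    by (subst sum.reindex) (auto simp: inj_on_def case_prod_unfold)
  also have "\<dots> \<le> (\<Sum>(i, j)\<in>{..<N} \<times> {..<N}. norm (f $ i) * norm (g $ j))"
    by (rule sum_mono2) auto
  also have "\<dots> = (\<Sum>i<N. norm (f $ i)) * (\<Sum>j<N. norm (g $ j))"
    by (simp add: sum_product sum.cartesian_product)
  also have "\<dots> \<le> B * C"
    using assms l1_bound_nonneg[OF assms(1)]
    by (intro mult_mono) (auto simp: l1_bound_def sum_nonneg)
  finally show "(\<Sum>n<N. norm ((f * g) $ n)) \<le> B * C" .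
qed

lemma l1_bound_monomial: "l1_bound (fps_const c * fps_X ^ k) (norm c)"
proof -
  have "(\<Sum>n<N. norm ((fps_const c * fps_X ^ k) $ n)) = (if k < N then norm c else 0)" for N
  proof -
    have "(\<Sum>n<N. norm ((fps_const c * fps_X ^ k) $ n)) = (\<Sum>n<N. if n = k then norm c else 0)"
      by (intro sum.cong) (auto simp: fps_X_power_nth)
    then show ?thesis by simp
  qed
  then show ?thesis by (auto simp: l1_bound_def)
qed

lemma l1_bound_one: "l1_bound 1 1"
  using l1_bound_monomial[of 1 0] by simp

lemma l1_bound_mono: "l1_bound f B \<Longrightarrow> B \<le> C \<Longrightarrow> l1_bound f C"
  unfolding l1_bound_def by (meson order.trans)

lemma l1_bound_power: "l1_bound f B \<Longrightarrow> l1_bound (f ^ n) (B ^ n)"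
  by (induction n) (auto simp: l1_bound_one l1_bound_mult)

lemma l1_bound_prod:
  "(\<And>i. i \<in> I \<Longrightarrow> l1_bound (f i) (B i)) \<Longrightarrow> l1_bound (prod f I) (prod B I)"
  by (induction I rule: infinite_finite_induct) (auto simp: l1_bound_one l1_bound_mult)

text \<open>The convolution inequality for a summable and a bounded sequence. It serves where one
  factor, such as an inverse Euler product, is only known to have bounded coefficients.\<close>

lemma norm_mult_nth_le:
  assumes "l1_bound f B" "\<And>n. norm (g $ n) \<le> C"
  shows "norm ((f * g) $ n) \<le> B * C"
proof -
  have C: "0 \<le> C" using assms(2) norm_ge_zero order.trans by blast
  have "norm ((f * g) $ n) \<le> (\<Sum>i\<in>{0..n}. norm (f $ i) * C)"
    unfolding fps_mult_nth
    by (intro order.trans[OF norm_sum] sum_mono) (simp add: norm_mult mult_left_mono assms(2))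
  also have "\<dots> = (\<Sum>i<Suc n. norm (f $ i)) * C"
    by (simp add: sum_distrib_right atLeast0AtMost lessThan_Suc_atMost)
  also have "\<dots> \<le> B * C"
    using assms(1) C unfolding l1_bound_def by (intro mult_right_mono) blast+
  finally show ?thesis .
qed

lemma fps_mult_nth_eq_0:
  assumes "\<And>i. i \<le> n \<Longrightarrow> g $ i = 0" shows "(f * g) $ n = (0::'a::comm_ring_1)"
  unfolding fps_mult_nth using assms by (intro sum.neutral) auto

lemma fps_mult_nth_cong:
  assumes "\<And>i. i \<le> n \<Longrightarrow> f $ i = f' $ i" "\<And>i. i \<le> n \<Longrightarrow> g $ i = g' $ i"
  shows "(f * g) $ n = (f' * g') $ n"
  unfolding fps_mult_nth using assms by (intro sum.cong) auto

text \<open>Since \<open>1/f - 1/g = (g - f)/(f g)\<close>, agreement up to degree \<open>n\<close>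
  passes to inverses. Infinite products are never formed; they are compared with finite ones
  coefficient by coefficient.\<close>

lemma fps_inverse_nth_cong:
  fixes f g :: "'a::field fps"
  assumes "\<And>i. i \<le> n \<Longrightarrow> f $ i = g $ i" "f $ 0 \<noteq> 0" "g $ 0 \<noteq> 0"
  shows "inverse f $ n = inverse g $ n"
proof -
  have "inverse f - inverse g = inverse f * inverse g * (g - f)"
  proof -
    have "inverse f * inverse g * (g - f) = inverse f * (inverse g * g) - inverse g * (inverse f * f)"
      by (simp only: algebra_simps)
    then show ?thesis
      by (simp only: inverse_mult_eq_1[OF assms(2)] inverse_mult_eq_1[OF assms(3)] mult_1_right)
  qed
  then have "(inverse f - inverse g) $ n = 0"
    using fps_mult_nth_eq_0[of n "g - f" "inverse f * inverse g"] assms(1) by simp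
  then show ?thesis by simp
qed

text \<open>The series is the geometric one in \<open>c X^d\<close>. Both facts come from the
  recurrence \<open>g = 1 + c X^d g\<close>: the signs by induction on the index, and the bound
  because the partial sums \<open>s\<close> satisfy \<open>s \<le> 1 + c s\<close>.\<close>

lemma inverse_one_minus_monomial:
  fixes c :: real
  assumes "0 \<le> c" "c < 1" "d > 0"
  defines "g \<equiv> inverse (1 - fps_const c * fps_X ^ d)"
  shows "g $ n \<ge> 0" "l1_bound g (1 / (1 - c))"
proof -
  have "(1 - fps_const c * fps_X ^ d) * g = 1"
    unfolding g_def by (rule inverse_mult_eq_1') (use assms in auto)
  then have g: "g = 1 + fps_const c * (fps_X ^ d * g)"
    by (simp add: algebra_simps)
  have rec: "g $ n = (if n = 0 then 1 else 0) + c * (if n < d then 0 else g $ (n - d))" for n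
    by (subst g) (simp add: fps_X_power_mult_nth)
  show nonneg: "g $ n \<ge> 0" for n
  proof (induction n rule: less_induct)
    case (less n) then show ?case using assms by (subst rec) auto
  qed
  show "l1_bound g (1 / (1 - c))"
    unfolding l1_bound_def
  proof
    fix N
    let ?s = "\<lambda>N. \<Sum>n<N. g $ n"
    have "?s N = (\<Sum>n<N. if n = 0 then 1 else 0) + c * (\<Sum>n<N. if n < d then 0 else g $ (n - d))"
      by (subst rec) (simp add: sum.distrib sum_distrib_left)
    also have "(\<Sum>n<N. if n < d then 0 else g $ (n - d)) = (\<Sum>n\<in>{..<N} - {..<d}. g $ (n - d))"
      by (rule sum.mono_neutral_cong_right) auto
    also have "\<dots> = sum (($) g) ((\<lambda>n. n - d) ` ({..<N} - {..<d}))"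
      by (subst sum.reindex) (auto simp: inj_on_def)
    also have "\<dots> \<le> ?s N"
      by (rule sum_mono2) (auto simp: nonneg)
    also have "(\<Sum>n<N. if n = 0 then 1 else (0::real)) \<le> 1" by simp
    finally have "?s N \<le> 1 + c * ?s N" using assms by (simp add: mult_left_mono)
    then have "?s N \<le> 1 / (1 - c)" using assms by (simp add: field_simps)
    then show "(\<Sum>n<N. norm (g $ n)) \<le> 1 / (1 - c)" using nonneg by simp
  qed
qed

text \<open>A second-order Taylor remainder for \<open>(1 - m)^a\<close>. Taking absolute values
  replaces \<open>m\<close> by \<open>- x\<close>, which leaves the total mass
  \<open>(1 + x)^a - 1 - a x\<close>. The bound depends on \<open>a x\<close> alone, which in the
  application is the number of primes of degree \<open>d\<close> over \<open>q^d\<close> and hence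
  \<open>O(1/d)\<close>.\<close>

lemma one_minus_monomial_power_remainder:
  fixes x :: real
  assumes "0 \<le> x"
  shows "l1_bound ((1 - fps_const x * fps_X ^ d) ^ a - 1 + fps_const (real a * x) * fps_X ^ d)
           ((real a * x)\<^sup>2 * exp (real a * x))"
proof -
  let ?B = "\<lambda>a. (1 - fps_const x * fps_X ^ d) ^ a - 1 + fps_const (real a * x) * fps_X ^ d"
  have "l1_bound (?B a) ((1 + x) ^ a - 1 - real a * x)"
  proof (induction a)
    case 0 then show ?case by (simp add: l1_bound_def)
  next
    case (Suc a)
    let ?m = "fps_const x * fps_X ^ d"
    have a: "fps_const (real a * x) * fps_X ^ d = of_nat a * ?m" for a
      by (simp only: fps_of_nat [symmetric] fps_const_mult [symmetric] mult.assoc)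
    have "?m ^ 2 = fps_const (x ^ 2) * fps_X ^ (2 * d)"
      by (simp only: power_mult_distrib fps_const_power power_mult [symmetric] mult.commute[of 2 d])
    then have e: "fps_const (real a * x ^ 2) * fps_X ^ (2 * d) = of_nat a * ?m ^ 2"
      by (simp only: fps_of_nat [symmetric] fps_const_mult [symmetric] mult.assoc)
    have n: "fps_const (- x) * fps_X ^ d = - ?m"
      by (simp flip: fps_const_neg)
    \<comment> \<open>Multiplying the remainder for \<open>a\<close> by \<open>1 - m\<close> gives
      the one for \<open>a + 1\<close> except for the new quadratic error
      \<open>a m^2\<close>.\<close>
    have idt: "(1 - m) * p - 1 + (1 + k) * m = (p - 1 + k * m) * (1 + - m) + k * m ^ 2" for m p k :: "real fps"
      by (simp add: algebra_simps power2_eq_square)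
    have "?B (Suc a) = ?B a * (1 + fps_const (- x) * fps_X ^ d)
        + fps_const (real a * x ^ 2) * fps_X ^ (2 * d)"
      unfolding a e n by (simp only: power_Suc of_nat_Suc idt)
    moreover have "l1_bound \<dots> (((1 + x) ^ a - 1 - real a * x) * (1 + norm (- x)) + norm (real a * x ^ 2))"
      by (intro l1_bound_add l1_bound_mult Suc l1_bound_one l1_bound_monomial)
    moreover have "((1 + x) ^ a - 1 - real a * x) * (1 + norm (- x)) + norm (real a * x ^ 2) =
        (1 + x) ^ Suc a - 1 - real (Suc a) * x"
      using assms by (simp add: algebra_simps power2_eq_square)
    ultimately show ?case by simp
  qed
  \<comment> \<open>With \<open>w = a x\<close> the chain is
    \<open>e^w - 1 - w \<le> w (e^w - 1) \<le> w^2 e^w\<close>, where both steps use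
    \<open>e^w - 1 \<le> w e^w\<close>.\<close>
  moreover have "(1 + x) ^ a - 1 - real a * x \<le> (real a * x)\<^sup>2 * exp (real a * x)"
  proof -
    define w where "w = real a * x"
    have w: "0 \<le> w" using assms by (simp add: w_def)
    have "(1 + x) ^ a \<le> exp x ^ a"
      using assms by (intro power_mono) (auto simp: exp_ge_add_one_self)
    then have 1: "(1 + x) ^ a \<le> exp w" by (simp add: w_def exp_of_nat_mult)
    have "1 - w \<le> exp (- w)" using exp_ge_add_one_self[of "-w"] by simp
    then have "exp w * (1 - w) \<le> exp w * exp (- w)" by (rule mult_left_mono) simp
    then have 2: "exp w - 1 \<le> w * exp w" by (simp add: exp_minus algebra_simps)
    then have "w * (exp w - 1) \<le> w * (w * exp w)" using w by (rule mult_left_mono)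
    with 1 2 show ?thesis unfolding w_def [symmetric] by (simp add: algebra_simps power2_eq_square)
  qed
  ultimately show ?thesis by (rule l1_bound_mono)
qed

lemma fps_nonneg_mult:
  "(\<And>n. f $ n \<ge> 0) \<Longrightarrow> (\<And>n. g $ n \<ge> 0) \<Longrightarrow> (f * g) $ n \<ge> (0::real)"
  by (simp add: fps_mult_nth sum_nonneg)

lemma fps_nonneg_power:
  assumes "\<And>n. f $ n \<ge> (0::real)" shows "(f ^ k) $ n \<ge> 0"
proof (induction k arbitrary: n)
  case (Suc k) then show ?case using assms by (simp add: fps_nonneg_mult)
qed simp

lemma fps_nonneg_prod:
  fixes f :: "'b \<Rightarrow> real fps"
  shows "(\<And>i n. i \<in> I \<Longrightarrow> f i $ n \<ge> 0) \<Longrightarrow> (prod f I) $ n \<ge> 0"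
proof (induction I arbitrary: n rule: infinite_finite_induct)
  case (insert x F) then show ?case by (simp add: fps_nonneg_mult)
qed simp_all

text \<open>Partial sums of coefficients undo the factor \<open>1 - X\<close>. This is how the zero
  of the Euler product at 1 is cancelled.\<close>

lemma sum_one_minus_X_mult_nth: "(\<Sum>m\<le>n. ((1 - fps_X) * f) $ m) = (f $ n :: 'a::comm_ring_1)"
  by (induction n) (auto simp: algebra_simps)

lemma one_minus_monomial_power_nth_0:
  "d > 0 \<Longrightarrow> ((1 - fps_const c * fps_X ^ d) ^ a) $ 0 = (1::'a::comm_ring_1)"
  by (simp add: fps_power_zeroth zero_power)

lemma one_minus_monomial_power_nth_small:
  fixes c :: "'a::comm_ring_1"
  assumes "0 < i" "i < d" shows "((1 - fps_const c * fps_X ^ d) ^ a) $ i = 0"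
proof (induction a)
  case (Suc a)
  have "((1 - fps_const c * fps_X ^ d) ^ Suc a) $ i =
     ((1 - fps_const c * fps_X ^ d) ^ a) $ i
     - (fps_X ^ d * (fps_const c * (1 - fps_const c * fps_X ^ d) ^ a)) $ i"
    by (simp add: algebra_simps)
  also have "\<dots> = 0" using Suc assms by (subst fps_X_power_mult_nth) auto
  finally show ?case .
qed (use assms in auto)

text \<open>Removing the divisors whose least degree \<open>d\<close> is attained at least twice costs
  \<open>(H * S d * R d) $ n\<close>. Each such term tends to \<open>0\<close> with \<open>n\<close>, and it is \<open>O(1/d\<^sup>2)\<close>
  uniformly in \<open>n\<close>, so the total tends to \<open>0\<close> by Tannery's theorem.\<close>

lemma least_degree_unique_sum_tendsto:
  fixes a :: "nat \<Rightarrow> nat" and q c C B :: real and H :: "real fps"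
  defines "E \<equiv> \<lambda>d. (1 - fps_const (1 / q ^ d) * fps_X ^ d) ^ a d"
  defines "M \<equiv> (1 - fps_X) * H"
  assumes q: "q > 1" and ac: "\<And>d. d > 0 \<Longrightarrow> real (a d) / q ^ d \<le> c / real d"
    and H: "l1_bound H B" and Z: "\<And>n. inverse M $ n \<le> C"
    and M: "\<And>n N. n \<le> N \<Longrightarrow> M $ n = (\<Prod>d\<in>{1..N}. E d) $ n"
  shows "(\<lambda>n. \<Sum>m\<le>n. \<Sum>d=1..m. real (a d) / q ^ d * (M * inverse (\<Prod>e\<in>{1..d}. E e)) $ (m - d))
           \<longlonglongrightarrow> 1"
proof -
  define w where "w = (\<lambda>d. real (a d) / q ^ d)"
  define g where "g = (\<lambda>d. inverse (1 - fps_const (1 / q ^ d) * fps_X ^ d))"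
  define Q where "Q = (\<lambda>d. \<Prod>e\<in>{1..d}. E e)"
  \<comment> \<open>\<open>S d\<close> is the inverse of \<open>Q d\<close>, written as a product of
    geometric series so that its coefficients are visibly nonnegative.\<close>
  define S where "S = (\<lambda>d. \<Prod>e\<in>{1..d}. g e ^ a e)"
  \<comment> \<open>The part of \<open>E d\<close> beyond its first-order approximation
    \<open>1 - w d X^d\<close>; it accounts for at least two primes of degree
    \<open>d\<close>.\<close>
  define R where "R = (\<lambda>d. E d - 1 + fps_const (w d) * fps_X ^ d)"
  \<comment> \<open>Dividing \<open>M\<close> by the factors up to \<open>d\<close> leaves the Euler
    product over degrees above \<open>d\<close>.\<close>
  define K where "K = (\<lambda>d. M * S d)"
  have x: "0 \<le> 1 / q ^ d" "1 / q ^ d < 1" if "d > 0" for d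
    using q that by (auto simp: field_simps one_less_power)
  have g_nonneg: "g d $ n \<ge> 0" if "d > 0" for d n
    unfolding g_def using inverse_one_minus_monomial(1)[OF x[OF that] that] .
  have g_l1: "l1_bound (g d) (1 / (1 - 1 / q ^ d))" if "d > 0" for d
    unfolding g_def using inverse_one_minus_monomial(2)[OF x[OF that] that] .
  have gE: "E d * g d ^ a d = 1" if "d > 0" for d
  proof -
    have "(1 - fps_const (1 / q ^ d) * fps_X ^ d) * g d = 1"
      unfolding g_def by (rule inverse_mult_eq_1') (use that in auto)
    then show ?thesis by (simp add: E_def power_mult_distrib [symmetric])
  qed
  have g0: "(g d ^ a d) $ 0 = 1" if "d > 0" for d
    unfolding g_def using that by (simp add: fps_power_zeroth zero_power)
  have MQ: "M $ n = Q N $ n" if "n \<le> N" for n N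
    using M[OF that] by (simp only: Q_def)
  have QS: "Q d * S d = 1" for d
    unfolding Q_def S_def by (simp add: prod.distrib [symmetric] gE)
  have Q0: "Q d $ 0 = 1" for d
    unfolding Q_def E_def by (simp add: fps_prod_nth' fps_prod_nth one_minus_monomial_power_nth_0)
  have S_inv: "inverse (Q d) = S d" for d
    using QS[of d] Q0[of d] by (metis fps_inverse_unique)
  have S_nonneg: "S d $ n \<ge> 0" for d n
    unfolding S_def by (intro fps_nonneg_prod fps_nonneg_power g_nonneg) auto
  have S_l1: "\<exists>B. l1_bound (S d) B" for d
    unfolding S_def by (rule exI, rule l1_bound_prod, rule l1_bound_power, rule g_l1) simp
  have S_step: "S d $ n \<le> S (Suc d) $ n" for d n
  proof -
    have "S d $ n = S d $ n * (g (Suc d) ^ a (Suc d)) $ (n - n)" using g0 by simp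
    also have "\<dots> \<le> (\<Sum>i=0..n. S d $ i * (g (Suc d) ^ a (Suc d)) $ (n - i))"
      by (rule member_le_sum) (auto intro!: mult_nonneg_nonneg S_nonneg fps_nonneg_power g_nonneg)
    also have "\<dots> = S (Suc d) $ n" by (simp add: S_def fps_mult_nth)
    finally show ?thesis .
  qed
  \<comment> \<open>The coefficient of \<open>S d\<close> at \<open>n\<close> grows with
    \<open>d\<close> and is that of \<open>1/M\<close> as soon as \<open>d \<ge> n\<close>, so the
    single constant \<open>C\<close> bounds all of them.\<close>
  have S_le: "norm (S d $ n) \<le> C" for d n
  proof -
    have "S d $ n \<le> S (max d n) $ n"
      using lift_Suc_mono_le[of "\<lambda>d. S d $ n"] S_step by simp
    also have "\<dots> = inverse M $ n"
      unfolding S_inv [symmetric]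
      by (rule fps_inverse_nth_cong) (use MQ[of _ "max d n"] Q0 in auto)
    also have "\<dots> \<le> C" by (rule Z)
    finally show ?thesis using S_nonneg by simp
  qed
  have R0: "R d $ i = 0" if "i < d" for i d
    using that unfolding R_def E_def
    by (cases "i = 0")
       (auto simp: one_minus_monomial_power_nth_0 one_minus_monomial_power_nth_small fps_X_power_nth)
  have R_l1: "l1_bound (R d) ((w d)\<^sup>2 * exp (w d))" if "d > 0" for d
    using one_minus_monomial_power_remainder[of "1 / q ^ d" d "a d"] x[OF that]
    by (simp add: R_def E_def w_def)
  have K_diff: "K d - K (Suc d) = K (Suc d) * R (Suc d)
      - fps_const (w (Suc d)) * (fps_X ^ Suc d * K (Suc d))" for d
  proof -
    have "S d = S (Suc d) * E (Suc d)"
      using gE[of "Suc d"] by (simp add: S_def mult.assoc mult.commute)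
    then have "K d = K (Suc d) * E (Suc d)" by (simp add: K_def mult.assoc)
    then show ?thesis by (simp add: R_def algebra_simps)
  qed
  \<comment> \<open>A product over degrees above \<open>m\<close> is 1 up to degree
    \<open>m\<close>.\<close>
  have K_end: "K m $ m = 0" if "m > 0" for m
  proof -
    have "K m $ m = (Q m * S m) $ m"
      unfolding K_def by (rule fps_mult_nth_cong) (use MQ[of _ m] in auto)
    then show ?thesis using QS that by simp
  qed
  \<comment> \<open>\<open>K (d - 1) = K d E d\<close>, and inserting
    \<open>E d = 1 - w d X^d + R d\<close> isolates the wanted summand in the difference of two
    neighbours. The correction at \<open>m = 0\<close> is the constant term 1 of \<open>M\<close>,
    which faces an empty sum.\<close>
  have tele: "(\<Sum>d=1..m. w d * K d $ (m - d)) = (\<Sum>d=1..m. (K d * R d) $ m) - M $ m + (if m = 0 then 1 else 0)"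
    for m
  proof (cases "m = 0")
    case True
    have "M $ 0 = 1" using M[of 0 0] by simp
    with True show ?thesis by simp
  next
    case False
    have "M $ m = K 0 $ m - K m $ m" using K_end False by (simp add: K_def S_def)
    also have "\<dots> = (\<Sum>d<m. (K d - K (Suc d)) $ m)"
      using sum_lessThan_telescope'[of "\<lambda>d. K d $ m" m] by simp
    also have "\<dots> = (\<Sum>d<m. (K (Suc d) * R (Suc d)) $ m - w (Suc d) * K (Suc d) $ (m - Suc d))"
    proof (intro sum.cong refl)
      fix d assume "d \<in> {..<m}"
      moreover define k where "k = Suc d"
      ultimately have "\<not> m < k" by simp
      then show "(K d - K (Suc d)) $ m = (K (Suc d) * R (Suc d)) $ m - w (Suc d) * K (Suc d) $ (m - Suc d)"
        unfolding K_diff unfolding k_def [symmetric] by (simp add: fps_X_power_mult_nth)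
    qed
    also have "\<dots> = (\<Sum>d=1..m. (K d * R d) $ m - w d * K d $ (m - d))"
      by (rule sum.reindex_bij_witness[of _ "\<lambda>d. d - 1" Suc]) auto
    finally show ?thesis using False by (simp add: sum_subtractf)
  qed
  \<comment> \<open>Summing over \<open>m\<close> divides every series by \<open>1 - X\<close>, so
    \<open>M\<close> becomes \<open>H\<close>. The sum over \<open>d\<close> may first be extended
    to \<open>n\<close>, because \<open>R d\<close> starts no earlier than degree
    \<open>d\<close>.\<close>
  have main: "(\<Sum>m\<le>n. \<Sum>d=1..m. w d * K d $ (m - d))
      = 1 - H $ n + (\<Sum>d=1..n. (H * S d * R d) $ n)" for n
  proof -
    have "(\<Sum>m\<le>n. \<Sum>d=1..m. (K d * R d) $ m) = (\<Sum>m\<le>n. \<Sum>d=1..n. (K d * R d) $ m)"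
    proof (rule sum.cong[OF refl])
      fix m assume "m \<in> {..n}"
      moreover have "(K d * R d) $ m = 0" if "d \<in> {1..n} - {1..m}" for d
        by (rule fps_mult_nth_eq_0, rule R0) (use that in auto)
      ultimately show "(\<Sum>d=1..m. (K d * R d) $ m) = (\<Sum>d=1..n. (K d * R d) $ m)"
        by (intro sum.mono_neutral_left) auto
    qed
    also have "\<dots> = (\<Sum>d=1..n. \<Sum>m\<le>n. (K d * R d) $ m)" by (rule sum.swap)
    also have "\<dots> = (\<Sum>d=1..n. (H * S d * R d) $ n)"
      using sum_one_minus_X_mult_nth[of "H * S d * R d" n for d]
      by (simp add: K_def M_def mult.assoc)
    finally show ?thesis
      using sum_one_minus_X_mult_nth[of H n]
      unfolding tele sum.distrib sum_subtractf M_def by simp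
  qed
  obtain c' where c': "c' > 0" "\<And>d. d > 0 \<Longrightarrow> w d \<le> c' / real d"
  proof
    show "max c 1 > 0" by simp
    show "w d \<le> max c 1 / real d" if "d > 0" for d
      using ac[OF that] that unfolding w_def by (meson divide_right_mono max.cobounded1 of_nat_0_le_iff order.trans)
  qed
  have w_nonneg: "0 \<le> w d" for d using q by (simp add: w_def)
  have B: "0 \<le> B" using H by (rule l1_bound_nonneg)
  have C: "0 \<le> C" using S_le[of 0 0] norm_ge_zero order.trans by blast
  define D where "D = B * C * (c'\<^sup>2 * exp c')"
  have term_le: "norm ((H * S d * R d) $ n) \<le> D * (1 / real d ^ 2)" if "d > 0" for d n
  proof -
    have "norm ((H * S d) $ n) \<le> B * C" for n by (rule norm_mult_nth_le[OF H S_le])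
    then have "norm ((R d * (H * S d)) $ n) \<le> ((w d)\<^sup>2 * exp (w d)) * (B * C)"
      by (rule norm_mult_nth_le[OF R_l1[OF that]])
    also have "\<dots> \<le> ((c' / real d)\<^sup>2 * exp c') * (B * C)"
    proof (intro mult_right_mono mult_mono power_mono)
      have "w d \<le> c' / real d" using c'(2)[OF that] .
      also have "\<dots> \<le> c'" using c'(1) that by (simp add: field_simps)
      finally show "exp (w d) \<le> exp c'" by simp
    qed (use c' that w_nonneg B C in auto)
    finally show ?thesis by (simp add: D_def mult.commute power_divide)
  qed
  have lim0: "(\<lambda>n. \<Sum>d=1..n. (H * S d * R d) $ n) \<longlonglongrightarrow> 0"
  proof -
    \<comment> \<open>Extending the terms by 0 gives a series over all \<open>d\<close> whose index
      set does not move with \<open>n\<close>, as the interchange of limit and sum requires.\<close>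
    define f where "f = (\<lambda>d n. if 1 \<le> d \<and> d \<le> n then (H * S d * R d) $ n else 0)"
    have fin: "suminf (\<lambda>d. f d n) = (\<Sum>d=1..n. (H * S d * R d) $ n)" for n
      by (subst suminf_finite[of "{1..n}"]) (auto simp: f_def intro!: sum.cong)
    have "((\<lambda>n. suminf (\<lambda>d. f d n)) \<longlongrightarrow> suminf (\<lambda>d. 0)) sequentially"
    proof (rule tannerys_theorem[where M = "\<lambda>d. D * (1 / real d ^ 2)", THEN conjunct2, THEN conjunct2])
      show "((\<lambda>n. f d n) \<longlongrightarrow> 0) sequentially" for d
      proof (cases "d = 0")
        case False
        \<comment> \<open>This bound for \<open>S d\<close> may grow with \<open>d\<close>. It only
          serves the limit for a fixed \<open>d\<close>; the domination uniform in \<open>d\<close>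
          is \<open>term_le\<close>.\<close>
        obtain S' where "l1_bound (S d) S'" using S_l1 by blast
        then have "l1_bound (H * S d * R d) (B * S' * ((w d)\<^sup>2 * exp (w d)))"
          using False by (intro l1_bound_mult H R_l1) auto
        then have "(\<lambda>n. (H * S d * R d) $ n) \<longlonglongrightarrow> 0" by (rule l1_bound_coeffs_tendsto_0)
        moreover have "eventually (\<lambda>n. f d n = (H * S d * R d) $ n) sequentially"
          using eventually_ge_at_top[of d] by eventually_elim (use False in \<open>simp add: f_def\<close>)
        ultimately show ?thesis by (simp add: filterlim_cong)
      qed (simp add: f_def)
      show "\<forall>\<^sub>F (d, n) in at_top \<times>\<^sub>F sequentially. norm (f d n) \<le> D * (1 / real d ^ 2)"
      proof (rule always_eventually, clarify)
        fix d n
        have "0 \<le> D" using B C by (simp add: D_def)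
        then show "norm (f d n) \<le> D * (1 / real d ^ 2)"
          using term_le[of d n] by (auto simp: f_def)
      qed
      show "summable (\<lambda>d. D * (1 / real d ^ 2))"
        by (intro summable_mult inverse_power_summable[where 'a = real, of 2, unfolded inverse_eq_divide]) simp
    qed simp
    then show ?thesis by (simp add: fin)
  qed
  have "(\<lambda>n. 1 - H $ n + (\<Sum>d=1..n. (H * S d * R d) $ n)) \<longlonglongrightarrow> 1 - 0 + 0"
    by (intro tendsto_intros lim0 l1_bound_coeffs_tendsto_0[OF H])
  then show ?thesis
    unfolding main [symmetric] unfolding K_def w_def S_inv [symmetric] Q_def by simp
qed

section \<open>Distinguishable sums over graded primes\<close>

text \<open>The passage from the Euler product to the limit sees the places only through their
  degrees, so it is carried out for an abstract set of graded primes.\<close>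

locale graded_primes =
  fixes P :: "'p set" and deg :: "'p \<Rightarrow> nat" and q :: real
  assumes deg_pos: "p \<in> P \<Longrightarrow> deg p > 0"
    and finite_deg: "finite {p \<in> P. deg p = d}"
    and q_gt_1: "q > 1"
begin

definition num :: "nat \<Rightarrow> nat" where "num d = card {p \<in> P. deg p = d}"

definition factor :: "nat \<Rightarrow> real fps" where
  "factor d = (1 - fps_const (1 / q ^ d) * fps_X ^ d) ^ num d"

text \<open>Sets of primes stand for squarefree divisors, the only ones on which the Moebius
  function does not vanish.\<close>

definition above :: "nat \<Rightarrow> nat \<Rightarrow> 'p set set" where
  "above d j = {A. finite A \<and> A \<subseteq> P \<and> (\<forall>p\<in>A. d < deg p) \<and> sum deg A = j}"

lemma finite_deg_le: "finite {p \<in> P. deg p \<le> m}"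
proof -
  have "{p \<in> P. deg p \<le> m} = (\<Union>d\<in>{..m}. {p \<in> P. deg p = d})" by auto
  then show ?thesis using finite_deg by simp
qed

lemma above_subset: "above d j \<subseteq> Pow {p \<in> P. d < deg p \<and> deg p \<le> j}"
proof
  fix A assume A: "A \<in> above d j"
  then have "deg p \<le> j" if "p \<in> A" for p
    using that member_le_sum[of p A deg] by (auto simp: above_def)
  with A show "A \<in> Pow {p \<in> P. d < deg p \<and> deg p \<le> j}" by (auto simp: above_def)
qed

lemma finite_above: "finite (above d j)"
  by (rule finite_subset[OF above_subset]) (use finite_deg_le[of j] in \<open>auto intro: rev_finite_subset\<close>)

lemma prod_factor_eq:
  "(\<Prod>e\<in>{d<..N}. factor e) = (\<Prod>p\<in>{p \<in> P. d < deg p \<and> deg p \<le> N}. 1 - fps_const (1 / q ^ deg p) * fps_X ^ deg p)"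
proof -
  let ?X = "{p \<in> P. d < deg p \<and> deg p \<le> N}"
  let ?m = "\<lambda>p. fps_const (1 / q ^ deg p) * fps_X ^ deg p"
  have fin: "finite ?X" by (rule rev_finite_subset[OF finite_deg_le[of N]]) auto
  have "(\<Prod>e\<in>{d<..N}. factor e) = (\<Prod>e\<in>{d<..N}. \<Prod>p\<in>{p \<in> ?X. deg p = e}. 1 - ?m p)"
  proof (rule prod.cong[OF refl])
    fix e assume e: "e \<in> {d<..N}"
    then have "{p \<in> ?X. deg p = e} = {p \<in> P. deg p = e}" by auto
    moreover have "(\<Prod>p\<in>{p \<in> P. deg p = e}. 1 - ?m p)
        = (\<Prod>p\<in>{p \<in> P. deg p = e}. 1 - fps_const (1 / q ^ e) * fps_X ^ e)"
      by (rule prod.cong) auto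
    ultimately show "factor e = (\<Prod>p\<in>{p \<in> ?X. deg p = e}. 1 - ?m p)"
      by (simp add: factor_def num_def)
  qed
  also have "\<dots> = (\<Prod>p\<in>?X. 1 - ?m p)"
    by (rule prod.group[OF fin]) auto
  finally show ?thesis .
qed

text \<open>Expanding the product over single primes, each set \<open>A\<close> contributes its sign
  and \<open>1/q\<close> to the power of its degree. The cutoff \<open>N\<close> is invisible
  because a prime in a set of total degree \<open>j\<close> has degree at most
  \<open>j\<close>.\<close>

lemma prod_factor_nth:
  assumes "j \<le> N"
  shows "(\<Prod>e\<in>{d<..N}. factor e) $ j = (\<Sum>A\<in>above d j. (-1) ^ card A) / q ^ j"
proof -
  let ?X = "{p \<in> P. d < deg p \<and> deg p \<le> N}"
  let ?m = "\<lambda>p. fps_const (1 / q ^ deg p) * fps_X ^ deg p"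
  have fin: "finite ?X" by (rule rev_finite_subset[OF finite_deg_le[of N]]) auto
  have "(\<Prod>e\<in>{d<..N}. factor e) = (\<Prod>p\<in>?X. 1 - ?m p)" by (rule prod_factor_eq)
  also have "\<dots> = (\<Prod>p\<in>?X. - ?m p + 1)" by (simp add: algebra_simps)
  also have "\<dots> = (\<Sum>A\<in>Pow ?X. \<Prod>p\<in>A. - ?m p)"
    using prod_add[OF fin, of "\<lambda>p. - ?m p" "\<lambda>_. 1"] by simp
  finally have eq: "(\<Prod>e\<in>{d<..N}. factor e) = (\<Sum>A\<in>Pow ?X. \<Prod>p\<in>A. - ?m p)" .
  have mono: "(\<Prod>p\<in>A. - ?m p) = fps_const ((-1) ^ card A / q ^ sum deg A) * fps_X ^ sum deg A"
    if "finite A" for A using that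
  proof (induction A)
    case (insert x A)
    have "fps_const ((-1) ^ card (insert x A) / q ^ sum deg (insert x A))
       = - fps_const (1 / q ^ deg x) * fps_const ((-1) ^ card A / q ^ sum deg A)"
      using insert(1,2) by (simp add: power_add)
    with insert show ?case by (simp add: power_add algebra_simps flip: fps_const_neg)
  qed simp
  have "(\<Prod>e\<in>{d<..N}. factor e) $ j
      = (\<Sum>A\<in>Pow ?X. (if sum deg A = j then (-1) ^ card A / q ^ j else 0))"
    unfolding eq fps_sum_nth
    by (intro sum.cong refl) (use fin in \<open>auto simp: mono finite_subset fps_X_power_nth\<close>)
  also have "\<dots> = (\<Sum>A\<in>above d j. (-1) ^ card A / q ^ j)"
  proof (rule sum.mono_neutral_cong_right)
    show "finite (Pow ?X)" using fin by simp
    show "above d j \<subseteq> Pow ?X" using above_subset[of d j] assms by fastforce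
    show "\<forall>i\<in>Pow ?X - above d j. (if sum deg i = j then (- 1) ^ card i / q ^ j else 0) = 0"
      using fin by (auto simp: above_def dest: finite_subset)
    show "\<And>x. x \<in> above d j \<Longrightarrow> (if sum deg x = j then (- 1) ^ card x / q ^ j else 0) = (- 1) ^ card x / q ^ j"
      by (auto simp: above_def)
  qed
  finally show ?thesis by (simp add: sum_divide_distrib)
qed

text \<open>\<open>M\<close> stands for the infinite Euler product and is known only through its
  agreement with long finite ones. Cancelling the factors up to \<open>d\<close> is therefore done
  in a finite product reaching to \<open>max d j\<close>.\<close>

lemma prod_factor_tail_nth:
  assumes M: "\<And>n N. n \<le> N \<Longrightarrow> M $ n = (\<Prod>d\<in>{1..N}. factor d) $ n"
  shows "(M * inverse (\<Prod>e\<in>{1..d}. factor e)) $ j = (\<Sum>A\<in>above d j. (-1) ^ card A) / q ^ j"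
proof -
  let ?N = "max d j"
  let ?Q = "\<Prod>e\<in>{1..d}. factor e"
  have Q0: "?Q $ 0 = 1"
    by (simp add: factor_def fps_prod_nth' one_minus_monomial_power_nth_0)
  have "(M * inverse ?Q) $ j = ((\<Prod>e\<in>{1..?N}. factor e) * inverse ?Q) $ j"
    by (rule fps_mult_nth_cong) (use M[of _ ?N] in auto)
  also have "(\<Prod>e\<in>{1..?N}. factor e) = (\<Prod>e\<in>{d<..?N}. factor e) * ?Q"
  proof -
    have "{1..?N} = {d<..?N} \<union> {1..d}" by auto
    moreover have "{d<..?N} \<inter> {1..d} = {}" by auto
    ultimately show ?thesis by (simp add: prod.union_disjoint)
  qed
  also have "\<dots> * inverse ?Q = (\<Prod>e\<in>{d<..?N}. factor e)"
    using inverse_mult_eq_1'[of ?Q] Q0 by (simp add: mult.assoc)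
  finally show ?thesis by (simp add: prod_factor_nth)
qed

definition uniquely_least :: "'p set \<Rightarrow> bool" where
  "uniquely_least B \<longleftrightarrow> (\<exists>!p. p \<in> B \<and> (\<forall>r\<in>B. deg p \<le> deg r))"

text \<open>The removed least prime accounts for the sign, and sorting by its degree
  \<open>d\<close> produces the factor \<open>num d\<close>, since what remains depends on
  \<open>d\<close> only.\<close>

lemma sum_uniquely_least:
  "(\<Sum>B | finite B \<and> B \<subseteq> P \<and> uniquely_least B \<and> sum deg B = m. (-1) ^ card B)
     = - (\<Sum>d=1..m. real (num d) * (\<Sum>A\<in>above d (m - d). (-1) ^ card A))"
proof -
  let ?S = "SIGMA p:{p \<in> P. deg p \<le> m}. above (deg p) (m - deg p)"
  let ?B = "{B. finite B \<and> B \<subseteq> P \<and> uniquely_least B \<and> sum deg B = m}"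
  have ab: "finite A" "A \<subseteq> P" "p \<notin> A" "\<And>r. r \<in> A \<Longrightarrow> deg p < deg r" "sum deg A = j"
    if "A \<in> above (deg p) j" for A p j using that by (auto simp: above_def)
  have bij: "bij_betw (\<lambda>(p, A). insert p A) ?S ?B"
  proof (rule bij_betwI')
    fix x y assume "x \<in> ?S" "y \<in> ?S"
    then show "((case x of (p, A) \<Rightarrow> insert p A) = (case y of (p, A) \<Rightarrow> insert p A)) = (x = y)"
    proof (cases x; cases y; clarsimp)
      fix p A r B
      assume A: "A \<in> above (deg p) (m - deg p)" and B: "B \<in> above (deg r) (m - deg r)"
      have "p = r" if "insert p A = insert r B"
      proof (rule ccontr)
        assume "p \<noteq> r"
        then have "r \<in> A" "p \<in> B" using that by auto
        then show False using ab(4)[OF A, of r] ab(4)[OF B, of p] by simp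
      qed
      then show "(insert p A = insert r B) = (p = r \<and> A = B)"
        using ab(3)[OF A] ab(3)[OF B] by (metis Diff_insert_absorb)
    qed
  next
    fix x assume "x \<in> ?S"
    then show "(case x of (p, A) \<Rightarrow> insert p A) \<in> ?B"
    proof (cases x; clarsimp)
      fix p A assume p: "p \<in> P" "deg p \<le> m" and A: "A \<in> above (deg p) (m - deg p)"
      have "uniquely_least (insert p A)"
        unfolding uniquely_least_def
      proof (rule ex1I[of _ p])
        show "p \<in> insert p A \<and> (\<forall>r\<in>insert p A. deg p \<le> deg r)" using ab(4)[OF A] by (auto intro: less_imp_le)
        fix r assume "r \<in> insert p A \<and> (\<forall>s\<in>insert p A. deg r \<le> deg s)"
        then show "r = p" using ab(4)[OF A, of r] by (auto simp: not_le [symmetric])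
      qed
      then show "finite A \<and> A \<subseteq> P \<and> uniquely_least (insert p A) \<and> sum deg (insert p A) = m"
        using ab[OF A] p by simp
    qed
  next
    fix B assume B: "B \<in> ?B"
    then obtain p where p: "p \<in> B" "\<forall>r\<in>B. deg p \<le> deg r"
      and u: "\<And>r. r \<in> B \<Longrightarrow> (\<forall>s\<in>B. deg r \<le> deg s) \<Longrightarrow> r = p"
      unfolding uniquely_least_def by blast
    have lt: "deg p < deg r" if "r \<in> B - {p}" for r
    proof (rule ccontr)
      assume "\<not> deg p < deg r"
      then have "\<forall>s\<in>B. deg r \<le> deg s" using p by (meson linorder_not_less order.trans)
      then show False using u[of r] that by auto
    qed
    have s: "deg p + sum deg (B - {p}) = m" using B p sum.remove[of B p deg] by simp
    have "(p, B - {p}) \<in> ?S" using B p lt s by (auto simp: above_def)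
    moreover have "insert p (B - {p}) = B" using p by auto
    ultimately show "\<exists>x\<in>?S. B = (case x of (p, A) \<Rightarrow> insert p A)"
      by (intro bexI[of _ "(p, B - {p})"]) auto
  qed
  have "(\<Sum>B\<in>?B. (-1::real) ^ card B) = (\<Sum>(p, A)\<in>?S. (-1) ^ card (insert p A))"
    using sum.reindex_bij_betw[OF bij, of "\<lambda>B. (-1::real) ^ card B"] by (simp add: case_prod_unfold)
  also have "\<dots> = (\<Sum>(p, A)\<in>?S. - ((-1) ^ card A))"
    by (rule sum.cong) (auto simp: card_insert_disjoint[OF ab(1,3)])
  also have "\<dots> = (\<Sum>p | p \<in> P \<and> deg p \<le> m. - (\<Sum>A\<in>above (deg p) (m - deg p). (-1) ^ card A))"
    by (subst sum.Sigma [symmetric]) (use finite_deg_le finite_above in \<open>auto simp: sum_negf\<close>)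
  also have "\<dots> = (\<Sum>d\<in>{1..m}. \<Sum>p\<in>{p \<in> {p \<in> P. deg p \<le> m}. deg p = d}.
                     - (\<Sum>A\<in>above (deg p) (m - deg p). (-1) ^ card A))"
    by (rule sum.group [symmetric]) (use finite_deg_le deg_pos in \<open>auto simp: Suc_le_eq\<close>)
  also have "\<dots> = (\<Sum>d\<in>{1..m}. - (real (num d) * (\<Sum>A\<in>above d (m - d). (-1) ^ card A)))"
  proof (rule sum.cong[OF refl])
    fix d assume "d \<in> {1..m}"
    then have "{p \<in> {p \<in> P. deg p \<le> m}. deg p = d} = {p \<in> P. deg p = d}" by auto
    then show "(\<Sum>p\<in>{p \<in> {p \<in> P. deg p \<le> m}. deg p = d}.
        - (\<Sum>A\<in>above (deg p) (m - deg p). (-1) ^ card A))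
      = - (real (num d) * (\<Sum>A\<in>above d (m - d). (-1) ^ card A))"
      by (simp add: num_def)
  qed
  finally show ?thesis by (simp add: sum_negf)
qed

definition mdeg :: "'p multiset \<Rightarrow> nat" where "mdeg D = (\<Sum>p\<in>#D. deg p)"

text \<open>Because degrees are positive, a divisor of degree at most \<open>m\<close> has at most
  \<open>m\<close> prime factors, all of degree at most \<open>m\<close>.\<close>

lemma finite_mdeg_le: "finite {D. set_mset D \<subseteq> P \<and> mdeg D \<le> m}"
proof (rule finite_subset)
  show "{D. set_mset D \<subseteq> P \<and> mdeg D \<le> m}
    \<subseteq> mset ` {xs. set xs \<subseteq> {p \<in> P. deg p \<le> m} \<and> length xs \<le> m}"
  proof
    fix D assume D: "D \<in> {D. set_mset D \<subseteq> P \<and> mdeg D \<le> m}"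
    obtain xs where xs: "D = mset xs" by (metis ex_mset)
    have "size D \<le> mdeg D"
      using D unfolding mdeg_def
      by (induction D) (use deg_pos in \<open>auto simp: Suc_le_eq intro!: add_less_le_mono\<close>, fastforce)
    moreover have "deg p \<le> mdeg D" if "p \<in># D" for p
      using that unfolding mdeg_def by (metis multi_member_split image_mset_add_mset sum_mset.add_mset le_add1)
    ultimately show "D \<in> mset ` {xs. set xs \<subseteq> {p \<in> P. deg p \<le> m} \<and> length xs \<le> m}"
      using D xs by (intro image_eqI[of _ _ xs]) fastforce+
  qed
  show "finite (mset ` {xs. set xs \<subseteq> {p \<in> P. deg p \<le> m} \<and> length xs \<le> m})"
    using finite_lists_length_le[OF finite_deg_le] by simp
qed

lemma sum_moebius_uniquely_least:
  "(\<Sum>D | set_mset D \<subseteq> P \<and> uniquely_least (set_mset D) \<and> mdeg D = m. real_of_int (div_moebius D))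
    = (\<Sum>B | finite B \<and> B \<subseteq> P \<and> uniquely_least B \<and> sum deg B = m. (-1) ^ card B)"
proof -
  let ?D = "{D. set_mset D \<subseteq> P \<and> uniquely_least (set_mset D) \<and> mdeg D = m}"
  let ?B = "{B. finite B \<and> B \<subseteq> P \<and> uniquely_least B \<and> sum deg B = m}"
  have fin: "finite ?D" by (rule rev_finite_subset[OF finite_mdeg_le[of m]]) auto
  have ms: "mset_set B \<in> ?D" if "B \<in> ?B" for B
    using that by (auto simp: mdeg_def sum_unfold_sum_mset)
  have "(\<Sum>D\<in>?D. real_of_int (div_moebius D)) = (\<Sum>D\<in>mset_set ` ?B. real_of_int (div_moebius D))"
  proof (rule sum.mono_neutral_right[OF fin])
    show "mset_set ` ?B \<subseteq> ?D" using ms by auto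
    show "\<forall>D\<in>?D - mset_set ` ?B. real_of_int (div_moebius D) = 0"
    proof (rule ballI, rule ccontr)
      fix D assume D: "D \<in> ?D - mset_set ` ?B" and n0: "real_of_int (div_moebius D) \<noteq> 0"
      have "count D p \<le> 1" for p using n0 by (auto simp: div_moebius_def split: if_splits)
      then have eq: "D = mset_set (set_mset D)"
        by (intro multiset_eqI) (metis (no_types, lifting) One_nat_def count_greater_zero_iff count_mset_set(1,3)
            finite_set_mset le_Suc_eq le_zero_eq not_gr_zero)
      have "set_mset D \<in> ?B" using D arg_cong[OF eq, of mdeg] by (auto simp: mdeg_def sum_unfold_sum_mset)
      with eq D show False by blast
    qed
  qed
  also have "\<dots> = (\<Sum>B\<in>?B. real_of_int (div_moebius (mset_set B)))"
    by (subst sum.reindex) (auto simp: inj_on_def)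
  also have "\<dots> = (\<Sum>B\<in>?B. (-1) ^ card B)"
    by (rule sum.cong) (auto simp: div_moebius_def count_mset_set')
  finally show ?thesis .
qed

text \<open>\<open>1/((1 - X) H)\<close> generates the numbers of effective divisors of degree
  \<open>n\<close> over \<open>q^n\<close>, so \<open>Z\<close> says that there are
  \<open>O(q^n)\<close> of them. Starting the sum at degree 2 instead of 1 leaves out the single
  primes of degree 1, which is where \<open>num 1\<close> enters the limit.\<close>

theorem sum_distinguishable_tendsto:
  assumes ac: "\<And>d. d > 0 \<Longrightarrow> real (num d) / q ^ d \<le> c / real d"
    and H: "l1_bound H B" and Z: "\<And>n. inverse ((1 - fps_X) * H) $ n \<le> C"
    and M: "\<And>n N. n \<le> N \<Longrightarrow> ((1 - fps_X) * H) $ n = (\<Prod>d\<in>{1..N}. factor d) $ n"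
  shows "(\<lambda>n. \<Sum>D | set_mset D \<subseteq> P \<and> uniquely_least (set_mset D) \<and> 2 \<le> mdeg D \<and> mdeg D \<le> n.
           real_of_int (div_moebius D) / q ^ mdeg D) \<longlonglongrightarrow> real (num 1) / q - 1"
proof -
  let ?M = "(1 - fps_X) * H"
  let ?D = "\<lambda>m. {D. set_mset D \<subseteq> P \<and> uniquely_least (set_mset D) \<and> mdeg D = m}"
  define t where "t = (\<lambda>m. \<Sum>d=1..m. real (num d) / q ^ d * (?M * inverse (\<Prod>e\<in>{1..d}. factor e)) $ (m - d))"
  have tail: "(?M * inverse (\<Prod>e\<in>{1..d}. factor e)) $ j = (\<Sum>A\<in>above d j. (-1) ^ card A) / q ^ j" for d j
    by (rule prod_factor_tail_nth) (rule M)
  have lim: "(\<lambda>n. \<Sum>m\<le>n. t m) \<longlonglongrightarrow> 1"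
    unfolding t_def factor_def
    by (rule least_degree_unique_sum_tendsto[OF q_gt_1 ac H Z]) (use M in \<open>auto simp: factor_def\<close>)
  have D: "(\<Sum>D\<in>?D m. real_of_int (div_moebius D) / q ^ mdeg D) = - t m" for m
  proof -
    have "(\<Sum>D\<in>?D m. real_of_int (div_moebius D) / q ^ mdeg D)
        = (\<Sum>D\<in>?D m. real_of_int (div_moebius D)) / q ^ m"
      by (simp add: sum_divide_distrib)
    also have "\<dots> = - (\<Sum>d=1..m. real (num d) * (\<Sum>A\<in>above d (m - d). (-1) ^ card A)) / q ^ m"
      by (simp only: sum_moebius_uniquely_least sum_uniquely_least)
    also have "\<dots> = - (\<Sum>d=1..m. real (num d) * (\<Sum>A\<in>above d (m - d). (-1) ^ card A) / q ^ m)"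
      by (simp add: sum_divide_distrib)
    also have "(\<Sum>d=1..m. real (num d) * (\<Sum>A\<in>above d (m - d). (-1) ^ card A) / q ^ m) = t m"
      unfolding t_def
    proof (rule sum.cong[OF refl])
      fix d assume "d \<in> {1..m}"
      then have "q ^ m = q ^ d * q ^ (m - d)" by (simp flip: power_add)
      then show "real (num d) * (\<Sum>A\<in>above d (m - d). (- 1) ^ card A) / q ^ m
         = real (num d) / q ^ d * (?M * inverse (\<Prod>e\<in>{1..d}. factor e)) $ (m - d)"
        unfolding tail by simp
    qed
    finally show ?thesis .
  qed
  have t0: "t 0 = 0" by (simp add: t_def)
  have t1: "t 1 = real (num 1) / q"
  proof -
    have "above (Suc 0) 0 = {{}}" by (auto simp: above_def)
    then show ?thesis using tail[of 1 0] by (simp add: t_def)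
  qed
  have eq: "(\<Sum>D | set_mset D \<subseteq> P \<and> uniquely_least (set_mset D) \<and> 2 \<le> mdeg D \<and> mdeg D \<le> n.
           real_of_int (div_moebius D) / q ^ mdeg D) = real (num 1) / q - (\<Sum>m\<le>n. t m)"
    (is "sum ?f ?A = _") if "n \<ge> 1" for n
  proof -
    have fin: "finite ?A" by (rule rev_finite_subset[OF finite_mdeg_le[of n]]) auto
    have "sum ?f ?A = (\<Sum>m\<in>{2..n}. sum ?f {D \<in> ?A. mdeg D = m})"
      by (rule sum.group [symmetric]) (use fin in auto)
    also have "\<dots> = (\<Sum>m\<in>{2..n}. sum ?f (?D m))"
      by (rule sum.cong[OF refl], rule sum.cong) auto
    also have "\<dots> = - (\<Sum>m\<in>{2..n}. t m)" by (simp only: D sum_negf)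
    also have "(\<Sum>m\<in>{2..n}. t m) = (\<Sum>m\<le>n. t m) - t 1 - t 0"
    proof -
      have "{..n} = insert 0 (insert 1 {2..n})" using that by auto
      then show ?thesis by simp
    qed
    finally show ?thesis unfolding t0 t1 by simp
  qed
  have "eventually (\<lambda>n. real (num 1) / q - (\<Sum>m\<le>n. t m) =
     (\<Sum>D | set_mset D \<subseteq> P \<and> uniquely_least (set_mset D) \<and> 2 \<le> mdeg D \<and> mdeg D \<le> n.
           real_of_int (div_moebius D) / q ^ mdeg D)) sequentially"
    by (rule eventually_sequentiallyI[of 1], rule eq [symmetric])
  moreover have "(\<lambda>n. real (num 1) / q - (\<Sum>m\<le>n. t m)) \<longlonglongrightarrow> real (num 1) / q - 1"
    by (intro tendsto_intros lim)
  ultimately show ?thesis by (rule Lim_transform_eventually [rotated])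
qed

end

section \<open>Quadratic characters of finite fields\<close>

text \<open>With these rules the simplifier turns a ring expression into a polynomial expression, whose normal
  form \<open>code_simp\<close> computes.\<close>

lemma (in cring) reify:
  "\<zero> = Ipolex l (Const 0)" "\<one> = Ipolex l (Const 1)" "\<guillemotleft>i\<guillemotright> = Ipolex l (Const i)"
  "Ipolex l P \<oplus> Ipolex l Q = Ipolex l (Add P Q)" "Ipolex l P \<ominus> Ipolex l Q = Ipolex l (Sub P Q)"
  "\<ominus> Ipolex l P = Ipolex l (Neg P)" "Ipolex l P \<otimes> Ipolex l Q = Ipolex l (Mul P Q)"
  "Ipolex l P [^] (n::nat) = Ipolex l (polex.Pow P n)"
  by simp_all

lemma (in ring) eqI_diff: "a \<ominus> b = \<zero> \<Longrightarrow> a \<in> carrier R \<Longrightarrow> b \<in> carrier R \<Longrightarrow> a = b"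
  by simp

lemma (in field) nonzero_pow_order:
  assumes "finite (carrier R)" "x \<in> carrier R" "x \<noteq> \<zero>"
  shows "x [^] (order R - 1) = \<one>"
proof -
  interpret G: group "Multiplicative_Group.mult_of R" by (rule field_mult_group)
  have "x [^]\<^bsub>Multiplicative_Group.mult_of R\<^esub> order (Multiplicative_Group.mult_of R) = \<one>"
    using G.pow_order_eq_1[of x] assms by (simp add: Multiplicative_Group.one_mult_of Multiplicative_Group.carrier_mult_of)
  then show ?thesis
    by (simp only: Multiplicative_Group.nat_pow_mult_of order_mult_of[OF assms(1)])
qed

lemma (in field) order_gt_1: "finite (carrier R) \<Longrightarrow> order R > 1"
  unfolding order_def using card_mono[of "carrier R" "{\<zero>, \<one>}"] by simp

lemma (in field) pow_order:
  assumes "finite (carrier R)" "x \<in> carrier R"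
  shows "x [^] order R = x"
proof (cases "x = \<zero>")
  case True
  then show ?thesis using order_gt_1[OF assms(1)] by (simp add: nat_pow_zero)
next
  case False
  have "x [^] Suc (order R - 1) = x" using nonzero_pow_order[OF assms False] assms by simp
  then show ?thesis using order_gt_1[OF assms(1)] by simp
qed

lemma card_set_mset_le_size: "card (set_mset M) \<le> size M"
  by (induction M) (auto simp: card_insert_if le_SucI)

lemma (in field) card_roots_le:
  assumes "p \<in> carrier (poly_ring R)" "p \<noteq> []"
  shows "finite {x \<in> carrier R. eval p x = \<zero>}" "card {x \<in> carrier R. eval p x = \<zero>} \<le> degree p"
proof -
  have eq: "{x \<in> carrier R. eval p x = \<zero>} = set_mset (roots p)"
    using roots_mem_iff_is_root[OF assms(1)] assms(2) by (auto simp: is_root_def)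
  then show "finite {x \<in> carrier R. eval p x = \<zero>}" by simp
  have "card (set_mset (roots p)) \<le> size (roots p)" by (rule card_set_mset_le_size)
  also have "\<dots> \<le> degree p" using size_roots_le_degree[OF assms(1)] .
  finally show "card {x \<in> carrier R. eval p x = \<zero>} \<le> degree p" by (simp only: eq)
qed

text \<open>For \<open>n = (q - 1) div 2\<close> this is the quadratic character of the field with \<open>q\<close> elements,
  but \<open>x\<close> may lie in a larger field.\<close>

definition qc :: "('a, 'm) ring_scheme \<Rightarrow> nat \<Rightarrow> 'a \<Rightarrow> real" where
  "qc R n x = (if x = \<zero>\<^bsub>R\<^esub> then 0 else if x [^]\<^bsub>R\<^esub> n = \<one>\<^bsub>R\<^esub> then 1 else -1)"

lemma (in domain) pow_pm_one:
  assumes "x \<in> carrier R" "x [^] (2 * n :: nat) = \<one>"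
  shows "x [^] n = \<one> \<or> x [^] n = \<ominus> \<one>"
proof -
  have "(x [^] n) \<otimes> (x [^] n) = \<one> \<otimes> \<one>"
    using assms by (simp add: nat_pow_mult mult_2)
  then show ?thesis using assms by (subst (asm) square_eq_iff) auto
qed

text \<open>In a domain \<open>x^(2n) = 1\<close> forces \<open>x^n\<close> to be 1 or -1, and these
  signs multiply. The condition is placed on the elements because they will live in an algebraically
  closed field, where it singles out the nonzero elements of the small one.\<close>

lemma (in domain) qc_mult:
  assumes "x \<in> carrier R" "y \<in> carrier R"
    and "x \<noteq> \<zero> \<Longrightarrow> x [^] (2 * n) = \<one>" "y \<noteq> \<zero> \<Longrightarrow> y [^] (2 * n) = \<one>"
  shows "qc R n (x \<otimes> y) = qc R n x * qc R n y"
proof (cases "x = \<zero> \<or> y = \<zero>")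
  case True
  then show ?thesis using assms by (auto simp: qc_def)
next
  case False
  then have xy: "x \<otimes> y \<noteq> \<zero>" using assms integral by blast
  have p: "(x \<otimes> y) [^] n = x [^] n \<otimes> y [^] n" using assms by (simp add: nat_pow_distrib)
  have "x [^] n = \<one> \<or> x [^] n = \<ominus> \<one>" "y [^] n = \<one> \<or> y [^] n = \<ominus> \<one>"
    using False assms pow_pm_one by auto
  moreover have "\<ominus> \<one> \<otimes> \<ominus> \<one> = \<one>" by (simp add: l_minus r_minus)
  ultimately show ?thesis using False xy
    by (cases "\<ominus> \<one> = \<one>") (auto simp: qc_def p)
qed

lemma (in domain) qc_square:
  assumes "x \<in> carrier R" "x \<noteq> \<zero>" "x [^] (2 * n) = \<one>"
  shows "qc R n (x \<otimes> x) = 1"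
  using qc_mult[OF assms(1,1), of n] assms by (auto simp: qc_def)

locale odd_finite_field = field R for R (structure) +
  assumes finite_carrier: "finite (carrier R)" and two_nonzero: "\<one> \<oplus> \<one> \<noteq> \<zero>"
begin

definition hq :: nat where "hq = (order R - 1) div 2"

lemma double_nonzero: "x \<in> carrier R \<Longrightarrow> x \<noteq> \<zero> \<Longrightarrow> x \<oplus> x \<noteq> \<zero>"
proof -
  assume x: "x \<in> carrier R" "x \<noteq> \<zero>"
  have "x \<oplus> x = (\<one> \<oplus> \<one>) \<otimes> x" using x by (simp add: l_distr)
  then show ?thesis using x two_nonzero integral[of "\<one> \<oplus> \<one>" x] by auto
qed

lemma neg_neq: "x \<in> carrier R \<Longrightarrow> x \<noteq> \<zero> \<Longrightarrow> \<ominus> x \<noteq> x"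
  using double_nonzero by (metis r_neg)

text \<open>Since \<open>-1\<close> differs from 1 it has order 2 in the multiplicative group, and
  Lagrange's theorem makes \<open>q - 1\<close> even.\<close>

lemma order_eq: "order R = 2 * hq + 1" and hq_pos: "hq > 0"
proof -
  interpret G: group "Multiplicative_Group.mult_of R" by (rule field_mult_group)
  have m1: "\<ominus> \<one> \<noteq> \<one>" using neg_neq[of \<one>] by simp
  have "G.ord (\<ominus> \<one>) = 2"
  proof -
    have "(\<ominus> \<one>) [^] (2::nat) = \<one>" by (simp add: power2_eq_square l_minus r_minus)
    then have "G.ord (\<ominus> \<one>) dvd 2"
      using G.pow_eq_id[of "\<ominus> \<one>" 2] by (simp add: Multiplicative_Group.mult_of_simps)
    moreover have "G.ord (\<ominus> \<one>) \<noteq> 1"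
      using G.ord_eq_1[of "\<ominus> \<one>"] m1 by (simp add: Multiplicative_Group.mult_of_simps)
    ultimately show ?thesis using prime_nat_iff two_is_prime_nat by blast
  qed
  then have "2 dvd order R - 1"
    using G.ord_dvd_group_order[of "\<ominus> \<one>"] finite_carrier
    by (simp add: Multiplicative_Group.mult_of_simps order_mult_of)
  then show "order R = 2 * hq + 1" "hq > 0" using order_gt_1[OF finite_carrier] by (auto simp: hq_def elim: oddE)
qed

lemma pow_2hq: "x \<in> carrier R \<Longrightarrow> x \<noteq> \<zero> \<Longrightarrow> x [^] (2 * hq) = \<one>"
  using nonzero_pow_order[OF finite_carrier] order_eq by simp

text \<open>The multiplicative group is cyclic. If an odd power of a generator \<open>g\<close> had
  \<open>hq\<close>-th power 1, then so would \<open>g\<close> itself, and its powers would exhaust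
  at most \<open>hq\<close> of the \<open>2 hq\<close> nonzero elements.\<close>

lemma euler_criterion:
  assumes "x \<in> carrier R" "x \<noteq> \<zero>"
  shows "(\<exists>y\<in>carrier R. y \<otimes> y = x) \<longleftrightarrow> x [^] hq = \<one>"
proof
  assume "\<exists>y\<in>carrier R. y \<otimes> y = x"
  then obtain y where y: "y \<in> carrier R" "y \<otimes> y = x" by blast
  then have "y \<noteq> \<zero>" using assms by auto
  then show "x [^] hq = \<one>" using pow_2hq[of y] y
    by (metis nat_pow_distrib nat_pow_mult mult_2)
next
  assume x1: "x [^] hq = \<one>"
  obtain g where g: "g \<in> carrier R" "g \<noteq> \<zero>" and gen: "carrier R - {\<zero>} = {g [^] i | i::nat. i \<in> UNIV}"
    using finite_field_mult_group_has_gen[OF finite_carrier] by (auto simp: Multiplicative_Group.carrier_mult_of)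
  obtain i :: nat where i: "x = g [^] i" using gen assms by blast
  show "\<exists>y\<in>carrier R. y \<otimes> y = x"
  proof (cases "even i")
    case True
    then obtain j where "i = j + j" by (metis evenE mult_2)
    then have "g [^] j \<otimes> g [^] j = x" using i g by (simp add: nat_pow_mult)
    then show ?thesis using g by blast
  next
    case False
    then obtain j where j: "i = 2 * j + 1" by (metis oddE)
    have "x [^] hq = g [^] (i * hq)" using i g by (simp only: nat_pow_pow)
    also have "i * hq = 2 * hq * j + hq" by (simp add: j algebra_simps)
    also have "g [^] \<dots> = (g [^] (2 * hq)) [^] j \<otimes> g [^] hq"
      using g by (simp add: nat_pow_pow nat_pow_mult)
    finally have gh: "g [^] hq = \<one>" using x1 pow_2hq[OF g] g by simp
    have "carrier R - {\<zero>} \<subseteq> (\<lambda>i. g [^] i) ` {..<hq}"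
    proof
      fix z assume "z \<in> carrier R - {\<zero>}"
      then obtain l :: nat where l: "z = g [^] l" using gen by blast
      have "g [^] l = g [^] (hq * (l div hq) + l mod hq)" by simp
      also have "\<dots> = (g [^] hq) [^] (l div hq) \<otimes> g [^] (l mod hq)"
        using g by (simp only: nat_pow_pow nat_pow_mult)
      also have "\<dots> = g [^] (l mod hq)" using gh g by simp
      finally show "z \<in> (\<lambda>i. g [^] i) ` {..<hq}" using l hq_pos by auto
    qed
    then have "card (carrier R - {\<zero>}) \<le> card {..<hq}" using surj_card_le by blast
    moreover have "card (carrier R - {\<zero>}) = 2 * hq"
      using order_eq finite_carrier by (simp add: order_def)
    ultimately show ?thesis using hq_pos by simp
  qed
qed

abbreviation quad :: "'a \<Rightarrow> real" where "quad \<equiv> qc R hq"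

lemma quad_mult: "x \<in> carrier R \<Longrightarrow> y \<in> carrier R \<Longrightarrow> quad (x \<otimes> y) = quad x * quad y"
  by (rule qc_mult) (auto intro: pow_2hq)

lemma card_sqrt:
  assumes "x \<in> carrier R" shows "real (card {y \<in> carrier R. y \<otimes> y = x}) = 1 + quad x"
proof (cases "x = \<zero>")
  case True
  then have "{y \<in> carrier R. y \<otimes> y = x} = {\<zero>}" using integral by auto
  then show ?thesis using True by (simp add: qc_def)
next
  case False
  show ?thesis
  proof (cases "\<exists>y\<in>carrier R. y \<otimes> y = x")
    case True
    then obtain y where y: "y \<in> carrier R" "y \<otimes> y = x" by blast
    then have "y \<noteq> \<zero>" using False by auto
    have "{z \<in> carrier R. z \<otimes> z = x} = {y, \<ominus> y}"
      using y square_eq_iff[of _ y] by (auto simp: l_minus r_minus)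
    moreover have "\<ominus> y \<noteq> y" using neg_neq y \<open>y \<noteq> \<zero>\<close> by blast
    ultimately show ?thesis using True False assms euler_criterion by (auto simp: qc_def)
  next
    case F: False
    then have e: "{z \<in> carrier R. z \<otimes> z = x} = {}" by auto
    show ?thesis using F False assms euler_criterion unfolding e by (auto simp: qc_def)
  qed
qed

text \<open>Every element is a square root of exactly one element, so the numbers of square roots,
  \<open>1 + quad x\<close>, add up to the order of the field.\<close>

lemma sum_quad: "(\<Sum>x\<in>carrier R. quad x) = 0"
proof -
  have "(\<Sum>x\<in>carrier R. real (card {y \<in> carrier R. y \<otimes> y = x})) = real (card (carrier R))"
  proof -
    have "(\<Sum>x\<in>carrier R. card {y \<in> carrier R. y \<otimes> y = x}) = card (\<Union>x\<in>carrier R. {y \<in> carrier R. y \<otimes> y = x})"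
      using finite_carrier by (intro card_UN_disjoint [symmetric]) auto
    also have "(\<Union>x\<in>carrier R. {y \<in> carrier R. y \<otimes> y = x}) = carrier R" by auto
    finally show ?thesis by (simp flip: of_nat_sum)
  qed
  then show ?thesis by (simp add: card_sqrt sum.distrib)
qed

lemma exists_nonresidue: "\<exists>c\<in>carrier R. quad c = -1"
proof (rule ccontr)
  assume "\<not> ?thesis"
  then have "quad x \<noteq> -1" if "x \<in> carrier R" for x using that by blast
  then have "quad x \<ge> 0" if "x \<in> carrier R" for x using that[THEN \<open>\<And>x. x \<in> carrier R \<Longrightarrow> quad x \<noteq> -1\<close>]
    by (auto simp: qc_def split: if_splits)
  moreover have "quad \<one> = 1" by (simp add: qc_def)
  ultimately have "(\<Sum>x\<in>carrier R. quad x) > 0"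
    using finite_carrier by (intro sum_pos2[of _ \<one>]) auto
  then show False by (simp add: sum_quad)
qed

text \<open>This counts the points of the conic \<open>z^2 = r^2 + \<beta> r + \<gamma>\<close> by
  the parameter \<open>t = z - r\<close>. In terms of \<open>t\<close> the equation is linear in
  \<open>r\<close>, namely \<open>r (2t - \<beta>) = \<gamma> - t^2\<close>. Every \<open>t\<close>
  except \<open>\<beta>/2\<close> gives one point, so there are one fewer than field
  elements.\<close>

lemma sum_quad_quadratic:
  assumes be: "\<beta> \<in> carrier R" "\<gamma> \<in> carrier R" and disc: "\<beta> \<otimes> \<beta> \<noteq> \<guillemotleft>4\<guillemotright> \<otimes> \<gamma>"
  shows "(\<Sum>r\<in>carrier R. quad (r \<otimes> r \<oplus> \<beta> \<otimes> r \<oplus> \<gamma>)) = -1"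
proof -
  let ?Q = "\<lambda>r. r \<otimes> r \<oplus> \<beta> \<otimes> r \<oplus> \<gamma>"
  let ?S = "SIGMA r:carrier R. {z \<in> carrier R. z \<otimes> z = ?Q r}"
  let ?T = "{t \<in> carrier R. t \<oplus> t \<ominus> \<beta> \<noteq> \<zero>}"
  have fS: "finite ?S" using finite_carrier by (intro finite_SigmaI) auto
  have key: "z \<otimes> z = ?Q r \<longleftrightarrow> r \<otimes> (t \<oplus> t \<ominus> \<beta>) = \<gamma> \<ominus> t \<otimes> t"
    if c: "r \<in> carrier R" "t \<in> carrier R" and z: "z = r \<oplus> t" for r t z
  proof -
    have "(r \<oplus> t) \<otimes> (r \<oplus> t) \<ominus> ?Q r \<ominus> (r \<otimes> (t \<oplus> t \<ominus> \<beta>) \<ominus> (\<gamma> \<ominus> t \<otimes> t)) = \<zero>"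
      using c be by algebra
    then have "z \<otimes> z \<ominus> ?Q r = r \<otimes> (t \<oplus> t \<ominus> \<beta>) \<ominus> (\<gamma> \<ominus> t \<otimes> t)"
      unfolding z by (rule eqI_diff) (use c be in auto)
    moreover have "z \<otimes> z \<ominus> ?Q r = \<zero> \<longleftrightarrow> z \<otimes> z = ?Q r"
      unfolding z by (rule r_right_minus_eq) (use c be in auto)
    moreover have "r \<otimes> (t \<oplus> t \<ominus> \<beta>) \<ominus> (\<gamma> \<ominus> t \<otimes> t) = \<zero> \<longleftrightarrow> r \<otimes> (t \<oplus> t \<ominus> \<beta>) = \<gamma> \<ominus> t \<otimes> t"
      by (rule r_right_minus_eq) (use c be in auto)
    ultimately show ?thesis by simp
  qed
  have "bij_betw (\<lambda>(r, z). z \<ominus> r) ?S ?T"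
  proof (rule bij_betw_imageI)
    have S: "(r, z) \<in> ?S \<Longrightarrow> r \<in> carrier R \<and> z \<in> carrier R \<and> r \<otimes> ((z \<ominus> r) \<oplus> (z \<ominus> r) \<ominus> \<beta>) = \<gamma> \<ominus> (z \<ominus> r) \<otimes> (z \<ominus> r)
       \<and> z \<ominus> r \<in> ?T" for r z
    proof -
      assume "(r, z) \<in> ?S"
      then have c: "r \<in> carrier R" "z \<in> carrier R" and zz: "z \<otimes> z = ?Q r" by auto
      define t where "t = z \<ominus> r"
      have t: "t \<in> carrier R" using c by (simp add: t_def)
      have "z = r \<oplus> t" unfolding t_def by (rule eqI_diff, use c in algebra) (use c in auto)
      then have e: "r \<otimes> (t \<oplus> t \<ominus> \<beta>) = \<gamma> \<ominus> t \<otimes> t" using key[OF c(1) t] zz by simp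
      \<comment> \<open>At \<open>t = \<beta>/2\<close> the linear equation would require
        \<open>\<gamma> = t^2\<close>, and the quadratic would have discriminant 0.\<close>
      have "t \<oplus> t \<ominus> \<beta> \<noteq> \<zero>"
      proof
        assume h: "t \<oplus> t \<ominus> \<beta> = \<zero>"
        then have b: "\<beta> = t \<oplus> t" using be t by (metis a_closed r_right_minus_eq)
        have g: "\<gamma> = t \<otimes> t" using e h c t be by (simp add: r_right_minus_eq) (metis m_closed r_right_minus_eq)
        define l where "l = [t]"
        have ic: "in_carrier l" using t by (simp add: l_def in_carrier_def)
        have vs: "t = Ipolex l (Var 0)" by (simp_all add: l_def)
        have "(t \<oplus> t) \<otimes> (t \<oplus> t) \<ominus> \<guillemotleft>4\<guillemotright> \<otimes> (t \<otimes> t) = \<zero>" by (simp only: vs reify[where l = l]) (rule norm_eq[OF ic], code_simp)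
        then have "\<beta> \<otimes> \<beta> = \<guillemotleft>4\<guillemotright> \<otimes> \<gamma>" unfolding b g by (rule eqI_diff) (use t in auto)
        with disc show False by simp
      qed
      then show ?thesis using c e t unfolding t_def by auto
    qed
    show "inj_on (\<lambda>(r, z). z \<ominus> r) ?S"
    proof (rule inj_onI)
      fix p p' assume "p \<in> ?S" "p' \<in> ?S" "(case p of (r, z) \<Rightarrow> z \<ominus> r) = (case p' of (r, z) \<Rightarrow> z \<ominus> r)"
      then obtain r z r' z' where p: "p = (r, z)" "p' = (r', z')"
        and a: "(r, z) \<in> ?S" "(r', z') \<in> ?S" "z \<ominus> r = z' \<ominus> r'"
        by (cases p; cases p') simp
      note A = S[OF a(1)] and B = S[OF a(2)]
      have c: "r \<in> carrier R" "z \<in> carrier R" "r' \<in> carrier R" "z' \<in> carrier R" using A B by auto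
      define t where "t = z \<ominus> r"
      have t: "t \<in> carrier R" "t \<oplus> t \<ominus> \<beta> \<noteq> \<zero>" using A be by (auto simp: t_def)
      have "r \<otimes> (t \<oplus> t \<ominus> \<beta>) = r' \<otimes> (t \<oplus> t \<ominus> \<beta>)" using A B a(3) by (simp add: t_def)
      then have rr: "r = r'" using t c be m_rcancel[of "t \<oplus> t \<ominus> \<beta>" r r'] by simp
      have "z = r \<oplus> (z \<ominus> r)" by (rule eqI_diff, use c in algebra) (use c in auto)
      moreover have "z' = r' \<oplus> (z' \<ominus> r')" by (rule eqI_diff, use c in algebra) (use c in auto)
      ultimately show "p = p'" using a(3) rr p by simp
    qed
    show "(\<lambda>(r, z). z \<ominus> r) ` ?S = ?T"
    proof (intro equalityI subsetI)
      fix t assume "t \<in> (\<lambda>(r, z). z \<ominus> r) ` ?S"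
      then obtain p where p: "p \<in> ?S" "t = (case p of (r, z) \<Rightarrow> z \<ominus> r)" by (rule imageE) blast
      obtain r z where rz: "p = (r, z)" by fastforce
      have "z \<ominus> r \<in> ?T" using S[of r z] p(1) unfolding rz by blast
      then show "t \<in> ?T" using p(2) rz by simp
    next
      fix t assume "t \<in> ?T"
      then have t: "t \<in> carrier R" "t \<oplus> t \<ominus> \<beta> \<noteq> \<zero>" by auto
      define d where "d = t \<oplus> t \<ominus> \<beta>"
      have d: "d \<in> carrier R" "d \<noteq> \<zero>" using t be by (auto simp: d_def)
      then have di: "inv d \<in> carrier R" "inv d \<otimes> d = \<one>" by auto
      define r where "r = (\<gamma> \<ominus> t \<otimes> t) \<otimes> inv d"
      have r: "r \<in> carrier R" using t be di by (auto simp: r_def)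
      have "r \<otimes> d = \<gamma> \<ominus> t \<otimes> t" using d di t be by (simp add: r_def m_assoc)
      then have "(r \<oplus> t) \<otimes> (r \<oplus> t) = ?Q r" using key[OF r t(1) refl] by (simp add: d_def)
      moreover have "t = (r \<oplus> t) \<ominus> r" by (rule eqI_diff, use r t in algebra) (use r t in auto)
      ultimately show "t \<in> (\<lambda>(r, z). z \<ominus> r) ` ?S"
        using r t by (intro image_eqI[of _ _ "(r, r \<oplus> t)"]) auto
    qed
  qed
  then have "card ?S = card ?T" by (rule bij_betw_same_card)
  moreover have T: "?T = carrier R - {\<beta> \<otimes> inv (\<one> \<oplus> \<one>)}"
  proof -
    have i: "inv (\<one> \<oplus> \<one>) \<in> carrier R" "(\<one> \<oplus> \<one>) \<otimes> inv (\<one> \<oplus> \<one>) = \<one>" using two_nonzero by auto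
    have "t \<oplus> t \<ominus> \<beta> = \<zero> \<longleftrightarrow> t = \<beta> \<otimes> inv (\<one> \<oplus> \<one>)" if t: "t \<in> carrier R" for t
    proof -
      have tt: "t \<oplus> t = (\<one> \<oplus> \<one>) \<otimes> t" using t by (simp add: l_distr)
      have "t \<oplus> t \<ominus> \<beta> = \<zero> \<longleftrightarrow> (\<one> \<oplus> \<one>) \<otimes> t = \<beta>" using t be tt by simp
      also have "\<dots> \<longleftrightarrow> t = \<beta> \<otimes> inv (\<one> \<oplus> \<one>)"
      proof
        assume "(\<one> \<oplus> \<one>) \<otimes> t = \<beta>"
        then have "\<beta> \<otimes> inv (\<one> \<oplus> \<one>) = t \<otimes> ((\<one> \<oplus> \<one>) \<otimes> inv (\<one> \<oplus> \<one>))"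
          using t i by (metis a_closed m_assoc m_comm one_closed)
        then show "t = \<beta> \<otimes> inv (\<one> \<oplus> \<one>)" using i t by simp
      next
        assume "t = \<beta> \<otimes> inv (\<one> \<oplus> \<one>)"
        then show "(\<one> \<oplus> \<one>) \<otimes> t = \<beta>" using i be
          by (metis a_closed m_lcomm one_closed r_one)
      qed
      finally show ?thesis .
    qed
    then show ?thesis by auto
  qed
  moreover have "card ?T + 1 = card (carrier R)"
    unfolding T using card_Suc_Diff1[OF finite_carrier, of "\<beta> \<otimes> inv (\<one> \<oplus> \<one>)"] be two_nonzero by simp
  ultimately have "card ?S + 1 = card (carrier R)" by simp
  moreover have "card ?S = (\<Sum>r\<in>carrier R. card {z \<in> carrier R. z \<otimes> z = ?Q r})"
    using finite_carrier by (intro card_SigmaI) auto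
  ultimately have "(\<Sum>r\<in>carrier R. real (card {z \<in> carrier R. z \<otimes> z = ?Q r})) = real (card (carrier R)) - 1"
    by (simp flip: of_nat_sum)
  moreover have "(\<Sum>r\<in>carrier R. real (card {z \<in> carrier R. z \<otimes> z = ?Q r})) = (\<Sum>r\<in>carrier R. 1 + quad (?Q r))"
    by (intro sum.cong refl card_sqrt) (use be in auto)
  ultimately show ?thesis by (simp add: sum.distrib)
qed

end

section \<open>Polynomials over a field\<close>

locale field_polys = field R for R (structure)
begin

sublocale UP: principal_domain "poly_ring R"
  by (rule univ_poly_is_principal[OF carrier_is_subfield])

lemmas poly_zero [simp] = univ_poly_zero[of R "carrier R"]
lemmas poly_one = univ_poly_one[of R "carrier R"]

abbreviation Pmult (infixl ".*" 70) where "u .* v \<equiv> u \<otimes>\<^bsub>poly_ring R\<^esub> v"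
abbreviation Padd (infixl ".+" 65) where "u .+ v \<equiv> u \<oplus>\<^bsub>poly_ring R\<^esub> v"
abbreviation Psub (infixl ".-" 65) where "u .- v \<equiv> u \<ominus>\<^bsub>poly_ring R\<^esub> v"
abbreviation Pneg (".~ _" [81] 80) where ".~ u \<equiv> \<ominus>\<^bsub>poly_ring R\<^esub> u"
abbreviation Ppow (infixr ".^" 75) where "u .^ (n::nat) \<equiv> u [^]\<^bsub>poly_ring R\<^esub> n"
abbreviation "zP \<equiv> \<zero>\<^bsub>poly_ring R\<^esub>"
abbreviation "oP \<equiv> \<one>\<^bsub>poly_ring R\<^esub>"
abbreviation Pdvd (infixl ".|" 50) where "u .| v \<equiv> u divides\<^bsub>poly_ring R\<^esub> v"

abbreviation "kX \<equiv> carrier (poly_ring R)"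

lemma poly_carrier_iff: "p \<in> kX \<longleftrightarrow> p = [] \<or> (set p \<subseteq> carrier R \<and> hd p \<noteq> \<zero>)"
  unfolding univ_poly_carrier [symmetric] polynomial_def by simp

lemma poly_set_carrier: "p \<in> kX \<Longrightarrow> set p \<subseteq> carrier R"
  by (auto simp: poly_carrier_iff)

lemma poly_degree_mult:
  assumes "p \<in> kX" "r \<in> kX" "p \<noteq> []" "r \<noteq> []"
  shows "degree (p .* r) = degree p + degree r"
    and "hd (p .* r) = hd p \<otimes> hd r" and "p .* r \<noteq> []"
proof -
  note P = assms(1,2)[unfolded univ_poly_carrier [symmetric]]
  show "degree (p .* r) = degree p + degree r"
    using poly_mult_degree_eq[OF carrier_is_subring P] assms by (simp add: univ_poly_mult)
  show "hd (p .* r) = hd p \<otimes> hd r"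
    using poly_mult_lead_coeff[OF carrier_is_subring P] assms by (simp add: univ_poly_mult)
  show "p .* r \<noteq> []"
    using UP.integral[of p r] assms by auto
qed

definition Mon :: "'a list set" where
  "Mon = {p \<in> kX. p \<noteq> [] \<and> hd p = \<one>}"

definition MIrr :: "'a list set" where
  "MIrr = {p \<in> Mon. pirreducible (carrier R) p}"

definition mons :: "nat \<Rightarrow> 'a list set" where "mons n = {p \<in> Mon. degree p = n}"

text \<open>Length at most \<open>d\<close> means degree below \<open>d\<close>, the zero polynomial
  being the empty list. These are the remainders modulo a monic polynomial of degree
  \<open>d\<close>.\<close>

definition red :: "nat \<Rightarrow> 'a list set" where "red d = {p \<in> kX. length p \<le> d}"

lemma MonD: "p \<in> Mon \<Longrightarrow> p \<in> kX" "p \<in> Mon \<Longrightarrow> p \<noteq> []" "p \<in> Mon \<Longrightarrow> hd p = \<one>"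
  by (auto simp: Mon_def)

lemma Mon_mult: "p \<in> Mon \<Longrightarrow> r \<in> Mon \<Longrightarrow> p .* r \<in> Mon"
  by (auto simp: Mon_def poly_degree_mult)

lemma Mon_degree_mult: "p \<in> Mon \<Longrightarrow> r \<in> Mon \<Longrightarrow> degree (p .* r) = degree p + degree r"
  using poly_degree_mult by (auto simp: Mon_def)

lemma Mon_cofactor:
  assumes "p \<in> Mon" "r \<in> kX" "p .* r \<in> Mon"
  shows "r \<in> Mon"
proof -
  have "r \<noteq> []" using assms UP.r_null[of p] by (auto simp: Mon_def)
  moreover have "hd r \<in> carrier R" using assms(2) calculation by (auto simp: poly_carrier_iff)
  ultimately show ?thesis using assms poly_degree_mult(2)[of p r] by (auto simp: Mon_def)
qed

lemma Mon_divides_cofactor: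
  assumes "p \<in> Mon" "g \<in> Mon" "p .| g"
  obtains h where "h \<in> Mon" "g = p .* h"
  using assms Mon_cofactor unfolding factor_def by blast

lemma one_in_Mon: "[\<one>] \<in> Mon"
  by (auto simp: Mon_def poly_carrier_iff)

lemma mons_eq: "mons n = (\<lambda>cs. \<one> # cs) ` {cs. set cs \<subseteq> carrier R \<and> length cs = n}"
proof (intro equalityI subsetI)
  fix p assume "p \<in> mons n"
  then show "p \<in> (\<lambda>cs. \<one> # cs) ` {cs. set cs \<subseteq> carrier R \<and> length cs = n}"
    by (cases p) (auto simp: mons_def Mon_def poly_carrier_iff)
qed (auto simp: mons_def Mon_def poly_carrier_iff)

lemma finite_mons: "finite (carrier R) \<Longrightarrow> finite (mons n)"
  by (simp add: mons_eq finite_lists_length_eq)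

lemma card_mons: "finite (carrier R) \<Longrightarrow> card (mons n) = order R ^ n"
  by (simp add: mons_eq card_image inj_on_def card_lists_length_eq order_def)

lemma mons_0: "mons 0 = {[\<one>]}" by (auto simp: mons_eq)

lemma card_red: "finite (carrier R) \<Longrightarrow> finite (red d) \<and> card (red d) = order R ^ d"
proof (induction d)
  case 0
  have "red 0 = {[]}" by (auto simp: red_def poly_carrier_iff)
  then show ?case by simp
next
  case (Suc d)
  let ?N = "(\<lambda>(c, cs). c # cs) ` ((carrier R - {\<zero>}) \<times> {cs. set cs \<subseteq> carrier R \<and> length cs = d})"
  have "red (Suc d) = red d \<union> ?N"
  proof (intro equalityI subsetI)
    fix p assume "p \<in> red (Suc d)"
    then show "p \<in> red d \<union> ?N"
      by (cases p; cases "length p \<le> d") (auto simp: red_def poly_carrier_iff)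
  qed (auto simp: red_def poly_carrier_iff)
  moreover have "red d \<inter> ?N = {}" by (auto simp: red_def)
  moreover have "finite ?N" using Suc.prems by (auto simp: finite_lists_length_eq)
  moreover have "card ?N = (order R - 1) * order R ^ d"
    using Suc.prems
    by (subst card_image) (auto simp: inj_on_def card_cartesian_product card_lists_length_eq order_def)
  ultimately have f: "finite (red (Suc d))" and
    "card (red (Suc d)) = order R ^ d + (order R - 1) * order R ^ d"
    using Suc by (auto simp: card_Un_disjoint)
  moreover have "order R ^ d + (order R - 1) * order R ^ d = order R ^ Suc d"
    using order_gt_1[OF Suc.prems] by (cases "order R") auto
  ultimately show ?case by simp
qed

lemma MIrrD:
  assumes "p \<in> MIrr"
  shows "p \<in> Mon" "p \<in> kX" "degree p > 0" "Divisibility.prime (poly_ring R) p" "p \<noteq> []"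
    and "p \<notin> Units (poly_ring R)"
proof -
  have p: "p \<in> Mon" "pirreducible (carrier R) p" using assms by (auto simp: MIrr_def)
  then show "p \<in> Mon" "p \<in> kX" "p \<noteq> []" by (auto simp: Mon_def)
  then show "degree p > 0" using pirreducible_degree[OF carrier_is_subfield _ p(2)] by simp
  show "Divisibility.prime (poly_ring R) p"
    using pprime_iff_pirreducible[OF carrier_is_subfield] p MonD(1) by (auto simp: ring_prime_def)
  show "p \<notin> Units (poly_ring R)"
    using pirreducibleE(2)[OF carrier_is_subring _ p(2)] p MonD(1) by blast
qed

lemma MIrr_prime:
  assumes "p \<in> MIrr" "u \<in> kX" "v \<in> kX"
    and "p .| (u .* v)"
  shows "p .| u \<or> p .| v"
  using MIrrD(4)[OF assms(1)] assms(2-4) by (auto elim!: primeE)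

lemma MIrr_divides_eq:
  assumes "p \<in> MIrr" "r \<in> MIrr" "p .| r" shows "p = r"
proof -
  obtain h where h: "h \<in> Mon" "r = p .* h"
    using Mon_divides_cofactor assms MIrrD by metis
  have "h \<in> Units (poly_ring R)"
    using pirreducibleE(3)[OF carrier_is_subring, of r p h] MIrrD[OF assms(1)] MIrrD[OF assms(2)]
      assms(2) h MonD(1)[OF h(1)]
    by (simp add: MIrr_def)
  then obtain k where "h = [k]" unfolding univ_poly_carrier_units by blast
  then have "h = [\<one>]" using MonD(3)[OF h(1)] by simp
  then show ?thesis using h MIrrD[OF assms(1)] UP.r_one[of p] by (simp add: poly_one)
qed

lemma Mon_has_MIrr_divisor:
  assumes "g \<in> Mon" "degree g > 0" obtains p where "p \<in> MIrr" "p .| g"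
  using assms
proof (induction "degree g" arbitrary: g thesis rule: less_induct)
  case less
  have gc: "g \<in> kX" "g \<noteq> []" using less by (auto simp: Mon_def)
  show ?case
  proof (cases "pirreducible (carrier R) g")
    case True
    then have "g \<in> MIrr" using less.prems(2) by (simp add: MIrr_def)
    then show ?thesis using less.prems(1) UP.divides_refl[OF gc(1)] by blast
  next
    case False
    have "g \<notin> Units (poly_ring R)"
      using univ_poly_units'[OF carrier_is_subfield] less.prems(3) by auto
    then obtain u v where uv: "u \<in> kX" "v \<in> kX"
      "g = u .* v" "u \<notin> Units (poly_ring R)" "v \<notin> Units (poly_ring R)"
      using pirreducibleI[OF carrier_is_subring gc] False by blast
    have nz: "u \<noteq> []" "v \<noteq> []" using uv gc UP.l_null[of v] UP.r_null[of u] by auto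
    have du: "degree u > 0" "degree v > 0"
      using uv nz univ_poly_units'[OF carrier_is_subfield] by auto
    have deg: "degree g = degree u + degree v" using poly_degree_mult(1)[OF uv(1,2) nz] uv(3) by simp
    have hu: "hd u \<in> carrier R" "hd u \<noteq> \<zero>" using uv(1) nz(1) by (auto simp: poly_carrier_iff)
    \<comment> \<open>A proper factor need not be monic, so it is scaled by the inverse of its
      leading coefficient before the induction hypothesis applies. An irreducible divisor cannot
      divide the unit \<open>c\<close> and therefore divides \<open>u\<close>.\<close>
    define c where "c = [inv (hd u)]"
    have c: "c \<in> kX" "c \<noteq> []" "degree c = 0" "hd c = inv (hd u)"
      using hu nonzero_imp_inverse_nonzero by (auto simp: c_def poly_carrier_iff)
    define w where "w = c .* u"
    have w: "w \<in> Mon" "degree w = degree u"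
      using poly_degree_mult[OF c(1) uv(1) c(2) nz(1)] c hu UP.m_closed[OF c(1) uv(1)]
      by (auto simp: w_def Mon_def)
    obtain p where p: "p \<in> MIrr" "p .| w"
    proof (rule less.hyps[of w])
      show "degree w < degree g" "0 < degree w" using w(2) deg du by linarith+
    qed (use w(1) in blast)+
    have cU: "c \<in> Units (poly_ring R)" using univ_poly_units'[OF carrier_is_subfield] c by blast
    have pc: "p \<in> kX" using p MIrrD by blast
    have "\<not> p .| c"
    proof
      assume "p .| c"
      then have "p \<in> Units (poly_ring R)" using cU pc UP.divides_unit by blast
      then show False using MIrrD(6)[OF p(1)] by blast
    qed
    then have "p .| u" using MIrr_prime[OF p(1) c(1) uv(1)] p(2) by (simp add: w_def)
    then have "p .| g" unfolding uv(3)
      using uv pc UP.divides_prod_r by blast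
    then show ?thesis using less.prems(1) p(1) by blast
  qed
qed

lemma coeff_minus:
  assumes "p \<in> kX" "r \<in> kX"
  shows "coeff (p .- r) i = coeff p i \<ominus> coeff r i"
proof -
  have cm: "coeff (map (\<lambda>a. \<ominus> a) r) i = \<ominus> coeff r i" if "set r \<subseteq> carrier R" for r :: "'a list"
    using that by (induction r) auto
  have s: "set p \<subseteq> carrier R" "set r \<subseteq> carrier R" "set (map (\<lambda>a. \<ominus> a) r) \<subseteq> carrier R"
    using assms[THEN poly_set_carrier] by auto
  show ?thesis
    unfolding a_minus_def univ_poly_a_inv_def'[OF carrier_is_subring assms(2)] univ_poly_add
      poly_add_coeff[OF s(1,3)] using cm[OF s(2)] by (simp add: a_minus_def)
qed

lemma length_le_iff_coeff:
  assumes "p \<in> kX" "\<And>i. i \<ge> d \<Longrightarrow> coeff p i = \<zero>"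
  shows "length p \<le> d"
proof (rule ccontr)
  assume "\<not> length p \<le> d"
  then have "p \<noteq> []" "d \<le> degree p" by auto
  then have "coeff p (degree p) \<noteq> \<zero>" using assms(1) lead_coeff_simp[of p] by (auto simp: poly_carrier_iff)
  then show False using assms(2) \<open>d \<le> degree p\<close> by blast
qed

lemma monic_diff:
  assumes "p \<in> mons d" "r \<in> mons d" shows "length (p .- r) \<le> d"
proof -
  have p: "p \<in> kX" "p \<noteq> []" "hd p = \<one>" "degree p = d"
    and r: "r \<in> kX" "r \<noteq> []" "hd r = \<one>" "degree r = d"
    using assms by (auto simp: mons_def Mon_def)
  show ?thesis
  proof (rule length_le_iff_coeff)
    show "p .- r \<in> kX" using p r UP.minus_closed by blast
    fix i assume "i \<ge> d"
    then consider "i = d" | "i > degree p" "i > degree r" using p r by fastforce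
    then have "coeff p i = coeff r i"
    proof cases
      case 1
      then show ?thesis using lead_coeff_simp[OF p(2)] lead_coeff_simp[OF r(2)] p r by simp
    next
      case 2
      then show ?thesis using coeff_degree[of p i] coeff_degree[of r i] by simp
    qed
    moreover have "coeff p i \<in> carrier R" using coeff_in_carrier[OF poly_set_carrier[OF p(1)]] .
    ultimately show "coeff (p .- r) i = \<zero>" using coeff_minus[OF p(1) r(1)] by simp
  qed
qed

lemma eval_poly_hom: "x \<in> carrier R \<Longrightarrow> ring_hom_ring (poly_ring R) R (\<lambda>p. eval p x)"
  by (rule eval_ring_hom[OF carrier_is_subring])

lemma poly_zero_by_roots:
  assumes "p \<in> kX" "length p \<le> card Xs" "finite Xs" "Xs \<subseteq> carrier R"
    "\<And>x. x \<in> Xs \<Longrightarrow> eval p x = \<zero>"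
  shows "p = []"
proof (rule ccontr)
  assume n: "p \<noteq> []"
  have "Xs \<subseteq> {x \<in> carrier R. eval p x = \<zero>}" using assms by auto
  then have "card Xs \<le> degree p" using card_roots_le[OF assms(1) n] card_mono le_trans by blast
  then show False using assms(2) n by (cases p) auto
qed

lemma mons_pow: "p \<in> mons d \<Longrightarrow> p .^ (n::nat) \<in> mons (n * d)"
proof (induction n)
  case 0
  then show ?case using one_in_Mon by (simp add: mons_def poly_one)
next
  case (Suc n)
  then have "p .^ n \<in> Mon" "degree (p .^ n) = n * d" "p \<in> Mon" "degree p = d"
    by (auto simp: mons_def)
  then show ?case using Mon_mult Mon_degree_mult by (auto simp: mons_def)
qed

text \<open>The polynomial \<open>(X + 1)\<^sup>q - X\<^sup>q - 1\<close> has degree below \<open>q\<close> and vanishes on the whole field.\<close>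

lemma var_plus_one_pow:
  assumes "finite (carrier R)"
  shows "[\<one>, \<one>] .^ order R = [\<one>, \<zero>] .^ order R .+ [\<one>]"
proof -
  let ?q = "order R"
  have Xs: "[\<one>, \<one>] \<in> mons 1" "[\<one>, \<zero>] \<in> mons 1" by (auto simp: mons_def Mon_def poly_carrier_iff)
  define p1 where "p1 = [\<one>, \<one>] .^ ?q"
  define p2 where "p2 = [\<one>, \<zero>] .^ ?q"
  have p12: "p1 \<in> mons ?q" "p2 \<in> mons ?q"
    using mons_pow[OF Xs(1), of ?q] mons_pow[OF Xs(2), of ?q] by (auto simp: p1_def p2_def)
  have c: "p1 \<in> kX" "p2 \<in> kX" "[\<one>] \<in> kX"
    using p12 by (auto simp: mons_def Mon_def poly_carrier_iff)
  define e where "e = p1 .- p2 .- [\<one>]"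
  have ec: "e \<in> kX" using c by (simp add: e_def)
  have "length e \<le> ?q"
  proof (rule length_le_iff_coeff[OF ec])
    fix i assume "i \<ge> ?q"
    then have i: "i \<ge> length (p1 .- p2)" "i > degree [\<one>]"
      using monic_diff[OF p12] order_gt_1[OF assms] by auto
    show "coeff e i = \<zero>"
      unfolding e_def coeff_minus[OF UP.minus_closed[OF c(1,2)] c(3)]
      using coeff_length[OF i(1)] coeff_degree[OF i(2)] by simp
  qed
  moreover have "eval e x = \<zero>" if x: "x \<in> carrier R" for x
  proof -
    interpret E: ring_hom_ring "poly_ring R" R "\<lambda>p. eval p x" by (rule eval_poly_hom[OF x])
    have "[\<one>, \<one>] \<in> kX" "[\<one>, \<zero>] \<in> kX" by (auto simp: poly_carrier_iff)
    then have "eval p1 x = (x \<oplus> \<one>) [^] ?q" "eval p2 x = x [^] ?q"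
      using E.hom_nat_pow[of "[\<one>, \<one>]" ?q] E.hom_nat_pow[of "[\<one>, \<zero>]" ?q] x
      by (auto simp: p1_def p2_def)
    then have "eval p1 x = x \<oplus> \<one>" "eval p2 x = x" using pow_order[OF assms] x by auto
    moreover have "eval e x = eval p1 x \<ominus> eval p2 x \<ominus> \<one>"
      unfolding e_def using c by (simp add: a_minus_def)
    moreover have "x \<oplus> \<one> \<ominus> x \<ominus> \<one> = \<zero>" using x by algebra
    ultimately show ?thesis by simp
  qed
  ultimately have "e = []"
    using poly_zero_by_roots[OF ec, of "carrier R"] assms by (simp add: order_def)
  then have "p1 .- p2 = [\<one>]"
    using c UP.r_right_minus_eq[of "p1 .- p2" "[\<one>]"] by (simp add: e_def)
  moreover have "p1 = p2 .+ (p1 .- p2)"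
    by (rule UP.eqI_diff, use c in algebra) (use c in auto)
  ultimately show ?thesis by (simp add: p1_def p2_def)
qed

text \<open>Distinct roots split off one at a time, the others remaining roots of the cofactor
  because there are no zero divisors. It will factor an irreducible polynomial over the Frobenius
  orbit of one root.\<close>

lemma eval_eq_prod_roots:
  assumes "p \<in> Mon" "degree p = card Xs" "finite Xs" "Xs \<subseteq> carrier R" "\<And>x. x \<in> Xs \<Longrightarrow> eval p x = \<zero>"
    and T: "T \<in> carrier R"
  shows "eval p T = (\<Otimes>x\<in>Xs. T \<ominus> x)"
  using assms(3,1,2,4,5)
proof (induction Xs arbitrary: p rule: finite_induct)
  case empty
  then have "p \<in> mons 0" by (simp add: mons_def)
  then show ?case by (simp add: mons_0)
next
  case (insert x Xs)
  have x: "x \<in> carrier R" "Xs \<subseteq> carrier R" using insert by auto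
  have l: "[\<one>, \<ominus> x] \<in> Mon" using x by (auto simp: Mon_def poly_carrier_iff)
  have "is_root p x" using insert x MonD by (auto simp: is_root_def)
  then have "[\<one>, \<ominus> x] .| p"
    using is_root_imp_pdivides[of p x] insert.prems(1) MonD(1) by (auto simp: pdivides_def)
  then obtain h where h: "h \<in> Mon" "p = [\<one>, \<ominus> x] .* h"
    using Mon_divides_cofactor[OF l insert.prems(1)] by blast
  have hc: "h \<in> kX" and hs: "set h \<subseteq> carrier R" using h MonD(1) poly_set_carrier by auto
  have ev: "eval p y = (y \<ominus> x) \<otimes> eval h y" if "y \<in> carrier R" for y
  proof -
    have "eval p y = eval [\<one>, \<ominus> x] y \<otimes> eval h y"
      unfolding h(2) using ring_hom_mult[OF ring_hom_ring.homh[OF eval_poly_hom[OF that]] MonD(1)[OF l] hc] .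
    then show ?thesis using that x by (simp add: a_minus_def)
  qed
  have "eval h T = (\<Otimes>x\<in>Xs. T \<ominus> x)"
  proof (rule insert.IH[OF h(1) _ x(2)])
    show "degree h = card Xs"
      using Mon_degree_mult[OF l h(1)] insert by (simp add: h(2))
    fix y assume y: "y \<in> Xs"
    then have yc: "y \<in> carrier R" "y \<noteq> x" using x insert by auto
    have "(y \<ominus> x) \<otimes> eval h y = \<zero>" using ev[OF yc(1)] insert.prems(4)[of y] y by simp
    moreover have "y \<ominus> x \<noteq> \<zero>" using yc x by simp
    ultimately show "eval h y = \<zero>" using integral[of "y \<ominus> x" "eval h y"] yc x eval_in_carrier[OF hs yc(1)] by auto
  qed
  moreover have "(\<Otimes>y\<in>insert x Xs. T \<ominus> y) = (T \<ominus> x) \<otimes> (\<Otimes>y\<in>Xs. T \<ominus> y)"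
    by (rule finprod_insert) (use insert T x in auto)
  ultimately show ?case using ev[OF T] by simp
qed

end

section \<open>Euler products over monic irreducible polynomials\<close>

context field_polys
begin

text \<open>Confining the irreducible divisors to a finite set \<open>Y\<close> allows induction on
  \<open>Y\<close> and keeps all products finite. For \<open>Y = irrs_le N\<close> nothing is lost
  up to degree \<open>N\<close>.\<close>

definition gmon :: "'a list set \<Rightarrow> nat \<Rightarrow> 'a list set" where
  "gmon Y n = {g \<in> mons n. \<forall>P\<in>MIrr. P .| g \<longrightarrow> P \<in> Y}"

definition zeta_fps :: "('a list \<Rightarrow> real) \<Rightarrow> 'a list set \<Rightarrow> real fps" where
  "zeta_fps w Y = Abs_fps (\<lambda>n. \<Sum>g\<in>gmon Y n. w g)"

lemma gmon_empty: "gmon {} n = (if n = 0 then {[\<one>]} else {})"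
proof (cases "n = 0")
  case True
  have "\<not> P .| [\<one>]" if "P \<in> MIrr" for P
    using that MIrrD UP.divides_one[of P] by (auto simp: poly_one)
  then show ?thesis using True by (auto simp: gmon_def mons_0)
next
  case False
  have "\<exists>P\<in>MIrr. P .| g" if "g \<in> mons n" for g
    using that False Mon_has_MIrr_divisor[of g] by (auto simp: mons_def)
  then show ?thesis using False by (auto simp: gmon_def)
qed

text \<open>Monic polynomials are sorted by divisibility by \<open>P\<close>. The cofactor may be
  divisible by \<open>P\<close> again, so the enlarged set occurs on both sides; this recursion is a
  geometric series in disguise.\<close>

lemma gmon_insert:
  assumes "P \<in> MIrr" "P \<notin> Y"
  shows "gmon (insert P Y) n = gmon Y n \<union>
     (if n < degree P then {} else (\<lambda>h. P .* h) ` gmon (insert P Y) (n - degree P))"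
    and "gmon Y n \<inter> (\<lambda>h. P .* h) ` gmon (insert P Y) m = {}"
proof -
  note P = MIrrD[OF assms(1)]
  show "gmon Y n \<inter> (\<lambda>h. P .* h) ` gmon (insert P Y) m = {}"
  proof -
    have "False" if "h \<in> Mon" "P .* h \<in> gmon Y n" for h
    proof -
      have "P .| (P .* h)" using MonD(1)[OF that(1)] by (auto simp: factor_def)
      then show False using that(2) assms by (auto simp: gmon_def)
    qed
    then show ?thesis by (auto simp: gmon_def mons_def)
  qed
  show "gmon (insert P Y) n = gmon Y n \<union>
     (if n < degree P then {} else (\<lambda>h. P .* h) ` gmon (insert P Y) (n - degree P))"
    (is "?A = ?B \<union> ?C")
  proof (intro equalityI subsetI)
    fix g assume g: "g \<in> ?A"
    then have gm: "g \<in> Mon" "degree g = n" by (auto simp: gmon_def mons_def)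
    show "g \<in> ?B \<union> ?C"
    proof (cases "P .| g")
      case False
      then show ?thesis using g by (auto simp: gmon_def)
    next
      case True
      then obtain h where h: "h \<in> Mon" "g = P .* h"
        using Mon_divides_cofactor[OF P(1) gm(1)] by blast
      have deg: "n = degree P + degree h" using Mon_degree_mult[OF P(1) h(1)] gm h by simp
      have "Q \<in> insert P Y" if Q: "Q \<in> MIrr" "Q .| h" for Q
      proof -
        have "Q .| g"
          unfolding h(2) using Q(2) P(2) MonD(1)[OF h(1)] MIrrD(2)[OF Q(1)]
          by (intro UP.divides_prod_l) auto
        then show ?thesis using g Q by (auto simp: gmon_def)
      qed
      then have "h \<in> gmon (insert P Y) (n - degree P)" using h(1) deg by (auto simp: gmon_def mons_def)
      then show ?thesis using h deg by auto
    qed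
  next
    fix g assume "g \<in> ?B \<union> ?C"
    then consider "g \<in> ?B" | h where "n \<ge> degree P" "h \<in> gmon (insert P Y) (n - degree P)" "g = P .* h"
      by (auto split: if_splits)
    then show "g \<in> ?A"
    proof cases
      case 1
      then show ?thesis by (auto simp: gmon_def)
    next
      case 2
      have h: "h \<in> Mon" "degree h = n - degree P" using 2 by (auto simp: gmon_def mons_def)
      have "g \<in> mons n" using Mon_mult[OF P(1) h(1)] Mon_degree_mult[OF P(1) h(1)] 2 h by (auto simp: mons_def)
      moreover have "Q \<in> insert P Y" if Q: "Q \<in> MIrr" "Q .| g" for Q
      proof -
        have "Q .| P \<or> Q .| h"
          using MIrr_prime[OF Q(1) P(2) MonD(1)[OF h(1)]] Q(2) 2(3) by simp
        then show ?thesis using MIrr_divides_eq[OF Q(1) assms(1)] Q(1) 2(2) by (auto simp: gmon_def)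
      qed
      ultimately show ?thesis by (auto simp: gmon_def)
    qed
  qed
qed

lemma finite_gmon: "finite (carrier R) \<Longrightarrow> finite (gmon Y n)"
  using finite_mons[of n] by (auto simp: gmon_def)

text \<open>For a completely multiplicative weight, the recursion \<open>gmon_insert\<close> says
  that admitting one more irreducible divides the series by its Euler factor.\<close>

lemma zeta_fps_euler:
  assumes fin: "finite (carrier R)" and w1: "w [\<one>] = 1"
    and wm: "\<And>p r. p \<in> Mon \<Longrightarrow> r \<in> Mon \<Longrightarrow> w (p .* r) = w p * w r"
    and Y: "finite Y" "Y \<subseteq> MIrr"
  shows "zeta_fps w Y * (\<Prod>P\<in>Y. 1 - fps_const (w P) * fps_X ^ degree P) = 1"
  using Y
proof (induction Y rule: finite_induct)
  case empty
  show ?case by (rule fps_ext) (auto simp: zeta_fps_def gmon_empty w1)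
next
  case (insert P Y)
  have PI: "P \<in> MIrr" "P \<notin> Y" using insert by auto
  note P = MIrrD[OF PI(1)]
  have "zeta_fps w (insert P Y) * (1 - fps_const (w P) * fps_X ^ degree P) = zeta_fps w Y"
  proof (rule fps_ext)
    fix n
    let ?d = "degree P"
    have "zeta_fps w (insert P Y) * (1 - fps_const (w P) * fps_X ^ ?d)
       = zeta_fps w (insert P Y) - fps_const (w P) * (fps_X ^ ?d * zeta_fps w (insert P Y))"
      by (simp add: algebra_simps)
    then have e: "(zeta_fps w (insert P Y) * (1 - fps_const (w P) * fps_X ^ ?d)) $ n
       = sum w (gmon (insert P Y) n) - w P * (if n < ?d then 0 else sum w (gmon (insert P Y) (n - ?d)))"
      by (simp add: fps_X_power_mult_nth zeta_fps_def)
    show "(zeta_fps w (insert P Y) * (1 - fps_const (w P) * fps_X ^ ?d)) $ n = zeta_fps w Y $ n"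
    proof (cases "n < ?d")
      case True
      then show ?thesis using gmon_insert(1)[OF PI, of n] e by (simp add: zeta_fps_def)
    next
      case False
      let ?G = "gmon (insert P Y) (n - ?d)"
      have inj: "inj_on (\<lambda>h. P .* h) ?G"
        using P by (auto simp: inj_on_def gmon_def mons_def Mon_def UP.m_lcancel)
      have "sum w (gmon (insert P Y) n) = sum w (gmon Y n \<union> (\<lambda>h. P .* h) ` ?G)"
        by (subst gmon_insert(1)[OF PI, of n]) (use False in simp)
      also have "\<dots> = sum w (gmon Y n) + sum w ((\<lambda>h. P .* h) ` ?G)"
        by (rule sum.union_disjoint) (use finite_gmon[OF fin] gmon_insert(2)[OF PI] in auto)
      also have "sum w ((\<lambda>h. P .* h) ` ?G) = (\<Sum>h\<in>?G. w (P .* h))"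
        using sum.reindex[OF inj, of w] by simp
      also have "\<dots> = (\<Sum>h\<in>?G. w P * w h)"
        by (rule sum.cong) (use wm[OF P(1)] in \<open>auto simp: gmon_def mons_def\<close>)
      finally show ?thesis using e False by (simp add: zeta_fps_def sum_distrib_left)
    qed
  qed
  moreover have "(\<Prod>P\<in>insert P Y. 1 - fps_const (w P) * fps_X ^ degree P)
     = (1 - fps_const (w P) * fps_X ^ degree P) * (\<Prod>P\<in>Y. 1 - fps_const (w P) * fps_X ^ degree P)"
    using insert by simp
  ultimately show ?case using insert by (simp add: mult.assoc [symmetric])
qed

definition irrs_le :: "nat \<Rightarrow> 'a list set" where "irrs_le N = {P \<in> MIrr. degree P \<le> N}"

lemma finite_irrs_le: "finite (carrier R) \<Longrightarrow> finite (irrs_le N)"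
proof (rule finite_subset)
  show "irrs_le N \<subseteq> (\<Union>n\<le>N. mons n)" by (auto simp: irrs_le_def mons_def MIrr_def)
qed (auto simp: finite_mons)

lemma gmon_irrs_le: "n \<le> N \<Longrightarrow> gmon (irrs_le N) n = mons n"
proof -
  assume n: "n \<le> N"
  have "degree P \<le> n" if "P \<in> MIrr" "g \<in> mons n" "P .| g" for P g
  proof -
    have "g \<in> Mon" "degree g = n" using that by (auto simp: mons_def)
    then show ?thesis
      using Mon_divides_cofactor[OF MIrrD(1)[OF that(1)] _ that(3)] Mon_degree_mult[OF MIrrD(1)[OF that(1)]]
      by (metis le_add1)
  qed
  then show ?thesis using n by (force simp: gmon_def irrs_le_def)
qed

end

section \<open>A character sum attached to the cubic\<close>

lemma (in domain) finite_domain_is_field: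
  assumes "finite (carrier R)" shows "field R"
proof (rule cring_fieldI)
  show "Units R = carrier R - {\<zero>}"
  proof (intro equalityI subsetI)
    fix x assume "x \<in> Units R"
    then show "x \<in> carrier R - {\<zero>}" using Units_r_inv_ex[of x] Units_closed[of x] by auto
  next
    fix x assume x: "x \<in> carrier R - {\<zero>}"
    have "inj_on (\<lambda>y. x \<otimes> y) (carrier R)" using x by (auto simp: inj_on_def m_lcancel)
    moreover have "(\<lambda>y. x \<otimes> y) ` carrier R \<subseteq> carrier R" using x by auto
    ultimately have "(\<lambda>y. x \<otimes> y) ` carrier R = carrier R"
      using assms by (simp add: card_image card_subset_eq)
    then obtain y where "y \<in> carrier R" "x \<otimes> y = \<one>" using one_closed by (metis imageE)
    then show "x \<in> Units R" using x by (auto simp: Units_def m_comm intro!: bexI[of _ y])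
  qed
qed

section \<open>Polynomial identities for a cubic without quadratic term\<close>

context cring
begin

lemma triple_flip:
  assumes c: "r \<in> carrier R" "s \<in> carrier R" "t \<in> carrier R" "z \<in> carrier R"
  shows "(r \<ominus> z) \<otimes> (s \<ominus> z) \<otimes> (t \<ominus> z) = \<ominus> \<one> \<otimes> ((z \<ominus> r) \<otimes> (z \<ominus> s) \<otimes> (z \<ominus> t))"
proof -
  define l where "l = [r, s, t, z]"
  have ic: "in_carrier l" using c by (simp add: l_def in_carrier_def)
  have vs: "r = Ipolex l (Var 0)" "s = Ipolex l (Var 1)" "t = Ipolex l (Var 2)" "z = Ipolex l (Var 3)" by (simp_all add: l_def)
  show ?thesis by (simp only: vs reify[where l = l]) (rule norm_eq[OF ic], code_simp)
qed

text \<open>Without a quadratic term the three roots add up to 0, so two of them determine the third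
  and both coefficients.\<close>

lemma cubic_split:
  assumes c: "r \<in> carrier R" "s \<in> carrier R" "a \<in> carrier R" "b \<in> carrier R" "T \<in> carrier R"
    and a: "a = \<ominus> (r \<otimes> r \<oplus> r \<otimes> s \<oplus> s \<otimes> s)"
    and b: "b = r \<otimes> s \<otimes> (r \<oplus> s)"
  shows "T [^] (3::nat) \<oplus> a \<otimes> T \<oplus> b = (T \<ominus> r) \<otimes> (T \<ominus> s) \<otimes> (T \<ominus> (\<ominus> (r \<oplus> s)))"
proof -
  define l where "l = [r, s, T]"
  have ic: "in_carrier l" using c by (simp add: l_def in_carrier_def)
  have vs: "r = Ipolex l (Var 0)" "s = Ipolex l (Var 1)" "T = Ipolex l (Var 2)" by (simp_all add: l_def)
  show ?thesis unfolding a b by (simp only: vs reify[where l = l]) (rule norm_eq[OF ic], code_simp)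
qed

text \<open>With the third root \<open>- (r + s)\<close>, the factors on the right are the three
  differences of roots. A nonzero discriminant thus means distinct roots.\<close>

lemma cubic_disc_identity:
  assumes c: "r \<in> carrier R" "s \<in> carrier R" "a \<in> carrier R" "b \<in> carrier R"
    and a: "a = \<ominus> (r \<otimes> r \<oplus> r \<otimes> s \<oplus> s \<otimes> s)"
    and b: "b = r \<otimes> s \<otimes> (r \<oplus> s)"
  shows "\<guillemotleft>4\<guillemotright> \<otimes> a [^] (3::nat) \<oplus> \<guillemotleft>27\<guillemotright> \<otimes> b [^] (2::nat)
      = \<ominus> (((r \<ominus> s) \<otimes> (\<guillemotleft>2\<guillemotright> \<otimes> r \<oplus> s) \<otimes> (r \<oplus> \<guillemotleft>2\<guillemotright> \<otimes> s)) [^] (2::nat))"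
proof -
  define l where "l = [r, s]"
  have ic: "in_carrier l" using c by (simp add: l_def in_carrier_def)
  have vs: "r = Ipolex l (Var 0)" "s = Ipolex l (Var 1)" by (simp_all add: l_def)
  show ?thesis unfolding a b by (simp only: vs reify[where l = l]) (rule norm_eq[OF ic], code_simp)
qed

text \<open>The cubic leaves the remainder \<open>w (X - u) + F\<close> on division by
  \<open>X^2 + uX + v\<close>, and this is what the coordinate \<open>w = a + u^2 - v\<close> is
  for. The right side is the product of that remainder over the two roots of the quadratic.\<close>

lemma cubic_quadratic_resultant:
  assumes c: "r \<in> carrier R" "s \<in> carrier R" "a \<in> carrier R" "b \<in> carrier R" "u \<in> carrier R"
      "v \<in> carrier R" "w \<in> carrier R" "t \<in> carrier R" "F \<in> carrier R"
    and a: "a = \<ominus> (r \<otimes> r \<oplus> r \<otimes> s \<oplus> s \<otimes> s)"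
    and b: "b = r \<otimes> s \<otimes> (r \<oplus> s)"
    and v: "v = a \<oplus> u \<otimes> u \<ominus> w" and t: "t = \<ominus> (r \<oplus> s)"
    and F: "F = u [^] (3::nat) \<oplus> a \<otimes> u \<oplus> b"
  shows "(r \<otimes> r \<oplus> u \<otimes> r \<oplus> v) \<otimes> (s \<otimes> s \<oplus> u \<otimes> s \<oplus> v) \<otimes> (t \<otimes> t \<oplus> u \<otimes> t \<oplus> v)
     = F \<otimes> F \<ominus> \<guillemotleft>3\<guillemotright> \<otimes> u \<otimes> F \<otimes> w \<oplus> (\<guillemotleft>3\<guillemotright> \<otimes> u \<otimes> u \<oplus> a) \<otimes> w \<otimes> w \<ominus> w \<otimes> w \<otimes> w"
proof -
  define l where "l = [r, s, u, w]"
  have ic: "in_carrier l" using c by (simp add: l_def in_carrier_def)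
  have vs: "r = Ipolex l (Var 0)" "s = Ipolex l (Var 1)" "u = Ipolex l (Var 2)" "w = Ipolex l (Var 3)" by (simp_all add: l_def)
  show ?thesis unfolding F v t a b by (simp only: vs reify[where l = l]) (rule norm_eq[OF ic], code_simp)
qed

text \<open>For \<open>w \<rho> = F\<close> the remainder is \<open>w (X - z)\<close> with
  \<open>z = u - \<rho>\<close>. The resultant is then \<open>w^2\<close> times the quadratic at
  \<open>z\<close>, while the cubic at \<open>z\<close> is \<open>- \<rho>\<close> times that same
  value of the quadratic.\<close>

lemma resultant_reciprocal:
  assumes c: "a \<in> carrier R" "b \<in> carrier R" "u \<in> carrier R" "w \<in> carrier R" "\<rho> \<in> carrier R" "F \<in> carrier R" "z \<in> carrier R"
    and F: "F = u [^] (3::nat) \<oplus> a \<otimes> u \<oplus> b" and w: "w \<otimes> \<rho> = F" and z: "z = u \<ominus> \<rho>"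
  shows "\<rho> \<otimes> (F \<otimes> F \<ominus> \<guillemotleft>3\<guillemotright> \<otimes> u \<otimes> F \<otimes> w \<oplus> (\<guillemotleft>3\<guillemotright> \<otimes> u \<otimes> u \<oplus> a) \<otimes> w \<otimes> w \<ominus> w \<otimes> w \<otimes> w)
     = w \<otimes> w \<otimes> (\<ominus> (z [^] (3::nat) \<oplus> a \<otimes> z \<oplus> b))"
proof -
  let ?G = "u [^] (3::nat) \<oplus> a \<otimes> u \<oplus> b"
  let ?W = "w \<otimes> \<rho>"
  define l where "l = [a, b, u, w, \<rho>]"
  have ic: "in_carrier l" using c by (simp add: l_def in_carrier_def)
  have vs: "a = Ipolex l (Var 0)" "b = Ipolex l (Var 1)" "u = Ipolex l (Var 2)" "w = Ipolex l (Var 3)" "\<rho> = Ipolex l (Var 4)" by (simp_all add: l_def)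
  have "\<rho> \<otimes> (?W \<otimes> ?W \<ominus> \<guillemotleft>3\<guillemotright> \<otimes> u \<otimes> ?W \<otimes> w \<oplus> (\<guillemotleft>3\<guillemotright> \<otimes> u \<otimes> u \<oplus> a) \<otimes> w \<otimes> w \<ominus> w \<otimes> w \<otimes> w)
     \<ominus> w \<otimes> w \<otimes> (\<ominus> ((u \<ominus> \<rho>) [^] (3::nat) \<oplus> a \<otimes> (u \<ominus> \<rho>) \<oplus> b)) \<ominus> w \<otimes> w \<otimes> (?G \<ominus> ?W) = \<zero>"
    by (simp only: vs reify[where l = l]) (rule norm_eq[OF ic], code_simp)
  moreover have "?G \<ominus> ?W = \<zero>" using F w c by simp
  ultimately have "\<rho> \<otimes> (?W \<otimes> ?W \<ominus> \<guillemotleft>3\<guillemotright> \<otimes> u \<otimes> ?W \<otimes> w \<oplus> (\<guillemotleft>3\<guillemotright> \<otimes> u \<otimes> u \<oplus> a) \<otimes> w \<otimes> w \<ominus> w \<otimes> w \<otimes> w)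
     \<ominus> w \<otimes> w \<otimes> (\<ominus> ((u \<ominus> \<rho>) [^] (3::nat) \<oplus> a \<otimes> (u \<ominus> \<rho>) \<oplus> b)) = \<zero>"
    using c by simp
  then show ?thesis unfolding w z by (rule eqI_diff) (use c in simp_all)
qed

text \<open>Taylor expansion of the cubic at its root \<open>u\<close>: it is divisible by
  \<open>\<rho>\<close>, and after removal of the square \<open>\<rho>^2\<close> a quadratic in
  \<open>\<rho>\<close> is left.\<close>

lemma cubic_shift_root:
  assumes c: "a \<in> carrier R" "b \<in> carrier R" "u \<in> carrier R" "\<rho> \<in> carrier R" "z \<in> carrier R"
    and F: "u [^] (3::nat) \<oplus> a \<otimes> u \<oplus> b = \<zero>" and z: "z = u \<ominus> \<rho>"
  shows "\<ominus> \<rho> \<otimes> (z [^] (3::nat) \<oplus> a \<otimes> z \<oplus> b) = \<rho> \<otimes> \<rho> \<otimes> (\<rho> \<otimes> \<rho> \<oplus> \<ominus> (\<guillemotleft>3\<guillemotright> \<otimes> u) \<otimes> \<rho> \<oplus> (\<guillemotleft>3\<guillemotright> \<otimes> u \<otimes> u \<oplus> a))"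
proof -
  define l where "l = [a, b, u, \<rho>]"
  have ic: "in_carrier l" using c by (simp add: l_def in_carrier_def)
  have vs: "a = Ipolex l (Var 0)" "b = Ipolex l (Var 1)" "u = Ipolex l (Var 2)" "\<rho> = Ipolex l (Var 3)" by (simp_all add: l_def)
  have "\<ominus> \<rho> \<otimes> ((u \<ominus> \<rho>) [^] (3::nat) \<oplus> a \<otimes> (u \<ominus> \<rho>) \<oplus> b) \<ominus> \<rho> \<otimes> \<rho> \<otimes> (\<rho> \<otimes> \<rho> \<oplus> \<ominus> (\<guillemotleft>3\<guillemotright> \<otimes> u) \<otimes> \<rho> \<oplus> (\<guillemotleft>3\<guillemotright> \<otimes> u \<otimes> u \<oplus> a))
    \<ominus> \<ominus> \<rho> \<otimes> (u [^] (3::nat) \<oplus> a \<otimes> u \<oplus> b) = \<zero>"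
    by (simp only: vs reify[where l = l]) (rule norm_eq[OF ic], code_simp)
  then have "\<ominus> \<rho> \<otimes> ((u \<ominus> \<rho>) [^] (3::nat) \<oplus> a \<otimes> (u \<ominus> \<rho>) \<oplus> b) \<ominus> \<rho> \<otimes> \<rho> \<otimes> (\<rho> \<otimes> \<rho> \<oplus> \<ominus> (\<guillemotleft>3\<guillemotright> \<otimes> u) \<otimes> \<rho> \<oplus> (\<guillemotleft>3\<guillemotright> \<otimes> u \<otimes> u \<oplus> a)) = \<zero>"
    unfolding F using c by simp
  then show ?thesis unfolding z by (rule eqI_diff) (use c in simp_all)
qed

text \<open>The squared factor is the derivative of the cubic at \<open>u\<close>, and the other one
  is minus the discriminant of its quadratic cofactor.\<close>

lemma cubic_disc_at_root:
  assumes c: "a \<in> carrier R" "b \<in> carrier R" "u \<in> carrier R"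
    and b: "b = \<ominus> (u [^] (3::nat) \<oplus> a \<otimes> u)"
  shows "\<guillemotleft>4\<guillemotright> \<otimes> a [^] (3::nat) \<oplus> \<guillemotleft>27\<guillemotright> \<otimes> b [^] (2::nat)
     = (\<guillemotleft>3\<guillemotright> \<otimes> u \<otimes> u \<oplus> \<guillemotleft>4\<guillemotright> \<otimes> a) \<otimes> (\<guillemotleft>3\<guillemotright> \<otimes> u \<otimes> u \<oplus> a) [^] (2::nat)"
proof -
  define l where "l = [a, u]"
  have ic: "in_carrier l" using c by (simp add: l_def in_carrier_def)
  have vs: "a = Ipolex l (Var 0)" "u = Ipolex l (Var 1)" by (simp_all add: l_def)
  show ?thesis unfolding b by (simp only: vs reify[where l = l]) (rule norm_eq[OF ic], code_simp)
qed

end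

locale curve_field = odd_finite_field R + field_polys R for R (structure) +
  fixes a b :: 'a
  assumes ab [simp]: "a \<in> carrier R" "b \<in> carrier R"
    and disc: "\<guillemotleft>4\<guillemotright> \<otimes> a [^] (3::nat) \<oplus> \<guillemotleft>27\<guillemotright> \<otimes> b [^] (2::nat) \<noteq> \<zero>"
begin

definition cub :: "'a \<Rightarrow> 'a" where "cub x = x [^] (3::nat) \<oplus> a \<otimes> x \<oplus> b"

lemma cub_closed [simp]: "x \<in> carrier R \<Longrightarrow> cub x \<in> carrier R"
  by (simp add: cub_def)

text \<open>By \<open>cubic_quadratic_resultant\<close> this is the resultant of the cubic with
  \<open>X^2 + uX + v\<close> in the coordinate \<open>w = a + u^2 - v\<close>.\<close>

definition res2 :: "'a \<Rightarrow> 'a \<Rightarrow> 'a" where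
  "res2 u w = cub u \<otimes> cub u \<ominus> \<guillemotleft>3\<guillemotright> \<otimes> u \<otimes> cub u \<otimes> w \<oplus> (\<guillemotleft>3\<guillemotright> \<otimes> u \<otimes> u \<oplus> a) \<otimes> w \<otimes> w \<ominus> w \<otimes> w \<otimes> w"

lemma quad_square: "x \<in> carrier R \<Longrightarrow> x \<noteq> \<zero> \<Longrightarrow> quad (x \<otimes> x) = 1"
  by (rule qc_square) (auto intro: pow_2hq)

lemma quad_zero: "quad \<zero> = 0" by (simp add: qc_def)

lemma quad_sq_nonzero: "x \<in> carrier R \<Longrightarrow> x \<noteq> \<zero> \<Longrightarrow> quad x * quad x = 1"
  using quad_square quad_mult by metis

text \<open>Substituting \<open>w = cub u / \<rho>\<close> turns the resultant \<open>res2 u w\<close> into \<open>- \<rho> * cub (u - \<rho>)\<close> up to squares.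
  The resulting formula persists when \<open>cub u = 0\<close>.\<close>

lemma sum_quad_res2_inner:
  assumes u: "u \<in> carrier R"
  shows "(\<Sum>w\<in>carrier R. quad (res2 u w)) = 1 + (\<Sum>\<rho>\<in>carrier R. quad (\<ominus> \<rho> \<otimes> cub (u \<ominus> \<rho>)))"
proof (cases "cub u = \<zero>")
  case False
  let ?F = "cub u"
  have Fc: "?F \<in> carrier R" using u by simp
  have "(\<Sum>w\<in>carrier R - {\<zero>}. quad (res2 u w)) = (\<Sum>\<rho>\<in>carrier R - {\<zero>}. quad (\<ominus> \<rho> \<otimes> cub (u \<ominus> \<rho>)))"
  proof (rule sum.reindex_bij_witness[of _ "\<lambda>\<rho>. ?F \<otimes> inv \<rho>" "\<lambda>w. ?F \<otimes> inv w"])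
    fix w assume "w \<in> carrier R - {\<zero>}"
    then have w: "w \<in> carrier R" "w \<noteq> \<zero>" "inv w \<in> carrier R" "inv w \<noteq> \<zero>" "w \<otimes> inv w = \<one>"
      using nonzero_imp_inverse_nonzero by auto
    define \<rho> where "\<rho> = ?F \<otimes> inv w"
    have r: "\<rho> \<in> carrier R" using w Fc by (simp add: \<rho>_def)
    have "w \<otimes> \<rho> = ?F \<otimes> (w \<otimes> inv w)" unfolding \<rho>_def using w Fc by (intro m_lcomm) auto
    then have wr: "w \<otimes> \<rho> = ?F" using w Fc by simp
    then have r0: "\<rho> \<noteq> \<zero>" using False w by auto
    then have ri: "inv \<rho> \<in> carrier R" "\<rho> \<otimes> inv \<rho> = \<one>" using r by auto
    have "?F \<otimes> inv \<rho> = w \<otimes> \<rho> \<otimes> inv \<rho>" by (simp only: wr)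
    also have "\<dots> = w" using w r ri by (simp add: m_assoc)
    finally show "?F \<otimes> inv (?F \<otimes> inv w) = w" by (simp only: \<rho>_def)
    show "?F \<otimes> inv w \<in> carrier R - {\<zero>}" using r r0 by (simp add: \<rho>_def)
    have z: "u \<ominus> \<rho> \<in> carrier R" using u r by simp
    have rc: "res2 u w \<in> carrier R" using u w by (simp add: res2_def)
    have "\<rho> \<otimes> res2 u w = w \<otimes> w \<otimes> (\<ominus> cub (u \<ominus> \<rho>))"
      unfolding res2_def cub_def[of "u \<ominus> \<rho>"]
      by (rule resultant_reciprocal[OF ab u w(1) r Fc z _ wr refl]) (simp add: cub_def)
    then have "quad \<rho> * quad (res2 u w) = quad (w \<otimes> w) * quad (\<ominus> cub (u \<ominus> \<rho>))"
      using rc r w z by (metis quad_mult m_closed a_inv_closed cub_closed)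
    then have "quad \<rho> * quad \<rho> * quad (res2 u w) = quad \<rho> * quad (\<ominus> cub (u \<ominus> \<rho>))"
      using quad_square[OF w(1,2)] by simp
    then have "quad (res2 u w) = quad (\<rho> \<otimes> \<ominus> cub (u \<ominus> \<rho>))"
      using quad_sq_nonzero[OF r r0] quad_mult[OF r, of "\<ominus> cub (u \<ominus> \<rho>)"] z by simp
    also have "\<rho> \<otimes> \<ominus> cub (u \<ominus> \<rho>) = \<ominus> \<rho> \<otimes> cub (u \<ominus> \<rho>)" using r z by (simp add: l_minus r_minus)
    finally show "quad (\<ominus> (?F \<otimes> inv w) \<otimes> cub (u \<ominus> ?F \<otimes> inv w)) = quad (res2 u w)"
      by (simp add: \<rho>_def)
    show "?F \<otimes> inv (?F \<otimes> inv w) = w" by fact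
    show "?F \<otimes> inv w \<in> carrier R - {\<zero>}" by fact
  qed
  \<comment> \<open>The two terms missed by the substitution: \<open>w = 0\<close> contributes the
    character of a nonzero square, which is the 1 of the claim, and \<open>\<rho> = 0\<close>
    contributes 0.\<close>
  moreover have "res2 u \<zero> = ?F \<otimes> ?F" using u by (simp add: res2_def)
  moreover have "\<ominus> \<zero> \<otimes> cub (u \<ominus> \<zero>) = \<zero>" using u by simp
  ultimately show ?thesis
    using finite_carrier quad_square[OF Fc False] sum.remove[of "carrier R" \<zero> "\<lambda>w. quad (res2 u w)"]
      sum.remove[of "carrier R" \<zero> "\<lambda>\<rho>. quad (\<ominus> \<rho> \<otimes> cub (u \<ominus> \<rho>))"]
    by (simp add: quad_zero)
next
  case True
  define D where "D = \<guillemotleft>3\<guillemotright> \<otimes> u \<otimes> u \<oplus> a"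
  have D: "D \<in> carrier R" using u by (simp add: D_def)
  have F0: "u [^] (3::nat) \<oplus> a \<otimes> u \<oplus> b = \<zero>" using True by (simp add: cub_def)
  have b: "b = \<ominus> (u [^] (3::nat) \<oplus> a \<otimes> u)"
    using F0 u by (metis ab a_comm a_closed m_closed minus_equality nat_pow_closed minus_minus)
  have nz: "\<guillemotleft>3\<guillemotright> \<otimes> u \<otimes> u \<oplus> \<guillemotleft>4\<guillemotright> \<otimes> a \<noteq> \<zero>"
    using cubic_disc_at_root[OF ab u b] disc u by auto
  let ?n = "\<lambda>r. r \<otimes> r \<oplus> \<ominus> (\<guillemotleft>3\<guillemotright> \<otimes> u) \<otimes> r \<oplus> D"
  \<comment> \<open>If the cubic vanishes at \<open>u\<close>, the resultant degenerates to
    \<open>w^2 (D - w)\<close>. Over all \<open>w\<close> the character of \<open>D - w\<close> sums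
    to 0, and the term at \<open>w = 0\<close> is lost to the square factor.\<close>
  have s1: "(\<Sum>w\<in>carrier R. quad (res2 u w)) = - quad D"
  proof -
    have "quad (res2 u w) = (if w = \<zero> then 0 else quad (D \<ominus> w))" if w: "w \<in> carrier R" for w
    proof -
      have "res2 u w = (w \<otimes> w) \<otimes> (D \<ominus> w)"
      proof -
        define l where "l = [u, w, D]"
        have ic: "in_carrier l" using u w D by (simp add: l_def in_carrier_def)
        have vs: "u = Ipolex l (Var 0)" "w = Ipolex l (Var 1)" "D = Ipolex l (Var 2)" by (simp_all add: l_def)
        have "\<zero> \<otimes> \<zero> \<ominus> \<guillemotleft>3\<guillemotright> \<otimes> u \<otimes> \<zero> \<otimes> w \<oplus> D \<otimes> w \<otimes> w \<ominus> w \<otimes> w \<otimes> w \<ominus> (w \<otimes> w) \<otimes> (D \<ominus> w) = \<zero>" by (simp only: vs reify[where l = l]) (rule norm_eq[OF ic], code_simp)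
        then show ?thesis unfolding res2_def True D_def [symmetric] by (rule eqI_diff) (use u w D in simp_all)
      qed
      then show ?thesis using w D quad_mult[of "w \<otimes> w" "D \<ominus> w"] quad_square[of w] by (auto simp: quad_zero)
    qed
    then have "(\<Sum>w\<in>carrier R. quad (res2 u w)) = (\<Sum>w\<in>carrier R. if w = \<zero> then 0 else quad (D \<ominus> w))"
      by (intro sum.cong) auto
    also have "\<dots> = (\<Sum>w\<in>carrier R. quad (D \<ominus> w)) - quad D"
      using finite_carrier D sum.remove[of "carrier R" \<zero> "\<lambda>w. quad (D \<ominus> w)"]
        sum.remove[of "carrier R" \<zero> "\<lambda>w. if w = \<zero> then 0 else quad (D \<ominus> w)"] by simp
    also have "(\<Sum>w\<in>carrier R. quad (D \<ominus> w)) = (\<Sum>w\<in>carrier R. quad w)"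
    proof (rule sum.reindex_bij_witness[of _ "\<lambda>w. D \<ominus> w" "\<lambda>w. D \<ominus> w"])
      fix w assume w: "w \<in> carrier R"
      show "D \<ominus> (D \<ominus> w) = w" by (rule eqI_diff, use w D in algebra) (use w D in auto)
      then show "D \<ominus> (D \<ominus> w) = w" .
    qed (use D in auto)
    finally show ?thesis by (simp add: sum_quad)
  qed
  \<comment> \<open>Up to squares the summand is a quadratic in \<open>\<rho>\<close> with
    discriminant \<open>- (3 u^2 + 4a)\<close>, which is nonzero because it divides the discriminant
    of the curve. The full sum is -1, and the term at \<open>\<rho> = 0\<close>, equal to
    \<open>quad D\<close>, is lost.\<close>
  have s2: "(\<Sum>\<rho>\<in>carrier R. quad (\<ominus> \<rho> \<otimes> cub (u \<ominus> \<rho>))) = -1 - quad D"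
  proof -
    have "quad (\<ominus> r \<otimes> cub (u \<ominus> r)) = (if r = \<zero> then 0 else quad (?n r))" if r: "r \<in> carrier R" for r
    proof -
      have z: "u \<ominus> r \<in> carrier R" using u r by simp
      have "\<ominus> r \<otimes> cub (u \<ominus> r) = (r \<otimes> r) \<otimes> ?n r"
        unfolding cub_def D_def by (rule cubic_shift_root[OF ab u r z F0 refl])
      then show ?thesis using r D u quad_mult[of "r \<otimes> r" "?n r"] quad_square[of r] by (auto simp: quad_zero)
    qed
    then have "(\<Sum>\<rho>\<in>carrier R. quad (\<ominus> \<rho> \<otimes> cub (u \<ominus> \<rho>))) = (\<Sum>r\<in>carrier R. if r = \<zero> then 0 else quad (?n r))"
      by (intro sum.cong) auto
    also have "\<dots> = (\<Sum>r\<in>carrier R. quad (?n r)) - quad D"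
      using finite_carrier D u sum.remove[of "carrier R" \<zero> "\<lambda>w. quad (?n w)"]
        sum.remove[of "carrier R" \<zero> "\<lambda>w. if w = \<zero> then 0 else quad (?n w)"] by simp
    also have "(\<Sum>r\<in>carrier R. quad (?n r)) = -1"
    proof (rule sum_quad_quadratic)
      have ac: "a \<in> carrier R" by simp
      define l where "l = [u, a]"
      have ic: "in_carrier l" using u ac by (simp add: l_def in_carrier_def)
      have vs: "u = Ipolex l (Var 0)" "a = Ipolex l (Var 1)" by (simp_all add: l_def)
      have id: "\<ominus> (\<guillemotleft>3\<guillemotright> \<otimes> u) \<otimes> \<ominus> (\<guillemotleft>3\<guillemotright> \<otimes> u) \<ominus> \<guillemotleft>4\<guillemotright> \<otimes> (\<guillemotleft>3\<guillemotright> \<otimes> u \<otimes> u \<oplus> a) = \<ominus> (\<guillemotleft>3\<guillemotright> \<otimes> u \<otimes> u \<oplus> \<guillemotleft>4\<guillemotright> \<otimes> a)"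
        by (simp only: vs reify[where l = l]) (rule norm_eq[OF ic], code_simp)
      show "\<ominus> (\<guillemotleft>3\<guillemotright> \<otimes> u) \<otimes> \<ominus> (\<guillemotleft>3\<guillemotright> \<otimes> u) \<noteq> \<guillemotleft>4\<guillemotright> \<otimes> D"
      proof
        assume "\<ominus> (\<guillemotleft>3\<guillemotright> \<otimes> u) \<otimes> \<ominus> (\<guillemotleft>3\<guillemotright> \<otimes> u) = \<guillemotleft>4\<guillemotright> \<otimes> D"
        then have "\<ominus> (\<guillemotleft>3\<guillemotright> \<otimes> u) \<otimes> \<ominus> (\<guillemotleft>3\<guillemotright> \<otimes> u) \<ominus> \<guillemotleft>4\<guillemotright> \<otimes> D = \<zero>" using D by simp
        then have "\<ominus> (\<guillemotleft>3\<guillemotright> \<otimes> u \<otimes> u \<oplus> \<guillemotleft>4\<guillemotright> \<otimes> a) = \<zero>" unfolding id D_def [symmetric] by (simp only: id D_def)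
        then show False using nz u ab by (metis a_closed add.inv_eq_1_iff m_closed of_int_closed)
      qed
    qed (use u D in auto)
    finally show ?thesis .
  qed
  show ?thesis unfolding s1 s2 by simp
qed

text \<open>Each \<open>u\<close> contributes 1. The remaining double sum is a convolution, so it
  factors after a shift of \<open>u\<close>, and one factor is the vanishing sum of
  \<open>quad\<close> over the field.\<close>

lemma sum_quad_res2: "(\<Sum>u\<in>carrier R. \<Sum>w\<in>carrier R. quad (res2 u w)) = real (order R)"
proof -
  have "(\<Sum>u\<in>carrier R. \<Sum>\<rho>\<in>carrier R. quad (\<ominus> \<rho> \<otimes> cub (u \<ominus> \<rho>)))
     = (\<Sum>\<rho>\<in>carrier R. \<Sum>u\<in>carrier R. quad (\<ominus> \<rho>) * quad (cub (u \<ominus> \<rho>)))"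
    by (subst sum.swap) (intro sum.cong refl quad_mult, auto)
  also have "\<dots> = (\<Sum>\<rho>\<in>carrier R. quad (\<ominus> \<rho>) * (\<Sum>u\<in>carrier R. quad (cub u)))"
  proof (rule sum.cong[OF refl])
    fix \<rho> assume r: "\<rho> \<in> carrier R"
    have "(\<Sum>u\<in>carrier R. quad (cub (u \<ominus> \<rho>))) = (\<Sum>u\<in>carrier R. quad (cub u))"
    proof (rule sum.reindex_bij_witness[of _ "\<lambda>u. u \<oplus> \<rho>" "\<lambda>u. u \<ominus> \<rho>"])
      fix u assume u: "u \<in> carrier R"
      show "u \<ominus> \<rho> \<oplus> \<rho> = u" by (rule eqI_diff, use u r in algebra) (use u r in auto)
      show "u \<oplus> \<rho> \<ominus> \<rho> = u" by (rule eqI_diff, use u r in algebra) (use u r in auto)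
    qed (use r in auto)
    then show "(\<Sum>u\<in>carrier R. quad (\<ominus> \<rho>) * quad (cub (u \<ominus> \<rho>))) = quad (\<ominus> \<rho>) * (\<Sum>u\<in>carrier R. quad (cub u))"
      by (simp add: sum_distrib_left [symmetric])
  qed
  also have "\<dots> = (\<Sum>\<rho>\<in>carrier R. quad (\<ominus> \<rho>)) * (\<Sum>u\<in>carrier R. quad (cub u))"
    by (simp add: sum_distrib_right)
  also have "(\<Sum>\<rho>\<in>carrier R. quad (\<ominus> \<rho>)) = (\<Sum>\<rho>\<in>carrier R. quad \<rho>)"
    by (rule sum.reindex_bij_witness[of _ "\<lambda>u. \<ominus> u" "\<lambda>u. \<ominus> u"]) auto
  finally have "(\<Sum>u\<in>carrier R. \<Sum>\<rho>\<in>carrier R. quad (\<ominus> \<rho> \<otimes> cub (u \<ominus> \<rho>))) = 0" by (simp add: sum_quad)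
  then show ?thesis by (simp add: sum_quad_res2_inner sum.distrib order_def)
qed

end

section \<open>The quadratic character of the curve\<close>

lemma (in ring_hom_ring) hom_of_natural: "h \<guillemotleft>n\<guillemotright>\<^sub>\<nat>\<^bsub>R\<^esub> = \<guillemotleft>n\<guillemotright>\<^sub>\<nat>\<^bsub>S\<^esub>"
  by (induction n) auto

lemma (in ring_hom_ring) hom_of_integer: "h \<guillemotleft>i\<guillemotright>\<^bsub>R\<^esub> = \<guillemotleft>i\<guillemotright>\<^bsub>S\<^esub>"
  by (simp add: of_integer_def hom_of_natural)

text \<open>Evaluation of polynomials over \<open>R\<close> at points of a larger field. It serves
  twice: with an algebraic closure of \<open>R\<close>, and with the function field of the
  curve.\<close>

locale poly_eval_hom = field_polys R + L: field_polys L
  for R (structure) and L (structure) +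
  fixes \<sigma> :: "'a \<Rightarrow> 'c"
  assumes \<sigma>_hom: "\<sigma> \<in> ring_hom R L"
begin

sublocale S: ring_hom_ring R L \<sigma>
  by (rule ring_hom_ringI2) (auto simp: ring_axioms L.ring_axioms \<sigma>_hom)

abbreviation Lmult (infixl ":*" 70) where "u :* v \<equiv> u \<otimes>\<^bsub>L\<^esub> v"
abbreviation Ladd (infixl ":+" 65) where "u :+ v \<equiv> u \<oplus>\<^bsub>L\<^esub> v"
abbreviation Lsub (infixl ":-" 65) where "u :- v \<equiv> u \<ominus>\<^bsub>L\<^esub> v"
abbreviation Lneg (":~ _" [81] 80) where ":~ u \<equiv> \<ominus>\<^bsub>L\<^esub> u"
abbreviation Lpow (infixr ":^" 75) where "u :^ (n::nat) \<equiv> u [^]\<^bsub>L\<^esub> n"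
abbreviation "zL \<equiv> \<zero>\<^bsub>L\<^esub>"
abbreviation "oL \<equiv> \<one>\<^bsub>L\<^esub>"

lemma \<sigma>_inj: "x \<in> carrier R \<Longrightarrow> y \<in> carrier R \<Longrightarrow> \<sigma> x = \<sigma> y \<Longrightarrow> x = y"
proof -
  have "\<sigma> ` carrier R \<noteq> {zL}"
  proof
    assume "\<sigma> ` carrier R = {zL}"
    then have "\<sigma> \<one> = zL" using one_closed by blast
    then show False by simp
  qed
  then have "inj_on \<sigma> (carrier R)" by (rule S.non_trivial_field_hom_imp_inj[OF field_axioms])
  then show "x \<in> carrier R \<Longrightarrow> y \<in> carrier R \<Longrightarrow> \<sigma> x = \<sigma> y \<Longrightarrow> x = y" by (auto dest: inj_onD)
qed

lemma \<sigma>_nonzero: "x \<in> carrier R \<Longrightarrow> x \<noteq> \<zero> \<Longrightarrow> \<sigma> x \<noteq> zL"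
  using \<sigma>_inj[of x \<zero>] S.hom_zero by auto

definition ev :: "'c \<Rightarrow> 'a list \<Rightarrow> 'c" where "ev \<theta> p = L.eval (map \<sigma> p) \<theta>"

lemma map_\<sigma>_carrier: "set p \<subseteq> carrier R \<Longrightarrow> set (map \<sigma> p) \<subseteq> carrier L"
  by auto

lemma ev_closed: "\<theta> \<in> carrier L \<Longrightarrow> set p \<subseteq> carrier R \<Longrightarrow> ev \<theta> p \<in> carrier L"
  unfolding ev_def by (intro L.eval_in_carrier map_\<sigma>_carrier)

lemma ev_hom:
  assumes t: "\<theta> \<in> carrier L" shows "ring_hom_ring (poly_ring R) L (ev \<theta>)"
proof (rule ring_hom_ringI2[OF UP.ring_axioms L.ring_axioms], rule ring_hom_memI)
  fix p r assume p: "p \<in> kX" and r: "r \<in> kX"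
  note c = poly_set_carrier[OF p] poly_set_carrier[OF r]
  note cm = c[THEN map_\<sigma>_carrier]
  show "ev \<theta> p \<in> carrier L" using ev_closed[OF t c(1)] .
  have pc: "set (poly_mult p r) \<subseteq> carrier R" "set (poly_add p r) \<subseteq> carrier R"
    using poly_mult_in_carrier poly_add_in_carrier c by (auto simp del: poly_add.simps poly_mult.simps)
  show "ev \<theta> (p .* r) = ev \<theta> p :* ev \<theta> r"
    unfolding ev_def univ_poly_mult
    using L.eval_normalize[OF map_\<sigma>_carrier[OF pc(1)] t] S.poly_mult_hom'[OF c] L.eval_poly_mult[OF cm t] by simp
  show "ev \<theta> (p .+ r) = ev \<theta> p :+ ev \<theta> r"
    unfolding ev_def univ_poly_add
    using L.eval_normalize[OF map_\<sigma>_carrier[OF pc(2)] t] S.poly_add_hom'[OF c] L.eval_poly_add[OF cm t] by simp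
next
  show "ev \<theta> oP = oL" using t by (simp add: ev_def poly_one)
qed

end

locale curve_closure = curve_field R a b + poly_eval_hom R L \<sigma>
  for R (structure) and a b and L (structure) and \<sigma> +
  assumes alg_closed: "p \<in> carrier (poly_ring L) \<Longrightarrow> degree p > 0 \<Longrightarrow> \<exists>x\<in>carrier L. ring.eval L p x = \<zero>\<^bsub>L\<^esub>"
begin

abbreviation q :: nat where "q \<equiv> order R"

lemma q_gt_1: "q > 1" using order_gt_1[OF finite_carrier] .

lemma \<sigma>_pow_q: "c \<in> carrier R \<Longrightarrow> \<sigma> c :^ q = \<sigma> c"
  using S.hom_nat_pow[of c q] pow_order[OF finite_carrier, of c] by simp

text \<open>The polynomial identity \<open>(X + 1)^q = X^q + 1\<close> over the small field is
  evaluated at \<open>u/v\<close> and multiplied by \<open>v^q\<close>. In this way additivity is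
  deduced from the order \<open>q\<close> alone.\<close>

lemma frob_add:
  assumes u: "u \<in> carrier L" and v: "v \<in> carrier L"
  shows "(u :+ v) :^ q = u :^ q :+ v :^ q"
proof (cases "v = zL")
  case True
  then show ?thesis using u q_gt_1 by (simp add: L.nat_pow_zero)
next
  case False
  have one: "(t :+ oL) :^ q = t :^ q :+ oL" if t: "t \<in> carrier L" for t
  proof -
    interpret E: ring_hom_ring "poly_ring R" L "ev t" by (rule ev_hom[OF t])
    have c: "[\<one>, \<one>] \<in> kX" "[\<one>, \<zero>] \<in> kX" "[\<one>] \<in> kX"
      by (auto simp: poly_carrier_iff)
    have e: "ev t [\<one>, \<one>] = t :+ oL" "ev t [\<one>, \<zero>] = t" "ev t [\<one>] = oL"
      using t by (auto simp: ev_def)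
    have "ev t ([\<one>, \<one>] .^ q) = ev t ([\<one>, \<zero>] .^ q .+ [\<one>])"
      using var_plus_one_pow[OF finite_carrier] by simp
    then show ?thesis using c e by (simp add: E.hom_nat_pow)
  qed
  have vi: "inv\<^bsub>L\<^esub> v \<in> carrier L" "inv\<^bsub>L\<^esub> v :* v = oL" using v False by auto
  define t where "t = u :* inv\<^bsub>L\<^esub> v"
  have t: "t \<in> carrier L" "t :* v = u" using u v vi by (auto simp: t_def L.m_assoc)
  have "u :+ v = (t :+ oL) :* v" using t v by (simp add: L.l_distr)
  then have "(u :+ v) :^ q = (t :^ q :+ oL) :* v :^ q"
    using t v one[OF t(1)] by (simp add: L.nat_pow_distrib)
  also have "\<dots> = (t :* v) :^ q :+ v :^ q"
    using t(1) v by (simp add: L.nat_pow_distrib L.l_distr)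
  finally show ?thesis by (simp add: t)
qed

lemma frob_inj:
  assumes u: "u \<in> carrier L" and v: "v \<in> carrier L" and e: "u :^ q = v :^ q"
  shows "u = v"
proof -
  have "(u :- v :+ v) :^ q = (u :- v) :^ q :+ v :^ q"
    by (rule frob_add) (use u v in auto)
  moreover have "u :- v :+ v = u" by (rule L.eqI_diff, use u v in algebra) (use u v in auto)
  moreover define z w where "z = (u :- v) :^ q" and "w = v :^ q"
  ultimately have zw: "w = z :+ w" using e by simp
  have c: "z \<in> carrier L" "w \<in> carrier L" using u v by (auto simp: z_def w_def)
  have "z :+ w :- w = z" by (rule L.eqI_diff, use c in algebra) (use c in auto)
  then have "z = zL" using zw c by simp
  then have "(u :- v) :^ q = zL" by (simp add: z_def)
  then have "u :- v = zL" using u v by (simp add: L.nat_pow_eq_0_iff)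
  then show ?thesis using u v by simp
qed

lemma frob_ev:
  assumes t: "\<theta> \<in> carrier L" and p: "set p \<subseteq> carrier R"
  shows "ev \<theta> p :^ q = ev (\<theta> :^ q) p"
  using p
proof (induction p)
  case Nil
  then show ?case using q_gt_1 by (simp add: ev_def L.nat_pow_zero)
next
  case (Cons c p)
  have c: "c \<in> carrier R" "set p \<subseteq> carrier R" using Cons by auto
  have e: "ev \<eta> (c # p) = \<sigma> c :* \<eta> :^ length p :+ ev \<eta> p" for \<eta> by (simp add: ev_def)
  have "ev \<theta> (c # p) :^ q = (\<sigma> c :* \<theta> :^ length p) :^ q :+ ev \<theta> p :^ q"
    unfolding e by (rule frob_add) (use t c ev_closed[OF t c(2)] in auto)
  also have "(\<sigma> c :* \<theta> :^ length p) :^ q = \<sigma> c :* (\<theta> :^ q) :^ length p"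
    using t c \<sigma>_pow_q[OF c(1)] by (simp add: L.nat_pow_distrib L.nat_pow_pow mult.commute)
  finally show ?case using Cons.IH[OF c(2)] unfolding e by simp
qed

lemma frob_ev_pow:
  assumes t: "\<theta> \<in> carrier L" and p: "set p \<subseteq> carrier R"
  shows "ev \<theta> p :^ (q ^ i) = ev (\<theta> :^ (q ^ i)) p"
proof (induction i)
  case 0
  then show ?case using t ev_closed[OF t p] by simp
next
  case (Suc i)
  have "ev \<theta> p :^ (q ^ Suc i) = (ev \<theta> p :^ (q ^ i)) :^ q"
    using ev_closed[OF t p] by (simp add: L.nat_pow_pow mult.commute)
  also have "\<dots> = ev ((\<theta> :^ (q ^ i)) :^ q) p" using Suc frob_ev[of "\<theta> :^ (q ^ i)" p] t p by simp
  finally show ?case using t by (simp add: L.nat_pow_pow mult.commute)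
qed

lemma frob_pow_inj:
  assumes "u \<in> carrier L" "v \<in> carrier L" "u :^ (q ^ i) = v :^ (q ^ i)" shows "u = v"
  using assms(3)
proof (induction i)
  case 0
  then show ?case using assms by simp
next
  case (Suc i)
  have "(u :^ (q ^ i)) :^ q = (v :^ (q ^ i)) :^ q"
    using Suc.prems assms by (simp add: L.nat_pow_pow mult.commute)
  then have "u :^ (q ^ i) = v :^ (q ^ i)" by (rule frob_inj[rotated 2]) (use assms in auto)
  then show ?case by (rule Suc.IH)
qed

text \<open>The fixed points are roots of the nonzero polynomial \<open>X^(q^i) - X\<close>.\<close>

lemma card_frob_fixed:
  assumes "i > 0" shows "finite {u \<in> carrier L. u :^ (q ^ i) = u}" "card {u \<in> carrier L. u :^ (q ^ i) = u} \<le> q ^ i"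
proof -
  let ?n = "q ^ i"
  have n: "?n > 1" using q_gt_1 assms by (rule one_less_power)
  let ?X = "[oL, zL]"
  have X: "?X \<in> L.mons 1" by (auto simp: L.mons_def L.Mon_def L.poly_carrier_iff)
  define m where "m = ?X [^]\<^bsub>poly_ring L\<^esub> ?n"
  have m: "m \<in> L.mons ?n" using L.mons_pow[OF X, of ?n] by (simp add: m_def)
  have c: "?X \<in> carrier (poly_ring L)" "m \<in> carrier (poly_ring L)"
    using X m by (auto simp: L.mons_def L.Mon_def)
  define e where "e = m \<ominus>\<^bsub>poly_ring L\<^esub> ?X"
  have ec: "e \<in> carrier (poly_ring L)" using c by (simp add: e_def)
  have ev: "L.eval e u = u :^ ?n :- u" if u: "u \<in> carrier L" for u
  proof -
    interpret E: ring_hom_ring "poly_ring L" L "\<lambda>p. L.eval p u" by (rule L.eval_poly_hom[OF u])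
    have "L.eval m u = u :^ ?n" unfolding m_def using E.hom_nat_pow[OF c(1), of ?n] u by simp
    then show ?thesis unfolding e_def using c u by (simp add: a_minus_def)
  qed
  have e0: "e \<noteq> []"
  proof
    assume "e = []"
    then have "m = ?X" using L.UP.r_right_minus_eq[OF c(2,1)] by (simp add: e_def)
    then show False using m n by (simp add: L.mons_def)
  qed
  have set: "{u \<in> carrier L. u :^ ?n = u} = {u \<in> carrier L. L.eval e u = zL}"
    using ev by auto
  have "length e \<le> Suc ?n"
  proof (rule L.length_le_iff_coeff[OF ec])
    fix j assume "j \<ge> Suc ?n"
    then have "j > degree m" "j > degree ?X" using m n by (auto simp: L.mons_def)
    then show "L.coeff e j = zL"
      unfolding e_def L.coeff_minus[OF c(2,1)] using L.coeff_degree[of m j] L.coeff_degree[of ?X j] by simp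
  qed
  then show "finite {u \<in> carrier L. u :^ ?n = u}" "card {u \<in> carrier L. u :^ ?n = u} \<le> ?n"
    unfolding set using L.card_roots_le[OF ec e0] by auto
qed

lemma MIrr_root:
  assumes "P \<in> MIrr" obtains \<theta> where "\<theta> \<in> carrier L" "ev \<theta> P = zL"
proof -
  note P = MIrrD[OF assms]
  have "map \<sigma> P \<in> L.Mon" using MonD[OF P(1)] poly_set_carrier[OF P(2)] by (auto simp: L.Mon_def L.poly_carrier_iff hd_map)
  then have "\<exists>x\<in>carrier L. L.eval (map \<sigma> P) x = zL"
    using alg_closed[of "map \<sigma> P"] P(3) L.MonD(1) by simp
  then show ?thesis using that by (auto simp: ev_def)
qed

text \<open>The kernel of evaluation is a proper ideal containing the ideal generated by
  \<open>P\<close>, which is maximal because \<open>P\<close> is irreducible.\<close>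

lemma ev_zero_iff:
  assumes P: "P \<in> MIrr" and t: "\<theta> \<in> carrier L" and z: "ev \<theta> P = zL" and p: "p \<in> kX"
  shows "ev \<theta> p = zL \<longleftrightarrow> P .| p"
proof -
  interpret E: ring_hom_ring "poly_ring R" L "ev \<theta>" by (rule ev_hom[OF t])
  note PP = MIrrD[OF P]
  have km: "x \<in> a_kernel (poly_ring R) L (ev \<theta>) \<longleftrightarrow> x \<in> kX \<and> ev \<theta> x = zL" for x
    unfolding a_kernel_def' by blast
  have dv: "p \<in> PIdl\<^bsub>poly_ring R\<^esub> P \<longleftrightarrow> P .| p" if "p \<in> kX" for p
    using that PP(2) UP.m_comm by (auto simp: cgenideal_def factor_def)
  have max: "maximalideal (PIdl\<^bsub>poly_ring R\<^esub> P) (poly_ring R)"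
    using UP.irreducible_imp_maximalideal[OF PP(2)] P by (auto simp: MIrr_def)
  have "a_kernel (poly_ring R) L (ev \<theta>) = PIdl\<^bsub>poly_ring R\<^esub> P \<or> a_kernel (poly_ring R) L (ev \<theta>) = kX"
  proof (rule maximalideal.I_maximal[OF max])
    show "ideal (a_kernel (poly_ring R) L (ev \<theta>)) (poly_ring R)" by (rule E.kernel_is_ideal)
    show "PIdl\<^bsub>poly_ring R\<^esub> P \<subseteq> a_kernel (poly_ring R) L (ev \<theta>)"
    proof
      fix x assume "x \<in> PIdl\<^bsub>poly_ring R\<^esub> P"
      then obtain y where "y \<in> kX" "x = y .* P" by (auto simp: cgenideal_def)
      then show "x \<in> a_kernel (poly_ring R) L (ev \<theta>)" using PP(2) z unfolding km by simp
    qed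
    show "a_kernel (poly_ring R) L (ev \<theta>) \<subseteq> kX" using km by blast
  qed
  moreover have "oP \<notin> a_kernel (poly_ring R) L (ev \<theta>)" unfolding km by simp
  ultimately have "a_kernel (poly_ring R) L (ev \<theta>) = PIdl\<^bsub>poly_ring R\<^esub> P" using UP.one_closed by blast
  then show ?thesis using dv[OF p] km[of p] p by simp
qed

end

section \<open>Remainders modulo a monic polynomial\<close>

context field_polys
begin

lemma coeff_add:
  assumes "p \<in> kX" "r \<in> kX"
  shows "coeff (p .+ r) i = coeff p i \<oplus> coeff r i"
  unfolding univ_poly_add using poly_add_coeff[OF assms[THEN poly_set_carrier]] by simp

lemma mons_add:
  assumes g: "g \<in> mons n" and p: "p \<in> kX" "length p \<le> n"
  shows "g .+ p \<in> mons n"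
proof -
  have gc: "g \<in> kX" "g \<noteq> []" "hd g = \<one>" "degree g = n" using g by (auto simp: mons_def Mon_def)
  let ?s = "g .+ p"
  have sc: "?s \<in> kX" using gc p by simp
  have cn: "coeff ?s n = \<one>"
    using lead_coeff_simp[OF gc(2)] gc coeff_length[OF p(2)] by (simp add: coeff_add[OF gc(1) p(1)])
  then have ne: "?s \<noteq> []" by (metis coeff.simps(1) one_not_zero)
  have "length ?s \<le> Suc n"
  proof (rule length_le_iff_coeff[OF sc])
    fix i assume "i \<ge> Suc n"
    then show "coeff ?s i = \<zero>"
      using coeff_degree[of g i] coeff_length[of p i] gc p by (simp add: coeff_add[OF gc(1) p(1)])
  qed
  moreover have "length ?s > n"
  proof (rule ccontr)
    assume "\<not> length ?s > n"
    then show False using coeff_length[of ?s n] cn by simp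
  qed
  ultimately have "degree ?s = n" by simp
  then show ?thesis using sc ne cn lead_coeff_simp[OF ne] by (simp add: mons_def Mon_def)
qed

lemma red_carrier: "p \<in> red d \<Longrightarrow> p \<in> kX"
  by (simp add: red_def)

lemma red_minus:
  assumes "p \<in> red d" "r \<in> red d" shows "p .- r \<in> red d"
proof -
  have c: "p \<in> kX" "r \<in> kX" "length p \<le> d" "length r \<le> d"
    using assms by (auto simp: red_def)
  have "length (p .- r) \<le> d"
    by (rule length_le_iff_coeff) (use c in \<open>auto simp: coeff_minus coeff_length\<close>)
  then show ?thesis using c by (simp add: red_def)
qed

lemma red_zero:
  assumes D: "D \<in> mons d" and p: "p \<in> red d" "D .| p" shows "p = []"
proof (rule ccontr)
  assume n: "p \<noteq> []"
  have Dc: "D \<in> kX" "D \<noteq> []" "degree D = d" using D by (auto simp: mons_def Mon_def)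
  obtain h where h: "h \<in> kX" "p = D .* h" using p(2) by (auto simp: factor_def)
  have "h \<noteq> []" using n h Dc UP.r_null[of D] by auto
  then have "degree p = d + degree h" using poly_degree_mult(1)[OF Dc(1) h(1) Dc(2)] Dc h by simp
  moreover have "length p \<le> d" "length p > 0" using p(1) n by (auto simp: red_def)
  ultimately show False by linarith
qed

lemma red_unique:
  assumes D: "D \<in> mons d" and p: "p \<in> red d" "r \<in> red d" "D .| (p .- r)"
  shows "p = r"
  using red_zero[OF D red_minus[OF p(1,2)] p(3)] UP.r_right_minus_eq[OF p(1,2)[THEN red_carrier]] by simp

lemma red_exists:
  assumes D: "D \<in> mons d" and p: "p \<in> kX"
  obtains r where "r \<in> red d" "D .| (p .- r)"
proof
  have Dc: "D \<in> kX" "D \<noteq> []" "degree D = d" using D by (auto simp: mons_def Mon_def)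
  note cl = long_division_closed[OF carrier_is_subfield p Dc(1)]
  show "p pmod D \<in> red d"
    using pmod_degree[OF carrier_is_subfield p Dc(1,2)] cl Dc by (auto simp: red_def)
  have e: "p = D .* (p pdiv D) .+ (p pmod D)"
    by (rule pdiv_pmod[OF carrier_is_subfield p Dc(1)])
  define u v where "u = D .* (p pdiv D)" and "v = p pmod D"
  have uv: "u \<in> kX" "v \<in> kX" using cl Dc by (auto simp: u_def v_def)
  have "p .- v = u"
  proof -
    have "u .+ v .- v = u" by (rule UP.eqI_diff, use uv in algebra) (use uv in auto)
    then show ?thesis using e by (simp only: u_def v_def)
  qed
  then show "D .| (p .- (p pmod D))"
    using cl(1) by (auto simp: factor_def u_def v_def)
qed

end

lemma (in ring_hom_ring) img_carrier_is_subring: "subring (h ` carrier R) S"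
  by (rule S.subringI) (auto simp flip: hom_mult hom_add hom_a_inv hom_one)

text \<open>\<open>r\<close>, \<open>s\<close> and \<open>t\<close> are the roots of the cubic in
  \<open>L\<close>, specified by the coefficient formulas so that the polynomial identities for
  cubics apply directly.\<close>

locale curve_split = curve_closure R a b L \<sigma>
  for R (structure) and a b and L (structure) and \<sigma> +
  fixes r s t
  assumes rst [simp]: "r \<in> carrier L" "s \<in> carrier L" "t \<in> carrier L"
    and distinct: "r \<noteq> s" "r \<noteq> t" "s \<noteq> t"
    and a_eq: "\<sigma> a = \<ominus>\<^bsub>L\<^esub> (r \<otimes>\<^bsub>L\<^esub> r \<oplus>\<^bsub>L\<^esub> r \<otimes>\<^bsub>L\<^esub> s \<oplus>\<^bsub>L\<^esub> s \<otimes>\<^bsub>L\<^esub> s)"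
    and b_eq: "\<sigma> b = r \<otimes>\<^bsub>L\<^esub> s \<otimes>\<^bsub>L\<^esub> (r \<oplus>\<^bsub>L\<^esub> s)"
    and t_eq: "t = \<ominus>\<^bsub>L\<^esub> (r \<oplus>\<^bsub>L\<^esub> s)"
begin

definition Lcub where "Lcub T = T :^ (3::nat) :+ \<sigma> a :* T :+ \<sigma> b"

definition F0 :: "'a list" where "F0 = [\<one>, \<zero>, a, b]"

lemma F0_mons: "F0 \<in> mons 3" and F0_carrier [simp]: "F0 \<in> kX" and F0_set: "set F0 \<subseteq> carrier R"
  by (auto simp: F0_def mons_def Mon_def poly_carrier_iff)

lemma Lcub_split: "T \<in> carrier L \<Longrightarrow> Lcub T = (T :- r) :* (T :- s) :* (T :- t)"
  unfolding Lcub_def t_eq by (rule L.cubic_split[OF _ _ _ _ _ a_eq b_eq]) auto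

lemma ev_F0: "T \<in> carrier L \<Longrightarrow> ev T F0 = Lcub T"
  by (simp add: ev_def F0_def Lcub_def L.a_assoc numeral_3_eq_3)

lemma Lcub_\<sigma>: "x \<in> carrier R \<Longrightarrow> Lcub (\<sigma> x) = \<sigma> (cub x)"
  by (simp add: Lcub_def cub_def S.hom_nat_pow)

lemma Lcub_roots: "Lcub r = zL" "Lcub s = zL" "Lcub t = zL"
  by (simp_all add: Lcub_split a_minus_def L.r_neg)

lemma Lcub_zero: "T \<in> carrier L \<Longrightarrow> Lcub T = zL \<Longrightarrow> T \<in> {r, s, t}"
  by (auto simp: Lcub_split L.integral_iff)

text \<open>The sign is chosen such that for monic \<open>g\<close> this is the product of the
  values of the cubic at the roots of \<open>g\<close>. For irreducible \<open>g\<close> it is the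
  norm of one such value.\<close>

definition psi :: "'a list \<Rightarrow> 'c" where
  "psi g = (:~ oL) :^ degree g :* (ev r g :* ev s g :* ev t g)"

definition chi :: "'a list \<Rightarrow> real" where "chi g = qc L hq (psi g)"

lemma chi_range: "chi g \<in> {-1, 0, 1}" by (simp add: chi_def qc_def)

lemma psi_closed: "g \<in> kX \<Longrightarrow> psi g \<in> carrier L"
  using poly_set_carrier[of g] by (simp add: psi_def ev_closed)

lemma m1_frob: "((:~ oL) :^ (n::nat)) :^ q = (:~ oL) :^ n"
proof -
  have "\<sigma> (\<ominus> \<one>) = :~ oL" by simp
  then have "(:~ oL) :^ q = :~ oL" using \<sigma>_pow_q[of "\<ominus> \<one>"] by simp
  then have "((:~ oL) :^ q) :^ n = (:~ oL) :^ n" by simp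
  then show ?thesis by (simp add: L.nat_pow_pow mult.commute)
qed

text \<open>The \<open>q\<close>-th power map fixes the coefficients of the cubic and of
  \<open>g\<close>. It therefore permutes the three roots, and with them the three factors of
  \<open>psi g\<close>.\<close>

lemma psi_frob:
  assumes g: "g \<in> kX" shows "psi g :^ q = psi g"
proof -
  let ?h = "\<lambda>x. x :^ q"
  let ?G = "\<lambda>x. ev x g"
  note gs = poly_set_carrier[OF g]
  have G: "?G \<in> carrier L \<rightarrow> carrier L" using ev_closed[OF _ gs] by auto
  have inj: "inj_on ?h {r, s, t}" by (rule inj_onI) (use frob_inj in auto)
  have img: "?h ` {r, s, t} = {r, s, t}"
  proof (rule endo_inj_surj[OF _ _ inj])
    have "?h x \<in> {r, s, t}" if "x \<in> carrier L" "Lcub x = zL" for x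
    proof -
      have "Lcub (?h x) = ev x F0 :^ q" using that ev_F0[of "?h x"] frob_ev[OF that(1) F0_set] by simp
      then have "Lcub (?h x) = zL" using that ev_F0[of x] q_gt_1 by (simp add: L.nat_pow_zero)
      then show ?thesis using Lcub_zero[of "?h x"] that by simp
    qed
    then show "?h ` {r, s, t} \<subseteq> {r, s, t}" using Lcub_roots by auto
  qed simp
  have three: "finprod L H {r, s, t} = H r :* (H s :* H t)" if "H \<in> carrier L \<rightarrow> carrier L" for H
    using that distinct rst by (subst L.finprod_insert; simp add: Pi_iff)+
  have "finprod L (\<lambda>x. ?G (?h x)) {r, s, t} = finprod L ?G (?h ` {r, s, t})"
    by (rule L.finprod_reindex [symmetric]) (use G inj in auto)
  also have "\<dots> = finprod L ?G {r, s, t}" by (simp only: img)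
  finally have e: "ev (?h r) g :* (ev (?h s) g :* ev (?h t) g) = ev r g :* (ev s g :* ev t g)"
    using three[OF G] three[of "\<lambda>x. ?G (?h x)"] G by (simp add: Pi_iff)
  have "psi g :^ q = (:~ oL) :^ degree g :* (ev r g :^ q :* (ev s g :^ q :* ev t g :^ q))"
    unfolding psi_def using ev_closed[OF _ gs] m1_frob[of "degree g"] by (simp add: L.nat_pow_distrib L.m_assoc)
  also have "\<dots> = psi g"
    unfolding psi_def using ev_closed[OF _ gs] e by (simp add: frob_ev gs L.m_assoc)
  finally show ?thesis .
qed

lemma psi_2hq:
  assumes g: "g \<in> kX" and n: "psi g \<noteq> zL" shows "psi g :^ (2 * hq) = oL"
proof -
  have "psi g :^ (2 * hq) :* psi g = oL :* psi g"
    using psi_frob[OF g] psi_closed[OF g] by (simp add: order_eq)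
  then show ?thesis using psi_closed[OF g] n by (subst (asm) L.m_rcancel) auto
qed

lemma psi_mult:
  assumes "g \<in> Mon" "h \<in> Mon" shows "psi (g .* h) = psi g :* psi h"
proof -
  have c: "g \<in> kX" "h \<in> kX" using assms MonD(1) by auto
  note s = c[THEN poly_set_carrier]
  have e: "ev x (g .* h) = ev x g :* ev x h" if "x \<in> carrier L" for x
    using ring_hom_mult[OF ring_hom_ring.homh[OF ev_hom[OF that]] c] .
  note cl = ev_closed[OF rst(1) s(1)] ev_closed[OF rst(2) s(1)] ev_closed[OF rst(3) s(1)]
    ev_closed[OF rst(1) s(2)] ev_closed[OF rst(2) s(2)] ev_closed[OF rst(3) s(2)]
  define m1 where "m1 = :~ oL"
  have m1: "m1 \<in> carrier L" by (simp add: m1_def)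
  have "psi (g .* h) = (m1 :^ degree g :* m1 :^ degree h) :*
     ((ev r g :* ev r h) :* (ev s g :* ev s h) :* (ev t g :* ev t h))"
    unfolding psi_def Mon_degree_mult[OF assms] m1_def [symmetric] using m1 by (simp add: e L.nat_pow_mult)
  also have "\<dots> = psi g :* psi h"
    unfolding psi_def m1_def [symmetric] using cl m1 by (simp add: L.m_ac)
  finally show ?thesis .
qed

lemma chi_mult: "g \<in> Mon \<Longrightarrow> h \<in> Mon \<Longrightarrow> chi (g .* h) = chi g * chi h"
  unfolding chi_def psi_mult by (rule L.qc_mult) (use MonD(1) psi_closed psi_2hq in auto)

lemma chi_one: "chi [\<one>] = 1"
  by (simp add: chi_def psi_def ev_def qc_def)

lemma qc_\<sigma>: "x \<in> carrier R \<Longrightarrow> qc L n (\<sigma> x) = qc R n x"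
proof -
  assume x: "x \<in> carrier R"
  have "\<sigma> x = zL \<longleftrightarrow> x = \<zero>" using x \<sigma>_nonzero by auto
  moreover have "\<sigma> x :^ n = oL \<longleftrightarrow> x [^] n = \<one>"
    using x \<sigma>_inj[of "x [^] n" \<one>] by (auto simp flip: S.hom_nat_pow)
  ultimately show ?thesis by (simp add: qc_def)
qed

text \<open>Every monic polynomial of degree at least 3 is uniquely \<open>F0 h + p\<close> with a
  remainder \<open>p\<close>, and its values at the roots of \<open>F0\<close> are those of
  \<open>p\<close>. Replacing \<open>p\<close> by \<open>c p\<close> for a nonresidue
  \<open>c\<close> permutes the remainders and multiplies \<open>psi\<close> by the nonresidue
  \<open>c^3\<close>, so the sum equals its own negative.\<close>

lemma sum_chi_ge_3:
  assumes "n \<ge> 3" shows "(\<Sum>g\<in>mons n. chi g) = 0"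
proof -
  let ?A = "poly_ring R"
  let ?f = "\<lambda>(h, p). F0 .* h .+ p"
  have F0M: "F0 \<in> Mon" "degree F0 = 3" using F0_mons by (auto simp: mons_def)
  have hm: "h \<in> carrier ?A" "F0 .* h \<in> mons n" "F0 .* h \<in> carrier ?A" if "h \<in> mons (n - 3)" for h
    using that assms Mon_mult[OF F0M(1), of h] Mon_degree_mult[OF F0M(1), of h] F0M MonD(1)
    by (auto simp: mons_def)
  have inj: "inj_on ?f (mons (n - 3) \<times> red 3)"
  proof (rule inj_onI)
    fix x y assume "x \<in> mons (n - 3) \<times> red 3" "y \<in> mons (n - 3) \<times> red 3" "?f x = ?f y"
    then obtain h p h' p' where xy: "x = (h, p)" "y = (h', p')" and h: "h \<in> mons (n - 3)" "h' \<in> mons (n - 3)"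
      and p: "p \<in> red 3" "p' \<in> red 3" and e: "F0 .* h .+ p = F0 .* h' .+ p'"
      by auto
    have c: "F0 \<in> carrier ?A" "h \<in> carrier ?A" "h' \<in> carrier ?A" "p \<in> carrier ?A" "p' \<in> carrier ?A"
      using hm h p red_carrier by auto
    have "f .* (h' .- h) .- (p .- p') .+ ((f .* h .+ p) .- (f .* h' .+ p')) = zP" if "f \<in> carrier ?A" for f
      using c that by algebra
    from this[of F0] have "F0 .* (h' .- h) .- (p .- p') .+ ((F0 .* h .+ p) .- (F0 .* h' .+ p')) = zP"
      by simp
    moreover have "(F0 .* h .+ p) .- (F0 .* h' .+ p') = zP"
      using e c by (simp del: poly_zero)
    ultimately have "F0 .* (h' .- h) .- (p .- p') = zP"
      using c by (simp del: poly_zero)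
    then have "p .- p' = F0 .* (h' .- h)"
      using c by (subst (asm) UP.r_right_minus_eq) auto
    then have "F0 .| (p .- p')" using c by (auto simp: factor_def)
    then have pp: "p = p'" using red_unique[OF F0_mons p] by blast
    then have "F0 .* h = F0 .* h'" by (intro UP.add.r_cancel[OF e[unfolded pp]]) (use c in auto)
    then have "h = h'" using c MonD(2)[OF F0M(1)] by (subst (asm) UP.m_lcancel) auto
    then show "x = y" using xy pp by simp
  qed
  have fin: "finite (mons (n - 3) \<times> red 3)" using finite_mons[OF finite_carrier] card_red[OF finite_carrier] by auto
  have "?f ` (mons (n - 3) \<times> red 3) \<subseteq> mons n"
    using hm mons_add assms by (auto simp: red_def)
  moreover have "card (?f ` (mons (n - 3) \<times> red 3)) = card (mons n)"
    using card_image[OF inj] card_mons[OF finite_carrier] card_red[OF finite_carrier] assms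
    by (simp add: card_cartesian_product flip: power_add)
  ultimately have img: "?f ` (mons (n - 3) \<times> red 3) = mons n"
    using finite_mons[OF finite_carrier] by (intro card_subset_eq) auto
  obtain c where c: "c \<in> carrier R" "quad c = -1" using exists_nonresidue by blast
  have c0: "c \<noteq> \<zero>" using c by (auto simp: qc_def)
  have Cc: "[c] \<in> carrier ?A" "[c] \<noteq> []" using c c0 by (auto simp: poly_carrier_iff)
  have flip: "chi (F0 .* h .+ [c] .* p) = - chi (F0 .* h .+ p)"
    and cred: "[c] .* p \<in> red 3"
    if h: "h \<in> mons (n - 3)" and p: "p \<in> red 3" for h p
  proof -
    have pc: "p \<in> carrier ?A" "[c] .* p \<in> carrier ?A" using p red_carrier Cc by auto
    show cr: "[c] .* p \<in> red 3"
    proof (cases "p = []")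
      case True
      then show ?thesis using p UP.r_null[OF Cc(1)] by simp
    next
      case False
      have "length p \<le> 3" using p by (simp add: red_def)
      then have "length ([c] .* p) \<le> 3" using poly_degree_mult(1)[OF Cc(1) pc(1) Cc(2) False] False by simp
      then show ?thesis using pc by (simp add: red_def)
    qed
    let ?g = "F0 .* h .+ p" and ?g' = "F0 .* h .+ [c] .* p"
    have gm: "?g \<in> mons n" "?g' \<in> mons n" using mons_add hm[OF h] pc p cr assms by (auto simp: red_def)
    then have gc: "?g \<in> carrier ?A" "degree ?g = n" "degree ?g' = n" by (auto simp: mons_def Mon_def)
    have e: "ev x ?g' = \<sigma> c :* ev x ?g" if x: "x \<in> carrier L" "Lcub x = zL" for x
    proof -
      interpret E: ring_hom_ring ?A L "ev x" by (rule ev_hom[OF x(1)])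
      have "ev x F0 = zL" "ev x [c] = \<sigma> c" using x ev_F0 c by (auto simp: ev_def)
      then show ?thesis using hm[OF h] pc Cc c by simp
    qed
    note cl = ev_closed[OF rst(1) poly_set_carrier[OF gc(1)]] ev_closed[OF rst(2) poly_set_carrier[OF gc(1)]]
       ev_closed[OF rst(3) poly_set_carrier[OF gc(1)]]
    have \<sigma>c: "\<sigma> c \<in> carrier L" using c by simp
    have m1: "(:~ oL) :^ n \<in> carrier L" by simp
    have "psi ?g' = \<sigma> (c \<otimes> (c \<otimes> c)) :* psi ?g"
      unfolding psi_def gc e[OF rst(1) Lcub_roots(1)] e[OF rst(2) Lcub_roots(2)] e[OF rst(3) Lcub_roots(3)]
      using cl \<sigma>c m1 c by (simp add: L.m_ac)
    then have "chi ?g' = qc L hq (\<sigma> (c \<otimes> (c \<otimes> c))) * chi ?g"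
      unfolding chi_def using psi_closed[OF gc(1)] psi_2hq[OF gc(1)] c c0 pow_2hq[of "c \<otimes> (c \<otimes> c)"]
      by (simp only:, intro L.qc_mult) (auto simp: integral_iff simp flip: S.hom_nat_pow S.hom_mult)
    also have "qc L hq (\<sigma> (c \<otimes> (c \<otimes> c))) = -1"
      using c quad_mult by (simp add: qc_\<sigma> del: S.hom_mult)
    finally show "chi ?g' = - chi ?g" by simp
  qed
  have zero: "(\<Sum>p\<in>red 3. chi (F0 .* h .+ p)) = 0" if h: "h \<in> mons (n - 3)" for h
  proof -
    have injc: "inj_on (\<lambda>p. [c] .* p) (red 3)"
      using Cc by (auto simp: inj_on_def red_def UP.m_lcancel)
    have "(\<lambda>p. [c] .* p) ` red 3 = red 3"
      by (rule endo_inj_surj[OF _ _ injc]) (use cred[OF h] card_red[OF finite_carrier] in auto)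
    then have "(\<Sum>p\<in>red 3. chi (F0 .* h .+ p)) = (\<Sum>p\<in>red 3. chi (F0 .* h .+ [c] .* p))"
      using sum.reindex[OF injc, of "\<lambda>p. chi (F0 .* h .+ p)"] by simp
    also have "\<dots> = - (\<Sum>p\<in>red 3. chi (F0 .* h .+ p))" using flip[OF h] by (simp add: sum_negf)
    finally show ?thesis by simp
  qed
  have "(\<Sum>g\<in>mons n. chi g) = (\<Sum>x\<in>mons (n - 3) \<times> red 3. chi (?f x))"
    using sum.reindex[OF inj, of chi] by (simp add: img)
  also have "\<dots> = (\<Sum>h\<in>mons (n - 3). \<Sum>p\<in>red 3. chi (F0 .* h .+ p))"
    by (simp add: sum.cartesian_product case_prod_unfold)
  also have "\<dots> = 0" by (intro sum.neutral ballI zero)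
  finally show ?thesis .
qed

lemma sum_chi_1: "(\<Sum>g\<in>mons 1. chi g) = (\<Sum>x\<in>carrier R. quad (cub x))"
proof -
  have img: "mons 1 = (\<lambda>x. [\<one>, \<ominus> x]) ` carrier R"
  proof -
    have "{cs. set cs \<subseteq> carrier R \<and> length cs = 1} = (\<lambda>x. [\<ominus> x]) ` carrier R"
    proof (intro equalityI subsetI)
      fix cs assume "cs \<in> {cs. set cs \<subseteq> carrier R \<and> length cs = 1}"
      then obtain y where "cs = [y]" "y \<in> carrier R" by (auto simp: length_Suc_conv)
      then show "cs \<in> (\<lambda>x. [\<ominus> x]) ` carrier R" by (intro image_eqI[of _ _ "\<ominus> y"]) auto
    qed auto
    then show ?thesis by (simp add: mons_eq image_image)
  qed
  have "chi [\<one>, \<ominus> x] = quad (cub x)" if x: "x \<in> carrier R" for x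
  proof -
    have sx: "\<sigma> x \<in> carrier L" using x by simp
    define z where "z = \<sigma> x"
    have z: "z \<in> carrier L" using sx by (simp add: z_def)
    have "psi [\<one>, \<ominus> x] = :~ oL :* ((r :- z) :* (s :- z) :* (t :- z))"
      using x by (simp add: psi_def ev_def a_minus_def z_def)
    also have "\<dots> = (z :- r) :* (z :- s) :* (z :- t)"
    proof -
      have c: "r \<in> carrier L" "s \<in> carrier L" "t \<in> carrier L" by simp_all
      show ?thesis unfolding L.triple_flip[OF c z] using c z by (simp add: L.l_minus L.r_minus)
    qed
    also have "\<dots> = \<sigma> (cub x)" using Lcub_split[OF sx] Lcub_\<sigma>[OF x] by (simp add: z_def)
    finally show ?thesis using x by (simp add: chi_def qc_\<sigma>)
  qed
  then show ?thesis unfolding img by (subst sum.reindex) (auto simp: inj_on_def neg_equal_iff_equal)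
qed

text \<open>For fixed \<open>u\<close> the map between the constant coefficient \<open>v\<close> and
  \<open>w = a + u^2 - v\<close> is an involution. It brings the resultant into the form
  \<open>res2\<close>, whose character sum is known.\<close>

lemma sum_chi_2: "(\<Sum>g\<in>mons 2. chi g) = real q"
proof -
  let ?v = "\<lambda>u w. a \<oplus> u \<otimes> u \<ominus> w"
  let ?g = "\<lambda>(u, w). [\<one>, u, ?v u w]"
  have inv: "?v u (?v u w) = w" if c: "u \<in> carrier R" "w \<in> carrier R" for u w
  proof -
    have ac: "a \<in> carrier R" by simp
    show ?thesis by (rule eqI_diff, use c ac in algebra) (use c in auto)
  qed
  have img: "mons 2 = ?g ` (carrier R \<times> carrier R)"
  proof -
    have "{cs. set cs \<subseteq> carrier R \<and> length cs = 2} = (\<lambda>(u, w). [u, ?v u w]) ` (carrier R \<times> carrier R)"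
    proof (intro equalityI subsetI)
      fix cs assume "cs \<in> {cs. set cs \<subseteq> carrier R \<and> length cs = 2}"
      then obtain u v where uv: "cs = [u, v]" "u \<in> carrier R" "v \<in> carrier R" by (auto simp: numeral_2_eq_2 length_Suc_conv)
      then show "cs \<in> (\<lambda>(u, w). [u, ?v u w]) ` (carrier R \<times> carrier R)"
        by (intro image_eqI[of _ _ "(u, ?v u v)"]) (auto simp: inv)
    qed auto
    then show ?thesis by (simp add: mons_eq image_image case_prod_unfold)
  qed
  have inj: "inj_on ?g (carrier R \<times> carrier R)"
  proof (rule inj_onI)
    fix x y assume "x \<in> carrier R \<times> carrier R" "y \<in> carrier R \<times> carrier R" "?g x = ?g y"
    then show "x = y" using inv by (cases x; cases y) (auto, metis)
  qed
  have "chi [\<one>, u, ?v u w] = quad (res2 u w)" if c: "u \<in> carrier R" "w \<in> carrier R" for u w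
  proof -
    let ?U = "\<sigma> u" and ?W = "\<sigma> w" and ?V = "\<sigma> (?v u w)"
    have V: "?V = \<sigma> a :+ ?U :* ?U :- ?W" using c by (simp add: a_minus_def)
    have F: "Lcub ?U = \<sigma> (cub u)" using Lcub_\<sigma> c by simp
    have "psi [\<one>, u, ?v u w] = (r :* r :+ ?U :* r :+ ?V) :* (s :* s :+ ?U :* s :+ ?V)
        :* (t :* t :+ ?U :* t :+ ?V)"
    proof -
      have "ev x [\<one>, u, ?v u w] = x :* x :+ ?U :* x :+ ?V" if "x \<in> carrier L" for x
        using that c by (simp add: ev_def L.power2_eq_square numeral_2_eq_2 [symmetric] L.a_assoc)
      moreover have "(:~ oL) :^ degree [\<one>, u, ?v u w] = oL" by (simp add: L.l_minus L.r_minus)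
      ultimately show ?thesis using c unfolding psi_def by simp
    qed
    also have "\<dots> = \<sigma> (cub u) :* \<sigma> (cub u) :- \<guillemotleft>3\<guillemotright>\<^bsub>L\<^esub> :* ?U :* \<sigma> (cub u) :* ?W
        :+ (\<guillemotleft>3\<guillemotright>\<^bsub>L\<^esub> :* ?U :* ?U :+ \<sigma> a) :* ?W :* ?W :- ?W :* ?W :* ?W"
      by (rule L.cubic_quadratic_resultant[OF _ _ _ _ _ _ _ _ _ a_eq b_eq V t_eq])
         (use c F in \<open>auto simp: Lcub_def\<close>)
    also have "\<dots> = \<sigma> (res2 u w)"
      using c by (simp add: res2_def a_minus_def S.hom_of_integer)
    finally show ?thesis using c by (simp add: chi_def qc_\<sigma> res2_def)
  qed
  then have "(\<Sum>x\<in>carrier R \<times> carrier R. chi (?g x)) = (\<Sum>x\<in>carrier R \<times> carrier R. quad (res2 (fst x) (snd x)))"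
    by (intro sum.cong) auto
  also have "\<dots> = (\<Sum>u\<in>carrier R. \<Sum>w\<in>carrier R. quad (res2 u w))"
    by (simp add: sum.cartesian_product case_prod_unfold)
  finally have "(\<Sum>x\<in>carrier R \<times> carrier R. chi (?g x)) = (\<Sum>u\<in>carrier R. \<Sum>w\<in>carrier R. quad (res2 u w))" .
  then show ?thesis using sum.reindex[OF inj, of chi] sum_quad_res2 by (simp add: img)
qed

end

section \<open>Residue fields and Frobenius orbits of irreducible polynomials\<close>

lemma geometric_sum_nat: "(\<Sum>i<d. (q::nat) ^ i) * (q - 1) = q ^ d - 1"
proof (cases "q = 0")
  case False
  have "(\<Sum>i<d. q ^ i) * (q - 1) + 1 = q ^ d"
  proof (induction d)
    case (Suc d)
    obtain m where m: "q = Suc m" using False by (cases q) auto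
    show ?case using Suc unfolding m by (simp add: algebra_simps)
  qed simp
  then show ?thesis by simp
qed (cases d; simp add: lessThan_Suc_eq_insert_0 sum.reindex)

context curve_split
begin

text \<open>The image of evaluation at a root is a copy of the polynomials modulo \<open>P\<close>.
  The remainders count it, and being a finite domain it is a field.\<close>

lemma residue_field:
  assumes P: "P \<in> MIrr" and th: "\<theta> \<in> carrier L" "ev \<theta> P = zL"
  defines "K \<equiv> L\<lparr>carrier := ev \<theta> ` kX\<rparr>"
  shows "bij_betw (ev \<theta>) (red (degree P)) (carrier K)" "odd_finite_field K" "order K = q ^ degree P"
    and "subring (carrier K) L"
proof -
  let ?A = "poly_ring R"
  let ?d = "degree P"
  interpret E: ring_hom_ring ?A L "ev \<theta>" by (rule ev_hom[OF th(1)])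
  have Pm: "P \<in> mons ?d" using MIrrD(1)[OF P] by (simp add: mons_def)
  have eqv: "ev \<theta> p = ev \<theta> p' \<longleftrightarrow> P .| (p .- p')" if p: "p \<in> carrier ?A" "p' \<in> carrier ?A" for p p'
  proof -
    have "ev \<theta> (p .- p') = ev \<theta> p :- ev \<theta> p'" using p by (simp add: a_minus_def)
    then show ?thesis using ev_zero_iff[OF P th, of "p .- p'"] p by (simp add: E.hom_closed)
  qed
  show bij: "bij_betw (ev \<theta>) (red ?d) (carrier K)"
  proof (rule bij_betw_imageI)
    show "inj_on (ev \<theta>) (red ?d)"
    proof (rule inj_onI)
      fix p p' assume p: "p \<in> red ?d" "p' \<in> red ?d" "ev \<theta> p = ev \<theta> p'"
      then have "P .| (p .- p')" using eqv red_carrier by blast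
      then show "p = p'" by (rule red_unique[OF Pm p(1,2)])
    qed
    show "ev \<theta> ` red ?d = carrier K"
    proof (intro equalityI subsetI)
      fix x assume "x \<in> carrier K"
      then obtain p where p: "p \<in> carrier ?A" "x = ev \<theta> p" by (auto simp: K_def)
      obtain p' where "p' \<in> red ?d" "P .| (p .- p')" using red_exists[OF Pm p(1)] by blast
      then show "x \<in> ev \<theta> ` red ?d" using eqv[OF p(1)] p(2) red_carrier by blast
    qed (use red_carrier in \<open>auto simp: K_def\<close>)
  qed
  have card: "finite (carrier K)" "card (carrier K) = q ^ ?d"
    using bij_betw_same_card[OF bij] bij_betw_finite[OF bij] card_red[OF finite_carrier] by auto
  then show "order K = q ^ ?d" by (simp add: order_def)
  show sub: "subring (carrier K) L" using E.img_carrier_is_subring by (simp add: K_def)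
  have "domain K" using L.subring_is_domain[OF sub] by (simp add: K_def)
  then interpret K: domain K .
  have "field K" using K.finite_domain_is_field card by simp
  moreover have "\<one>\<^bsub>K\<^esub> \<oplus>\<^bsub>K\<^esub> \<one>\<^bsub>K\<^esub> \<noteq> \<zero>\<^bsub>K\<^esub>"
    using \<sigma>_nonzero[of "\<one> \<oplus> \<one>"] two_nonzero by (simp add: K_def)
  ultimately show "odd_finite_field K"
    using card by (simp add: odd_finite_field_def odd_finite_field_axioms_def)
qed

text \<open>If two conjugates with exponents below the degree coincided, then, Frobenius being
  injective, \<open>\<theta>\<close> would be fixed by a power \<open>q^e\<close> with
  \<open>e\<close> smaller than the degree. The whole residue field would then be fixed, which has
  too many elements. So the orbit supplies all roots of \<open>P\<close>.\<close>

lemma frobenius_orbit: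
  assumes P: "P \<in> MIrr" and th: "\<theta> \<in> carrier L" "ev \<theta> P = zL"
  defines "orb \<equiv> \<lambda>i::nat. \<theta> :^ (q ^ i)"
  shows "inj_on orb {..<degree P}" "\<And>i. ev (orb i) P = zL" "\<And>i. orb i \<in> carrier L"
    and "\<And>T. T \<in> carrier L \<Longrightarrow> ev T P = (\<Otimes>\<^bsub>L\<^esub>i\<in>{..<degree P}. T :- orb i)"
    and "\<theta> :^ (q ^ degree P) = \<theta>"
proof -
  let ?d = "degree P"
  let ?K = "L\<lparr>carrier := ev \<theta> ` kX\<rparr>"
  note PD = MIrrD[OF P]
  note Ps = poly_set_carrier[OF PD(2)]
  note res = residue_field[OF P th]
  interpret K: odd_finite_field ?K by (rule res(2))
  show oc: "orb i \<in> carrier L" for i using th by (simp add: orb_def)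
  show root: "ev (orb i) P = zL" for i
    using frob_ev_pow[OF th(1) Ps, of i] th q_gt_1 by (simp add: orb_def L.nat_pow_zero)
  have "ev \<theta> [\<one>, \<zero>] = \<theta>" using th by (simp add: ev_def)
  then have "\<theta> \<in> carrier ?K" using image_eqI[of \<theta> "ev \<theta>" "[\<one>, \<zero>]" "kX"] by (simp add: poly_carrier_iff)
  then have "\<theta> [^]\<^bsub>?K\<^esub> order ?K = \<theta>" using K.pow_order[OF K.finite_carrier] by blast
  then show "\<theta> :^ (q ^ ?d) = \<theta>" using res(3) by (simp add: nat_pow_def)
  show inj: "inj_on orb {..<?d}"
  proof -
    have "False" if ij: "i < j" "j < ?d" "orb i = orb j" for i j
    proof -
      let ?e = "j - i"
      have "(\<theta> :^ (q ^ ?e)) :^ (q ^ i) = \<theta> :^ (q ^ i)"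
        using ij th by (simp add: orb_def L.nat_pow_pow flip: power_add)
      then have fx: "\<theta> :^ (q ^ ?e) = \<theta>" using frob_pow_inj[of "\<theta> :^ (q ^ ?e)" \<theta> i] th by simp
      have "carrier ?K \<subseteq> {u \<in> carrier L. u :^ (q ^ ?e) = u}"
      proof
        fix u assume "u \<in> carrier ?K"
        then obtain p where p: "p \<in> kX" "u = ev \<theta> p" by auto
        show "u \<in> {u \<in> carrier L. u :^ (q ^ ?e) = u}"
          using frob_ev_pow[OF th(1) poly_set_carrier[OF p(1)], of ?e] ev_closed[OF th(1) poly_set_carrier[OF p(1)]] fx p by simp
      qed
      then have "card (carrier ?K) \<le> q ^ ?e"
        using card_frob_fixed[of ?e] ij card_mono[of "{u \<in> carrier L. u :^ (q ^ ?e) = u}" "carrier ?K"] by simp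
      then have "q ^ ?d \<le> q ^ ?e" using res(3) by (simp add: order_def)
      then show False using ij q_gt_1 power_le_imp_le_exp[of q ?d ?e] by simp
    qed
    then show ?thesis by (auto simp: inj_on_def) (metis linorder_neqE_nat)
  qed
  fix T assume T: "T \<in> carrier L"
  have Pm: "map \<sigma> P \<in> L.Mon" using MonD[OF PD(1)] Ps by (auto simp: L.Mon_def L.poly_carrier_iff hd_map)
  have "L.eval (map \<sigma> P) T = (\<Otimes>\<^bsub>L\<^esub>x\<in>orb ` {..<?d}. T :- x)"
    by (rule L.eval_eq_prod_roots[OF Pm _ _ _ _ T]) (use card_image[OF inj] root oc in \<open>auto simp: ev_def\<close>)
  also have "\<dots> = (\<Otimes>\<^bsub>L\<^esub>i\<in>{..<?d}. T :- orb i)"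
    by (rule L.finprod_reindex[OF _ inj]) (use oc T in auto)
  finally show "ev T P = (\<Otimes>\<^bsub>L\<^esub>i\<in>{..<?d}. T :- orb i)" by (simp add: ev_def)
qed

text \<open>\<open>P\<close> is factored over its Frobenius orbit, and the product over the three
  roots of the cubic is exchanged with the one over the orbit. The resulting sign cancels the one in
  \<open>psi\<close>, and the cubic takes conjugate values at conjugate points.\<close>

lemma psi_irreducible:
  assumes P: "P \<in> MIrr" and th: "\<theta> \<in> carrier L" "ev \<theta> P = zL"
  shows "psi P = Lcub \<theta> :^ (\<Sum>i<degree P. q ^ i)"
proof -
  let ?d = "degree P"
  define orb where "orb = (\<lambda>i::nat. \<theta> :^ (q ^ i))"
  note fo0 = frobenius_orbit[OF P th]
  have fo3: "orb i \<in> carrier L" for i unfolding orb_def by (rule fo0(3))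
  have fo4: "ev T P = (\<Otimes>\<^bsub>L\<^esub>i\<in>{..<degree P}. T :- orb i)" if "T \<in> carrier L" for T
    unfolding orb_def by (rule fo0(4)[OF that])
  define m1 where "m1 = :~ oL"
  have m1: "m1 \<in> carrier L" "m1 :* m1 = oL" by (auto simp: m1_def L.l_minus L.r_minus)
  have Lc: "Lcub (orb i) \<in> carrier L" for i using fo3[of i] by (simp add: Lcub_def)
  have flip: "(r :- z) :* (s :- z) :* (t :- z) = m1 :* Lcub z" if z: "z \<in> carrier L" for z
  proof -
    have c: "r \<in> carrier L" "s \<in> carrier L" "t \<in> carrier L" by simp_all
    show ?thesis unfolding Lcub_split[OF z] m1_def by (rule L.triple_flip[OF c z])
  qed
  have "ev r P :* ev s P :* ev t P
      = (\<Otimes>\<^bsub>L\<^esub>i\<in>{..<?d}. (r :- orb i) :* (s :- orb i) :* (t :- orb i))"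
    using fo3 by (simp add: fo4 L.finprod_multf Pi_iff)
  also have "\<dots> = (\<Otimes>\<^bsub>L\<^esub>i\<in>{..<?d}. m1 :* Lcub (orb i))"
    by (rule L.finprod_cong') (use fo3 Lc m1 flip in auto)
  also have "\<dots> = m1 :^ ?d :* (\<Otimes>\<^bsub>L\<^esub>i\<in>{..<?d}. Lcub (orb i))"
    using m1 Lc by (subst L.finprod_multf) (auto simp: L.finprod_const)
  finally have "psi P = m1 :^ ?d :* (m1 :^ ?d :* (\<Otimes>\<^bsub>L\<^esub>i\<in>{..<?d}. Lcub (orb i)))"
    unfolding psi_def m1_def by simp
  also have "\<dots> = (m1 :* m1) :^ ?d :* (\<Otimes>\<^bsub>L\<^esub>i\<in>{..<?d}. Lcub (orb i))"
    using m1(1) Lc by (subst L.nat_pow_distrib) (auto simp: L.m_assoc L.finprod_closed)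
  also have "\<dots> = (\<Otimes>\<^bsub>L\<^esub>i\<in>{..<?d}. Lcub (orb i))" using m1 Lc by (simp add: L.finprod_closed Pi_iff)
  also have "\<dots> = (\<Otimes>\<^bsub>L\<^esub>i\<in>{..<?d}. Lcub \<theta> :^ (q ^ i))"
  proof (rule L.finprod_cong')
    show "Lcub (orb i) = Lcub \<theta> :^ (q ^ i)" for i
      using frob_ev_pow[OF th(1) F0_set, of i] ev_F0[OF th(1)] ev_F0[OF fo3[of i]] by (simp add: orb_def)
  qed (use th in \<open>auto simp: Lcub_def\<close>)
  also have "\<dots> = Lcub \<theta> :^ (\<Sum>i<?d. q ^ i)"
  proof -
    have u: "Lcub \<theta> \<in> carrier L" using th by (simp add: Lcub_def)
    have "(\<Otimes>\<^bsub>L\<^esub>i\<in>{..<n}. Lcub \<theta> :^ (q ^ i)) = Lcub \<theta> :^ (\<Sum>i<n. q ^ i)" for n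
    proof (induction n)
      case (Suc n)
      have "(\<Otimes>\<^bsub>L\<^esub>i\<in>{..<Suc n}. Lcub \<theta> :^ (q ^ i)) = Lcub \<theta> :^ (q ^ n) :* (\<Otimes>\<^bsub>L\<^esub>i\<in>{..<n}. Lcub \<theta> :^ (q ^ i))"
        unfolding lessThan_Suc using u by (intro L.finprod_insert) auto
      then show ?case using Suc u by (simp add: L.nat_pow_mult add.commute)
    qed simp
    then show ?thesis .
  qed
  finally show ?thesis .
qed

text \<open>Square roots modulo \<open>P\<close> are square roots of \<open>Lcub \<theta>\<close> in
  the residue field. Euler's criterion there has the exponent \<open>K.hq = N hq\<close>, where
  \<open>N\<close> is the norm exponent of \<open>psi_irreducible\<close>.\<close>

lemma card_sqrt_mod_irreducible:
  assumes P: "P \<in> MIrr"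
  shows "real (card {p \<in> red (degree P). P .| (p .* p .- F0)}) = 1 + chi P"
proof -
  let ?A = "poly_ring R"
  let ?d = "degree P"
  obtain \<theta> where th: "\<theta> \<in> carrier L" "ev \<theta> P = zL" using MIrr_root[OF P] by blast
  let ?K = "L\<lparr>carrier := ev \<theta> ` kX\<rparr>"
  note PD = MIrrD[OF P]
  note res = residue_field[OF P th]
  interpret E: ring_hom_ring ?A L "ev \<theta>" by (rule ev_hom[OF th(1)])
  interpret K: odd_finite_field ?K by (rule res(2))
  let ?u = "Lcub \<theta>"
  have u1: "?u = ev \<theta> F0" using ev_F0[OF th(1)] by simp
  have u: "?u = ev \<theta> F0" "?u \<in> carrier ?K" "?u \<in> carrier L" unfolding u1 using F0_carrier by simp_all
  have "bij_betw (ev \<theta>) {p \<in> red ?d. P .| (p .* p .- F0)} {y \<in> carrier ?K. y \<otimes>\<^bsub>?K\<^esub> y = ?u}"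
  proof (rule bij_betw_Collect[OF res(1)])
    fix p assume "p \<in> red ?d"
    then have p: "p \<in> carrier ?A" by (rule red_carrier)
    have "ev \<theta> (p .* p .- F0) = ev \<theta> p :* ev \<theta> p :- ?u"
      using p u F0_carrier by (simp add: a_minus_def del: F0_carrier)
    then show "ev \<theta> p \<otimes>\<^bsub>?K\<^esub> ev \<theta> p = ?u \<longleftrightarrow> P .| (p .* p .- F0)"
      using ev_zero_iff[OF P th, of "p .* p .- F0"] p u by simp
  qed
  then have "card {p \<in> red ?d. P .| (p .* p .- F0)} = card {y \<in> carrier ?K. y \<otimes>\<^bsub>?K\<^esub> y = ?u}"
    by (rule bij_betw_same_card)
  also have "real \<dots> = 1 + qc ?K K.hq ?u" by (rule K.card_sqrt[OF u(2)])
  also have "qc ?K K.hq ?u = chi P"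
  proof -
    define N where "N = (\<Sum>i<?d. q ^ i)"
    have hqK: "2 * K.hq = q ^ ?d - 1" using K.order_eq res(3) by simp
    have "N * (2 * hq) = q ^ ?d - 1" unfolding N_def using geometric_sum_nat[of q ?d] order_eq by simp
    then have e: "N * hq = K.hq" using hqK by simp
    have "q ^ 0 \<le> N" unfolding N_def by (rule member_le_sum) (use PD(3) in auto)
    then have N0: "N \<noteq> 0" by simp
    have "?u [^]\<^bsub>?K\<^esub> K.hq = (?u :^ N) :^ hq"
      using u(3) by (simp add: L.nat_pow_pow e) (simp add: nat_pow_def)
    moreover have "?u :^ N = zL \<longleftrightarrow> ?u = zL"
      using N0 u(3) by (auto simp: L.nat_pow_zero L.nat_pow_eq_0_iff)
    ultimately show ?thesis
      unfolding chi_def psi_irreducible[OF P th] N_def [symmetric] by (simp add: qc_def)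
  qed
  finally show ?thesis .
qed

text \<open>Each irreducible polynomial of degree \<open>n\<close> brings \<open>n\<close> roots of
  its own, and all of them are among the at most \<open>q^n\<close> fixed points of the
  \<open>q^n\<close>-th power map.\<close>

lemma card_MIrr_degree:
  assumes "n > 0" shows "card {P \<in> MIrr. degree P = n} * n \<le> q ^ n"
proof -
  let ?I = "{P \<in> MIrr. degree P = n}"
  let ?Z = "\<lambda>P. {x \<in> carrier L. ev x P = zL}"
  let ?U = "{u \<in> carrier L. u :^ (q ^ n) = u}"
  have finI: "finite ?I"
    by (rule finite_subset[OF _ finite_mons[OF finite_carrier, of n]]) (auto simp: mons_def MIrr_def)
  have sub: "?Z P \<subseteq> ?U" if "P \<in> ?I" for P
    using that frobenius_orbit(5)[of P] by auto
  have finZ: "finite (?Z P)" if "P \<in> ?I" for P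
    using finite_subset[OF sub[OF that] card_frob_fixed(1)[OF assms]] .
  have card: "n \<le> card (?Z P)" if PI: "P \<in> ?I" for P
  proof -
    have P: "P \<in> MIrr" "degree P = n" using PI by auto
    obtain \<theta> where th: "\<theta> \<in> carrier L" "ev \<theta> P = zL" using MIrr_root[OF P(1)] by blast
    note fo = frobenius_orbit[OF P(1) th]
    have "card ((\<lambda>i::nat. \<theta> :^ (q ^ i)) ` {..<n}) = n" using card_image[OF fo(1)] P(2) by simp
    moreover have "(\<lambda>i::nat. \<theta> :^ (q ^ i)) ` {..<n} \<subseteq> ?Z P" using fo(2,3) by auto
    ultimately show ?thesis using card_mono[OF finZ[OF PI], of "(\<lambda>i::nat. \<theta> :^ (q ^ i)) ` {..<n}"] by simp
  qed
  have disj: "?Z P \<inter> ?Z Q = {}" if "P \<in> ?I" "Q \<in> ?I" "P \<noteq> Q" for P Q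
  proof -
    have "P = Q" if x: "x \<in> ?Z P" "x \<in> ?Z Q" for x
    proof (rule MIrr_divides_eq)
      show "P .| Q"
        using ev_zero_iff[of P x Q] x \<open>P \<in> ?I\<close> \<open>Q \<in> ?I\<close> MIrrD(2)[of Q] by auto
    qed (use \<open>P \<in> ?I\<close> \<open>Q \<in> ?I\<close> in auto)
    then show ?thesis using that by blast
  qed
  have "card ?I * n = (\<Sum>P\<in>?I. n)" by simp
  also have "\<dots> \<le> (\<Sum>P\<in>?I. card (?Z P))" by (rule sum_mono) (rule card)
  also have "\<dots> = card (\<Union>P\<in>?I. ?Z P)"
    by (rule card_UN_disjoint [symmetric]) (use finI finZ disj in auto)
  also have "\<dots> \<le> card ?U" by (rule card_mono[OF card_frob_fixed(1)[OF assms]]) (use sub in blast)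
  also have "\<dots> \<le> q ^ n" by (rule card_frob_fixed(2)[OF assms])
  finally show ?thesis .
qed

end

context curve_closure
begin

lemma exists_split: "\<exists>r s t. curve_split R a b L \<sigma> r s t"
proof -
  have ac: "\<sigma> a \<in> carrier L" "\<sigma> b \<in> carrier L" by simp_all
  have "[oL, zL, \<sigma> a, \<sigma> b] \<in> carrier (poly_ring L)" by (auto simp: L.poly_carrier_iff)
  then obtain r where r: "r \<in> carrier L" "L.eval [oL, zL, \<sigma> a, \<sigma> b] r = zL"
    using alg_closed[of "[oL, zL, \<sigma> a, \<sigma> b]"] by auto
  \<comment> \<open>This quadratic is the cofactor of \<open>X - r\<close> in the cubic; a root of
    it is the second root of the cubic.\<close>
  have "[oL, r, r :* r :+ \<sigma> a] \<in> carrier (poly_ring L)" using r by (auto simp: L.poly_carrier_iff)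
  then obtain s where s: "s \<in> carrier L" "L.eval [oL, r, r :* r :+ \<sigma> a] s = zL"
    using alg_closed[of "[oL, r, r :* r :+ \<sigma> a]"] by auto
  define A B where "A = \<sigma> a" and "B = \<sigma> b"
  have AB: "A \<in> carrier L" "B \<in> carrier L" using ac by (auto simp: A_def B_def)
  have rc: "r \<in> carrier L" and sc: "s \<in> carrier L" using r s by auto
  have e1: "r :* r :* r :+ (A :* r :+ B) = zL" using r by (simp add: A_def B_def)
  have e2: "s :* s :+ (r :* s :+ (r :* r :+ A)) = zL" using s rc by (simp add: A_def)
  have aeq: "A = :~ (r :* r :+ r :* s :+ s :* s)"
  proof (rule L.eqI_diff)
    have "A :- :~ (r :* r :+ r :* s :+ s :* s) = s :* s :+ (r :* s :+ (r :* r :+ A))"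
      by (rule L.eqI_diff, use AB rc sc in algebra) (use AB rc sc in auto)
    then show "A :- :~ (r :* r :+ r :* s :+ s :* s) = zL" using e2 by simp
  qed (use AB rc sc in auto)
  have beq: "B = r :* s :* (r :+ s)"
  proof (rule L.eqI_diff)
    have "B :- r :* s :* (r :+ s) = r :* r :* r :+ (A :* r :+ B)"
      unfolding aeq by (rule L.eqI_diff, use AB rc sc in algebra) (use AB rc sc in auto)
    then show "B :- r :* s :* (r :+ s) = zL" using e1 by simp
  qed (use AB rc sc in auto)
  define t where "t = :~ (r :+ s)"
  have tc: "t \<in> carrier L" using rc sc by (simp add: t_def)
  have "\<sigma> (\<guillemotleft>4\<guillemotright> \<otimes> a [^] (3::nat) \<oplus> \<guillemotleft>27\<guillemotright> \<otimes> b [^] (2::nat)) \<noteq> zL" by (rule \<sigma>_nonzero) (use disc in auto)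
  then have "\<guillemotleft>4\<guillemotright>\<^bsub>L\<^esub> :* A :^ (3::nat) :+ \<guillemotleft>27\<guillemotright>\<^bsub>L\<^esub> :* B :^ (2::nat) \<noteq> zL"
    by (simp add: S.hom_of_integer S.hom_nat_pow A_def B_def)
  then have nz: "(r :- s) :* (\<guillemotleft>2\<guillemotright>\<^bsub>L\<^esub> :* r :+ s) :* (r :+ \<guillemotleft>2\<guillemotright>\<^bsub>L\<^esub> :* s) \<noteq> zL"
    using L.cubic_disc_identity[OF rc sc AB aeq beq] by (auto simp: L.nat_pow_zero)
  have "r \<noteq> s"
  proof
    assume "r = s"
    then show False using nz rc sc by (simp add: a_minus_def L.r_neg)
  qed
  moreover have "r \<noteq> t"
  proof
    assume rt: "r = t"
    have "\<guillemotleft>2\<guillemotright>\<^bsub>L\<^esub> :* r :+ s = r :- t" unfolding t_def L.of_int_2 by (rule L.eqI_diff, use rc sc in algebra) (use rc sc in auto)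
    also have "\<dots> = zL" using rt tc by (simp add: a_minus_def L.r_neg)
    finally show False using nz rc sc by simp
  qed
  moreover have "s \<noteq> t"
  proof
    assume st: "s = t"
    have "r :+ \<guillemotleft>2\<guillemotright>\<^bsub>L\<^esub> :* s = s :- t" unfolding t_def L.of_int_2 by (rule L.eqI_diff, use rc sc in algebra) (use rc sc in auto)
    also have "\<dots> = zL" using st tc by (simp add: a_minus_def L.r_neg)
    finally show False using nz rc sc by simp
  qed
  ultimately have "curve_split R a b L \<sigma> r s t"
    using rc sc tc aeq beq
    by (intro curve_split.intro curve_closure_axioms curve_split_axioms.intro) (auto simp: A_def B_def t_def)
  then show ?thesis by blast
qed

end

context curve_field
begin

text \<open>The existential form hides the algebraic closure and the roots chosen in it. Only the
  values of the character on polynomials over the small field are used later.\<close>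

theorem exists_quadratic_character:
  "\<exists>\<chi> :: 'a list \<Rightarrow> real. \<chi> [\<one>] = 1
     \<and> (\<forall>g\<in>Mon. \<forall>h\<in>Mon. \<chi> (g .* h) = \<chi> g * \<chi> h)
     \<and> (\<forall>P\<in>MIrr. real (card {p \<in> red (degree P).
           P .| (p .* p .- [\<one>, \<zero>, a, b])}) = 1 + \<chi> P)
     \<and> (\<Sum>g\<in>mons 1. \<chi> g) = (\<Sum>x\<in>carrier R. quad (cub x))
     \<and> (\<Sum>g\<in>mons 2. \<chi> g) = real (order R)
     \<and> (\<forall>n\<ge>3. (\<Sum>g\<in>mons n. \<chi> g) = 0)
     \<and> (\<forall>g. \<chi> g \<in> {-1, 0, 1})"
  and card_MIrr: "n > 0 \<Longrightarrow> card {P \<in> MIrr. degree P = n} * n \<le> order R ^ n"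
proof -
  interpret C: algebraic_closure alg_closure "indexed_const ` carrier R" by (rule alg_closureE(1))
  have closed: "\<exists>x\<in>carrier alg_closure. C.eval p x = \<zero>\<^bsub>alg_closure\<^esub>"
    if p: "p \<in> carrier (poly_ring alg_closure)" "degree p > 0" for p
  proof -
    have "size (C.roots p) > 0" using C.roots_over_carrier[OF p(1)] p(2) by (simp add: C.splitted_def)
    then obtain x where "x \<in># C.roots p" by (metis nonempty_has_size multiset_nonemptyE)
    then show ?thesis using C.roots_mem_iff_is_root[OF p(1)] by (auto simp: C.is_root_def)
  qed
  interpret CC: curve_closure R a b alg_closure indexed_const
    by (intro curve_closure.intro curve_field_axioms poly_eval_hom.intro poly_eval_hom_axioms.intro field_polys_axioms curve_closure_axioms.intro field_polys.intro C.field_axioms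
         alg_closureE(2) closed)
  obtain r s t where "curve_split R a b alg_closure indexed_const r s t" using CC.exists_split by blast
  then interpret CS: curve_split R a b alg_closure indexed_const r s t .
  show "n > 0 \<Longrightarrow> card {P \<in> MIrr. degree P = n} * n \<le> order R ^ n" by (rule CS.card_MIrr_degree)
  show "\<exists>\<chi> :: 'a list \<Rightarrow> real. \<chi> [\<one>] = 1
     \<and> (\<forall>g\<in>Mon. \<forall>h\<in>Mon. \<chi> (g .* h) = \<chi> g * \<chi> h)
     \<and> (\<forall>P\<in>MIrr. real (card {p \<in> red (degree P).
           P .| (p .* p .- [\<one>, \<zero>, a, b])}) = 1 + \<chi> P)
     \<and> (\<Sum>g\<in>mons 1. \<chi> g) = (\<Sum>x\<in>carrier R. quad (cub x))
     \<and> (\<Sum>g\<in>mons 2. \<chi> g) = real (order R)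
     \<and> (\<forall>n\<ge>3. (\<Sum>g\<in>mons n. \<chi> g) = 0)
     \<and> (\<forall>g. \<chi> g \<in> {-1, 0, 1})"
    by (intro exI[of _ CS.chi] conjI ballI allI impI CS.chi_one CS.chi_mult CS.sum_chi_1 CS.sum_chi_2 CS.sum_chi_ge_3 CS.chi_range
         CS.card_sqrt_mod_irreducible[unfolded CS.F0_def])
qed

end

section \<open>Valuation rings and places\<close>

context field
begin

text \<open>Zero is listed separately because the value of \<open>inv\<close> at
  \<open>\<zero>\<close> is unspecified.\<close>

definition nonunits :: "'a set \<Rightarrow> 'a set" where
  "nonunits V = {z \<in> V. z = \<zero> \<or> inv z \<notin> V}"

lemma valuation_ringD:
  assumes "valuation_ring R C V"
  shows "subring V R" "C \<subseteq> V" "V \<subseteq> carrier R" "V \<noteq> carrier R"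
    and "\<And>z. z \<in> carrier R \<Longrightarrow> z \<noteq> \<zero> \<Longrightarrow> z \<in> V \<or> inv z \<in> V"
  using assms unfolding valuation_ring_def by auto

text \<open>Of two nonzero elements \<open>z\<close> and \<open>w\<close> one divides the other in a
  valuation ring. Their sum is thus a multiple of one of them, and multiples of nonunits are
  nonunits.\<close>

lemma nonunits_ideal:
  assumes V: "valuation_ring R C V"
  shows "ideal (nonunits V) (R\<lparr>carrier := V\<rparr>)" "\<one> \<notin> nonunits V"
proof -
  note VD = valuation_ringD[OF V]
  note sb = subringE[OF VD(1)]
  have mult: "v \<otimes> z \<in> nonunits V" if v: "v \<in> V" and z: "z \<in> nonunits V" for v z
  proof -
    have zV: "z \<in> V" and z': "z = \<zero> \<or> inv z \<notin> V" using z by (auto simp: nonunits_def)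
    have c: "v \<in> carrier R" "z \<in> carrier R" using v zV VD(3) by auto
    show ?thesis
    proof (cases "v \<otimes> z = \<zero>")
      case True
      then show ?thesis using sb(2) by (simp add: nonunits_def)
    next
      case False
      then have nz: "v \<noteq> \<zero>" "z \<noteq> \<zero>" using c by auto
      have "inv z = v \<otimes> inv (v \<otimes> z)"
        using c nz by (simp add: nonzero_inverse_mult_distrib m_lcomm[of v])
      then have "inv (v \<otimes> z) \<notin> V" using z' nz v sb(6) by auto
      then show ?thesis using sb(6) v zV by (simp add: nonunits_def)
    qed
  qed
  have add: "z \<oplus> w \<in> nonunits V" if zw: "z \<in> nonunits V" "w \<in> nonunits V" for z w
  proof -
    have wl: "z \<oplus> w \<in> nonunits V" if zw: "z \<in> nonunits V" "w \<in> nonunits V" "w \<noteq> \<zero>" "z \<otimes> inv w \<in> V" for z w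
    proof -
      have c: "z \<in> carrier R" "w \<in> carrier R" using zw VD(3) by (auto simp: nonunits_def)
      have "z \<oplus> w = (z \<otimes> inv w \<oplus> \<one>) \<otimes> w" using c zw(3) by (simp add: l_distr m_assoc)
      moreover have "z \<otimes> inv w \<oplus> \<one> \<in> V" using zw(4) sb(3,7) by auto
      ultimately show ?thesis using mult zw(2) by simp
    qed
    have c: "z \<in> carrier R" "w \<in> carrier R" using zw VD(3) by (auto simp: nonunits_def)
    show ?thesis
    proof (cases "z = \<zero> \<or> w = \<zero>")
      case True
      then show ?thesis using zw c by auto
    next
      case False
      have "inv (z \<otimes> inv w) = w \<otimes> inv z"
        using False c by (simp add: nonzero_inverse_mult_distrib nonzero_imp_inverse_nonzero nonzero_inverse_inverse_eq m_comm)
      moreover have "z \<otimes> inv w \<noteq> \<zero>" using False c nonzero_imp_inverse_nonzero integral[of z "inv w"] by auto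
      ultimately have "z \<otimes> inv w \<in> V \<or> w \<otimes> inv z \<in> V" using VD(5)[of "z \<otimes> inv w"] False c by auto
      then show ?thesis using wl[OF zw] wl[OF zw(2,1)] False c by (auto simp: a_comm)
    qed
  qed
  have ring: "ring (R\<lparr>carrier := V\<rparr>)" using subring_is_ring[OF VD(1)] .
  show "\<one> \<notin> nonunits V" using sb(3) by (auto simp: nonunits_def)
  have neg: "\<ominus> z \<in> nonunits V" if "z \<in> nonunits V" for z
    using mult[of "\<ominus> \<one>" z] that sb(3,5) VD(3) by (auto simp: nonunits_def l_minus)
  interpret Vr: ring "R\<lparr>carrier := V\<rparr>" by (rule ring)
  have ainv: "\<ominus>\<^bsub>R\<lparr>carrier := V\<rparr>\<^esub> z = \<ominus> z" if "z \<in> V" for z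
    using that VD(3) sb(5) by (intro Vr.minus_equality) (auto simp: l_neg)
  show "ideal (nonunits V) (R\<lparr>carrier := V\<rparr>)"
  proof (rule idealI[OF ring])
    show "subgroup (nonunits V) (add_monoid (R\<lparr>carrier := V\<rparr>))"
    proof (rule Vr.add.subgroupI)
      show "nonunits V \<subseteq> carrier (R\<lparr>carrier := V\<rparr>)" by (auto simp: nonunits_def)
      show "nonunits V \<noteq> {}" using sb(2) by (auto simp: nonunits_def)
      fix z assume z: "z \<in> nonunits V"
      then have "z \<in> V" by (simp add: nonunits_def)
      then show "\<ominus>\<^bsub>R\<lparr>carrier := V\<rparr>\<^esub> z \<in> nonunits V" using ainv neg z by simp
    next
      fix z w assume "z \<in> nonunits V" "w \<in> nonunits V"
      then show "z \<oplus>\<^bsub>R\<lparr>carrier := V\<rparr>\<^esub> w \<in> nonunits V" using add by simp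
    qed
    fix z x assume zx: "z \<in> nonunits V" "x \<in> carrier (R\<lparr>carrier := V\<rparr>)"
    then show "x \<otimes>\<^bsub>R\<lparr>carrier := V\<rparr>\<^esub> z \<in> nonunits V" using mult by simp
    have "z \<in> carrier R" "x \<in> carrier R" using zx VD(3) by (auto simp: nonunits_def)
    then show "z \<otimes>\<^bsub>R\<lparr>carrier := V\<rparr>\<^esub> x \<in> nonunits V" using mult zx m_comm by simp
  qed
qed

text \<open>A proper ideal contains no unit, so every proper ideal lies inside the ideal of
  nonunits.\<close>

lemma maximalideal_iff_nonunits:
  assumes V: "valuation_ring R C V"
  shows "maximalideal P (R\<lparr>carrier := V\<rparr>) \<longleftrightarrow> P = nonunits V"
proof -
  note VD = valuation_ringD[OF V]
  note N = nonunits_ideal[OF V]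
  have sub: "J \<subseteq> nonunits V" if J: "ideal J (R\<lparr>carrier := V\<rparr>)" "J \<noteq> V" for J
  proof
    fix z assume z: "z \<in> J"
    interpret J: ideal J "R\<lparr>carrier := V\<rparr>" by fact
    have JV: "J \<subseteq> V" using J.a_subset by simp
    have "inv z \<notin> V" if "z \<noteq> \<zero>"
    proof
      assume i: "inv z \<in> V"
      have "inv z \<otimes> z \<in> J" using J.I_l_closed[of z "inv z"] z i by simp
      moreover have "z \<in> carrier R" using z JV VD(3) by auto
      ultimately have "\<one> \<in> J" using that by simp
      then have "J = V" using J.one_imp_carrier by simp
      then show False using J by simp
    qed
    then show "z \<in> nonunits V" using z JV by (auto simp: nonunits_def)
  qed
  show ?thesis
  proof
    assume "maximalideal P (R\<lparr>carrier := V\<rparr>)"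
    then interpret P: maximalideal P "R\<lparr>carrier := V\<rparr>" .
    have "P \<subseteq> nonunits V" using sub[OF P.ideal_axioms] P.I_notcarr by simp
    moreover have "nonunits V \<subseteq> carrier (R\<lparr>carrier := V\<rparr>)" by (auto simp: nonunits_def)
    ultimately have "nonunits V = P \<or> nonunits V = carrier (R\<lparr>carrier := V\<rparr>)" using P.I_maximal[OF N(1)] by blast
    then show "P = nonunits V" using N(2) subringE(3)[OF VD(1)] by auto
  next
    assume P: "P = nonunits V"
    show "maximalideal P (R\<lparr>carrier := V\<rparr>)" unfolding P
    proof (rule maximalidealI[OF N(1)])
      show "carrier (R\<lparr>carrier := V\<rparr>) \<noteq> nonunits V" using N(2) subringE(3)[OF VD(1)] by auto
      fix J assume "ideal J (R\<lparr>carrier := V\<rparr>)" "nonunits V \<subseteq> J" "J \<subseteq> carrier (R\<lparr>carrier := V\<rparr>)"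
      then show "J = nonunits V \<or> J = carrier (R\<lparr>carrier := V\<rparr>)" using sub by auto
    qed
  qed
qed

text \<open>A place determines its ring: a nonzero \<open>z\<close> belongs to the ring unless its
  inverse is a nonunit. This makes the definite description in \<open>place_ring\<close> meaningful
  and lets places be counted as valuation rings.\<close>

lemma valuation_ring_from_nonunits:
  assumes V: "valuation_ring R C V"
  shows "V = {z \<in> carrier R. z = \<zero> \<or> inv z \<notin> nonunits V}"
proof (intro equalityI subsetI)
  note VD = valuation_ringD[OF V]
  fix z assume z: "z \<in> V"
  then have "z \<in> carrier R" using VD(3) by auto
  then show "z \<in> {z \<in> carrier R. z = \<zero> \<or> inv z \<notin> nonunits V}"
    using z nonzero_imp_inverse_nonzero nonzero_inverse_inverse_eq by (auto simp: nonunits_def)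
next
  note VD = valuation_ringD[OF V]
  fix z assume z: "z \<in> {z \<in> carrier R. z = \<zero> \<or> inv z \<notin> nonunits V}"
  then show "z \<in> V"
    using VD(5)[of z] subringE(2)[OF VD(1)] nonzero_inverse_inverse_eq[of z] by (cases "z = \<zero>") (auto simp: nonunits_def)
qed

lemma nonunits_inj:
  "valuation_ring R C V \<Longrightarrow> valuation_ring R C V' \<Longrightarrow> nonunits V = nonunits V' \<Longrightarrow> V = V'"
  using valuation_ring_from_nonunits[of C V] valuation_ring_from_nonunits[of C V'] by simp

lemma places_eq: "places R C = nonunits ` {V. valuation_ring R C V}"
  unfolding places_def using maximalideal_iff_nonunits by blast

lemma place_ring_nonunits:
  assumes V: "valuation_ring R C V" shows "place_ring R C (nonunits V) = R\<lparr>carrier := V\<rparr>"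
proof -
  have "(THE W. valuation_ring R C W \<and> maximalideal (nonunits V) (R\<lparr>carrier := W\<rparr>)) = V"
  proof (rule the_equality)
    show "valuation_ring R C V \<and> maximalideal (nonunits V) (R\<lparr>carrier := V\<rparr>)"
      using V maximalideal_iff_nonunits[OF V] by simp
    fix W assume "valuation_ring R C W \<and> maximalideal (nonunits V) (R\<lparr>carrier := W\<rparr>)"
    then show "W = V" using nonunits_inj[of C W V] V maximalideal_iff_nonunits[of C W] by metis
  qed
  then show ?thesis by (simp add: place_ring_def)
qed

end

lemma (in ring) card_dimension:
  assumes K: "subfield K R" and d: "dimension n K E" and fin: "finite K"
  shows "finite E \<and> card E = card K ^ n"
  using d K fin
proof (induction n K E rule: dimension.induct)
  case (zero_dim K)
  then show ?case by simp
next
  case (Suc_dim v E n K)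
  note sp = space_subgroup_props[OF Suc_dim.prems(1) Suc_dim.hyps(3)]
  have Kc: "K \<subseteq> carrier R" using subfieldE(3)[OF Suc_dim.prems(1)] .
  have ih: "finite E" "card E = card K ^ n" using Suc_dim.IH Suc_dim.prems by auto
  let ?f = "\<lambda>(k, e). k \<otimes> v \<oplus> e"
  have img: "line_extension K v E = ?f ` (K \<times> E)"
    unfolding set_eq_iff line_extension_mem_iff by (fastforce simp: image_def)
  have "inj_on ?f (K \<times> E)"
  proof (rule inj_onI)
    fix x y assume "x \<in> K \<times> E" "y \<in> K \<times> E" "?f x = ?f y"
    then obtain k e k' e' where xy: "x = (k, e)" "y = (k', e')" and c: "k \<in> K" "e \<in> E" "k' \<in> K" "e' \<in> E"
      and eq: "k \<otimes> v \<oplus> e = k' \<otimes> v \<oplus> e'" by auto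
    have cc: "k \<in> carrier R" "k' \<in> carrier R" "e \<in> carrier R" "e' \<in> carrier R" "v \<in> carrier R"
      using c Kc sp(1) Suc_dim.hyps(1) by auto
    have d: "(k \<ominus> k') \<otimes> v = e' \<ominus> e"
    proof -
      have "(k \<ominus> k') \<otimes> v = (k \<otimes> v \<oplus> e) \<ominus> (k' \<otimes> v \<oplus> e)"
        using cc by (simp add: a_minus_def l_distr l_minus minus_add a_ac r_neg2 r_neg1 r_neg)
      also have "\<dots> = (k' \<otimes> v \<oplus> e') \<ominus> (k' \<otimes> v \<oplus> e)" by (simp only: eq)
      also have "\<dots> = e' \<ominus> e" using cc by (simp add: a_minus_def minus_add a_ac r_neg2 r_neg1 r_neg)
      finally show ?thesis .
    qed
    have "k = k'"
    proof (rule ccontr)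
      assume "k \<noteq> k'"
      then have "k \<ominus> k' \<in> K - {\<zero>}"
        using c cc subringE(5,7)[OF subfieldE(1)[OF Suc_dim.prems(1)]] by (simp add: a_minus_def) (metis a_minus_def r_right_minus_eq)
      moreover have "(k \<ominus> k') \<otimes> v \<in> E" unfolding d using sp c by (simp add: a_minus_def)
      ultimately have "v \<in> E" using sp(6)[of "k \<ominus> k'" v] cc(5) by simp
      then show False using Suc_dim.hyps(2) by simp
    qed
    moreover have "e = e'" by (rule add.l_cancel[OF eq[unfolded calculation]]) (use cc in auto)
    ultimately show "x = y" using xy by simp
  qed
  then have "card (?f ` (K \<times> E)) = card K * card E" by (simp add: card_image card_cartesian_product)
  then show ?case using ih Suc_dim.prems by (simp add: img)
qed

text \<open>Degrees of places are dimensions of residue fields over the constants. Everything being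
  finite, counting residue classes determines them.\<close>

lemma (in ring) dim_by_card:
  assumes K: "subfield K R" and fin: "finite (carrier R)" and card: "card (carrier R) = card K ^ e"
  shows "dim K (carrier R) = e"
proof -
  have finK: "finite K" using fin subfieldE(3)[OF K] finite_subset by blast
  have K2: "card K > 1"
    using subfieldE(6)[OF K] subringE(2,3)[OF subfieldE(1)[OF K]] finK card_mono[of K "{\<zero>, \<one>}"] by auto
  obtain xs where xs: "set xs = carrier R" using finite_list[OF fin] by blast
  have "Span K xs = carrier R"
    using Span_base_incl[OF K, of xs] Span_in_carrier[of K xs] subfieldE(3)[OF K] xs by auto
  then have "finite_dimension K (carrier R)" using Span_finite_dimension[OF K, of xs] xs by simp
  then obtain n where n: "dimension n K (carrier R)" by (auto elim: finite_dimensionE')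
  then have "card K ^ n = card K ^ e" using card_dimension[OF K n finK] card by simp
  then have "n = e" using K2 by (simp add: power_inject_exp)
  then show ?thesis using dimI[OF K n] by (simp add: over_def)
qed

context field
begin

lemma card_residue_field:
  assumes V: "valuation_ring R C V" and T: "T \<subseteq> V"
    and ex: "\<And>z. z \<in> V \<Longrightarrow> \<exists>x\<in>T. z \<ominus> x \<in> nonunits V"
    and un: "\<And>x x'. x \<in> T \<Longrightarrow> x' \<in> T \<Longrightarrow> x \<ominus> x' \<in> nonunits V \<Longrightarrow> x = x'"
  shows "bij_betw (\<lambda>x. nonunits V +>\<^bsub>R\<lparr>carrier := V\<rparr>\<^esub> x) T (carrier (R\<lparr>carrier := V\<rparr> Quot nonunits V))"
proof -
  let ?V = "R\<lparr>carrier := V\<rparr>"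
  note VD = valuation_ringD[OF V]
  interpret I: ideal "nonunits V" ?V by (rule nonunits_ideal(1)[OF V])
  have minus: "z \<ominus>\<^bsub>?V\<^esub> x = z \<ominus> x" if "z \<in> V" "x \<in> V" for z x
  proof -
    have "\<ominus>\<^bsub>?V\<^esub> x = \<ominus> x"
      using that VD(3) subringE(5)[OF VD(1)] by (intro I.minus_equality) (auto simp: l_neg)
    then show ?thesis by (simp add: a_minus_def)
  qed
  have eq: "nonunits V +>\<^bsub>?V\<^esub> z = nonunits V +>\<^bsub>?V\<^esub> x \<longleftrightarrow> z \<ominus> x \<in> nonunits V" if "z \<in> V" "x \<in> V" for z x
    using I.quotient_eq_iff_same_a_r_cos[OF I.ideal_axioms, of z x] that minus[OF that] by simp
  show ?thesis
  proof (rule bij_betw_imageI)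
    show "inj_on (\<lambda>x. nonunits V +>\<^bsub>?V\<^esub> x) T"
    proof (rule inj_onI)
      fix x y assume xy: "x \<in> T" "y \<in> T" "nonunits V +>\<^bsub>?V\<^esub> x = nonunits V +>\<^bsub>?V\<^esub> y"
      then have "x \<ominus> y \<in> nonunits V" using eq[of x y] T by blast
      then show "x = y" by (rule un[OF xy(1,2)])
    qed
    show "(\<lambda>x. nonunits V +>\<^bsub>?V\<^esub> x) ` T = carrier (?V Quot nonunits V)"
    proof (intro equalityI subsetI)
      fix Y assume "Y \<in> carrier (?V Quot nonunits V)"
      then obtain z where z: "z \<in> V" "Y = nonunits V +>\<^bsub>?V\<^esub> z" by (auto simp: FactRing_def A_RCOSETS_def')
      obtain x where x: "x \<in> T" "z \<ominus> x \<in> nonunits V" using ex[OF z(1)] by blast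
      then have "Y = nonunits V +>\<^bsub>?V\<^esub> x" using eq[OF z(1), of x] z(2) T by blast
      then show "Y \<in> (\<lambda>x. nonunits V +>\<^bsub>?V\<^esub> x) ` T" using x by blast
    qed (use T in \<open>auto simp: FactRing_def A_RCOSETS_def'\<close>)
  qed
qed

lemma place_degree_by_card:
  assumes V: "valuation_ring R C V" and C: "subfield C R" "finite C" "card C > 1"
    and card: "card (carrier (R\<lparr>carrier := V\<rparr> Quot nonunits V)) = card C ^ e"
  shows "place_degree R C (nonunits V) = e"
proof -
  let ?V = "R\<lparr>carrier := V\<rparr>"
  let ?Q = "?V Quot nonunits V"
  let ?h = "\<lambda>c. nonunits V +>\<^bsub>?V\<^esub> c"
  note VD = valuation_ringD[OF V]
  interpret I: ideal "nonunits V" ?V by (rule nonunits_ideal(1)[OF V])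
  have max: "maximalideal (nonunits V) ?V" using maximalideal_iff_nonunits[OF V] by simp
  have Vdom: "domain ?V" using subring_is_domain[OF VD(1)] .
  have Qf: "field ?Q" using maximalideal.quotient_is_field[OF max] Vdom by (simp add: domain_def)
  interpret Q: field ?Q by (rule Qf)
  interpret H: ring_hom_ring ?V ?Q ?h
    by (rule ring_hom_ringI2[OF I.ring_axioms Q.ring_axioms I.rcos_ring_hom])
  have CV: "subfield C ?V"
    using subfield_iff(2)[OF C(1)] VD(2) by (intro I.subfield_iff(1)) auto
  have sub: "subfield (?h ` C) ?Q"
    by (rule H.img_is_subfield(2)[OF CV]) simp
  have inj: "inj_on ?h C"
    by (rule H.img_is_subfield(1)[OF CV]) simp
  have cpos: "card C ^ e > 0" using C by simp
  have fin: "finite (carrier ?Q)" by (rule card_ge_0_finite) (use card cpos in simp)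
  have "Q.dim (?h ` C) (carrier ?Q) = e"
    by (rule Q.dim_by_card[OF sub fin]) (use card card_image[OF inj] in simp)
  then show ?thesis unfolding place_degree_def place_ring_nonunits[OF V] .
qed

end

text \<open>A local ring is a valuation ring as soon as every nonzero element is a unit times a power of one
  element \<open>\<tau>\<close>. Here the ring is the localisation of \<open>A\<close> at the ideal \<open>m\<close>.\<close>

locale local_valuation = field R for R (structure) +
  fixes A m :: "'a set" and \<tau> :: 'a
  assumes A: "subring A R" and mA: "m \<subseteq> A" and m0: "\<zero> \<in> m" and m1: "\<one> \<notin> m"
    and m_add: "x \<in> m \<Longrightarrow> y \<in> m \<Longrightarrow> x \<oplus> y \<in> m"
    and m_mult: "a \<in> A \<Longrightarrow> x \<in> m \<Longrightarrow> a \<otimes> x \<in> m"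
    and m_max: "b \<in> A \<Longrightarrow> b \<notin> m \<Longrightarrow> \<exists>b'\<in>A. b \<otimes> b' \<ominus> \<one> \<in> m"
    and frac: "z \<in> carrier R \<Longrightarrow> \<exists>a\<in>A. \<exists>b\<in>A. b \<noteq> \<zero> \<and> z \<otimes> b = a"
    and \<tau>: "\<tau> \<in> m" "\<tau> \<noteq> \<zero>"
    and factor: "x \<in> A \<Longrightarrow> x \<noteq> \<zero> \<Longrightarrow> \<exists>n::nat. \<exists>a\<in>A - m. \<exists>b\<in>A - m. x \<otimes> b = \<tau> [^] n \<otimes> a"
begin

definition loc :: "'a set" where "loc = {z \<in> carrier R. \<exists>a\<in>A. \<exists>b\<in>A - m. z \<otimes> b = a}"

lemma Ac: "x \<in> A \<Longrightarrow> x \<in> carrier R" using subringE(1)[OF A] by auto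

lemmas Acl = subringE(2,3,5,6,7)[OF A]

lemma m_neg: "x \<in> m \<Longrightarrow> \<ominus> x \<in> m"
  using m_mult[of "\<ominus> \<one>" x] Acl mA Ac by (auto simp: l_minus)

lemma m_minus: "x \<in> m \<Longrightarrow> y \<in> m \<Longrightarrow> x \<ominus> y \<in> m"
  unfolding a_minus_def by (intro m_add m_neg)

lemma A_minus: "x \<in> A \<Longrightarrow> y \<in> A \<Longrightarrow> x \<ominus> y \<in> A"
  unfolding a_minus_def using Acl by auto

lemma m_prime: assumes "x \<in> A" "y \<in> A" "x \<otimes> y \<in> m" shows "x \<in> m \<or> y \<in> m"
proof (rule ccontr)
  assume "\<not> (x \<in> m \<or> y \<in> m)"
  then obtain x' where x': "x' \<in> A" "x \<otimes> x' \<ominus> \<one> \<in> m" using m_max assms by blast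
  have c: "x \<in> carrier R" "y \<in> carrier R" "x' \<in> carrier R" using assms x' Ac by auto
  \<comment> \<open>With \<open>x'\<close> an inverse of \<open>x\<close> modulo \<open>m\<close>,
    this writes \<open>y\<close> as a combination of two elements of \<open>m\<close>.\<close>
  have "y = x' \<otimes> (x \<otimes> y) \<ominus> y \<otimes> (x \<otimes> x' \<ominus> \<one>)"
  proof -
    have "y \<ominus> (x' \<otimes> (x \<otimes> y) \<ominus> y \<otimes> (x \<otimes> x' \<ominus> \<one>)) = \<zero>" using c by algebra
    then show ?thesis using c by (subst (asm) r_right_minus_eq) auto
  qed
  moreover have "x' \<otimes> (x \<otimes> y) \<ominus> y \<otimes> (x \<otimes> x' \<ominus> \<one>) \<in> m" using m_minus m_mult x' assms by auto
  ultimately show False using \<open>\<not> (x \<in> m \<or> y \<in> m)\<close> by auto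
qed

lemma compl_mult: "x \<in> A - m \<Longrightarrow> y \<in> A - m \<Longrightarrow> x \<otimes> y \<in> A - m"
  using m_prime[of x y] Acl by auto

lemma compl_nz: "x \<in> A - m \<Longrightarrow> x \<noteq> \<zero>" using m0 by auto

lemma A_loc: "A \<subseteq> loc"
proof
  fix x assume "x \<in> A"
  then have "x \<otimes> \<one> = x" "x \<in> carrier R" "\<one> \<in> A - m" using m1 Acl(2) Ac by auto
  then show "x \<in> loc" unfolding loc_def using \<open>x \<in> A\<close> by blast
qed

lemma locI: "a \<in> A \<Longrightarrow> b \<in> A - m \<Longrightarrow> z \<in> carrier R \<Longrightarrow> z \<otimes> b = a \<Longrightarrow> z \<in> loc"
  unfolding loc_def by blast

lemma locE: assumes "z \<in> loc" obtains a b where "a \<in> A" "b \<in> A - m" "z \<otimes> b = a" "z \<in> carrier R"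
  using assms unfolding loc_def by blast

lemma loc_subring: "subring loc R"
proof (rule subringI)
  show "loc \<subseteq> carrier R" by (auto simp: loc_def)
  show "\<one> \<in> loc" using A_loc Acl by auto
  fix x assume x: "x \<in> loc"
  obtain a b where ab: "a \<in> A" "b \<in> A - m" "x \<otimes> b = a" "x \<in> carrier R" using locE[OF x] .
  show "\<ominus> x \<in> loc" by (rule locI[of "\<ominus> a" b]) (use ab Acl Ac in \<open>auto simp: l_minus\<close>)
  fix y assume y: "y \<in> loc"
  obtain a' b' where ab': "a' \<in> A" "b' \<in> A - m" "y \<otimes> b' = a'" "y \<in> carrier R" using locE[OF y] .
  have c: "x \<in> carrier R" "y \<in> carrier R" "b \<in> carrier R" "b' \<in> carrier R" using ab ab' Ac by auto
  show "x \<otimes> y \<in> loc"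
  proof (rule locI[of "a \<otimes> a'" "b \<otimes> b'"])
    have "x \<otimes> y \<otimes> (b \<otimes> b') \<ominus> (x \<otimes> b) \<otimes> (y \<otimes> b') = \<zero>" using c by algebra
    then show "x \<otimes> y \<otimes> (b \<otimes> b') = a \<otimes> a'" using c ab ab' by (subst (asm) r_right_minus_eq) auto
  qed (use ab ab' Acl compl_mult in auto)
  show "x \<oplus> y \<in> loc"
  proof (rule locI[of "a \<otimes> b' \<oplus> a' \<otimes> b" "b \<otimes> b'"])
    have "(x \<oplus> y) \<otimes> (b \<otimes> b') \<ominus> ((x \<otimes> b) \<otimes> b' \<oplus> (y \<otimes> b') \<otimes> b) = \<zero>" using c by algebra
    then show "(x \<oplus> y) \<otimes> (b \<otimes> b') = a \<otimes> b' \<oplus> a' \<otimes> b" using c ab ab' by (subst (asm) r_right_minus_eq) auto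
  qed (use ab ab' Acl compl_mult in auto)
qed

lemma \<tau>_inv: "inv \<tau> \<notin> loc"
proof
  assume "inv \<tau> \<in> loc"
  then obtain a b where ab: "a \<in> A" "b \<in> A - m" "inv \<tau> \<otimes> b = a" by (rule locE) blast
  have c: "\<tau> \<in> carrier R" "b \<in> carrier R" using \<tau> mA ab Ac by auto
  have "b = (\<tau> \<otimes> inv \<tau>) \<otimes> b" using c \<tau> by simp
  also have "\<dots> = \<tau> \<otimes> a" using c \<tau> ab(3) by (simp add: m_assoc del: r_inv)
  finally have "b = a \<otimes> \<tau>" using c ab Ac by (simp add: m_comm)
  then show False using m_mult[OF ab(1) \<tau>(1)] ab by simp
qed

lemma \<tau>_pow: "\<tau> [^] (n::nat) \<in> A" "\<tau> [^] (n::nat) \<in> carrier R" "\<tau> [^] (n::nat) \<noteq> \<zero>"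
proof -
  have tA: "\<tau> \<in> A" using \<tau> mA by auto
  show "\<tau> [^] n \<in> A" by (induction n) (use tA Acl in auto)
  then show "\<tau> [^] n \<in> carrier R" by (rule Ac)
  show "\<tau> [^] n \<noteq> \<zero>" using \<tau> Ac[OF tA] by simp
qed

text \<open>Numerator and denominator are each a power of \<open>\<tau>\<close> up to elements
  outside \<open>m\<close>, which are invertible in \<open>loc\<close>. Comparing the two exponents
  decides whether \<open>z\<close> or its inverse is in \<open>loc\<close>.\<close>

lemma loc_valuation:
  assumes z: "z \<in> carrier R" "z \<noteq> \<zero>" shows "z \<in> loc \<or> inv z \<in> loc"
proof -
  obtain x y where xy: "x \<in> A" "y \<in> A" "y \<noteq> \<zero>" "z \<otimes> y = x" using frac[OF z(1)] by blast
  have c: "x \<in> carrier R" "y \<in> carrier R" using xy Ac by auto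
  have x0: "x \<noteq> \<zero>" using xy z c integral by blast
  obtain n :: nat and a b where n: "a \<in> A - m" "b \<in> A - m" "x \<otimes> b = \<tau> [^] n \<otimes> a" using factor[OF xy(1) x0] by blast
  obtain k :: nat and a' b' where k: "a' \<in> A - m" "b' \<in> A - m" "y \<otimes> b' = \<tau> [^] k \<otimes> a'" using factor[OF xy(2,3)] by blast
  have cc: "a \<in> carrier R" "b \<in> carrier R" "a' \<in> carrier R" "b' \<in> carrier R" using n k Ac by auto
  have zz: "z \<in> carrier R" by (rule z(1))
  define s t where "s = \<tau> [^] n" and "t = \<tau> [^] k"
  have st: "s \<in> carrier R" "t \<in> carrier R" "s \<noteq> \<zero>" "t \<noteq> \<zero>" using \<tau>_pow by (auto simp: s_def t_def)
  have "z \<otimes> (t \<otimes> a') \<otimes> b = z \<otimes> (y \<otimes> b') \<otimes> b" using k by (simp add: t_def)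
  also have "\<dots> = (z \<otimes> y) \<otimes> b \<otimes> b'" using c cc zz by (simp add: m_ac)
  also have "\<dots> = s \<otimes> a \<otimes> b'" using xy n by (simp add: s_def)
  finally have main: "z \<otimes> (t \<otimes> a') \<otimes> b = s \<otimes> a \<otimes> b'" .
  show ?thesis
  proof (cases "k \<le> n")
    case True
    define u where "u = \<tau> [^] (n - k)"
    have u: "u \<in> A" "u \<in> carrier R" using \<tau>_pow by (auto simp: u_def)
    have s: "s = t \<otimes> u" using True \<tau> mA Ac by (simp add: s_def t_def u_def nat_pow_mult subsetD)
    have "t \<otimes> (z \<otimes> (a' \<otimes> b)) = t \<otimes> (u \<otimes> a \<otimes> b')" using main st cc u zz unfolding s by (simp add: m_ac)
    then have "z \<otimes> (a' \<otimes> b) = u \<otimes> a \<otimes> b'" using st cc u zz by (subst (asm) m_lcancel) auto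
    then have "z \<in> loc" by (intro locI[of "u \<otimes> a \<otimes> b'" "a' \<otimes> b"]) (use n k u Acl compl_mult zz in auto)
    then show ?thesis ..
  next
    case False
    define u where "u = \<tau> [^] (k - n)"
    have u: "u \<in> A" "u \<in> carrier R" using \<tau>_pow by (auto simp: u_def)
    have t: "t = s \<otimes> u" using False \<tau> mA Ac by (simp add: s_def t_def u_def nat_pow_mult subsetD)
    have zi: "inv z \<in> carrier R" "inv z \<otimes> z = \<one>" using z by auto
    have "s \<otimes> (z \<otimes> (u \<otimes> a' \<otimes> b)) = s \<otimes> (a \<otimes> b')" using main st cc u zz unfolding t by (simp add: m_ac)
    then have e: "z \<otimes> (u \<otimes> a' \<otimes> b) = a \<otimes> b'" using st cc u zz by (subst (asm) m_lcancel) auto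
    have "inv z \<otimes> (a \<otimes> b') = (inv z \<otimes> z) \<otimes> (u \<otimes> a' \<otimes> b)"
      unfolding e [symmetric] using zi(1) zz u cc by (simp add: m_assoc)
    then have "inv z \<otimes> (a \<otimes> b') = u \<otimes> a' \<otimes> b" using zi u cc by simp
    then have "inv z \<in> loc" by (intro locI[of "u \<otimes> a' \<otimes> b" "a \<otimes> b'"]) (use n k u Acl compl_mult zi in auto)
    then show ?thesis ..
  qed
qed

lemma valuation_ring_loc:
  assumes "C \<subset> A" shows "valuation_ring R C loc"
proof -
  have "inv \<tau> \<in> carrier R" using \<tau> mA Ac by auto
  then have "loc \<noteq> carrier R" using \<tau>_inv by auto
  then show ?thesis
    unfolding valuation_ring_def using loc_subring loc_valuation assms A_loc subringE(1)[OF loc_subring] by blast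
qed

lemma nonunits_loc: "nonunits loc = {z \<in> carrier R. \<exists>a\<in>m. \<exists>b\<in>A - m. z \<otimes> b = a}"
proof (intro equalityI subsetI)
  fix z assume z: "z \<in> nonunits loc"
  then have "z \<in> loc" by (simp add: nonunits_def)
  then obtain a b where ab: "a \<in> A" "b \<in> A - m" "z \<otimes> b = a" "z \<in> carrier R" by (rule locE) blast
  have "a \<in> m"
  proof (rule ccontr)
    assume a: "a \<notin> m"
    have c: "a \<in> carrier R" "b \<in> carrier R" using ab Ac by auto
    have "a \<noteq> \<zero>" using a m0 by auto
    then have z0: "z \<noteq> \<zero>" using ab c by auto
    have "inv z \<otimes> a = b" using ab(3) [symmetric] ab(4) c z0 by (simp add: m_assoc [symmetric])
    then have "inv z \<in> loc" by (intro locI[of b a]) (use ab a z0 in auto)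
    then show False using z z0 by (simp add: nonunits_def)
  qed
  then show "z \<in> {z \<in> carrier R. \<exists>a\<in>m. \<exists>b\<in>A - m. z \<otimes> b = a}" using ab by auto
next
  fix z assume "z \<in> {z \<in> carrier R. \<exists>a\<in>m. \<exists>b\<in>A - m. z \<otimes> b = a}"
  then obtain a b where ab: "a \<in> m" "b \<in> A - m" "z \<otimes> b = a" "z \<in> carrier R" by auto
  have zl: "z \<in> loc" using ab mA by (intro locI[of a b]) auto
  have "inv z \<notin> loc" if z0: "z \<noteq> \<zero>"
  proof
    assume "inv z \<in> loc"
    then obtain a' b' where ab': "a' \<in> A" "b' \<in> A - m" "inv z \<otimes> b' = a'" by (rule locE) blast
    have c: "a \<in> carrier R" "b \<in> carrier R" "b' \<in> carrier R" "inv z \<in> carrier R" using ab ab' mA Ac z0 by auto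
    have "a' \<otimes> a = (inv z \<otimes> z) \<otimes> (b' \<otimes> b)" using c ab(4) by (simp only: ab(3) [symmetric] ab'(3) [symmetric]) (simp add: m_ac del: l_inv)
    then have "a' \<otimes> a = b' \<otimes> b" using c ab(4) z0 by simp
    then show False using m_mult[OF ab'(1) ab(1)] compl_mult[OF ab'(2) ab(2)] by simp
  qed
  then show "z \<in> nonunits loc" using zl by (auto simp: nonunits_def)
qed

lemma nonunits_loc_A: "x \<in> A \<Longrightarrow> x \<in> nonunits loc \<longleftrightarrow> x \<in> m"
proof
  assume x: "x \<in> A" "x \<in> nonunits loc"
  then obtain a b where ab: "a \<in> m" "b \<in> A - m" "x \<otimes> b = a" by (auto simp: nonunits_loc)
  then show "x \<in> m" using m_prime[of x b] x by auto
next
  assume x: "x \<in> A" "x \<in> m"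
  then have "x \<otimes> \<one> = x" "x \<in> carrier R" "\<one> \<in> A - m" using m1 Acl(2) Ac by auto
  then show "x \<in> nonunits loc" unfolding nonunits_loc using x by blast
qed

text \<open>Valuation rings are maximal under domination. Elements outside \<open>m\<close> are
  invertible in \<open>W\<close>, so \<open>W\<close> contains \<open>loc\<close>. An element of
  \<open>W\<close> outside \<open>loc\<close> would have its inverse in the maximal ideal of
  \<open>loc\<close>, hence in that of \<open>W\<close>.\<close>

lemma loc_unique:
  assumes W: "valuation_ring R C W" and AW: "A \<subseteq> W" and N: "\<And>x. x \<in> A \<Longrightarrow> x \<in> nonunits W \<longleftrightarrow> x \<in> m"
  shows "W = loc"
proof -
  note WD = valuation_ringD[OF W]
  note Wcl = subringE[OF WD(1)]
  have unit: "inv b \<in> W" if "b \<in> A - m" for b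
    using N[of b] that AW compl_nz[OF that] by (auto simp: nonunits_def)
  have solve: "z = a \<otimes> inv b" if "z \<otimes> b = a" "z \<in> carrier R" "b \<in> A - m" for z a b
    using that compl_nz[OF that(3)] Ac by (auto simp: m_assoc)
  show ?thesis
  proof (intro equalityI subsetI)
    fix z assume "z \<in> loc"
    then obtain a b where ab: "a \<in> A" "b \<in> A - m" "z \<otimes> b = a" "z \<in> carrier R" by (rule locE) blast
    then have "z = a \<otimes> inv b" using solve by blast
    then show "z \<in> W" using ab unit AW Wcl(6) by auto
  next
    fix z assume z: "z \<in> W"
    show "z \<in> loc"
    proof (rule ccontr)
      assume nz: "z \<notin> loc"
      have zc: "z \<in> carrier R" using z WD(3) by auto
      have z0: "z \<noteq> \<zero>" using nz A_loc Acl by auto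
      then have il: "inv z \<in> loc" using loc_valuation zc nz by blast
      have zi: "inv z \<in> carrier R" "inv z \<noteq> \<zero>" "inv (inv z) = z"
        using zc z0 nonzero_imp_inverse_nonzero nonzero_inverse_inverse_eq by auto
      have "inv z \<in> nonunits loc" using il nz zi by (simp add: nonunits_def)
      then obtain a b where ab: "a \<in> m" "b \<in> A - m" "inv z \<otimes> b = a" by (auto simp: nonunits_loc)
      have aA: "a \<in> A" using ab mA by auto
      have aN: "a \<in> nonunits W" using N[OF aA] ab by simp
      have c: "a \<in> carrier R" "b \<in> carrier R" "inv b \<in> carrier R" using aA ab Ac compl_nz[OF ab(2)] by auto
      have b0: "b \<noteq> \<zero>" using compl_nz[OF ab(2)] .
      have a0: "a \<noteq> \<zero>" using ab(3) zi b0 c integral by blast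
      have "inv a = z \<otimes> inv b"
        using nonzero_inverse_mult_distrib[of "inv z" b] ab(3) zi zc b0 c by (simp add: m_comm)
      then have "inv a \<in> W" using z unit[OF ab(2)] Wcl(6) by simp
      then show False using aN a0 by (simp add: nonunits_def)
    qed
  qed
qed

text \<open>A fraction with denominator \<open>b\<close> outside \<open>m\<close> is congruent to
  its numerator times an inverse of \<open>b\<close> modulo \<open>m\<close>. Representatives of the
  residue field can therefore be taken from \<open>A\<close>.\<close>

lemma residue_transversal:
  assumes C: "C \<subset> A" and T: "T \<subseteq> A"
    and ex: "\<And>z. z \<in> A \<Longrightarrow> \<exists>x\<in>T. z \<ominus> x \<in> m"
    and un: "\<And>x x'. x \<in> T \<Longrightarrow> x' \<in> T \<Longrightarrow> x \<ominus> x' \<in> m \<Longrightarrow> x = x'"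
  shows "card (carrier (R\<lparr>carrier := loc\<rparr> Quot nonunits loc)) = card T"
proof -
  have "bij_betw (\<lambda>x. nonunits loc +>\<^bsub>R\<lparr>carrier := loc\<rparr>\<^esub> x) T (carrier (R\<lparr>carrier := loc\<rparr> Quot nonunits loc))"
  proof (rule card_residue_field[OF valuation_ring_loc[OF C]])
    show "T \<subseteq> loc" using T A_loc by auto
    show "x = x'" if "x \<in> T" "x' \<in> T" "x \<ominus> x' \<in> nonunits loc" for x x'
    proof -
      have "x \<ominus> x' \<in> A" using that T by (intro A_minus) auto
      then have "x \<ominus> x' \<in> m" using nonunits_loc_A that by blast
      then show ?thesis by (rule un[OF that(1,2)])
    qed
    fix z assume "z \<in> loc"
    then obtain a b where ab: "a \<in> A" "b \<in> A - m" "z \<otimes> b = a" "z \<in> carrier R" by (rule locE) blast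
    obtain b' where b': "b' \<in> A" "b \<otimes> b' \<ominus> \<one> \<in> m" using m_max ab by blast
    obtain x where x: "x \<in> T" "a \<otimes> b' \<ominus> x \<in> m" using ex[of "a \<otimes> b'"] ab b' Acl by auto
    have xA: "x \<in> A" using x T by auto
    have c: "b \<in> carrier R" "b' \<in> carrier R" "x \<in> carrier R" "z \<in> carrier R" using ab b' xA Ac by auto
    have "(z \<ominus> x) \<otimes> b = b \<otimes> (a \<otimes> b' \<ominus> x) \<ominus> a \<otimes> (b \<otimes> b' \<ominus> \<one>)"
    proof -
      have "(z \<ominus> x) \<otimes> b \<ominus> (b \<otimes> ((z \<otimes> b) \<otimes> b' \<ominus> x) \<ominus> (z \<otimes> b) \<otimes> (b \<otimes> b' \<ominus> \<one>)) = \<zero>" using c by algebra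
      then show ?thesis using c ab(3) by (subst (asm) r_right_minus_eq) auto
    qed
    moreover have "b \<otimes> (a \<otimes> b' \<ominus> x) \<ominus> a \<otimes> (b \<otimes> b' \<ominus> \<one>) \<in> m"
      using m_minus m_mult x b' ab by auto
    ultimately have "z \<ominus> x \<in> nonunits loc" using ab c unfolding nonunits_loc by auto
    then show "\<exists>x\<in>T. z \<ominus> x \<in> nonunits loc" using x by blast
  qed
  then show ?thesis using bij_betw_same_card by fastforce
qed

end

section \<open>Quadratic extensions of a fraction field\<close>

lemma (in cring) quad_mult_expand:
  assumes "u \<in> carrier R" "v \<in> carrier R" "u' \<in> carrier R" "v' \<in> carrier R" "y \<in> carrier R" "g \<in> carrier R"
    and "y \<otimes> y = g"
  shows "(u \<oplus> v \<otimes> y) \<otimes> (u' \<oplus> v' \<otimes> y) = (u \<otimes> u' \<oplus> g \<otimes> (v \<otimes> v')) \<oplus> (u \<otimes> v' \<oplus> v \<otimes> u') \<otimes> y"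
proof -
  have "(u \<oplus> v \<otimes> y) \<otimes> (u' \<oplus> v' \<otimes> y) \<ominus> ((u \<otimes> u' \<oplus> (y \<otimes> y) \<otimes> (v \<otimes> v')) \<oplus> (u \<otimes> v' \<oplus> v \<otimes> u') \<otimes> y) = \<zero>"
    using assms(1-6) by algebra
  then show ?thesis using assms by (subst (asm) r_right_minus_eq) auto
qed

lemma (in cring) quad_add_expand:
  assumes "u \<in> carrier R" "v \<in> carrier R" "u' \<in> carrier R" "v' \<in> carrier R" "y \<in> carrier R"
  shows "(u \<oplus> v \<otimes> y) \<oplus> (u' \<oplus> v' \<otimes> y) = (u \<oplus> u') \<oplus> (v \<oplus> v') \<otimes> y"
    and "(u \<oplus> v \<otimes> y) \<ominus> (u' \<oplus> v' \<otimes> y) = (u \<ominus> u') \<oplus> (v \<ominus> v') \<otimes> y"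
    and "\<ominus> (u \<oplus> v \<otimes> y) = \<ominus> u \<oplus> \<ominus> v \<otimes> y"
proof -
  have "(u \<oplus> v \<otimes> y) \<oplus> (u' \<oplus> v' \<otimes> y) \<ominus> ((u \<oplus> u') \<oplus> (v \<oplus> v') \<otimes> y) = \<zero>" using assms by algebra
  then show "(u \<oplus> v \<otimes> y) \<oplus> (u' \<oplus> v' \<otimes> y) = (u \<oplus> u') \<oplus> (v \<oplus> v') \<otimes> y"
    using assms by (subst (asm) r_right_minus_eq) auto
  have "(u \<oplus> v \<otimes> y) \<ominus> (u' \<oplus> v' \<otimes> y) \<ominus> ((u \<ominus> u') \<oplus> (v \<ominus> v') \<otimes> y) = \<zero>" using assms by algebra
  then show "(u \<oplus> v \<otimes> y) \<ominus> (u' \<oplus> v' \<otimes> y) = (u \<ominus> u') \<oplus> (v \<ominus> v') \<otimes> y"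
    using assms by (subst (asm) r_right_minus_eq) auto
  have "\<ominus> (u \<oplus> v \<otimes> y) \<ominus> (\<ominus> u \<oplus> \<ominus> v \<otimes> y) = \<zero>" using assms by algebra
  then show "\<ominus> (u \<oplus> v \<otimes> y) = \<ominus> u \<oplus> \<ominus> v \<otimes> y" using assms by (subst (asm) r_right_minus_eq) auto
qed

text \<open>\<open>R\<close> arises from the fraction field of \<open>A\<close> by adjoining a
  square root \<open>y\<close> of \<open>f\<close>. The locale is used for two models of the same
  function field, with polynomials evaluated at \<open>x\<close> and at \<open>1/x\<close>.\<close>

locale quad_ext = field R + A: domain A for R (structure) and A (structure) +
  fixes \<iota> :: "'c \<Rightarrow> 'a" and y :: 'a and f :: 'c
  assumes \<iota>_hom: "\<iota> \<in> ring_hom A R" and y [simp]: "y \<in> carrier R" and f [simp]: "f \<in> carrier A"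
    and y_sq: "y \<otimes> y = \<iota> f"
    and rep: "z \<in> carrier R \<Longrightarrow> \<exists>u\<in>carrier A. \<exists>v\<in>carrier A. \<exists>w\<in>carrier A. w \<noteq> \<zero>\<^bsub>A\<^esub> \<and> z \<otimes> \<iota> w = \<iota> u \<oplus> \<iota> v \<otimes> y"
    and indep: "u \<in> carrier A \<Longrightarrow> v \<in> carrier A \<Longrightarrow> \<iota> u \<oplus> \<iota> v \<otimes> y = \<zero> \<Longrightarrow> u = \<zero>\<^bsub>A\<^esub> \<and> v = \<zero>\<^bsub>A\<^esub>"
    and two_unit: "\<one>\<^bsub>A\<^esub> \<oplus>\<^bsub>A\<^esub> \<one>\<^bsub>A\<^esub> \<in> Units A"
begin

abbreviation Amult (infixl ".*" 70) where "u .* v \<equiv> u \<otimes>\<^bsub>A\<^esub> v"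
abbreviation Aadd (infixl ".+" 65) where "u .+ v \<equiv> u \<oplus>\<^bsub>A\<^esub> v"
abbreviation Asub (infixl ".-" 65) where "u .- v \<equiv> u \<ominus>\<^bsub>A\<^esub> v"
abbreviation Aneg (".~ _" [81] 80) where ".~ u \<equiv> \<ominus>\<^bsub>A\<^esub> u"
abbreviation Apow (infixr ".^" 75) where "u .^ (n::nat) \<equiv> u [^]\<^bsub>A\<^esub> n"
abbreviation "zA \<equiv> \<zero>\<^bsub>A\<^esub>"
abbreviation "oA \<equiv> \<one>\<^bsub>A\<^esub>"

abbreviation "cA \<equiv> carrier A"

sublocale I: ring_hom_ring A R \<iota>
  by (rule ring_hom_ringI2) (auto simp: ring_axioms A.ring_axioms \<iota>_hom)

definition el :: "'c \<Rightarrow> 'c \<Rightarrow> 'a" where "el u v = \<iota> u \<oplus> \<iota> v \<otimes> y"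

definition Rg :: "'a set" where "Rg = {el u v | u v. u \<in> cA \<and> v \<in> cA}"

lemma el_closed [simp]: "u \<in> cA \<Longrightarrow> v \<in> cA \<Longrightarrow> el u v \<in> carrier R"
  by (simp add: el_def)

lemma el_add: "u \<in> cA \<Longrightarrow> v \<in> cA \<Longrightarrow> u' \<in> cA \<Longrightarrow> v' \<in> cA
   \<Longrightarrow> el u v \<oplus> el u' v' = el (u .+ u') (v .+ v')"
  unfolding el_def using quad_add_expand(1)[of "\<iota> u" "\<iota> v" "\<iota> u'" "\<iota> v'" y] by simp

lemma el_minus: "u \<in> cA \<Longrightarrow> v \<in> cA \<Longrightarrow> u' \<in> cA \<Longrightarrow> v' \<in> cA
   \<Longrightarrow> el u v \<ominus> el u' v' = el (u .- u') (v .- v')"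
  unfolding el_def using quad_add_expand(2)[of "\<iota> u" "\<iota> v" "\<iota> u'" "\<iota> v'" y] by (simp add: a_minus_def)

lemma el_neg: "u \<in> cA \<Longrightarrow> v \<in> cA \<Longrightarrow> \<ominus> el u v = el (.~ u) (.~ v)"
  unfolding el_def using quad_add_expand(3)[of "\<iota> u" "\<iota> v" "\<iota> u" "\<iota> v" y] by simp

lemma el_mult: "u \<in> cA \<Longrightarrow> v \<in> cA \<Longrightarrow> u' \<in> cA \<Longrightarrow> v' \<in> cA
   \<Longrightarrow> el u v \<otimes> el u' v' = el (u .* u' .+ f .* (v .* v')) (u .* v' .+ v .* u')"
  unfolding el_def using quad_mult_expand[of "\<iota> u" "\<iota> v" "\<iota> u'" "\<iota> v'" y "\<iota> f"] y_sq by simp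

lemma el_zero_iff: "u \<in> cA \<Longrightarrow> v \<in> cA \<Longrightarrow> el u v = \<zero> \<longleftrightarrow> u = zA \<and> v = zA"
  using indep[of u v] by (auto simp: el_def)

lemma el_inj:
  assumes "u \<in> cA" "v \<in> cA" "u' \<in> cA" "v' \<in> cA" "el u v = el u' v'"
  shows "u = u' \<and> v = v'"
proof -
  have "el u v \<ominus> el u' v' = \<zero>" using assms r_right_minus_eq[of "el u' v'" "el u' v'"] by simp
  then have "el (u .- u') (v .- v') = \<zero>" using assms(1-4) el_minus[of u v u' v'] by simp
  then show ?thesis using assms by (subst (asm) el_zero_iff) auto
qed

lemma \<iota>_el: "u \<in> cA \<Longrightarrow> \<iota> u = el u zA" and y_el: "y = el zA oA"
  by (simp_all add: el_def)

lemma RgI: "u \<in> cA \<Longrightarrow> v \<in> cA \<Longrightarrow> el u v \<in> Rg" by (auto simp: Rg_def)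

lemma RgE: assumes "x \<in> Rg" obtains u v where "u \<in> cA" "v \<in> cA" "x = el u v"
  using assms by (auto simp: Rg_def)

lemma Rg_subring: "subring Rg R"
proof (rule subringI)
  show "Rg \<subseteq> carrier R" by (auto simp: Rg_def)
  show "\<one> \<in> Rg" using RgI[of "oA" "zA"] by (simp add: el_def)
  fix x assume "x \<in> Rg"
  then obtain u v where x: "u \<in> cA" "v \<in> cA" "x = el u v" using RgE by blast
  show "\<ominus> x \<in> Rg" using x el_neg RgI by simp
  fix z assume "z \<in> Rg"
  then obtain u' v' where z: "u' \<in> cA" "v' \<in> cA" "z = el u' v'" using RgE by blast
  show "x \<otimes> z \<in> Rg" using x z el_mult RgI by simp
  show "x \<oplus> z \<in> Rg" using x z el_add RgI by simp
qed

lemma Rg_frac: "z \<in> carrier R \<Longrightarrow> \<exists>a\<in>Rg. \<exists>b\<in>Rg. b \<noteq> \<zero> \<and> z \<otimes> b = a"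
proof -
  assume "z \<in> carrier R"
  then obtain u v w where uvw: "u \<in> cA" "v \<in> cA" "w \<in> cA" "w \<noteq> zA"
    "z \<otimes> \<iota> w = \<iota> u \<oplus> \<iota> v \<otimes> y" using rep by blast
  have "\<iota> w \<in> Rg" "\<iota> w \<noteq> \<zero>" using uvw \<iota>_el[of w] RgI[of w "zA"] el_zero_iff[of w "zA"] by auto
  moreover have "\<iota> u \<oplus> \<iota> v \<otimes> y \<in> Rg" using RgI[of u v] uvw by (simp add: el_def)
  ultimately show ?thesis using uvw(5) by blast
qed

end

text \<open>In the locale below \<open>\<delta>\<close> plays the role of the degree: it decreases when the prime \<open>\<pi>\<close> is cancelled.\<close>

locale quad_place = quad_ext R A \<iota> y f
  for R (structure) and A (structure) and \<iota> y f +
  fixes \<pi> :: 'c and \<delta> :: "'c \<Rightarrow> nat" and T0 :: "'c set"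
  assumes \<pi> [simp]: "\<pi> \<in> carrier A" and \<pi>_nz: "\<pi> \<noteq> \<zero>\<^bsub>A\<^esub>" and \<pi>_one: "\<not> \<pi> divides\<^bsub>A\<^esub> \<one>\<^bsub>A\<^esub>"
    and inv_mod: "u \<in> carrier A \<Longrightarrow> \<not> \<pi> divides\<^bsub>A\<^esub> u \<Longrightarrow> \<exists>w\<in>carrier A. \<pi> divides\<^bsub>A\<^esub> (u \<otimes>\<^bsub>A\<^esub> w \<ominus>\<^bsub>A\<^esub> \<one>\<^bsub>A\<^esub>)"
    and \<delta>: "w \<in> carrier A \<Longrightarrow> w \<noteq> \<zero>\<^bsub>A\<^esub> \<Longrightarrow> \<delta> w < \<delta> (\<pi> \<otimes>\<^bsub>A\<^esub> w)"
    and sqfree: "\<not> (\<pi> \<otimes>\<^bsub>A\<^esub> \<pi>) divides\<^bsub>A\<^esub> f"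
    and T0: "T0 \<subseteq> carrier A"
    and T0_ex: "u \<in> carrier A \<Longrightarrow> \<exists>x\<in>T0. \<pi> divides\<^bsub>A\<^esub> (u \<ominus>\<^bsub>A\<^esub> x)"
    and T0_un: "x \<in> T0 \<Longrightarrow> x' \<in> T0 \<Longrightarrow> \<pi> divides\<^bsub>A\<^esub> (x \<ominus>\<^bsub>A\<^esub> x') \<Longrightarrow> x = x'"
begin

definition D :: "'c \<Rightarrow> bool" where "D u \<longleftrightarrow> \<pi> divides\<^bsub>A\<^esub> u"

lemma DE: assumes "D u" "u \<in> cA" obtains w where "w \<in> cA" "u = \<pi> .* w"
  using assms by (auto simp: D_def factor_def)

lemma DI: "w \<in> cA \<Longrightarrow> D (\<pi> .* w)" by (auto simp: D_def factor_def)

lemma D_zero [simp]: "D zA" using DI[of "zA"] by simp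

lemma D_one: "\<not> D oA" using \<pi>_one by (simp add: D_def)

lemma D_mult: "u \<in> cA \<Longrightarrow> w \<in> cA \<Longrightarrow> D u \<Longrightarrow> D (u .* w)"
  using DI by (auto elim!: DE simp: A.m_assoc)

lemma D_mult2: "u \<in> cA \<Longrightarrow> w \<in> cA \<Longrightarrow> D u \<Longrightarrow> D (w .* u)"
  using D_mult[of u w] by (simp add: A.m_comm)

lemma D_add: assumes "u \<in> cA" "w \<in> cA" "D u" "D w" shows "D (u .+ w)"
proof -
  obtain u' w' where c: "u' \<in> cA" "u = \<pi> .* u'" "w' \<in> cA" "w = \<pi> .* w'"
    using assms by (metis DE)
  then have "u .+ w = \<pi> .* (u' .+ w')" by (simp add: A.r_distr)
  then show ?thesis using DI c by simp
qed

lemma D_neg: assumes "u \<in> cA" "D u" shows "D (.~ u)"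
proof -
  obtain u' where c: "u' \<in> cA" "u = \<pi> .* u'" using assms by (metis DE)
  then have ".~ u = \<pi> .* (.~ u')" by (simp add: A.r_minus)
  then show ?thesis using DI c by simp
qed

lemma D_minus: "u \<in> cA \<Longrightarrow> w \<in> cA \<Longrightarrow> D u \<Longrightarrow> D w \<Longrightarrow> D (u .- w)"
  unfolding a_minus_def by (intro D_add D_neg) auto

lemma D_cong: assumes "u \<in> cA" "w \<in> cA" "D (u .- w)" shows "D u \<longleftrightarrow> D w"
proof -
  have e: "u = (u .- w) .+ w" "w = u .- (u .- w)"
  proof -
    have "u .- ((u .- w) .+ w) = zA" "w .- (u .- (u .- w)) = zA"
      using assms(1,2) by algebra+
    then show "u = (u .- w) .+ w" "w = u .- (u .- w)"
      using assms(1,2) by (auto simp: A.r_right_minus_eq)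
  qed
  show ?thesis
  proof
    assume "D w"
    then have "D ((u .- w) .+ w)" by (intro D_add) (use assms in auto)
    then show "D u" using e(1) by simp
  next
    assume "D u"
    then have "D (u .- (u .- w))" by (rule D_minus[rotated 2]) (use assms in auto)
    then show "D w" using e(2) by simp
  qed
qed

lemma D_prime: assumes "u \<in> cA" "w \<in> cA" "D (u .* w)" shows "D u \<or> D w"
proof (rule ccontr)
  assume n: "\<not> (D u \<or> D w)"
  then obtain u' where u': "u' \<in> cA" "D (u .* u' .- oA)" using inv_mod[OF assms(1)] by (auto simp: D_def)
  have "u' .* (u .* w) .- w .* (u .* u' .- oA) .- w = zA"
    using assms(1,2) u'(1) by algebra
  then have "w = u' .* (u .* w) .- w .* (u .* u' .- oA)"
    using assms u' by (subst (asm) A.r_right_minus_eq) auto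
  moreover have "D (u' .* (u .* w) .- w .* (u .* u' .- oA))"
    by (rule D_minus[OF _ _ D_mult2 D_mult2]) (use assms u' in auto)
  ultimately show False using n by simp
qed

lemma D_double: assumes "u \<in> cA" "D (u .+ u)" shows "D u"
proof -
  let ?t = "oA .+ oA"
  have t: "?t \<in> cA" "inv\<^bsub>A\<^esub> ?t \<in> cA" "?t .* inv\<^bsub>A\<^esub> ?t = oA"
    using two_unit A.Units_r_inv A.Units_inv_closed by auto
  have "u .+ u = ?t .* u" using assms by (simp add: A.l_distr)
  then have "D ?t \<or> D u" using D_prime[OF t(1) assms(1)] assms(2) by simp
  moreover have "\<not> D ?t" using D_mult[OF t(1,2)] t(3) D_one by auto
  ultimately show ?thesis by simp
qed

text \<open>The highest common power of \<open>\<pi>\<close> is removed. The measure gives zero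
  entries no weight, because zero stays divisible by \<open>\<pi>\<close> forever.\<close>

lemma pair_factor:
  assumes "u \<in> cA" "v \<in> cA" "\<not> (u = zA \<and> v = zA)"
  shows "\<exists>n::nat. \<exists>u0\<in>cA. \<exists>v0\<in>cA. u = \<pi> .^ n .* u0 \<and> v = \<pi> .^ n .* v0 \<and> \<not> (D u0 \<and> D v0)"
  using assms
proof (induction "(if u = zA then 0 else \<delta> u) + (if v = zA then 0 else \<delta> v)" arbitrary: u v rule: less_induct)
  case less
  show ?case
  proof (cases "D u \<and> D v")
    case False
    have "u = \<pi> .^ (0::nat) .* u \<and> v = \<pi> .^ (0::nat) .* v" using less by simp
    then show ?thesis using False less.prems by blast
  next
    case True
    obtain u' v' where c: "u' \<in> cA" "u = \<pi> .* u'" "v' \<in> cA" "v = \<pi> .* v'"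
      using True less.prems by (metis DE)
    have nz: "\<not> (u' = zA \<and> v' = zA)" using less.prems c by auto
    have "\<delta> u' < \<delta> u" if "u' \<noteq> zA" using that \<delta>[of u'] c by simp
    moreover have "\<delta> v' < \<delta> v" if "v' \<noteq> zA" using that \<delta>[of v'] c by simp
    moreover have "u = zA \<longleftrightarrow> u' = zA" "v = zA \<longleftrightarrow> v' = zA"
      using c \<pi>_nz A.integral[of \<pi> u'] A.integral[of \<pi> v'] by auto
    ultimately have "(if u' = zA then 0 else \<delta> u') + (if v' = zA then 0 else \<delta> v')
        < (if u = zA then 0 else \<delta> u) + (if v = zA then 0 else \<delta> v)"
      using nz by auto
    then obtain n :: nat and u0 v0 where h: "u0 \<in> cA" "v0 \<in> cA" "u' = \<pi> .^ n .* u0"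
      "v' = \<pi> .^ n .* v0" "\<not> (D u0 \<and> D v0)"
      using less.hyps[OF _ c(1,3) nz] by blast
    have "u = \<pi> .^ Suc n .* u0" "v = \<pi> .^ Suc n .* v0"
      unfolding c(2,4) h(3,4) using h by (simp_all add: A.m_ac)
    then show ?thesis using h by blast
  qed
qed

lemma single_factor:
  assumes "u \<in> cA" "u \<noteq> zA"
  shows "\<exists>n::nat. \<exists>u0\<in>cA. u = \<pi> .^ n .* u0 \<and> \<not> D u0"
proof -
  obtain n :: nat and u0 v0 where h: "u0 \<in> cA" "v0 \<in> cA" "u = \<pi> .^ n .* u0"
    "zA = \<pi> .^ n .* v0" "\<not> (D u0 \<and> D v0)"
    using pair_factor[of u "zA"] assms by auto
  have "\<pi> .^ n \<noteq> zA" using \<pi>_nz by (simp add: A.nat_pow_eq_0_iff)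
  then have "v0 = zA" using h(4) [symmetric] h(2) A.integral[of "\<pi> .^ n" v0] by auto
  then show ?thesis using h by auto
qed

lemma el_scale: "u \<in> cA \<Longrightarrow> v \<in> cA \<Longrightarrow> c \<in> cA \<Longrightarrow> el (c .* u) (c .* v) = \<iota> c \<otimes> el u v"
  by (simp add: el_def r_distr m_assoc)

text \<open>The kernel of reduction modulo \<open>\<pi>\<close> with \<open>y\<close> sent to
  \<open>s\<close>, where \<open>s\<close> will be a square root of \<open>f\<close> modulo
  \<open>\<pi>\<close>. The ramified case, with \<open>s\<close> divisible by \<open>\<pi>\<close>,
  is included.\<close>

definition msplit :: "'c \<Rightarrow> 'a set" where
  "msplit s = {el u v | u v. u \<in> cA \<and> v \<in> cA \<and> D (u .+ v .* s)}"

text \<open>The ideal generated by \<open>\<pi>\<close>, which is the right one when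
  \<open>f\<close> has no square root modulo \<open>\<pi>\<close>.\<close>

definition minert :: "'a set" where
  "minert = {el u v | u v. u \<in> cA \<and> v \<in> cA \<and> D u \<and> D v}"

lemma msplit_iff: "u \<in> cA \<Longrightarrow> v \<in> cA \<Longrightarrow> el u v \<in> msplit s \<longleftrightarrow> D (u .+ v .* s)"
  unfolding msplit_def using el_inj by blast

lemma minert_iff: "u \<in> cA \<Longrightarrow> v \<in> cA \<Longrightarrow> el u v \<in> minert \<longleftrightarrow> D u \<and> D v"
  unfolding minert_def using el_inj by blast

lemma \<pi>_pow: "\<pi> .^ (n::nat) \<in> cA" "\<pi> .^ n \<noteq> zA"
  using \<pi>_nz by (auto simp: A.nat_pow_eq_0_iff)

lemma \<iota>_nz: "u \<in> cA \<Longrightarrow> u \<noteq> zA \<Longrightarrow> \<iota> u \<noteq> \<zero>"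
  using \<iota>_el[of u] el_zero_iff[of u "zA"] by simp

lemma D_f_pi:
  assumes "D f" obtains g where "g \<in> cA" "f = \<pi> .* g" "\<not> D g"
proof -
  obtain g where g: "g \<in> cA" "f = \<pi> .* g" using assms f by (metis DE)
  have "\<not> D g"
  proof
    assume "D g"
    then obtain h where "h \<in> cA" "g = \<pi> .* h" using g by (metis DE)
    then have "f = (\<pi> .* \<pi>) .* h" using g by (simp add: A.m_assoc)
    then show False using sqfree \<open>h \<in> cA\<close> by (auto simp: factor_def)
  qed
  then show ?thesis using that g by blast
qed

text \<open>If \<open>\<pi>\<close> does not divide \<open>s\<close> the prime splits and
  \<open>\<pi>\<close> is a uniformizer. If it does, then \<open>f\<close> is \<open>\<pi>\<close>
  times an element prime to \<open>\<pi>\<close>, because \<open>f\<close> is not divisible by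
  \<open>\<pi>^2\<close>; the prime ramifies and \<open>y\<close> is a uniformizer.\<close>

lemma local_valuation_split:
  assumes s: "s \<in> cA" and Ds: "D (s .* s .- f)"
  shows "local_valuation R Rg (msplit s) (if D s then y else \<iota> \<pi>)"
proof -
  \<comment> \<open>Reduction with \<open>y\<close> sent to \<open>s\<close> is multiplicative
    modulo \<open>\<pi>\<close>: the two sides differ by a multiple of
    \<open>s^2 - f\<close>.\<close>
  have mm: "D ((u .* u' .+ f .* (v .* v')) .+ (u .* v' .+ v .* u') .* s)
      \<longleftrightarrow> D ((u .+ v .* s) .* (u' .+ v' .* s))"
    if c: "u \<in> cA" "v \<in> cA" "u' \<in> cA" "v' \<in> cA" for u v u' v'
  proof (rule D_cong)
    have fc: "f \<in> cA" by simp
    have "((u .* u' .+ f .* (v .* v')) .+ (u .* v' .+ v .* u') .* s)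
      .- ((u .+ v .* s) .* (u' .+ v' .* s)) .- (.~ (v .* v')) .* (s .* s .- f) = zA"
      using c s fc by algebra
    then have "((u .* u' .+ f .* (v .* v')) .+ (u .* v' .+ v .* u') .* s)
      .- ((u .+ v .* s) .* (u' .+ v' .* s)) = (.~ (v .* v')) .* (s .* s .- f)"
      using c s by (subst (asm) A.r_right_minus_eq) auto
    moreover have "D ((.~ (v .* v')) .* (s .* s .- f))" by (rule D_mult2) (use c s Ds in auto)
    ultimately show "D ((u .* u' .+ f .* (v .* v')) .+ (u .* v' .+ v .* u') .* s
      .- (u .+ v .* s) .* (u' .+ v' .* s))" by simp
  qed (use c s in auto)
  have Dfs: "D f \<longleftrightarrow> D s"
  proof -
    have "D (s .* s) \<longleftrightarrow> D f" by (rule D_cong) (use s Ds in auto)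
    then show ?thesis using D_prime[OF s s] D_mult[OF s s] by auto
  qed
  let ?\<tau> = "if D s then y else \<iota> \<pi>"
  have fct: "\<exists>n::nat. \<exists>a\<in>Rg - msplit s. \<exists>b\<in>Rg - msplit s. x \<otimes> b = ?\<tau> [^] n \<otimes> a" if x: "x \<in> Rg" "x \<noteq> \<zero>" for x
  proof -
    obtain u v where uv: "u \<in> cA" "v \<in> cA" "x = el u v" using RgE[OF x(1)] .
    then have "\<not> (u = zA \<and> v = zA)" using x el_zero_iff by auto
    then obtain n :: nat and u0 v0 where h: "u0 \<in> cA" "v0 \<in> cA" "u = \<pi> .^ n .* u0"
      "v = \<pi> .^ n .* v0" "\<not> (D u0 \<and> D v0)" using pair_factor[OF uv(1,2)] by blast
    have xe: "x = \<iota> \<pi> [^] n \<otimes> el u0 v0" using uv h el_scale[OF h(1,2) \<pi>_pow(1)[of n]] by (simp add: I.hom_nat_pow)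
    have e0: "el u0 v0 \<in> carrier R" "el u0 v0 \<in> Rg" using h RgI by auto
    have one: "\<one> \<in> Rg - msplit s"
      using msplit_iff[of "oA" "zA" s] D_one RgI[of "oA" "zA"] s by (simp add: el_def)
    have pc: "\<iota> \<pi> [^] n \<in> carrier R" by simp
    show ?thesis
    proof (cases "D s")
      case False
      then have \<tau>: "?\<tau> = \<iota> \<pi>" by simp
      show ?thesis
      proof (cases "el u0 v0 \<in> msplit s")
        case F: False
        then have "x \<otimes> \<one> = ?\<tau> [^] n \<otimes> el u0 v0" using xe e0 \<tau> by simp
        then show ?thesis using F e0 one by blast
      next
        case True
        then have D1: "D (u0 .+ v0 .* s)" using msplit_iff h by blast
        \<comment> \<open>The conjugate stays outside the ideal: otherwise \<open>\<pi>\<close>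
          would divide \<open>2 u0\<close> and then \<open>v0 s\<close>, hence both coordinates.
          Multiplication by it leaves the norm, an element of \<open>A\<close> from which the power
          of \<open>\<pi>\<close> can be split off.\<close>
        let ?c = "el u0 (.~ v0)"
        have cn: "?c \<notin> msplit s"
        proof
          assume "?c \<in> msplit s"
          then have D2: "D (u0 .+ .~ v0 .* s)" using msplit_iff h by simp
          have "D ((u0 .+ v0 .* s) .+ (u0 .+ .~ v0 .* s))" by (rule D_add[OF _ _ D1 D2]) (use h s in auto)
          moreover have "(u0 .+ v0 .* s) .+ (u0 .+ .~ v0 .* s) .- (u0 .+ u0) = zA" using h(1,2) s by algebra
          ultimately have "D (u0 .+ u0)" using h s by (subst (asm) A.r_right_minus_eq) auto
          then have Du: "D u0" using D_double h by blast
          have "D (v0 .* s)"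
          proof -
            have "D ((u0 .+ v0 .* s) .- u0)" by (rule D_minus[OF _ _ D1 Du]) (use h s in auto)
            moreover have "(u0 .+ v0 .* s) .- u0 .- v0 .* s = zA" using h(1,2) s by algebra
            ultimately show ?thesis using h s by (subst (asm) A.r_right_minus_eq) auto
          qed
          then have "D v0" using D_prime[OF h(2) s] False by blast
          then show False using Du h by blast
        qed
        have cR: "?c \<in> Rg" "?c \<in> carrier R" using h RgI by auto
        let ?N = "u0 .* u0 .+ f .* (v0 .* .~ v0)"
        have Nc: "?N \<in> cA" using h by simp
        have "u0 .* .~ v0 .+ v0 .* u0 = zA" using h by (simp add: A.r_minus A.m_comm A.l_neg)
        then have pr: "el u0 v0 \<otimes> ?c = \<iota> ?N" using el_mult[of u0 v0 u0 ".~ v0"] h \<iota>_el[OF Nc] by simp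
        have "el u0 v0 \<noteq> \<zero>" using el_zero_iff[OF h(1,2)] h(5) by auto
        moreover have "?c \<noteq> \<zero>" using cn msplit_iff[of "zA" "zA" s] s by (auto simp: el_def)
        ultimately have "\<iota> ?N \<noteq> \<zero>" using pr e0 cR integral by metis
        then have "?N \<noteq> zA" by auto
        then obtain k :: nat and N0 where k: "N0 \<in> cA" "?N = \<pi> .^ k .* N0" "\<not> D N0"
          using single_factor[OF Nc] by blast
        have "x \<otimes> ?c = \<iota> \<pi> [^] n \<otimes> (el u0 v0 \<otimes> ?c)" using xe pc e0 cR by (simp add: m_assoc)
        also have "\<dots> = \<iota> \<pi> [^] n \<otimes> (\<iota> \<pi> [^] k \<otimes> \<iota> N0)" unfolding pr k(2) using k(1) by (simp add: I.hom_nat_pow)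
        also have "\<dots> = ?\<tau> [^] (n + k) \<otimes> \<iota> N0" using \<tau> k(1) by (simp add: nat_pow_mult [symmetric] m_assoc)
        finally have "x \<otimes> ?c = ?\<tau> [^] (n + k) \<otimes> \<iota> N0" .
        moreover have "\<iota> N0 \<in> Rg - msplit s"
          using \<iota>_el[OF k(1)] msplit_iff[OF k(1), of "zA" s] RgI[OF k(1), of "zA"] k s by simp
        ultimately show ?thesis using cn cR by blast
      qed
    next
      case True
      then have \<tau>: "?\<tau> = y" by simp
      obtain g where g: "g \<in> cA" "f = \<pi> .* g" "\<not> D g" using D_f_pi Dfs True by blast
      have gm: "\<iota> c \<in> Rg - msplit s" if "c \<in> cA" "\<not> D c" for c
        using \<iota>_el[OF that(1)] msplit_iff[OF that(1), of "zA" s] RgI[OF that(1), of "zA"] that s by simp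
      have gpow: "g .^ (j::nat) \<in> cA" "\<not> D (g .^ j)" for j
      proof -
        show "g .^ j \<in> cA" using g by simp
        show "\<not> D (g .^ j)"
        proof (induction j)
          case (Suc j)
          then show ?case using D_prime[of "g .^ j" g] g by auto
        qed (simp add: D_one)
      qed
      \<comment> \<open>In the ramified case \<open>\<pi> g = y^2\<close> with \<open>g\<close> a
        unit of the localisation, so \<open>\<pi>^n\<close> counts as \<open>y^(2n)\<close>. What is
        left has valuation 0 or 1 according to whether \<open>\<pi>\<close> divides
        \<open>u0\<close>.\<close>
      have yy: "\<iota> \<pi> \<otimes> \<iota> g = y \<otimes> y" using y_sq g by simp
      have piy: "\<iota> \<pi> [^] n \<otimes> \<iota> (g .^ n) = y [^] (2 * n)"
      proof -
        have "\<iota> \<pi> [^] n \<otimes> \<iota> (g .^ n) = (\<iota> \<pi> \<otimes> \<iota> g) [^] n" using g by (simp add: nat_pow_distrib I.hom_nat_pow)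
        also have "\<dots> = (y [^] (2::nat)) [^] n" unfolding yy by (simp add: power2_eq_square)
        finally show ?thesis by (simp add: nat_pow_pow)
      qed
      let ?G = "\<iota> (g .^ n)"
      have G: "?G \<in> Rg - msplit s" "?G \<in> carrier R" using gm gpow by auto
      have xG: "x \<otimes> ?G = y [^] (2 * n) \<otimes> el u0 v0"
      proof -
        have "x \<otimes> ?G = (\<iota> \<pi> [^] n \<otimes> ?G) \<otimes> el u0 v0" using xe pc e0 G by (simp add: m_ac)
        then show ?thesis by (simp only: piy)
      qed
      show ?thesis
      proof (cases "D u0")
        case F: False
        have "\<not> D (u0 .+ v0 .* s)"
        proof -
          have "D (u0 .+ v0 .* s) \<longleftrightarrow> D u0"
          proof (rule D_cong)
            have "(u0 .+ v0 .* s) .- u0 .- v0 .* s = zA" using h(1,2) s by algebra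
            then have "(u0 .+ v0 .* s) .- u0 = v0 .* s" using h s by (subst (asm) A.r_right_minus_eq) auto
            then show "D ((u0 .+ v0 .* s) .- u0)" using D_mult2[OF s h(2) True] by simp
          qed (use h s in auto)
          then show ?thesis using F by simp
        qed
        then have "el u0 v0 \<in> Rg - msplit s" using msplit_iff h e0 by blast
        then show ?thesis using xG G \<tau> by auto
      next
        case Du: True
        then have nv: "\<not> D v0" using h by blast
        obtain u1 where u1: "u1 \<in> cA" "u0 = \<pi> .* u1" using DE[OF Du h(1)] .
        \<comment> \<open>With \<open>u0 = \<pi> u1\<close>, multiplying \<open>u0 + v0 y\<close> by
          \<open>g\<close> produces \<open>f u1 + g v0 y\<close>, from which one factor
          \<open>y\<close> comes out. The cofactor \<open>?w\<close> is a unit because neither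
          \<open>g\<close> nor \<open>v0\<close> is divisible by \<open>\<pi>\<close>.\<close>
        let ?w = "el (g .* v0) u1"
        have "el u0 v0 \<otimes> \<iota> g = y \<otimes> ?w"
        proof -
          have "el u0 v0 \<otimes> \<iota> g = el (u0 .* g) (v0 .* g)"
            using el_mult[of u0 v0 g "zA"] h g \<iota>_el[OF g(1)] by simp
          moreover have "u0 .* g = f .* u1" unfolding u1(2) g(2) using u1 g by (simp add: A.m_ac)
          moreover have "y \<otimes> ?w = el (f .* u1) (g .* v0)"
            using el_mult[of "zA" "oA" "g .* v0" u1] y_el u1 g h by simp
          ultimately show ?thesis using h g by (simp add: A.m_comm)
        qed
        moreover have wc: "?w \<in> Rg" "?w \<in> carrier R" using u1 g h RgI by auto
        ultimately have e: "x \<otimes> (?G \<otimes> \<iota> g) = y [^] (2 * n + 1) \<otimes> ?w"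
        proof -
          assume w: "el u0 v0 \<otimes> \<iota> g = y \<otimes> ?w"
          have gc: "\<iota> g \<in> carrier R" using g by simp
          have xc: "x \<in> carrier R" using uv by simp
          have "x \<otimes> (?G \<otimes> \<iota> g) = (x \<otimes> ?G) \<otimes> \<iota> g" using xc G gc by (simp add: m_assoc)
          also have "\<dots> = y [^] (2 * n) \<otimes> (el u0 v0 \<otimes> \<iota> g)" unfolding xG using e0 gc by (simp add: m_assoc)
          also have "\<dots> = y [^] (2 * n + 1) \<otimes> ?w" unfolding w using wc by (simp add: m_assoc)
          finally show ?thesis .
        qed
        have "?w \<notin> msplit s"
        proof
          assume "?w \<in> msplit s"
          then have "D (g .* v0 .+ u1 .* s)" using msplit_iff u1 g h by simp
          moreover have "D (u1 .* s)" using D_mult2[OF s u1(1) True] .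
          ultimately have "D ((g .* v0 .+ u1 .* s) .- u1 .* s)" by (intro D_minus) (use u1 g h s in auto)
          moreover have "(g .* v0 .+ u1 .* s) .- u1 .* s .- g .* v0 = zA" using u1(1) g(1) h(2) s by algebra
          ultimately have "D (g .* v0)" using u1 g h s by (subst (asm) A.r_right_minus_eq) auto
          then show False using D_prime g h nv by blast
        qed
        moreover have "?G \<otimes> \<iota> g \<in> Rg - msplit s"
        proof -
          have "?G \<otimes> \<iota> g = \<iota> (g .^ Suc n)" using g by simp
          then show ?thesis using gm gpow by metis
        qed
        moreover have "x \<otimes> (?G \<otimes> \<iota> g) = ?\<tau> [^] (2 * n + 1) \<otimes> ?w" using e by (simp only: \<tau>)
        ultimately show ?thesis using wc by blast
      qed
    qed
  qed
  show ?thesis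
  proof (intro local_valuation.intro local_valuation_axioms.intro field_axioms)
    show "subring Rg R" by (rule Rg_subring)
    show "msplit s \<subseteq> Rg" using RgI by (auto simp: msplit_def)
    show "\<zero> \<in> msplit s" using msplit_iff[of "zA" "zA" s] s by (simp add: el_def)
    show "\<one> \<notin> msplit s" using msplit_iff[of "oA" "zA" s] s D_one by (simp add: el_def)
    fix x z assume "x \<in> msplit s" "z \<in> msplit s"
    then obtain u v u' v' where c: "u \<in> cA" "v \<in> cA" "u' \<in> cA" "v' \<in> cA"
      and d: "D (u .+ v .* s)" "D (u' .+ v' .* s)" and xz: "x = el u v" "z = el u' v'"
      by (auto simp: msplit_def)
    have "D ((u .+ v .* s) .+ (u' .+ v' .* s))" by (rule D_add[OF _ _ d]) (use c s in auto)
    then show "x \<oplus> z \<in> msplit s"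
      unfolding xz el_add[OF c] using msplit_iff c A.quad_add_expand(1)[OF c s] by simp
  next
    fix x z assume "x \<in> Rg" "z \<in> msplit s"
    then obtain u v u' v' where c: "u \<in> cA" "v \<in> cA" "u' \<in> cA" "v' \<in> cA"
      and d: "D (u' .+ v' .* s)" and xz: "x = el u v" "z = el u' v'"
      by (auto simp: msplit_def Rg_def)
    have "D ((u .+ v .* s) .* (u' .+ v' .* s))" by (rule D_mult2[OF _ _ d]) (use c s in auto)
    then show "x \<otimes> z \<in> msplit s" unfolding xz el_mult[OF c] using msplit_iff c mm[OF c] by simp
  next
    fix x assume x: "x \<in> Rg" "x \<notin> msplit s"
    obtain u v where uv: "u \<in> cA" "v \<in> cA" "x = el u v" using RgE[OF x(1)] .
    let ?c = "u .+ v .* s"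
    have "\<not> D ?c" using x uv msplit_iff by blast
    then obtain w where w: "w \<in> cA" "D (?c .* w .- oA)" using inv_mod[of ?c] uv s by (auto simp: D_def)
    have "x \<otimes> \<iota> w \<ominus> \<one> = el (u .* w .- oA) (v .* w)"
    proof -
      have "x \<otimes> \<iota> w = el (u .* w) (v .* w)" using el_mult[of u v w "zA"] uv w \<iota>_el[OF w(1)] by simp
      moreover have "\<one> = el oA zA" by (simp add: el_def)
      ultimately show ?thesis using el_minus[of "u .* w" "v .* w" "oA" "zA"] uv w by (simp add: a_minus_def)
    qed
    moreover have "el (u .* w .- oA) (v .* w) \<in> msplit s"
    proof -
      have "(u .* w .- oA) .+ (v .* w) .* s .- ((u .+ v .* s) .* w .- oA) = zA"
        using uv(1,2) w(1) s by algebra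
      then have "D ((u .* w .- oA) .+ (v .* w) .* s)" using w uv s by (subst (asm) A.r_right_minus_eq) auto
      then show ?thesis using msplit_iff uv w by simp
    qed
    moreover have "\<iota> w \<in> Rg" using \<iota>_el[OF w(1)] RgI w by simp
    ultimately show "\<exists>b'\<in>Rg. x \<otimes> b' \<ominus> \<one> \<in> msplit s" by metis
  next
    fix z assume "z \<in> carrier R"
    then show "\<exists>a\<in>Rg. \<exists>b\<in>Rg. b \<noteq> \<zero> \<and> z \<otimes> b = a" by (rule Rg_frac)
  next
    show "?\<tau> \<in> msplit s"
      using msplit_iff[of "zA" "oA" s] msplit_iff[of \<pi> "zA" s] y_el \<iota>_el[OF \<pi>] s DI[of "oA"] by auto
    show "?\<tau> \<noteq> \<zero>" using el_zero_iff[of "zA" "oA"] y_el \<iota>_nz[OF \<pi> \<pi>_nz] by auto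
  qed (use fct in blast)
qed

end

section \<open>Valuation rings above a prime of the base ring\<close>

lemma (in cring) diff_squares:
  assumes c: "x \<in> carrier R" "s \<in> carrier R" shows "(x \<ominus> s) \<otimes> (x \<ominus> \<ominus> s) = \<ominus> (s \<otimes> s \<ominus> x \<otimes> x)"
proof -
  have "(x \<ominus> s) \<otimes> (x \<ominus> \<ominus> s) \<ominus> \<ominus> (s \<otimes> s \<ominus> x \<otimes> x) = \<zero>" using c by algebra
  then show ?thesis using c by (subst (asm) r_right_minus_eq) auto
qed

lemma (in cring) minus_split:
  assumes c: "x \<in> carrier R" "r \<in> carrier R" "t \<in> carrier R" shows "x \<ominus> t = (x \<ominus> r) \<oplus> (r \<ominus> t)"
proof -
  have "x \<ominus> t \<ominus> ((x \<ominus> r) \<oplus> (r \<ominus> t)) = \<zero>" using c by algebra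
  then show ?thesis using c by (subst (asm) r_right_minus_eq) auto
qed

lemma (in cring) quad_shift:
  assumes c: "u \<in> carrier R" "v \<in> carrier R" "t \<in> carrier R" "x \<in> carrier R"
  shows "u \<oplus> v \<otimes> x = (u \<oplus> v \<otimes> t) \<oplus> v \<otimes> (x \<ominus> t)" "u \<oplus> v \<otimes> t = (u \<oplus> v \<otimes> x) \<oplus> \<ominus> (v \<otimes> (x \<ominus> t))"
proof -
  have "(u \<oplus> v \<otimes> x) \<ominus> ((u \<oplus> v \<otimes> t) \<oplus> v \<otimes> (x \<ominus> t)) = \<zero>" "(u \<oplus> v \<otimes> t) \<ominus> ((u \<oplus> v \<otimes> x) \<oplus> \<ominus> (v \<otimes> (x \<ominus> t))) = \<zero>"
    using c by algebra+
  then show "u \<oplus> v \<otimes> x = (u \<oplus> v \<otimes> t) \<oplus> v \<otimes> (x \<ominus> t)" "u \<oplus> v \<otimes> t = (u \<oplus> v \<otimes> x) \<oplus> \<ominus> (v \<otimes> (x \<ominus> t))"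
    using c by (auto simp: r_right_minus_eq)
qed

context field begin

lemma nonunits_closed:
  assumes V: "valuation_ring R C V"
  shows "x \<in> nonunits V \<Longrightarrow> x \<in> V" "x \<in> nonunits V \<Longrightarrow> x' \<in> nonunits V \<Longrightarrow> x \<oplus> x' \<in> nonunits V"
    and "z \<in> V \<Longrightarrow> x \<in> nonunits V \<Longrightarrow> z \<otimes> x \<in> nonunits V" "z \<in> V \<Longrightarrow> x \<in> nonunits V \<Longrightarrow> x \<otimes> z \<in> nonunits V"
    and "\<zero> \<in> nonunits V" "x \<in> nonunits V \<Longrightarrow> \<ominus> x \<in> nonunits V"
proof -
  note VD = valuation_ringD[OF V]
  interpret N: ideal "nonunits V" "R\<lparr>carrier := V\<rparr>" by (rule nonunits_ideal(1)[OF V])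
  show "x \<in> nonunits V \<Longrightarrow> x \<in> V" for x by (simp add: nonunits_def)
  show "x \<in> nonunits V \<Longrightarrow> x' \<in> nonunits V \<Longrightarrow> x \<oplus> x' \<in> nonunits V" using additive_subgroup.a_closed[OF N.additive_subgroup_axioms, of x x'] by simp
  show m: "z \<in> V \<Longrightarrow> x \<in> nonunits V \<Longrightarrow> z \<otimes> x \<in> nonunits V" for x z using N.I_l_closed[of x z] by simp
  show "z \<in> V \<Longrightarrow> x \<in> nonunits V \<Longrightarrow> x \<otimes> z \<in> nonunits V" using N.I_r_closed[of x z] by simp
  show "\<zero> \<in> nonunits V" using additive_subgroup.zero_closed[OF N.additive_subgroup_axioms] by simp
  assume x: "x \<in> nonunits V"
  then have xc: "x \<in> carrier R" using VD(3) by (auto simp: nonunits_def)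
  have "\<ominus> \<one> \<in> V" using subringE(3,5)[OF VD(1)] by auto
  from m[OF this x] show "\<ominus> x \<in> nonunits V" using xc by (simp add: l_minus)
qed

lemma nonunits_prime:
  assumes V: "valuation_ring R C V" and x: "x \<in> V" "z \<in> V" "x \<otimes> z \<in> nonunits V"
  shows "x \<in> nonunits V \<or> z \<in> nonunits V"
proof (rule ccontr)
  assume n: "\<not> ?thesis"
  then have "inv x \<in> V" "x \<noteq> \<zero>" using x by (auto simp: nonunits_def)
  then have "inv x \<otimes> (x \<otimes> z) \<in> nonunits V" using nonunits_closed(3)[OF V] x by simp
  moreover have "x \<in> carrier R" "z \<in> carrier R" using x valuation_ringD(3)[OF V] by auto
  ultimately show False using n \<open>x \<noteq> \<zero>\<close> by (simp add: m_assoc [symmetric])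
qed

text \<open>A case of integral closedness: if the inverse of \<open>z\<close> is in the ring, then
  so is \<open>z = z^2 (1/z)\<close>. It puts \<open>y\<close> into every valuation ring that
  contains \<open>f\<close>.\<close>

lemma valuation_ring_sqrt:
  assumes V: "valuation_ring R C V" and z: "z \<in> carrier R" "z \<otimes> z \<in> V" shows "z \<in> V"
proof (rule ccontr)
  note VD = valuation_ringD[OF V]
  assume n: "z \<notin> V"
  then have z0: "z \<noteq> \<zero>" using subringE(2)[OF VD(1)] by auto
  then have "inv z \<in> V" using VD(5)[OF z(1)] n by blast
  then have "(z \<otimes> z) \<otimes> inv z \<in> V" using subringE(6)[OF VD(1)] z by blast
  then show False using n z z0 by (simp add: m_assoc)
qed

end

context quad_place begin

text \<open>If \<open>\<pi>\<close> divided the norm but not \<open>v\<close>, dividing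
  \<open>u\<close> by \<open>v\<close> modulo \<open>\<pi>\<close> would give a square root of
  \<open>f\<close>. Once \<open>v\<close> is divisible, so is \<open>u^2\<close>.\<close>

lemma D_norm:
  assumes nr: "\<And>s. s \<in> cA \<Longrightarrow> \<not> D (s .* s .- f)" and c: "u \<in> cA" "v \<in> cA"
    and d: "D (u .* u .- f .* (v .* v))"
  shows "D u \<and> D v"
proof -
  have fc: "f \<in> cA" by simp
  have "D v"
  proof (rule ccontr)
    assume "\<not> D v"
    then obtain w where w: "w \<in> cA" "D (v .* w .- oA)" using inv_mod[OF c(2)] by (auto simp: D_def)
    let ?e = "(w .* w) .* (u .* u .- f .* (v .* v)) .+ (f .* (v .* w .+ oA)) .* (v .* w .- oA)"
    have "D ?e" by (rule D_add[OF _ _ D_mult2 D_mult2]) (use c w d in auto)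
    moreover have "(u .* w) .* (u .* w) .- f .- ?e = zA" using c w(1) fc by algebra
    ultimately have "D ((u .* w) .* (u .* w) .- f)" using c w by (subst (asm) A.r_right_minus_eq) auto
    then show False using nr[of "u .* w"] c w by simp
  qed
  moreover have "D (u .* u) \<longleftrightarrow> D (f .* (v .* v))" by (rule D_cong) (use c d in auto)
  moreover have "D (f .* (v .* v))" using \<open>D v\<close> c by (intro D_mult2) auto
  ultimately show ?thesis using D_prime[OF c(1) c(1)] by blast
qed

lemma el_conj:
  assumes c: "u \<in> cA" "v \<in> cA" "w \<in> cA"
  shows "el u v \<otimes> el (u .* w) (.~ (v .* w)) = \<iota> ((u .* u .- f .* (v .* v)) .* w)"
proof -
  have fc: "f \<in> cA" by simp
  have "u .* .~ (v .* w) .+ v .* (u .* w) = zA" using c by algebra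
  moreover have "u .* (u .* w) .+ f .* (v .* .~ (v .* w)) .- (u .* u .- f .* (v .* v)) .* w = zA"
    using c fc by algebra
  then have "u .* (u .* w) .+ f .* (v .* .~ (v .* w)) = (u .* u .- f .* (v .* v)) .* w"
    using c by (subst (asm) A.r_right_minus_eq) auto
  ultimately show ?thesis
    using el_mult[of u v "u .* w" ".~ (v .* w)"] c \<iota>_el[of "(u .* u .- f .* (v .* v)) .* w"] by simp
qed

text \<open>An element outside the ideal has a norm prime to \<open>\<pi>\<close>. Its conjugate
  divided by that norm is an inverse modulo the ideal, and \<open>\<pi>\<close> remains a
  uniformizer.\<close>

lemma local_valuation_inert:
  assumes nr: "\<And>s. s \<in> cA \<Longrightarrow> \<not> D (s .* s .- f)"
  shows "local_valuation R Rg minert (\<iota> \<pi>)"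
proof (intro local_valuation.intro local_valuation_axioms.intro field_axioms)
  show "subring Rg R" by (rule Rg_subring)
  show "minert \<subseteq> Rg" using RgI by (auto simp: minert_def)
  show "\<zero> \<in> minert" using minert_iff[of "zA" "zA"] by (simp add: el_def)
  show one: "\<one> \<notin> minert" using minert_iff[of "oA" "zA"] D_one by (simp add: el_def)
  fix x z assume "x \<in> minert" "z \<in> minert"
  then obtain u v u' v' where c: "u \<in> cA" "v \<in> cA" "u' \<in> cA" "v' \<in> cA"
    and d: "D u" "D v" "D u'" "D v'" and xz: "x = el u v" "z = el u' v'"
    by (auto simp: minert_def)
  show "x \<oplus> z \<in> minert" unfolding xz el_add[OF c] using minert_iff c D_add d by simp
next
  fix x z assume "x \<in> Rg" "z \<in> minert"
  then obtain u v u' v' where c: "u \<in> cA" "v \<in> cA" "u' \<in> cA" "v' \<in> cA"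
    and d: "D u'" "D v'" and xz: "x = el u v" "z = el u' v'"
    by (auto simp: minert_def Rg_def)
  have "D (u .* u' .+ f .* (v .* v'))" "D (u .* v' .+ v .* u')"
    using c d by (auto intro!: D_add D_mult2)
  then show "x \<otimes> z \<in> minert" unfolding xz el_mult[OF c] using minert_iff c by simp
next
  fix x assume x: "x \<in> Rg" "x \<notin> minert"
  obtain u v where uv: "u \<in> cA" "v \<in> cA" "x = el u v" using RgE[OF x(1)] .
  let ?N = "u .* u .- f .* (v .* v)"
  have Nc: "?N \<in> cA" using uv by simp
  have "\<not> D ?N" using D_norm[OF nr uv(1,2)] x uv minert_iff by blast
  then obtain w where w: "w \<in> cA" "D (?N .* w .- oA)" using inv_mod[OF Nc] by (auto simp: D_def)
  let ?b = "el (u .* w) (.~ (v .* w))"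
  have Nw: "?N .* w \<in> cA" using Nc w by simp
  have "x \<otimes> ?b = \<iota> (?N .* w)" using el_conj[OF uv(1,2) w(1)] uv(3) by simp
  then have "x \<otimes> ?b \<ominus> \<one> = \<iota> (?N .* w .- oA)" using Nw by (simp only: a_minus_def) simp
  also have "\<dots> = el (?N .* w .- oA) zA" using Nw by (intro \<iota>_el) simp
  also have "\<dots> \<in> minert" using Nw w minert_iff by simp
  finally show "\<exists>b'\<in>Rg. x \<otimes> b' \<ominus> \<one> \<in> minert" using RgI[of "u .* w" ".~ (v .* w)"] uv w by auto
next
  fix z assume "z \<in> carrier R"
  then show "\<exists>a\<in>Rg. \<exists>b\<in>Rg. b \<noteq> \<zero> \<and> z \<otimes> b = a" by (rule Rg_frac)
next
  show "\<iota> \<pi> \<in> minert" using minert_iff[of \<pi> "zA"] \<iota>_el[OF \<pi>] DI[of "oA"] by simp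
  show "\<iota> \<pi> \<noteq> \<zero>" using \<iota>_nz[OF \<pi> \<pi>_nz] .
next
  fix x assume x: "x \<in> Rg" "x \<noteq> \<zero>"
  obtain u v where uv: "u \<in> cA" "v \<in> cA" "x = el u v" using RgE[OF x(1)] .
  then have "\<not> (u = zA \<and> v = zA)" using x el_zero_iff by auto
  then obtain n :: nat and u0 v0 where h: "u0 \<in> cA" "v0 \<in> cA" "u = \<pi> .^ n .* u0"
    "v = \<pi> .^ n .* v0" "\<not> (D u0 \<and> D v0)" using pair_factor[OF uv(1,2)] by blast
  have "x \<otimes> \<one> = \<iota> \<pi> [^] n \<otimes> el u0 v0" using uv h el_scale[OF h(1,2) \<pi>_pow(1)[of n]] by (simp add: I.hom_nat_pow)
  moreover have "el u0 v0 \<in> Rg - minert" using minert_iff h RgI by blast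
  moreover have "\<one> \<in> Rg - minert"
    using minert_iff[of "oA" "zA"] D_one RgI[of "oA" "zA"] by (simp add: el_def)
  ultimately show "\<exists>n::nat. \<exists>a\<in>Rg - minert. \<exists>b\<in>Rg - minert. x \<otimes> b = \<iota> \<pi> [^] n \<otimes> a" by blast
qed

abbreviation "Vsplit s \<equiv> local_valuation.loc R Rg (msplit s)"
abbreviation "Vinert \<equiv> local_valuation.loc R Rg minert"

text \<open>\<open>valuation_ring\<close> asks for a strict inclusion of the constants. Linear
  independence of 1 and \<open>y\<close> over \<open>A\<close> keeps \<open>y\<close> out of the
  image of \<open>A\<close>.\<close>

lemma psubset_Rg: assumes "C \<subseteq> \<iota> ` cA" shows "C \<subset> Rg"
proof -
  have "\<iota> ` cA \<subseteq> Rg" using RgI[of _ "zA"] \<iota>_el by auto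
  moreover have "y \<in> Rg" using RgI[of "zA" "oA"] y_el by simp
  moreover have "y \<notin> \<iota> ` cA"
  proof
    assume "y \<in> \<iota> ` cA"
    then obtain u where "u \<in> cA" "el zA oA = el u zA" using y_el \<iota>_el by auto
    then show False using el_inj[of "zA" "oA" u "zA"] by simp
  qed
  ultimately show ?thesis using assms by blast
qed

lemma \<iota>_inj: "inj_on \<iota> (cA)"
proof (rule inj_onI)
  fix u u' assume "u \<in> cA" "u' \<in> cA" "\<iota> u = \<iota> u'"
  then show "u = u'" using el_inj[of u "zA" u' "zA"] \<iota>_el by simp
qed

text \<open>At this place \<open>y\<close> is congruent to \<open>s\<close>, so the residues of
  \<open>A\<close> modulo \<open>\<pi>\<close> already represent everything.\<close>

lemma card_residue_split:
  assumes C: "C \<subseteq> \<iota> ` cA" and s: "s \<in> cA" and Ds: "D (s .* s .- f)"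
  shows "card (carrier (R\<lparr>carrier := Vsplit s\<rparr> Quot nonunits (Vsplit s))) = card T0"
proof -
  interpret L: local_valuation R Rg "msplit s" "if D s then y else \<iota> \<pi>" by (rule local_valuation_split[OF s Ds])
  have tc: "t \<in> cA" if "t \<in> T0" for t using that T0 by auto
  have "card (carrier (R\<lparr>carrier := L.loc\<rparr> Quot nonunits L.loc)) = card (\<iota> ` T0)"
  proof (rule L.residue_transversal[OF psubset_Rg[OF C]])
    show "\<iota> ` T0 \<subseteq> Rg" using RgI[of _ "zA"] \<iota>_el tc by auto
    fix z assume "z \<in> Rg"
    then obtain u v where uv: "u \<in> cA" "v \<in> cA" "z = el u v" using RgE by blast
    obtain x where x: "x \<in> T0" "D (u .+ v .* s .- x)" using T0_ex[of "u .+ v .* s"] uv s by (auto simp: D_def)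
    note xc = tc[OF x(1)]
    have "z \<ominus> \<iota> x = el (u .- x) v" using el_minus[OF uv(1,2) xc A.zero_closed] uv \<iota>_el[OF xc] by (simp add: a_minus_def)
    moreover have "(u .- x) .+ v .* s = u .+ v .* s .- x" using uv xc s by (simp add: a_minus_def A.a_ac)
    ultimately have "z \<ominus> \<iota> x \<in> msplit s" using msplit_iff[of "u .- x" v s] uv xc x by simp
    then show "\<exists>x\<in>\<iota> ` T0. z \<ominus> x \<in> msplit s" using x by blast
  next
    fix z z' assume "z \<in> \<iota> ` T0" "z' \<in> \<iota> ` T0" and m: "z \<ominus> z' \<in> msplit s"
    then obtain x x' where x: "x \<in> T0" "x' \<in> T0" "z = \<iota> x" "z' = \<iota> x'" by auto
    note xc = tc[OF x(1)] tc[OF x(2)]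
    have "z \<ominus> z' = el (x .- x') zA" using x xc \<iota>_el[of "x .- x'"] by (simp add: a_minus_def)
    then have "D (x .- x')" using m msplit_iff[of "x .- x'" "zA" s] xc s by simp
    then show "z = z'" using T0_un[OF x(1,2)] x by (simp add: D_def)
  qed
  also have "\<dots> = card T0" using \<iota>_inj T0 by (intro card_image) (rule inj_on_subset)
  finally show ?thesis .
qed

text \<open>Here both coordinates of \<open>u + v y\<close> are independent modulo
  \<open>\<pi>\<close>, so the residue field is quadratic over that of \<open>\<pi>\<close>.\<close>

lemma card_residue_inert:
  assumes C: "C \<subseteq> \<iota> ` cA" and nr: "\<And>s. s \<in> cA \<Longrightarrow> \<not> D (s .* s .- f)"
  shows "card (carrier (R\<lparr>carrier := Vinert\<rparr> Quot nonunits Vinert)) = card T0 ^ 2"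
proof -
  interpret L: local_valuation R Rg minert "\<iota> \<pi>" by (rule local_valuation_inert[OF nr])
  have tc: "t \<in> cA" if "t \<in> T0" for t using that T0 by auto
  let ?T = "(\<lambda>(u, v). el u v) ` (T0 \<times> T0)"
  have "card (carrier (R\<lparr>carrier := L.loc\<rparr> Quot nonunits L.loc)) = card ?T"
  proof (rule L.residue_transversal[OF psubset_Rg[OF C]])
    show "?T \<subseteq> Rg" using RgI tc by auto
    fix z assume "z \<in> Rg"
    then obtain u v where uv: "u \<in> cA" "v \<in> cA" "z = el u v" using RgE by blast
    obtain x where x: "x \<in> T0" "D (u .- x)" using T0_ex[of u] uv by (auto simp: D_def)
    obtain x' where x': "x' \<in> T0" "D (v .- x')" using T0_ex[of v] uv by (auto simp: D_def)
    have "z \<ominus> el x x' \<in> minert"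
      using el_minus[OF uv(1,2) tc[OF x(1)] tc[OF x'(1)]] uv x x' minert_iff[of "u .- x" "v .- x'"] tc by simp
    then show "\<exists>x\<in>?T. z \<ominus> x \<in> minert" using x x' by blast
  next
    fix z z' assume "z \<in> ?T" "z' \<in> ?T" and m: "z \<ominus> z' \<in> minert"
    then obtain u v u' v' where x: "u \<in> T0" "v \<in> T0" "u' \<in> T0" "v' \<in> T0" "z = el u v" "z' = el u' v'" by auto
    have "D (u .- u')" "D (v .- v')"
      using m el_minus[of u v u' v'] x tc minert_iff[of "u .- u'" "v .- v'"] by auto
    then show "z = z'" using T0_un[OF x(1,3)] T0_un[OF x(2,4)] x by (simp add: D_def)
  qed
  also have "\<dots> = card (T0 \<times> T0)"
  proof (intro card_image inj_onI)
    fix z z' assume z: "z \<in> T0 \<times> T0" "z' \<in> T0 \<times> T0" "(case z of (u, v) \<Rightarrow> el u v) = (case z' of (u, v) \<Rightarrow> el u v)"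
    show "z = z'" using el_inj[of "fst z" "snd z" "fst z'" "snd z'"] z tc by (auto simp: case_prod_beta prod_eq_iff)
  qed
  finally show ?thesis by (simp add: card_cartesian_product Power.power2_eq_square)
qed

text \<open>An element of \<open>A\<close> prime to \<open>\<pi>\<close> has an inverse modulo
  \<open>\<pi>\<close>. Being a nonunit of \<open>W\<close> as well would put 1 into the maximal
  ideal.\<close>

lemma above_\<pi>:
  assumes W: "valuation_ring R C W" and AW: "\<iota> ` cA \<subseteq> W" and piW: "\<iota> \<pi> \<in> nonunits W"
  shows "y \<in> W" "Rg \<subseteq> W" "u \<in> cA \<Longrightarrow> \<iota> u \<in> nonunits W \<longleftrightarrow> D u"
proof -
  note WD = valuation_ringD[OF W]
  show y: "y \<in> W" using valuation_ring_sqrt[OF W y] AW f unfolding y_sq by blast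
  show "Rg \<subseteq> W" using y subringE(6,7)[OF WD(1)] subsetD[OF AW imageI] by (auto simp: Rg_def el_def)
  show "\<iota> u \<in> nonunits W \<longleftrightarrow> D u" if u: "u \<in> cA"
  proof
    assume "D u"
    then obtain w where "w \<in> cA" "u = \<pi> .* w" using u by (metis DE)
    then show "\<iota> u \<in> nonunits W" using nonunits_closed(4)[OF W] AW piW by auto
  next
    assume uN: "\<iota> u \<in> nonunits W"
    show "D u"
    proof (rule ccontr)
      assume "\<not> D u"
      then obtain w where w: "w \<in> cA" "D (u .* w .- oA)" using inv_mod[OF u] by (auto simp: D_def)
      then obtain c where c: "c \<in> cA" "u .* w .- oA = \<pi> .* c" using u DE[of "u .* w .- oA"] by auto
      have "oA .- (u .* w .+ .~ (u .* w .- oA)) = zA" using u w(1) by algebra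
      then have "oA = u .* w .+ .~ (\<pi> .* c)" unfolding c(2) using u w c by (subst (asm) A.r_right_minus_eq) auto
      then have "\<iota> oA = \<iota> (u .* w .+ .~ (\<pi> .* c))" by simp
      also have "\<dots> = \<iota> u \<otimes> \<iota> w \<oplus> \<ominus> (\<iota> \<pi> \<otimes> \<iota> c)" using u w(1) c(1) by simp
      also have "\<dots> \<in> nonunits W"
        by (intro nonunits_closed(2)[OF W] nonunits_closed(6)[OF W] nonunits_closed(4)[OF W] uN piW subsetD[OF AW imageI] w(1) c(1))
      finally show False using nonunits_ideal(2)[OF W] by simp
    qed
  qed
qed

lemma D_sq_cong:
  assumes c: "r \<in> cA" "t \<in> cA" and d: "D (r .- t)" "D (r .* r .- f)"
  shows "D (t .* t .- f)"
proof -
  have fc: "f \<in> cA" by simp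
  have "D (r .* r .- f) \<longleftrightarrow> D (t .* t .- f)"
  proof (rule D_cong)
    have "(r .* r .- f) .- (t .* t .- f) .- (r .- t) .* (r .+ t) = zA" using c fc by algebra
    then have "(r .* r .- f) .- (t .* t .- f) = (r .- t) .* (r .+ t)"
      using c by (subst (asm) A.r_right_minus_eq) auto
    then show "D ((r .* r .- f) .- (t .* t .- f))" using D_mult[OF _ _ d(1)] c by simp
  qed (use c in auto)
  then show ?thesis using d by simp
qed

text \<open>The product \<open>(y - s)(y + s)\<close> lies in the maximal ideal of \<open>W\<close>,
  which is prime. So \<open>y\<close> is congruent to \<open>s\<close> or \<open>- s\<close> there,
  and this choice determines \<open>W\<close> by \<open>loc_unique\<close>.\<close>

lemma above_split:
  assumes W: "valuation_ring R C W" and AW: "\<iota> ` cA \<subseteq> W" and piW: "\<iota> \<pi> \<in> nonunits W"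
    and s: "s \<in> cA" and Ds: "D (s .* s .- f)"
  shows "\<exists>s\<in>T0. D (s .* s .- f) \<and> W = Vsplit s"
proof -
  note WD = valuation_ringD[OF W] and ab = above_\<pi>[OF W AW piW]
  have iW: "\<iota> u \<in> W" if "u \<in> cA" for u using AW that by auto
  have iN: "\<iota> u \<in> nonunits W" if "u \<in> cA" "D u" for u using ab(3) that by auto
  have ex: "\<exists>s\<in>cA. D (s .* s .- f) \<and> y \<ominus> \<iota> s \<in> nonunits W"
  proof -
    have sc: "\<iota> s \<in> carrier R" "y \<in> carrier R" using s by auto
    have "(y \<ominus> \<iota> s) \<otimes> (y \<ominus> \<ominus> \<iota> s) = \<ominus> \<iota> (s .* s .- f)"
      using diff_squares[OF sc(2,1)] y_sq s by (simp add: a_minus_def)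
    also have "\<dots> \<in> nonunits W" using nonunits_closed(6)[OF W] iN s Ds by simp
    finally have "(y \<ominus> \<iota> s) \<otimes> (y \<ominus> \<ominus> \<iota> s) \<in> nonunits W" .
    moreover have "y \<ominus> \<iota> s \<in> W" "y \<ominus> \<ominus> \<iota> s \<in> W"
      unfolding a_minus_def using ab(1) iW[OF s] subringE(5,7)[OF WD(1)] by auto
    ultimately have "y \<ominus> \<iota> s \<in> nonunits W \<or> y \<ominus> \<iota> (.~ s) \<in> nonunits W"
      using nonunits_prime[OF W] s by simp
    moreover have "(.~ s) .* (.~ s) = s .* s" using s by (simp add: A.l_minus A.r_minus)
    ultimately show ?thesis using s Ds by (metis A.a_inv_closed)
  qed
  then obtain r where r: "r \<in> cA" "D (r .* r .- f)" "y \<ominus> \<iota> r \<in> nonunits W" by blast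
  obtain t where t: "t \<in> T0" "D (r .- t)" using T0_ex[OF r(1)] by (auto simp: D_def)
  have tc: "t \<in> cA" using t T0 by auto
  have Dt: "D (t .* t .- f)" by (rule D_sq_cong[OF r(1) tc t(2) r(2)])
  have yt: "y \<ominus> \<iota> t \<in> nonunits W"
  proof -
    have c: "y \<in> carrier R" "\<iota> r \<in> carrier R" "\<iota> t \<in> carrier R" using r tc by auto
    have "y \<ominus> \<iota> t = (y \<ominus> \<iota> r) \<oplus> (\<iota> r \<ominus> \<iota> t)" by (rule minus_split[OF c])
    also have "\<iota> r \<ominus> \<iota> t = \<iota> (r .- t)" using r tc by (simp add: a_minus_def)
    finally show ?thesis using nonunits_closed(2)[OF W r(3)] iN[OF _ t(2)] r tc by simp
  qed
  interpret L: local_valuation R Rg "msplit t" "if D t then y else \<iota> \<pi>" by (rule local_valuation_split[OF tc Dt])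
  have "W = L.loc"
  proof (rule L.loc_unique[OF W ab(2)])
    fix x assume "x \<in> Rg"
    then obtain u v where uv: "u \<in> cA" "v \<in> cA" "x = el u v" using RgE by blast
    have c: "\<iota> u \<in> carrier R" "\<iota> v \<in> carrier R" "\<iota> t \<in> carrier R" "y \<in> carrier R" using uv tc by auto
    have i: "\<iota> (u .+ v .* t) = \<iota> u \<oplus> \<iota> v \<otimes> \<iota> t" using uv tc by simp
    have e: "x = \<iota> (u .+ v .* t) \<oplus> \<iota> v \<otimes> (y \<ominus> \<iota> t)" "\<iota> (u .+ v .* t) = x \<oplus> \<ominus> (\<iota> v \<otimes> (y \<ominus> \<iota> t))"
      unfolding i uv(3) el_def by (rule quad_shift[OF c])+
    have n: "\<iota> v \<otimes> (y \<ominus> \<iota> t) \<in> nonunits W" using nonunits_closed(3)[OF W] iW uv yt by simp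
    have "x \<in> nonunits W \<longleftrightarrow> \<iota> (u .+ v .* t) \<in> nonunits W"
      using nonunits_closed(2)[OF W _ n] nonunits_closed(2)[OF W _ nonunits_closed(6)[OF W n]] e by metis
    also have "\<dots> \<longleftrightarrow> D (u .+ v .* t)" using ab(3)[of "u .+ v .* t"] uv tc by blast
    finally show "x \<in> nonunits W \<longleftrightarrow> x \<in> msplit t" using msplit_iff uv by simp
  qed
  then show ?thesis using t Dt by blast
qed

lemma above_inert:
  assumes W: "valuation_ring R C W" and AW: "\<iota> ` cA \<subseteq> W" and piW: "\<iota> \<pi> \<in> nonunits W"
    and nr: "\<And>s. s \<in> cA \<Longrightarrow> \<not> D (s .* s .- f)"
  shows "W = Vinert"
proof -
  note WD = valuation_ringD[OF W] and ab = above_\<pi>[OF W AW piW]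
  interpret L: local_valuation R Rg minert "\<iota> \<pi>" by (rule local_valuation_inert[OF nr])
  show ?thesis
  proof (rule L.loc_unique[OF W ab(2)])
    fix x assume "x \<in> Rg"
    then obtain u v where uv: "u \<in> cA" "v \<in> cA" "x = el u v" using RgE by blast
    show "x \<in> nonunits W \<longleftrightarrow> x \<in> minert"
    proof
      assume x: "x \<in> nonunits W"
      let ?c = "el (u .* oA) (.~ (v .* oA))"
      have "?c \<in> W" using ab(2) RgI uv by auto
      then have "x \<otimes> ?c \<in> nonunits W" using nonunits_closed(4)[OF W] x by simp
      then have "\<iota> (u .* u .- f .* (v .* v)) \<in> nonunits W" using el_conj[OF uv(1,2) A.one_closed] uv by simp
      then have "D (u .* u .- f .* (v .* v))" using ab(3) uv by simp
      then show "x \<in> minert" using D_norm[OF nr uv(1,2)] minert_iff uv by simp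
    next
      assume "x \<in> minert"
      then have "\<iota> u \<in> nonunits W" "\<iota> v \<in> nonunits W" using minert_iff uv ab(3) by auto
      then show "x \<in> nonunits W" unfolding uv(3) el_def using nonunits_closed(2,4)[OF W] ab(1) by auto
    qed
  qed
qed

lemma Vsplit_valuation:
  assumes C: "C \<subseteq> \<iota> ` cA" and s: "s \<in> cA" and Ds: "D (s .* s .- f)"
  shows "valuation_ring R C (Vsplit s)" "\<iota> ` cA \<subseteq> Vsplit s" "\<iota> \<pi> \<in> nonunits (Vsplit s)"
proof -
  interpret L: local_valuation R Rg "msplit s" "if D s then y else \<iota> \<pi>" by (rule local_valuation_split[OF s Ds])
  show "valuation_ring R C L.loc" by (rule L.valuation_ring_loc[OF psubset_Rg[OF C]])
  have iR: "\<iota> u \<in> Rg" if "u \<in> cA" for u using RgI[of u "zA"] \<iota>_el that by simp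
  then show "\<iota> ` cA \<subseteq> L.loc" using L.A_loc by auto
  show "\<iota> \<pi> \<in> nonunits L.loc"
    using L.nonunits_loc_A[OF iR[OF \<pi>]] msplit_iff[of \<pi> "zA" s] \<iota>_el[OF \<pi>] s DI[of "oA"] by simp
qed

lemma Vinert_valuation:
  assumes C: "C \<subseteq> \<iota> ` cA" and nr: "\<And>s. s \<in> cA \<Longrightarrow> \<not> D (s .* s .- f)"
  shows "valuation_ring R C Vinert" "\<iota> ` cA \<subseteq> Vinert" "\<iota> \<pi> \<in> nonunits Vinert"
proof -
  interpret L: local_valuation R Rg minert "\<iota> \<pi>" by (rule local_valuation_inert[OF nr])
  show "valuation_ring R C L.loc" by (rule L.valuation_ring_loc[OF psubset_Rg[OF C]])
  have iR: "\<iota> u \<in> Rg" if "u \<in> cA" for u using RgI[of u "zA"] \<iota>_el that by simp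
  then show "\<iota> ` cA \<subseteq> L.loc" using L.A_loc by auto
  show "\<iota> \<pi> \<in> nonunits L.loc"
    using L.nonunits_loc_A[OF iR[OF \<pi>]] minert_iff[of \<pi> "zA"] \<iota>_el[OF \<pi>] DI[of "oA"] by simp
qed

text \<open>The element \<open>y - s\<close> is a nonunit at the place of \<open>s\<close>, and at
  the place of \<open>t\<close> only if \<open>s\<close> and \<open>t\<close> agree modulo
  \<open>\<pi>\<close>.\<close>

lemma inj_Vsplit: "inj_on Vsplit {s \<in> T0. D (s .* s .- f)}"
proof (rule inj_onI)
  fix s t assume "s \<in> {s \<in> T0. D (s .* s .- f)}" "t \<in> {s \<in> T0. D (s .* s .- f)}" and eq: "Vsplit s = Vsplit t"
  then have st: "s \<in> T0" "D (s .* s .- f)" "t \<in> T0" "D (t .* t .- f)" by auto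
  then have c: "s \<in> cA" "t \<in> cA" using T0 by auto
  interpret S: local_valuation R Rg "msplit s" "if D s then y else \<iota> \<pi>" by (rule local_valuation_split[OF c(1) st(2)])
  interpret T: local_valuation R Rg "msplit t" "if D t then y else \<iota> \<pi>" by (rule local_valuation_split[OF c(2) st(4)])
  let ?x = "el (.~ s) oA"
  have xR: "?x \<in> Rg" using RgI c by simp
  have "?x \<in> msplit s" using msplit_iff[of ".~ s" "oA" s] c by (simp add: A.l_neg)
  then have "?x \<in> msplit t" using S.nonunits_loc_A[OF xR] T.nonunits_loc_A[OF xR] eq by simp
  then have "D (t .- s)" using msplit_iff[of ".~ s" "oA" t] c by (simp add: a_minus_def A.a_comm)
  then show "s = t" using T0_un st by (auto simp: D_def)
qed

end

section \<open>Fraction fields\<close>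

context domain begin

lemma frac_class_eq:
  "a \<in> carrier R \<Longrightarrow> b \<in> carrier R - {\<zero>} \<Longrightarrow>
   frac_class R a b = {(c, d). c \<in> carrier R \<and> d \<in> carrier R - {\<zero>} \<and> a \<otimes> d = c \<otimes> b}"
  unfolding frac_class_def frac_rel_def by auto

lemma frac_class_eq_iff:
  assumes "a \<in> carrier R" "b \<in> carrier R - {\<zero>}" "c \<in> carrier R" "d \<in> carrier R - {\<zero>}"
  shows "frac_class R a b = frac_class R c d \<longleftrightarrow> a \<otimes> d = c \<otimes> b"
proof
  assume "frac_class R a b = frac_class R c d"
  moreover have "(c, d) \<in> frac_class R c d" using assms by (simp add: frac_class_eq)
  ultimately have "(c, d) \<in> frac_class R a b" by simp
  then show "a \<otimes> d = c \<otimes> b" using assms by (simp add: frac_class_eq)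
next
  have imp: "c \<otimes> g = e \<otimes> d"
    if c: "a \<in> carrier R" "b \<in> carrier R - {\<zero>}" "c \<in> carrier R" "d \<in> carrier R - {\<zero>}" "a \<otimes> d = c \<otimes> b"
      "e \<in> carrier R" "g \<in> carrier R - {\<zero>}" "a \<otimes> g = e \<otimes> b" for a b c d e g
  proof -
    have "b \<otimes> (c \<otimes> g) = (c \<otimes> b) \<otimes> g" using c by (simp add: m_ac)
    also have "\<dots> = (a \<otimes> g) \<otimes> d" unfolding c(5) [symmetric] using c(1-4,6,7) by (simp add: m_ac)
    also have "\<dots> = b \<otimes> (e \<otimes> d)" unfolding c(8) using c(1-4,6,7) by (simp add: m_ac)
    finally show ?thesis using c by (simp add: m_lcancel)
  qed
  assume e: "a \<otimes> d = c \<otimes> b"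
  show "frac_class R a b = frac_class R c d"
    unfolding frac_class_eq[OF assms(1,2)] frac_class_eq[OF assms(3,4)]
    using imp[OF assms e] imp[OF assms(3,4,1,2) e[symmetric]] by blast
qed

lemma frac_class_mem:
  "a \<in> carrier R \<Longrightarrow> b \<in> carrier R - {\<zero>} \<Longrightarrow> (a', b') \<in> frac_class R a b \<longleftrightarrow>
   a' \<in> carrier R \<and> b' \<in> carrier R - {\<zero>} \<and> a \<otimes> b' = a' \<otimes> b"
  by (simp add: frac_class_eq)

lemma nonzero_mult: "b \<in> carrier R - {\<zero>} \<Longrightarrow> d \<in> carrier R - {\<zero>} \<Longrightarrow> b \<otimes> d \<in> carrier R - {\<zero>}"
  using integral by auto

text \<open>The operations of \<open>fraction_field\<close> are unions over all pairs of
  representatives. Such a union collapses to a single class when the result is independent of the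
  representatives and both index sets are nonempty.\<close>

lemma UN_pairs_const:
  assumes "p \<in> S" "p' \<in> T" "\<And>a b c d. (a, b) \<in> S \<Longrightarrow> (c, d) \<in> T \<Longrightarrow> g a b c d = Z"
  shows "(\<Union>(a, b)\<in>S. \<Union>(c, d)\<in>T. g a b c d) = Z"
proof -
  have inner: "(\<Union>(c, d)\<in>T. g a b c d) = Z" if "(a, b) \<in> S" for a b
  proof -
    have "(\<Union>(c, d)\<in>T. g a b c d) = (\<Union>y\<in>T. Z)" by (intro SUP_cong refl) (use assms(3)[OF that] in auto)
    then show ?thesis using assms(2) by auto
  qed
  have "(\<Union>(a, b)\<in>S. \<Union>(c, d)\<in>T. g a b c d) = (\<Union>x\<in>S. Z)"
  proof (intro SUP_cong refl)
    fix x assume "x \<in> S"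
    then show "(case x of (a, b) \<Rightarrow> \<Union>(c, d)\<in>T. g a b c d) = Z" using inner[of "fst x" "snd x"] by (cases x) simp
  qed
  then show ?thesis using assms(1) by auto
qed

lemma frac_mult:
  assumes "a \<in> carrier R" "b \<in> carrier R - {\<zero>}" "c \<in> carrier R" "d \<in> carrier R - {\<zero>}"
  shows "frac_class R a b \<otimes>\<^bsub>fraction_field R\<^esub> frac_class R c d = frac_class R (a \<otimes> c) (b \<otimes> d)"
proof -
  have eq: "frac_class R (a' \<otimes> c') (b' \<otimes> d') = frac_class R (a \<otimes> c) (b \<otimes> d)"
    if "(a', b') \<in> frac_class R a b" "(c', d') \<in> frac_class R c d" for a' b' c' d'
  proof (subst frac_class_eq_iff)
    have h: "a' \<in> carrier R" "b' \<in> carrier R - {\<zero>}" "a \<otimes> b' = a' \<otimes> b"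
      "c' \<in> carrier R" "d' \<in> carrier R - {\<zero>}" "c \<otimes> d' = c' \<otimes> d" using that assms by (auto simp: frac_class_mem)
    then show "a' \<otimes> c' \<in> carrier R" "b' \<otimes> d' \<in> carrier R - {\<zero>}" "a \<otimes> c \<in> carrier R" "b \<otimes> d \<in> carrier R - {\<zero>}"
      using assms nonzero_mult by auto
    have "(a' \<otimes> c') \<otimes> (b \<otimes> d) = (a' \<otimes> b) \<otimes> (c' \<otimes> d)" using h(1,2,4,5) assms by (simp add: m_ac)
    also have "\<dots> = (a \<otimes> c) \<otimes> (b' \<otimes> d')" unfolding h(3) [symmetric] h(6) [symmetric] using h(1,2,4,5) assms by (simp add: m_ac)
    finally show "a' \<otimes> c' \<otimes> (b \<otimes> d) = a \<otimes> c \<otimes> (b' \<otimes> d')" .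
  qed
  have m: "(a, b) \<in> frac_class R a b" "(c, d) \<in> frac_class R c d" using assms by (auto simp: frac_class_mem)
  show ?thesis
    unfolding fraction_field_def by (simp, rule UN_pairs_const[OF m eq])
qed

lemma frac_add:
  assumes "a \<in> carrier R" "b \<in> carrier R - {\<zero>}" "c \<in> carrier R" "d \<in> carrier R - {\<zero>}"
  shows "frac_class R a b \<oplus>\<^bsub>fraction_field R\<^esub> frac_class R c d = frac_class R (a \<otimes> d \<oplus> c \<otimes> b) (b \<otimes> d)"
proof -
  have eq: "frac_class R (a' \<otimes> d' \<oplus> c' \<otimes> b') (b' \<otimes> d') = frac_class R (a \<otimes> d \<oplus> c \<otimes> b) (b \<otimes> d)"
    if "(a', b') \<in> frac_class R a b" "(c', d') \<in> frac_class R c d" for a' b' c' d'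
  proof (subst frac_class_eq_iff)
    have h: "a' \<in> carrier R" "b' \<in> carrier R - {\<zero>}" "a \<otimes> b' = a' \<otimes> b"
      "c' \<in> carrier R" "d' \<in> carrier R - {\<zero>}" "c \<otimes> d' = c' \<otimes> d" using that assms by (auto simp: frac_class_mem)
    then show "a' \<otimes> d' \<oplus> c' \<otimes> b' \<in> carrier R" "b' \<otimes> d' \<in> carrier R - {\<zero>}" "a \<otimes> d \<oplus> c \<otimes> b \<in> carrier R" "b \<otimes> d \<in> carrier R - {\<zero>}"
      using assms nonzero_mult by auto
    have "(a' \<otimes> d' \<oplus> c' \<otimes> b') \<otimes> (b \<otimes> d) = (a' \<otimes> b) \<otimes> (d \<otimes> d') \<oplus> (c' \<otimes> d) \<otimes> (b \<otimes> b')"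
      using h(1,2,4,5) assms by (simp add: l_distr r_distr m_ac)
    also have "\<dots> = (a \<otimes> d \<oplus> c \<otimes> b) \<otimes> (b' \<otimes> d')"
      unfolding h(3) [symmetric] h(6) [symmetric] using h(1,2,4,5) assms by (simp add: l_distr r_distr m_ac)
    finally show "(a' \<otimes> d' \<oplus> c' \<otimes> b') \<otimes> (b \<otimes> d) = (a \<otimes> d \<oplus> c \<otimes> b) \<otimes> (b' \<otimes> d')" .
  qed
  have m: "(a, b) \<in> frac_class R a b" "(c, d) \<in> frac_class R c d" using assms by (auto simp: frac_class_mem)
  show ?thesis
    unfolding fraction_field_def by (simp, rule UN_pairs_const[OF m eq])
qed

lemma frac_carrier: "carrier (fraction_field R) = {frac_class R a b | a b. a \<in> carrier R \<and> b \<in> carrier R - {\<zero>}}"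
  and frac_zero: "\<zero>\<^bsub>fraction_field R\<^esub> = frac_class R \<zero> \<one>"
  and frac_one: "\<one>\<^bsub>fraction_field R\<^esub> = frac_class R \<one> \<one>"
  by (simp_all add: fraction_field_def)

lemma frac_closed: "a \<in> carrier R \<Longrightarrow> b \<in> carrier R - {\<zero>} \<Longrightarrow> frac_class R a b \<in> carrier (fraction_field R)"
  unfolding frac_carrier by blast

lemma fracE:
  assumes "z \<in> carrier (fraction_field R)"
  obtains a b where "a \<in> carrier R" "b \<in> carrier R - {\<zero>}" "z = frac_class R a b"
  using assms unfolding frac_carrier by blast

lemma one_nz: "\<one> \<in> carrier R - {\<zero>}" by simp

theorem field_fraction_field: "field (fraction_field R)"
proof -
  let ?F = "fraction_field R"
  have closed: "a \<otimes> d \<oplus> c \<otimes> b \<in> carrier R" if "a \<in> carrier R" "b \<in> carrier R - {\<zero>}" "c \<in> carrier R" "d \<in> carrier R - {\<zero>}" for a b c d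
    using that by auto
  have ag: "abelian_group ?F"
  proof (rule abelian_groupI)
    fix x y assume "x \<in> carrier ?F" "y \<in> carrier ?F"
    then obtain a b c d where h: "a \<in> carrier R" "b \<in> carrier R - {\<zero>}" "c \<in> carrier R" "d \<in> carrier R - {\<zero>}"
      "x = frac_class R a b" "y = frac_class R c d" by (metis fracE)
    show "x \<oplus>\<^bsub>?F\<^esub> y \<in> carrier ?F" unfolding h(5,6) frac_add[OF h(1-4)] by (intro frac_closed closed nonzero_mult h)
    show "x \<oplus>\<^bsub>?F\<^esub> y = y \<oplus>\<^bsub>?F\<^esub> x" unfolding h(5,6) frac_add[OF h(1-4)] frac_add[OF h(3,4,1,2)] using h by (simp add: m_comm a_comm)
    fix z assume "z \<in> carrier ?F"
    then obtain e g where h': "e \<in> carrier R" "g \<in> carrier R - {\<zero>}" "z = frac_class R e g" by (metis fracE)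
    have "x \<oplus>\<^bsub>?F\<^esub> y \<oplus>\<^bsub>?F\<^esub> z = frac_class R ((a \<otimes> d \<oplus> c \<otimes> b) \<otimes> g \<oplus> e \<otimes> (b \<otimes> d)) ((b \<otimes> d) \<otimes> g)"
      unfolding h(5,6) h'(3) frac_add[OF h(1-4)] by (intro frac_add closed nonzero_mult h h')
    moreover have "x \<oplus>\<^bsub>?F\<^esub> (y \<oplus>\<^bsub>?F\<^esub> z) = frac_class R (a \<otimes> (d \<otimes> g) \<oplus> (c \<otimes> g \<oplus> e \<otimes> d) \<otimes> b) (b \<otimes> (d \<otimes> g))"
      unfolding h(5,6) h'(3) frac_add[OF h(3,4) h'(1,2)] by (intro frac_add closed nonzero_mult h h')
    moreover have "(a \<otimes> d \<oplus> c \<otimes> b) \<otimes> g \<oplus> e \<otimes> (b \<otimes> d) = a \<otimes> (d \<otimes> g) \<oplus> (c \<otimes> g \<oplus> e \<otimes> d) \<otimes> b"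
      using h h' by (simp add: l_distr r_distr m_ac a_ac)
    ultimately show "x \<oplus>\<^bsub>?F\<^esub> y \<oplus>\<^bsub>?F\<^esub> z = x \<oplus>\<^bsub>?F\<^esub> (y \<oplus>\<^bsub>?F\<^esub> z)" using h h' by (simp add: m_assoc)
  next
    show "\<zero>\<^bsub>?F\<^esub> \<in> carrier ?F" unfolding frac_zero by (rule frac_closed) auto
    fix x assume "x \<in> carrier ?F"
    then obtain a b where h: "a \<in> carrier R" "b \<in> carrier R - {\<zero>}" "x = frac_class R a b" by (metis fracE)
    show "\<zero>\<^bsub>?F\<^esub> \<oplus>\<^bsub>?F\<^esub> x = x" unfolding h(3) frac_zero frac_add[OF zero_closed one_nz h(1,2)] using h by simp
    have "frac_class R (\<ominus> a) b \<oplus>\<^bsub>?F\<^esub> x = frac_class R (\<ominus> a \<otimes> b \<oplus> a \<otimes> b) (b \<otimes> b)"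
      unfolding h(3) by (intro frac_add h a_inv_closed)
    also have "\<dots> = \<zero>\<^bsub>?F\<^esub>"
      unfolding frac_zero using h nonzero_mult[OF h(2) h(2)] by (subst frac_class_eq_iff) (auto simp: l_minus l_neg)
    finally show "\<exists>y\<in>carrier ?F. y \<oplus>\<^bsub>?F\<^esub> x = \<zero>\<^bsub>?F\<^esub>" using frac_closed[of "\<ominus> a" b] h by auto
  qed
  have cm: "comm_monoid ?F"
  proof (rule comm_monoidI)
    fix x y assume "x \<in> carrier ?F" "y \<in> carrier ?F"
    then obtain a b c d where h: "a \<in> carrier R" "b \<in> carrier R - {\<zero>}" "c \<in> carrier R" "d \<in> carrier R - {\<zero>}"
      "x = frac_class R a b" "y = frac_class R c d" by (metis fracE)
    show "x \<otimes>\<^bsub>?F\<^esub> y \<in> carrier ?F" unfolding h(5,6) frac_mult[OF h(1-4)] by (intro frac_closed m_closed nonzero_mult h)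
    show "x \<otimes>\<^bsub>?F\<^esub> y = y \<otimes>\<^bsub>?F\<^esub> x" unfolding h(5,6) frac_mult[OF h(1-4)] frac_mult[OF h(3,4,1,2)] using h by (simp add: m_comm)
    fix z assume "z \<in> carrier ?F"
    then obtain e g where h': "e \<in> carrier R" "g \<in> carrier R - {\<zero>}" "z = frac_class R e g" by (metis fracE)
    have "x \<otimes>\<^bsub>?F\<^esub> y \<otimes>\<^bsub>?F\<^esub> z = frac_class R (a \<otimes> c \<otimes> e) (b \<otimes> d \<otimes> g)"
      unfolding h(5,6) h'(3) frac_mult[OF h(1-4)] by (intro frac_mult m_closed nonzero_mult h h')
    moreover have "x \<otimes>\<^bsub>?F\<^esub> (y \<otimes>\<^bsub>?F\<^esub> z) = frac_class R (a \<otimes> (c \<otimes> e)) (b \<otimes> (d \<otimes> g))"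
      unfolding h(5,6) h'(3) frac_mult[OF h(3,4) h'(1,2)] by (intro frac_mult m_closed nonzero_mult h h')
    ultimately show "x \<otimes>\<^bsub>?F\<^esub> y \<otimes>\<^bsub>?F\<^esub> z = x \<otimes>\<^bsub>?F\<^esub> (y \<otimes>\<^bsub>?F\<^esub> z)" using h h' by (simp add: m_assoc)
  next
    show "\<one>\<^bsub>?F\<^esub> \<in> carrier ?F" unfolding frac_one by (rule frac_closed) auto
    fix x assume "x \<in> carrier ?F"
    then obtain a b where h: "a \<in> carrier R" "b \<in> carrier R - {\<zero>}" "x = frac_class R a b" by (metis fracE)
    show "\<one>\<^bsub>?F\<^esub> \<otimes>\<^bsub>?F\<^esub> x = x" unfolding h(3) frac_one frac_mult[OF one_closed one_nz h(1,2)] using h by simp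
  qed
  have "cring ?F"
  proof (rule cringI[OF ag cm])
    fix x y z assume "x \<in> carrier ?F" "y \<in> carrier ?F" "z \<in> carrier ?F"
    then obtain a b c d e g where h: "a \<in> carrier R" "b \<in> carrier R - {\<zero>}" "c \<in> carrier R" "d \<in> carrier R - {\<zero>}"
      "e \<in> carrier R" "g \<in> carrier R - {\<zero>}"
      "x = frac_class R a b" "y = frac_class R c d" "z = frac_class R e g" by (metis fracE)
    have "(x \<oplus>\<^bsub>?F\<^esub> y) \<otimes>\<^bsub>?F\<^esub> z = frac_class R ((a \<otimes> d \<oplus> c \<otimes> b) \<otimes> e) (b \<otimes> d \<otimes> g)"
      unfolding h(7-9) frac_add[OF h(1-4)] by (intro frac_mult closed nonzero_mult h)
    moreover have "x \<otimes>\<^bsub>?F\<^esub> z \<oplus>\<^bsub>?F\<^esub> y \<otimes>\<^bsub>?F\<^esub> z = frac_class R ((a \<otimes> e) \<otimes> (d \<otimes> g) \<oplus> (c \<otimes> e) \<otimes> (b \<otimes> g)) ((b \<otimes> g) \<otimes> (d \<otimes> g))"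
      unfolding h(7-9) frac_mult[OF h(1,2,5,6)] frac_mult[OF h(3-6)] by (intro frac_add m_closed nonzero_mult h)
    moreover have "frac_class R ((a \<otimes> d \<oplus> c \<otimes> b) \<otimes> e) (b \<otimes> d \<otimes> g) = frac_class R ((a \<otimes> e) \<otimes> (d \<otimes> g) \<oplus> (c \<otimes> e) \<otimes> (b \<otimes> g)) ((b \<otimes> g) \<otimes> (d \<otimes> g))"
      by (subst frac_class_eq_iff) (use h nonzero_mult in \<open>auto simp: l_distr r_distr m_ac integral_iff\<close>)
    ultimately show "(x \<oplus>\<^bsub>?F\<^esub> y) \<otimes>\<^bsub>?F\<^esub> z = x \<otimes>\<^bsub>?F\<^esub> z \<oplus>\<^bsub>?F\<^esub> y \<otimes>\<^bsub>?F\<^esub> z" by simp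
  qed
  then show ?thesis
  proof (rule cring.cring_fieldI2)
    show "\<zero>\<^bsub>?F\<^esub> \<noteq> \<one>\<^bsub>?F\<^esub>" unfolding frac_zero frac_one by (subst frac_class_eq_iff) auto
    fix x assume x: "x \<in> carrier ?F" "x \<noteq> \<zero>\<^bsub>?F\<^esub>"
    then obtain a b where h: "a \<in> carrier R" "b \<in> carrier R - {\<zero>}" "x = frac_class R a b" by (metis fracE)
    have "a \<noteq> \<zero>" using x h unfolding frac_zero by (auto simp: frac_class_eq_iff)
    then have a: "a \<in> carrier R - {\<zero>}" using h by simp
    have "x \<otimes>\<^bsub>?F\<^esub> frac_class R b a = frac_class R (a \<otimes> b) (b \<otimes> a)" unfolding h(3) using h a by (intro frac_mult) auto
    also have "\<dots> = \<one>\<^bsub>?F\<^esub>" unfolding frac_one using h a nonzero_mult[OF h(2) a] by (subst frac_class_eq_iff) (auto simp: m_comm)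
    finally show "\<exists>y\<in>carrier ?F. x \<otimes>\<^bsub>?F\<^esub> y = \<one>\<^bsub>?F\<^esub>" using frac_closed[of b a] h a by auto
  qed
qed

lemma frac_hom: "(\<lambda>c. frac_class R c \<one>) \<in> ring_hom R (fraction_field R)"
proof (rule ring_hom_memI)
  fix c d assume cd: "c \<in> carrier R" "d \<in> carrier R"
  show "frac_class R c \<one> \<in> carrier (fraction_field R)" using cd by (intro frac_closed) auto
  show "frac_class R (c \<otimes> d) \<one> = frac_class R c \<one> \<otimes>\<^bsub>fraction_field R\<^esub> frac_class R d \<one>"
    using frac_mult[OF cd(1) one_nz cd(2) one_nz] by simp
  show "frac_class R (c \<oplus> d) \<one> = frac_class R c \<one> \<oplus>\<^bsub>fraction_field R\<^esub> frac_class R d \<one>"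
    using frac_add[OF cd(1) one_nz cd(2) one_nz] cd by simp
qed (simp add: frac_one)

lemma frac_hom_zero_iff: "c \<in> carrier R \<Longrightarrow> frac_class R c \<one> = \<zero>\<^bsub>fraction_field R\<^esub> \<longleftrightarrow> c = \<zero>"
  unfolding frac_zero by (subst frac_class_eq_iff) auto

lemma frac_rep:
  assumes "z \<in> carrier (fraction_field R)"
  shows "\<exists>c\<in>carrier R. \<exists>d\<in>carrier R - {\<zero>}. z \<otimes>\<^bsub>fraction_field R\<^esub> frac_class R d \<one> = frac_class R c \<one>"
proof -
  obtain c d where h: "c \<in> carrier R" "d \<in> carrier R - {\<zero>}" "z = frac_class R c d" using fracE[OF assms] .
  have d: "d \<in> carrier R" using h by simp
  have "z \<otimes>\<^bsub>fraction_field R\<^esub> frac_class R d \<one> = frac_class R (c \<otimes> d) (d \<otimes> \<one>)"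
    unfolding h(3) by (rule frac_mult[OF h(1,2) d one_nz])
  also have "\<dots> = frac_class R c \<one>" by (subst frac_class_eq_iff) (use h in auto)
  finally show ?thesis using h by blast
qed

end

text \<open>The ring of all \<open>u + v y\<close> over \<open>A\<close>, before fractions are
  taken. Condition \<open>aniso\<close> says that the norm form vanishes only at zero, and it makes
  the ring a domain.\<close>

locale quad_ring = Q: cring Q + A: domain A for Q (structure) and A (structure) +
  fixes j :: "'c \<Rightarrow> 'a" and y :: 'a and f :: 'c
  assumes j_hom: "j \<in> ring_hom A Q" and y [simp]: "y \<in> carrier Q" and f [simp]: "f \<in> carrier A"
    and y_sq: "y \<otimes>\<^bsub>Q\<^esub> y = j f"
    and rep: "z \<in> carrier Q \<Longrightarrow> \<exists>u\<in>carrier A. \<exists>v\<in>carrier A. z = j u \<oplus>\<^bsub>Q\<^esub> j v \<otimes>\<^bsub>Q\<^esub> y"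
    and indep: "u \<in> carrier A \<Longrightarrow> v \<in> carrier A \<Longrightarrow> j u \<oplus>\<^bsub>Q\<^esub> j v \<otimes>\<^bsub>Q\<^esub> y = \<zero>\<^bsub>Q\<^esub> \<Longrightarrow> u = \<zero>\<^bsub>A\<^esub> \<and> v = \<zero>\<^bsub>A\<^esub>"
    and aniso: "u \<in> carrier A \<Longrightarrow> v \<in> carrier A \<Longrightarrow> u \<otimes>\<^bsub>A\<^esub> u = f \<otimes>\<^bsub>A\<^esub> (v \<otimes>\<^bsub>A\<^esub> v) \<Longrightarrow> u = \<zero>\<^bsub>A\<^esub> \<and> v = \<zero>\<^bsub>A\<^esub>"
    and two_unit: "\<one>\<^bsub>A\<^esub> \<oplus>\<^bsub>A\<^esub> \<one>\<^bsub>A\<^esub> \<in> Units A"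
begin

sublocale J: ring_hom_ring A Q j
  by (rule ring_hom_ringI2) (auto simp: Q.ring_axioms A.ring_axioms j_hom)

text \<open>The cofactor is the conjugate and \<open>n\<close> is the norm. This moves denominators
  into \<open>A\<close>.\<close>

lemma conj:
  assumes z: "z \<in> carrier Q" "z \<noteq> \<zero>\<^bsub>Q\<^esub>"
  shows "\<exists>z'\<in>carrier Q. \<exists>n\<in>carrier A. n \<noteq> \<zero>\<^bsub>A\<^esub> \<and> z \<otimes>\<^bsub>Q\<^esub> z' = j n"
proof -
  obtain u v where uv: "u \<in> carrier A" "v \<in> carrier A" "z = j u \<oplus>\<^bsub>Q\<^esub> j v \<otimes>\<^bsub>Q\<^esub> y" using rep[OF z(1)] by blast
  let ?n = "u \<otimes>\<^bsub>A\<^esub> u \<ominus>\<^bsub>A\<^esub> f \<otimes>\<^bsub>A\<^esub> (v \<otimes>\<^bsub>A\<^esub> v)"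
  let ?z = "j u \<oplus>\<^bsub>Q\<^esub> \<ominus>\<^bsub>Q\<^esub> j v \<otimes>\<^bsub>Q\<^esub> y"
  have "z \<otimes>\<^bsub>Q\<^esub> ?z = (j u \<otimes>\<^bsub>Q\<^esub> j u \<oplus>\<^bsub>Q\<^esub> j f \<otimes>\<^bsub>Q\<^esub> (j v \<otimes>\<^bsub>Q\<^esub> \<ominus>\<^bsub>Q\<^esub> j v)) \<oplus>\<^bsub>Q\<^esub> (j u \<otimes>\<^bsub>Q\<^esub> \<ominus>\<^bsub>Q\<^esub> j v \<oplus>\<^bsub>Q\<^esub> j v \<otimes>\<^bsub>Q\<^esub> j u) \<otimes>\<^bsub>Q\<^esub> y"
    unfolding uv(3) using uv y_sq by (intro Q.quad_mult_expand) auto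
  also have "j u \<otimes>\<^bsub>Q\<^esub> \<ominus>\<^bsub>Q\<^esub> j v \<oplus>\<^bsub>Q\<^esub> j v \<otimes>\<^bsub>Q\<^esub> j u = \<zero>\<^bsub>Q\<^esub>" using uv by (simp add: Q.r_minus Q.m_comm Q.l_neg)
  also have "(j u \<otimes>\<^bsub>Q\<^esub> j u \<oplus>\<^bsub>Q\<^esub> j f \<otimes>\<^bsub>Q\<^esub> (j v \<otimes>\<^bsub>Q\<^esub> \<ominus>\<^bsub>Q\<^esub> j v)) \<oplus>\<^bsub>Q\<^esub> \<zero>\<^bsub>Q\<^esub> \<otimes>\<^bsub>Q\<^esub> y = j ?n"
    using uv by (simp add: a_minus_def Q.r_minus)
  finally have "z \<otimes>\<^bsub>Q\<^esub> ?z = j ?n" .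
  moreover have "?n \<noteq> \<zero>\<^bsub>A\<^esub>"
  proof
    assume "?n = \<zero>\<^bsub>A\<^esub>"
    then have "u = \<zero>\<^bsub>A\<^esub> \<and> v = \<zero>\<^bsub>A\<^esub>" using uv by (intro aniso) auto
    then show False using uv z by simp
  qed
  moreover have "?z \<in> carrier Q" "?n \<in> carrier A" using uv by auto
  ultimately show ?thesis by blast
qed

lemma scale_zero:
  assumes "n \<in> carrier A" "n \<noteq> \<zero>\<^bsub>A\<^esub>" "z \<in> carrier Q" "j n \<otimes>\<^bsub>Q\<^esub> z = \<zero>\<^bsub>Q\<^esub>" shows "z = \<zero>\<^bsub>Q\<^esub>"
proof -
  obtain u v where uv: "u \<in> carrier A" "v \<in> carrier A" "z = j u \<oplus>\<^bsub>Q\<^esub> j v \<otimes>\<^bsub>Q\<^esub> y" using rep[OF assms(3)] by blast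
  have "j (n \<otimes>\<^bsub>A\<^esub> u) \<oplus>\<^bsub>Q\<^esub> j (n \<otimes>\<^bsub>A\<^esub> v) \<otimes>\<^bsub>Q\<^esub> y = j n \<otimes>\<^bsub>Q\<^esub> z" unfolding uv(3) using uv(1,2) assms(1) by (simp add: Q.r_distr Q.m_assoc)
  then have "n \<otimes>\<^bsub>A\<^esub> u = \<zero>\<^bsub>A\<^esub> \<and> n \<otimes>\<^bsub>A\<^esub> v = \<zero>\<^bsub>A\<^esub>" using assms uv by (intro indep) auto
  then have "u = \<zero>\<^bsub>A\<^esub>" "v = \<zero>\<^bsub>A\<^esub>" using A.integral[of n u] A.integral[of n v] assms uv by auto
  then show ?thesis using uv by simp
qed

lemma domain_Q: "domain Q"
proof (rule domain.intro[OF Q.cring_axioms], unfold_locales)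
  show "\<one>\<^bsub>Q\<^esub> \<noteq> \<zero>\<^bsub>Q\<^esub>" using indep[of "\<one>\<^bsub>A\<^esub>" "\<zero>\<^bsub>A\<^esub>"] by auto
  fix x z assume xz: "x \<otimes>\<^bsub>Q\<^esub> z = \<zero>\<^bsub>Q\<^esub>" "x \<in> carrier Q" "z \<in> carrier Q"
  show "x = \<zero>\<^bsub>Q\<^esub> \<or> z = \<zero>\<^bsub>Q\<^esub>"
  proof (cases "x = \<zero>\<^bsub>Q\<^esub>")
    case False
    then obtain x' n where h: "x' \<in> carrier Q" "n \<in> carrier A" "n \<noteq> \<zero>\<^bsub>A\<^esub>" "x \<otimes>\<^bsub>Q\<^esub> x' = j n" using conj[OF xz(2)] by blast
    have "j n \<otimes>\<^bsub>Q\<^esub> z = x' \<otimes>\<^bsub>Q\<^esub> (x \<otimes>\<^bsub>Q\<^esub> z)" unfolding h(4) [symmetric] using h(1) xz by (simp add: Q.m_ac)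
    then have "j n \<otimes>\<^bsub>Q\<^esub> z = \<zero>\<^bsub>Q\<^esub>" using xz h by simp
    then show ?thesis using scale_zero h xz by blast
  qed simp
qed

abbreviation "\<iota> u \<equiv> frac_class Q (j u) \<one>\<^bsub>Q\<^esub>"

theorem quad_ext_fraction_field: "quad_ext (fraction_field Q) A \<iota> (frac_class Q y \<one>\<^bsub>Q\<^esub>) f"
proof -
  interpret D: domain Q by (rule domain_Q)
  interpret F: field "fraction_field Q" by (rule D.field_fraction_field)
  let ?h = "\<lambda>c. frac_class Q c \<one>\<^bsub>Q\<^esub>"
  let ?F = "fraction_field Q"
  interpret H: ring_hom_ring Q ?F ?h
    by (rule ring_hom_ringI2) (auto simp: Q.ring_axioms F.ring_axioms D.frac_hom)
  show ?thesis
  proof (intro quad_ext.intro quad_ext_axioms.intro F.field_axioms A.domain_axioms f two_unit)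
    show "\<iota> \<in> ring_hom A ?F" using ring_hom_trans[OF j_hom D.frac_hom] by (simp add: comp_def)
    show "?h y \<in> carrier ?F" by simp
    show "?h y \<otimes>\<^bsub>?F\<^esub> ?h y = \<iota> f" using H.hom_mult[of y y] y_sq by simp
    fix u v assume uv: "u \<in> carrier A" "v \<in> carrier A" "\<iota> u \<oplus>\<^bsub>?F\<^esub> \<iota> v \<otimes>\<^bsub>?F\<^esub> ?h y = \<zero>\<^bsub>?F\<^esub>"
    then have "?h (j u \<oplus>\<^bsub>Q\<^esub> j v \<otimes>\<^bsub>Q\<^esub> y) = \<zero>\<^bsub>?F\<^esub>" by simp
    then have "j u \<oplus>\<^bsub>Q\<^esub> j v \<otimes>\<^bsub>Q\<^esub> y = \<zero>\<^bsub>Q\<^esub>" using uv(1,2) by (subst (asm) D.frac_hom_zero_iff) auto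
    then show "u = \<zero>\<^bsub>A\<^esub> \<and> v = \<zero>\<^bsub>A\<^esub>" by (rule indep[OF uv(1,2)])
  next
    fix z assume z: "z \<in> carrier ?F"
    then obtain c d where cd: "c \<in> carrier Q" "d \<in> carrier Q" "d \<noteq> \<zero>\<^bsub>Q\<^esub>" "z \<otimes>\<^bsub>?F\<^esub> ?h d = ?h c" using D.frac_rep by blast
    obtain d' n where h: "d' \<in> carrier Q" "n \<in> carrier A" "n \<noteq> \<zero>\<^bsub>A\<^esub>" "d \<otimes>\<^bsub>Q\<^esub> d' = j n" using conj[OF cd(2,3)] by blast
    obtain u v where uv: "u \<in> carrier A" "v \<in> carrier A" "c \<otimes>\<^bsub>Q\<^esub> d' = j u \<oplus>\<^bsub>Q\<^esub> j v \<otimes>\<^bsub>Q\<^esub> y" using rep[of "c \<otimes>\<^bsub>Q\<^esub> d'"] cd h by auto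
    have "z \<otimes>\<^bsub>?F\<^esub> \<iota> n = (z \<otimes>\<^bsub>?F\<^esub> ?h d) \<otimes>\<^bsub>?F\<^esub> ?h d'" unfolding h(4) [symmetric] using cd(1,2) h(1) z by (simp add: F.m_assoc)
    also have "\<dots> = ?h (c \<otimes>\<^bsub>Q\<^esub> d')" unfolding cd(4) using cd h by simp
    also have "\<dots> = \<iota> u \<oplus>\<^bsub>?F\<^esub> \<iota> v \<otimes>\<^bsub>?F\<^esub> ?h y" unfolding uv(3) using uv(1,2) by simp
    finally show "\<exists>u\<in>carrier A. \<exists>v\<in>carrier A. \<exists>w\<in>carrier A. w \<noteq> \<zero>\<^bsub>A\<^esub> \<and> z \<otimes>\<^bsub>?F\<^esub> \<iota> w = \<iota> u \<oplus>\<^bsub>?F\<^esub> \<iota> v \<otimes>\<^bsub>?F\<^esub> ?h y"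
      using uv h by blast
  qed
qed

end

section \<open>The function field of the curve\<close>

lemma (in ideal) rcos_zero_iff:
  assumes "x \<in> carrier R" shows "I +> x = \<zero>\<^bsub>R Quot I\<^esub> \<longleftrightarrow> x \<in> I"
proof -
  have z: "\<zero>\<^bsub>R Quot I\<^esub> = I" by (simp add: FactRing_def)
  show ?thesis unfolding z using a_coset_join1[OF _ assms a_subgroup] a_coset_join2[OF assms a_subgroup] by blast
qed

lemma (in ideal) rcosE:
  assumes "z \<in> carrier (R Quot I)" obtains x where "x \<in> carrier R" "z = I +> x"
  using assms by (auto simp: FactRing_simps)

lemma (in cring) maximal_inverse_mod:
  assumes "maximalideal I R" "u \<in> carrier R" "u \<notin> I"
  shows "\<exists>w\<in>carrier R. u \<otimes> w \<ominus> \<one> \<in> I"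
proof -
  interpret I: maximalideal I R by fact
  interpret Q: field "R Quot I" by (rule I.quotient_is_field[OF is_cring])
  interpret H: ring_hom_ring R "R Quot I" "(+>) I" by (rule I.rcos_ring_hom_ring)
  have u: "I +> u \<noteq> \<zero>\<^bsub>R Quot I\<^esub>" using I.rcos_zero_iff assms by simp
  have "inv\<^bsub>R Quot I\<^esub> (I +> u) \<in> carrier (R Quot I)" using u assms by simp
  then obtain w where w: "w \<in> carrier R" "inv\<^bsub>R Quot I\<^esub> (I +> u) = I +> w" by (rule I.rcosE) blast
  have "(I +> u) \<otimes>\<^bsub>R Quot I\<^esub> (I +> w) = \<one>\<^bsub>R Quot I\<^esub>" unfolding w(2) [symmetric] using u assms by simp
  then have "I +> (u \<otimes> w \<ominus> \<one>) = \<zero>\<^bsub>R Quot I\<^esub>" using assms w(1) by (simp add: a_minus_def Q.r_neg)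
  then show ?thesis using I.rcos_zero_iff[of "u \<otimes> w \<ominus> \<one>"] assms(2) w(1) by auto
qed

context field_polys begin

lemma MIrr_inverse_mod:
  assumes P: "P \<in> MIrr" and u: "u \<in> kX" and n: "\<not> P .| u"
  shows "\<exists>w\<in>kX. P .| (u .* w .- oP)"
proof -
  note PP = MIrrD[OF P]
  have mem: "x \<in> PIdl\<^bsub>poly_ring R\<^esub> P \<longleftrightarrow> P .| x" if "x \<in> kX" for x
    using that PP(2) UP.m_comm by (auto simp: cgenideal_def factor_def)
  have "maximalideal (PIdl\<^bsub>poly_ring R\<^esub> P) (poly_ring R)"
    using UP.irreducible_imp_maximalideal[OF PP(2)] P by (auto simp: MIrr_def)
  from UP.maximal_inverse_mod[OF this u] n mem[OF u]
  obtain w where w: "w \<in> kX" "u .* w .- oP \<in> PIdl\<^bsub>poly_ring R\<^esub> P" by auto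
  moreover have "u .* w .- oP \<in> kX" using u w by simp
  ultimately show ?thesis using mem by blast
qed

lemma poly_const_hom: "poly_of_const \<in> ring_hom R (poly_ring R)"
  using canonical_embedding_is_hom[OF carrier_is_subring] by simp

sublocale PC: ring_hom_ring R "poly_ring R" poly_of_const
  by (rule ring_hom_ringI2) (auto simp: ring_axioms UP.ring_axioms poly_const_hom)

lemma poly_of_const_eq: "c \<in> carrier R \<Longrightarrow> poly_of_const c = (if c = \<zero> then [] else [c])"
  by (simp add: poly_of_const_def)

lemma poly_two_unit:
  assumes "\<one> \<oplus> \<one> \<noteq> \<zero>" shows "oP .+ oP \<in> Units (poly_ring R)"
proof -
  have "oP .+ oP = poly_of_const (\<one> \<oplus> \<one>)" by simp
  also have "\<dots> = [\<one> \<oplus> \<one>]" using assms by (simp add: poly_of_const_eq)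
  also have "\<dots> \<in> Units (poly_ring R)" using assms by (simp add: univ_poly_units[OF carrier_is_subfield])
  finally show ?thesis .
qed

text \<open>Parity of degrees: a nonzero left side has even degree and a nonzero right side has odd
  degree.\<close>

lemma odd_degree_aniso:
  assumes f: "f \<in> kX" "f \<noteq> []" "odd (degree f)"
    and u: "u \<in> kX" and v: "v \<in> kX"
    and e: "u .* u = f .* (v .* v)"
  shows "u = [] \<and> v = []"
proof (cases "v = []")
  case True
  then have "v .* v = []" using UP.r_null[OF v] by simp
  then have "u .* u = []" using e UP.r_null[OF f(1)] by simp
  then show ?thesis using True UP.integral[of u u] u by simp
next
  case False
  note vv = poly_degree_mult[OF v v False False]
  have vvc: "v .* v \<in> kX" using v by simp
  note fv = poly_degree_mult[OF f(1) vvc f(2) vv(3)]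
  have "u \<noteq> []" using e fv(3) UP.r_null[OF u] by auto
  then have "degree u + degree u = degree f + (degree v + degree v)" using poly_degree_mult(1)[OF u u] fv(1) vv(1) e by simp
  moreover have "even (degree u + degree u)" "odd (degree f + (degree v + degree v))" using f(3) by auto
  ultimately show ?thesis by metis
qed

end

text \<open>Division by the monic polynomial \<open>Y^2 - f\<close> works over a domain and leaves
  linear remainders. They are unique since a nonzero multiple of it has degree at least 2.\<close>

lemma (in domain) monic_quadratic_quotient:
  assumes f: "f \<in> carrier R"
  defines "B \<equiv> poly_ring R" defines "I \<equiv> PIdl\<^bsub>B\<^esub> [\<one>, \<zero>, \<ominus> f]"
  defines "j \<equiv> (\<lambda>u. I +>\<^bsub>B\<^esub> poly_of_const u)" and "y \<equiv> I +>\<^bsub>B\<^esub> [\<one>, \<zero>]"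
  shows "cring (B Quot I)" "j \<in> ring_hom R (B Quot I)" "y \<in> carrier (B Quot I)" "y \<otimes>\<^bsub>B Quot I\<^esub> y = j f"
    and "z \<in> carrier (B Quot I) \<Longrightarrow> \<exists>u\<in>carrier R. \<exists>v\<in>carrier R. z = j u \<oplus>\<^bsub>B Quot I\<^esub> j v \<otimes>\<^bsub>B Quot I\<^esub> y"
    and "u \<in> carrier R \<Longrightarrow> v \<in> carrier R \<Longrightarrow> j u \<oplus>\<^bsub>B Quot I\<^esub> j v \<otimes>\<^bsub>B Quot I\<^esub> y = \<zero>\<^bsub>B Quot I\<^esub> \<Longrightarrow> u = \<zero> \<and> v = \<zero>"
proof -
  note sr = carrier_is_subring
  interpret B: domain B unfolding B_def by (rule univ_poly_is_domain[OF sr])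
  let ?G = "[\<one>, \<zero>, \<ominus> f]" and ?Y = "[\<one>, \<zero>]"
  have G: "?G \<in> carrier B" and Y: "?Y \<in> carrier B"
    using f by (simp_all add: B_def univ_poly_carrier [symmetric] polynomial_def)
  interpret I: ideal I B unfolding I_def by (rule B.cgenideal_ideal[OF G])
  have ph: "poly_of_const \<in> ring_hom R B" using canonical_embedding_is_hom[OF sr] by (simp add: B_def)
  interpret PC: ring_hom_ring R B poly_of_const by (rule ring_hom_ringI2) (auto simp: ring_axioms B.ring_axioms ph)
  show cr: "cring (B Quot I)" by (rule I.quotient_is_cring[OF B.is_cring])
  interpret Q: cring "B Quot I" by (rule cr)
  interpret H: ring_hom_ring B "B Quot I" "(+>\<^bsub>B\<^esub>) I" by (rule I.rcos_ring_hom_ring)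
  show "j \<in> ring_hom R (B Quot I)" using ring_hom_trans[OF ph I.rcos_ring_hom] by (simp add: comp_def j_def)
  show yc: "y \<in> carrier (B Quot I)" using Y by (simp add: y_def)
  have jc: "u \<in> carrier R \<Longrightarrow> j u \<in> carrier (B Quot I)" for u by (simp add: j_def)
  have ev: "p = B.eval (map poly_of_const p) ?Y" if "p \<in> carrier B" for p
    using eval_rewrite[OF sr, of p] that by (simp add: B_def var_def)
  have Geq: "?G = ?Y \<otimes>\<^bsub>B\<^esub> ?Y \<ominus>\<^bsub>B\<^esub> poly_of_const f"
    by (subst ev[OF G]) (use Y f in \<open>simp add: numeral_eq_Suc a_minus_def\<close>)
  have lin: "[v, u] = poly_of_const u \<oplus>\<^bsub>B\<^esub> poly_of_const v \<otimes>\<^bsub>B\<^esub> ?Y" if "u \<in> carrier R" "v \<in> carrier R" "v \<noteq> \<zero>" for u v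
  proof -
    have "[v, u] \<in> carrier B" using that by (simp add: B_def univ_poly_carrier [symmetric] polynomial_def)
    then show ?thesis by (subst ev) (use Y that in \<open>simp_all add: B.a_comm\<close>)
  qed
  have jy: "j u \<oplus>\<^bsub>B Quot I\<^esub> j v \<otimes>\<^bsub>B Quot I\<^esub> y = I +>\<^bsub>B\<^esub> (poly_of_const u \<oplus>\<^bsub>B\<^esub> poly_of_const v \<otimes>\<^bsub>B\<^esub> ?Y)"
    if "u \<in> carrier R" "v \<in> carrier R" for u v
    using that Y by (simp add: j_def y_def)
  have GI: "?G \<otimes>\<^bsub>B\<^esub> h \<in> I" if "h \<in> carrier B" for h
    using I.I_r_closed[OF B.cgenideal_self[OF G, folded I_def] that] .
  have "I +>\<^bsub>B\<^esub> ?G = \<zero>\<^bsub>B Quot I\<^esub>" using I.rcos_zero_iff[OF G] B.cgenideal_self[OF G] by (simp add: I_def)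
  then have "y \<otimes>\<^bsub>B Quot I\<^esub> y \<ominus>\<^bsub>B Quot I\<^esub> j f = \<zero>\<^bsub>B Quot I\<^esub>" unfolding Geq using Y f by (simp add: a_minus_def y_def j_def)
  then show "y \<otimes>\<^bsub>B Quot I\<^esub> y = j f" using yc jc[OF f] by (subst (asm) Q.r_right_minus_eq) auto
  show "\<exists>u\<in>carrier R. \<exists>v\<in>carrier R. z = j u \<oplus>\<^bsub>B Quot I\<^esub> j v \<otimes>\<^bsub>B Quot I\<^esub> y" if "z \<in> carrier (B Quot I)" for z
  proof -
    obtain p where p: "p \<in> carrier B" "z = I +>\<^bsub>B\<^esub> p" using I.rcosE[OF \<open>z \<in> carrier (B Quot I)\<close>] .
    have "\<exists>q r. polynomial (carrier R) q \<and> polynomial (carrier R) r \<and>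
        p = (?G \<otimes>\<^bsub>poly_ring R\<^esub> q) \<oplus>\<^bsub>poly_ring R\<^esub> r \<and> (r = [] \<or> degree r < degree ?G)"
      by (rule long_division_theorem[OF sr]) (use p G in \<open>auto simp: B_def univ_poly_carrier\<close>)
    then obtain h r where hr: "h \<in> carrier B" "r \<in> carrier B" "p = ?G \<otimes>\<^bsub>B\<^esub> h \<oplus>\<^bsub>B\<^esub> r" "r = [] \<or> degree r < 2"
      by (auto simp: B_def univ_poly_carrier)
    have "z = I +>\<^bsub>B\<^esub> r"
      using p hr(1-3) GI[OF hr(1)] I.rcos_zero_iff[of "?G \<otimes>\<^bsub>B\<^esub> h"] G H.hom_add[of "?G \<otimes>\<^bsub>B\<^esub> h" r] by simp
    moreover have "\<exists>u\<in>carrier R. \<exists>v\<in>carrier R. r = poly_of_const u \<oplus>\<^bsub>B\<^esub> poly_of_const v \<otimes>\<^bsub>B\<^esub> ?Y"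
    proof (cases "length r = 2")
      case True
      then obtain v u where r: "r = [v, u]" by (auto simp: numeral_eq_Suc length_Suc_conv)
      then have "u \<in> carrier R" "v \<in> carrier R" "v \<noteq> \<zero>" using hr(2) by (auto simp: B_def univ_poly_carrier [symmetric] polynomial_def)
      then show ?thesis using lin r by blast
    next
      case False
      then have "r = [] \<or> (\<exists>u. r = [u])" using hr(4) by (cases r) (auto simp: numeral_eq_Suc less_Suc_eq)
      then obtain u where u: "u \<in> carrier R" "r = poly_of_const u"
      proof (elim disjE exE)
        fix u assume r: "r = [u]"
        then have "u \<in> carrier R" "u \<noteq> \<zero>" using hr(2) by (auto simp: B_def univ_poly_carrier [symmetric] polynomial_def)
        then show ?thesis using that[of u] r by (simp add: poly_of_const_def)
      qed (use that[of \<zero>] in \<open>simp add: poly_of_const_def\<close>)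
      then have "r = poly_of_const u \<oplus>\<^bsub>B\<^esub> poly_of_const \<zero> \<otimes>\<^bsub>B\<^esub> ?Y" using Y by simp
      then show ?thesis using u by blast
    qed
    ultimately obtain u v where "u \<in> carrier R" "v \<in> carrier R"
      "z = I +>\<^bsub>B\<^esub> (poly_of_const u \<oplus>\<^bsub>B\<^esub> poly_of_const v \<otimes>\<^bsub>B\<^esub> ?Y)" by blast
    then show ?thesis using jy[of u v] by metis
  qed
  show "u = \<zero> \<and> v = \<zero>" if u: "u \<in> carrier R" and v: "v \<in> carrier R" and z: "j u \<oplus>\<^bsub>B Quot I\<^esub> j v \<otimes>\<^bsub>B Quot I\<^esub> y = \<zero>\<^bsub>B Quot I\<^esub>"
  proof -
    define w where "w = poly_of_const u \<oplus>\<^bsub>B\<^esub> poly_of_const v \<otimes>\<^bsub>B\<^esub> ?Y"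
    have w_eq: "w = (if v \<noteq> \<zero> then [v, u] else if u \<noteq> \<zero> then [u] else [])"
    proof (cases "v = \<zero>")
      case True
      then have "w = poly_of_const u" using u Y by (simp add: w_def)
      then show ?thesis using True u by (simp add: poly_of_const_def)
    qed (use lin[OF u v] in \<open>simp add: w_def\<close>)
    have wc: "w \<in> carrier B" using u v Y by (simp add: w_def)
    have "w \<in> I" using z jy[OF u v] I.rcos_zero_iff[OF wc] by (simp add: w_def)
    then obtain h where h: "h \<in> carrier B" "w = h \<otimes>\<^bsub>B\<^esub> ?G" unfolding I_def cgenideal_def by blast
    have "w = []"
    proof (rule ccontr)
      assume n: "w \<noteq> []"
      have "h \<noteq> []"
      proof
        assume "h = []"
        then have "h = \<zero>\<^bsub>B\<^esub>" by (simp add: B_def univ_poly_zero)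
        then have "w = \<zero>\<^bsub>B\<^esub>" using h G by simp
        then show False using n by (simp add: B_def univ_poly_zero)
      qed
      then have "degree w = degree h + 2"
        using poly_mult_degree_eq[OF sr, of h ?G] h G by (simp add: B_def univ_poly_carrier univ_poly_mult)
      then show False using w_eq n by (auto split: if_splits)
    qed
    then show ?thesis using w_eq by (auto split: if_splits)
  qed
qed

context curve_field begin

abbreviation "fcub \<equiv> [\<one>, \<zero>, a, b]"

lemma fcub_mons: "fcub \<in> mons 3" and fcub_carrier [simp]: "fcub \<in> carrier (poly_ring R)"
  by (simp_all add: mons_def Mon_def poly_carrier_iff)

definition emb :: "'a list \<Rightarrow> ('a list list set \<times> 'a list list set) set" where
  "emb u = frac_class (coordinate_ring R a b) (curve_ideal R a b +>\<^bsub>bivariate R\<^esub> ring.poly_of_const (poly_ring R) u) \<one>\<^bsub>coordinate_ring R a b\<^esub>"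

definition yF :: "('a list list set \<times> 'a list list set) set" where
  "yF = frac_class (coordinate_ring R a b) (curve_ideal R a b +>\<^bsub>bivariate R\<^esub> [\<one>\<^bsub>poly_ring R\<^esub>, \<zero>\<^bsub>poly_ring R\<^esub>]) \<one>\<^bsub>coordinate_ring R a b\<^esub>"

lemma function_field_quad_ext: "quad_ext (function_field R a b) (poly_ring R) emb yF fcub"
proof -
  interpret quad_ring "coordinate_ring R a b" "poly_ring R" "\<lambda>u. curve_ideal R a b +>\<^bsub>bivariate R\<^esub> UP.poly_of_const u"
    "curve_ideal R a b +>\<^bsub>bivariate R\<^esub> [\<one>\<^bsub>poly_ring R\<^esub>, \<zero>\<^bsub>poly_ring R\<^esub>]" fcub
    unfolding coordinate_ring_def curve_ideal_def
  proof (intro quad_ring.intro quad_ring_axioms.intro UP.domain_axioms fcub_carrier)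
    note M = UP.monic_quadratic_quotient[OF fcub_carrier]
    show "cring (bivariate R Quot PIdl\<^bsub>bivariate R\<^esub> [\<one>\<^bsub>poly_ring R\<^esub>, \<zero>\<^bsub>poly_ring R\<^esub>, \<ominus>\<^bsub>poly_ring R\<^esub> fcub])" by (rule M(1))
    show "u = \<zero>\<^bsub>poly_ring R\<^esub> \<and> v = \<zero>\<^bsub>poly_ring R\<^esub>" if "u \<in> carrier (poly_ring R)" "v \<in> carrier (poly_ring R)"
      "u \<otimes>\<^bsub>poly_ring R\<^esub> u = fcub \<otimes>\<^bsub>poly_ring R\<^esub> (v \<otimes>\<^bsub>poly_ring R\<^esub> v)" for u v
      using odd_degree_aniso[OF fcub_carrier _ _ that] by simp
    show "\<one>\<^bsub>poly_ring R\<^esub> \<oplus>\<^bsub>poly_ring R\<^esub> \<one>\<^bsub>poly_ring R\<^esub> \<in> Units (poly_ring R)" by (rule poly_two_unit[OF two_nonzero])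
  qed (rule UP.monic_quadratic_quotient[OF fcub_carrier]; assumption)+
  show ?thesis using quad_ext_fraction_field by (simp add: function_field_def emb_def [abs_def] yF_def)
qed

end

section \<open>The affine chart and the chart at infinity\<close>

context field_polys begin

lemma linear_MIrr: assumes "c \<in> carrier R" shows "[\<one>, c] \<in> MIrr"
proof -
  have "[\<one>, c] \<in> kX" using assms by (simp add: poly_carrier_iff)
  then show ?thesis using degree_one_imp_pirreducible[OF carrier_is_subfield, of "[\<one>, c]"] by (simp add: MIrr_def Mon_def)
qed

lemma mult_linear_linear: "e \<in> carrier R \<Longrightarrow> g \<in> carrier R \<Longrightarrow> [\<one>, e] .* [\<one>, g] = [\<one>, g \<oplus> e, e \<otimes> g]"
  by (simp add: univ_poly_mult)

lemma mult_linear_quadratic: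
  "e \<in> carrier R \<Longrightarrow> s \<in> carrier R \<Longrightarrow> t \<in> carrier R \<Longrightarrow>
   [\<one>, e] .* [\<one>, s, t] = [\<one>, s \<oplus> e, t \<oplus> e \<otimes> s, e \<otimes> t]"
  by (simp add: univ_poly_mult)

lemma mons_1_eq: assumes "p \<in> mons 1" obtains e where "e \<in> carrier R" "p = [\<one>, e]"
  using assms unfolding mons_eq by (auto simp: length_Suc_conv)

end

context curve_field begin

abbreviation "A \<equiv> poly_ring R"
abbreviation "F \<equiv> function_field R a b"
abbreviation "C \<equiv> constant_field R a b"

abbreviation Fmult (infixl ":*" 70) where "u :* v \<equiv> u \<otimes>\<^bsub>function_field R a b\<^esub> v"
abbreviation Fadd (infixl ":+" 65) where "u :+ v \<equiv> u \<oplus>\<^bsub>function_field R a b\<^esub> v"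
abbreviation Fsub (infixl ":-" 65) where "u :- v \<equiv> u \<ominus>\<^bsub>function_field R a b\<^esub> v"
abbreviation Fneg (":~ _" [81] 80) where ":~ u \<equiv> \<ominus>\<^bsub>function_field R a b\<^esub> u"
abbreviation Fpow (infixr ":^" 75) where "u :^ (n::nat) \<equiv> u [^]\<^bsub>function_field R a b\<^esub> n"
abbreviation "zF0 \<equiv> \<zero>\<^bsub>function_field R a b\<^esub>"
abbreviation "oF \<equiv> \<one>\<^bsub>function_field R a b\<^esub>"

sublocale FF: quad_ext F A emb yF fcub by (rule function_field_quad_ext)

text \<open>By degrees a repeated factor is linear, say \<open>X + e\<close>, with linear cofactor
  \<open>X + g\<close>. The missing quadratic term forces \<open>g = - 2e\<close>, and then
  \<open>4 a^3 + 27 b^2\<close> vanishes identically in \<open>e\<close>.\<close>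

lemma fcub_squarefree:
  assumes P: "P \<in> MIrr" shows "\<not> (P .* P) .| fcub"
proof
  assume d: "(P .* P) .| fcub"
  note PP = MIrrD[OF P]
  have fM: "fcub \<in> Mon" using fcub_mons by (simp add: mons_def)
  obtain h where h: "h \<in> Mon" "fcub = (P .* P) .* h" using Mon_divides_cofactor[OF Mon_mult[OF PP(1) PP(1)] fM d] .
  have "3 = degree P + degree P + degree h"
    using Mon_degree_mult[OF Mon_mult[OF PP(1) PP(1)] h(1)] Mon_degree_mult[OF PP(1) PP(1)] unfolding h(2) [symmetric] by simp
  moreover from this have "degree P = 1" using PP(3) by linarith
  ultimately have "degree P = 1" "degree h = 1" by auto
  then have "P \<in> mons 1" "h \<in> mons 1" using PP(1) h(1) by (auto simp: mons_def)
  then obtain e g where eg: "e \<in> carrier R" "g \<in> carrier R" "P = [\<one>, e]" "h = [\<one>, g]" by (metis mons_1_eq)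
  have "fcub = P .* (P .* h)" unfolding h(2) using PP(2) MonD(1)[OF h(1)] by (simp add: UP.m_assoc)
  also have "\<dots> = [\<one>, (g \<oplus> e) \<oplus> e, (e \<otimes> g) \<oplus> e \<otimes> (g \<oplus> e), e \<otimes> (e \<otimes> g)]"
    unfolding eg(3,4) using eg(1,2) by (simp only: mult_linear_linear) (intro mult_linear_quadratic, auto)
  finally have q: "(g \<oplus> e) \<oplus> e = \<zero>" and aa: "a = (e \<otimes> g) \<oplus> e \<otimes> (g \<oplus> e)" and bb: "b = e \<otimes> (e \<otimes> g)" by auto
  have "g \<ominus> \<ominus> (e \<oplus> e) \<ominus> ((g \<oplus> e) \<oplus> e) = \<zero>" using eg(1,2) by algebra
  then have "g = \<ominus> (e \<oplus> e)" unfolding q using eg(1,2) by (simp add: a_minus_def) (metis a_minus_def r_right_minus_eq add.inv_closed a_inv_closed a_closed minus_minus)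
  moreover define l where "l = [e]"
  have ic: "in_carrier l" using eg(1) by (simp add: l_def in_carrier_def)
  have vs: "e = Ipolex l (Var 0)" by (simp_all add: l_def)
  ultimately have "\<guillemotleft>4\<guillemotright> \<otimes> a [^] (3::nat) \<oplus> \<guillemotleft>27\<guillemotright> \<otimes> b [^] (2::nat) =
      \<guillemotleft>4\<guillemotright> \<otimes> ((e \<otimes> \<ominus> (e \<oplus> e)) \<oplus> e \<otimes> (\<ominus> (e \<oplus> e) \<oplus> e)) [^] (3::nat) \<oplus> \<guillemotleft>27\<guillemotright> \<otimes> (e \<otimes> (e \<otimes> \<ominus> (e \<oplus> e))) [^] (2::nat)"
    using aa bb by simp
  also have "\<dots> = \<zero>" by (simp only: vs reify[where l = l]) (rule norm_eq[OF ic], code_simp)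
  finally show False using disc by simp
qed

lemma quad_place_poly:
  assumes Q: "quad_ext F A i y f" and P: "P \<in> MIrr" and sq: "\<not> (P .* P) .| f"
  shows "quad_place F A i y f P length (red (degree P))"
proof (intro quad_place.intro quad_place_axioms.intro Q sq)
  note PP = MIrrD[OF P]
  have Pm: "P \<in> mons (degree P)" using PP by (simp add: mons_def)
  show "P \<in> kX" "P \<noteq> zP" using PP by auto
  show "\<not> P .| oP" using PP(2,6) UP.divides_unit by auto
  show "red (degree P) \<subseteq> kX" using red_carrier by auto
  show "\<exists>w\<in>kX. P .| (u .* w .- oP)" if "u \<in> kX" "\<not> P .| u" for u
    by (rule MIrr_inverse_mod[OF P that])
  show "length w < length (P .* w)" if w: "w \<in> kX" "w \<noteq> zP" for w
    using poly_degree_mult(1,3)[OF PP(2) w(1) PP(5)] w PP(3) by (cases w; cases "P .* w") auto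
  show "\<exists>x\<in>red (degree P). P .| (u .- x)" if "u \<in> kX" for u
    using red_exists[OF Pm that] by blast
  show "x = x'" if "x \<in> red (degree P)" "x' \<in> red (degree P)" "P .| (x .- x')" for x x'
    by (rule red_unique[OF Pm that])
qed

lemma quad_place_finite: "P \<in> MIrr \<Longrightarrow> quad_place F A emb yF fcub P length (red (degree P))"
  by (intro quad_place_poly function_field_quad_ext fcub_squarefree)

definition sig :: "'a \<Rightarrow> ('a list list set \<times> 'a list list set) set" where "sig c = emb (poly_of_const c)"

sublocale E: poly_eval_hom R F sig
proof (intro poly_eval_hom.intro poly_eval_hom_axioms.intro field_polys_axioms field_polys.intro FF.field_axioms)
  show "sig \<in> ring_hom R F" using ring_hom_trans[OF poly_const_hom FF.\<iota>_hom] by (simp add: comp_def sig_def [abs_def])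
qed

lemma C_eq: "C = sig ` carrier R" unfolding constant_field_def sig_def emb_def ..

lemma C_subfield: "subfield C F" and C_card: "finite C" "card C = order R"
proof -
  show "subfield C F" unfolding C_eq by (rule E.S.img_is_subfield(2)[OF carrier_is_subfield]) simp
  show "finite C" unfolding C_eq using finite_carrier by simp
  have "inj_on sig (carrier R)" using E.\<sigma>_inj by (auto simp: inj_on_def)
  then show "card C = order R" unfolding C_eq order_def by (rule card_image)
qed

lemma C_emb: "C \<subseteq> emb ` kX" unfolding C_eq sig_def by auto

definition xF where "xF = emb [\<one>, \<zero>]"

definition zF where "zF = inv\<^bsub>F\<^esub> xF"

lemma X_carrier [simp]: "[\<one>, \<zero>] \<in> kX" by (simp add: poly_carrier_iff)

lemma XX_nz: "[\<one>, \<zero>] .* [\<one>, \<zero>] \<noteq> []"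
  using UP.integral[of "[\<one>, \<zero>]" "[\<one>, \<zero>]"] by auto

lemma emb_zero_iff: "u \<in> kX \<Longrightarrow> emb u = zF0 \<longleftrightarrow> u = []"
  using FF.\<iota>_el[of u] FF.el_zero_iff[OF _ UP.zero_closed, of u] by simp

lemma xz [simp]: "xF \<in> carrier F" "zF \<in> carrier F" "xF :* zF = oF" "zF :* xF = oF" "xF \<noteq> zF0" "zF \<noteq> zF0"
proof -
  show x: "xF \<in> carrier F" by (simp add: xF_def)
  show n: "xF \<noteq> zF0" by (simp add: xF_def emb_zero_iff)
  show "zF \<in> carrier F" "xF :* zF = oF" "zF :* xF = oF" using x n by (simp_all add: zF_def)
  show "zF \<noteq> zF0" using x n by (simp add: zF_def FF.nonzero_imp_inverse_nonzero)
qed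

lemma emb_ev: assumes p: "p \<in> kX" shows "emb p = E.ev xF p"
proof -
  have pc: "set (map poly_of_const p) \<subseteq> kX" using poly_set_carrier[OF p] by auto
  have "emb p = emb (UP.eval (map poly_of_const p) [\<one>, \<zero>])"
    using eval_rewrite[OF carrier_is_subring p] by (simp add: var_def)
  also have "\<dots> = FF.eval (map emb (map poly_of_const p)) xF" unfolding xF_def by (rule FF.I.eval_hom'[OF X_carrier pc])
  finally have "emb p = FF.eval (map (\<lambda>c. emb (poly_of_const c)) p) xF" by (simp add: comp_def)
  then show ?thesis unfolding E.ev_def by (simp add: sig_def cong: map_cong)
qed

lemma ev_X [simp]: "t \<in> carrier F \<Longrightarrow> E.ev t [\<one>, \<zero>] = t" by (simp add: E.ev_def)

lemma ev_const: "t \<in> carrier F \<Longrightarrow> c \<in> carrier R \<Longrightarrow> E.ev t (poly_of_const c) = sig c"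
  by (auto simp: E.ev_def poly_of_const_eq)

lemma ev_Cons: "t \<in> carrier F \<Longrightarrow> E.ev t (c # p) = sig c :* t :^ length p :+ E.ev t p"
  by (simp add: E.ev_def)

lemma sig_closed [simp]: "c \<in> carrier R \<Longrightarrow> sig c \<in> carrier F" by simp

lemma pow_cancel: assumes "s \<in> carrier F" "t \<in> carrier F" "s :* t = oF" shows "s :^ (n::nat) :* t :^ n = oF"
  using FF.nat_pow_distrib[OF assms(1,2), of n] assms(3) by simp

text \<open>Multiplying \<open>p(s)\<close> by \<open>t^n\<close> with \<open>t = 1/s\<close>
  reverses the coefficients. Since \<open>length p \<le> n\<close> means that \<open>n\<close>
  exceeds the degree, the reversed polynomial has no constant term, which is the factor
  \<open>X\<close>.\<close>

lemma ev_reverse: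
  assumes st: "s \<in> carrier F" "t \<in> carrier F" "s :* t = oF" and p: "set p \<subseteq> carrier R" "length p \<le> n"
  shows "\<exists>r\<in>kX. E.ev s p :* t :^ n = E.ev t ([\<one>, \<zero>] .* r)"
proof -
  interpret H: ring_hom_ring A F "E.ev t" by (rule E.ev_hom[OF st(2)])
  show ?thesis using p
  proof (induction p)
    case Nil
    have "E.ev s [] :* t :^ n = E.ev t ([\<one>, \<zero>] .* zP)" using st UP.r_null[OF X_carrier] by (simp add: E.ev_def)
    then show ?case using UP.zero_closed by blast
  next
    case (Cons c p)
    then obtain r where r: "r \<in> kX" "E.ev s p :* t :^ n = E.ev t ([\<one>, \<zero>] .* r)" by auto
    have c: "c \<in> carrier R" "set p \<subseteq> carrier R" using Cons by auto
    obtain m where m: "n = length p + Suc m" using Cons.prems(2) by (metis Suc_le_eq add.commute add_Suc less_imp_Suc_add length_Cons add_Suc_right)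
    let ?q = "poly_of_const c .* [\<one>, \<zero>] .^ m"
    have qc: "?q \<in> kX" using c by simp
    have "sig c :* s :^ length p :* t :^ n = sig c :* (s :^ length p :* t :^ length p) :* t :^ Suc m"
      unfolding m using st c by (simp add: FF.m_assoc FF.nat_pow_mult [symmetric])
    also have "\<dots> = t :* (sig c :* t :^ m)" unfolding pow_cancel[OF st] using st c by (simp add: FF.m_ac)
    also have "\<dots> = E.ev t ([\<one>, \<zero>] .* ?q)" using qc c st by (simp add: H.hom_nat_pow ev_const)
    finally have e: "sig c :* s :^ length p :* t :^ n = E.ev t ([\<one>, \<zero>] .* ?q)" .
    have "E.ev s (c # p) :* t :^ n = E.ev t ([\<one>, \<zero>] .* ?q) :+ E.ev t ([\<one>, \<zero>] .* r)"
      unfolding e [symmetric] r(2) [symmetric] ev_Cons[OF st(1)] using c st E.ev_closed[OF st(1) c(2)] by (simp add: FF.l_distr)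
    also have "\<dots> = E.ev t ([\<one>, \<zero>] .* ?q .+ [\<one>, \<zero>] .* r)"
      by (rule H.hom_add[symmetric]) (use qc r(1) in auto)
    also have "[\<one>, \<zero>] .* ?q .+ [\<one>, \<zero>] .* r = [\<one>, \<zero>] .* (?q .+ r)"
      by (rule UP.r_distr[symmetric]) (use qc r(1) in auto)
    finally show ?case using qc r(1) by blast
  qed
qed

lemma eval_X_mult: "r \<in> kX \<Longrightarrow> eval ([\<one>, \<zero>] .* r) \<zero> = \<zero>"
proof -
  assume r: "r \<in> kX"
  interpret H: ring_hom_ring A R "\<lambda>p. eval p \<zero>" by (rule eval_poly_hom) simp
  show ?thesis using H.hom_mult[OF X_carrier r] H.hom_closed[OF r] by simp
qed

text \<open>Transcendence of \<open>1/x\<close>: after multiplication by a power of \<open>x\<close>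
  the leading coefficient becomes the constant term of a polynomial in \<open>x\<close>, which
  vanishes only if all its coefficients do.\<close>

lemma ev_zF_zero: assumes p: "p \<in> kX" and z: "E.ev zF p = zF0" shows "p = []"
proof (cases p)
  case (Cons c p')
  then have c: "c \<in> carrier R" "set p' \<subseteq> carrier R" "c \<noteq> \<zero>" using p by (auto simp: poly_carrier_iff)
  obtain r where r: "r \<in> kX" "E.ev zF p' :* xF :^ length p' = E.ev xF ([\<one>, \<zero>] .* r)"
    using ev_reverse[of zF xF p' "length p'"] c by auto
  have "zF0 = E.ev zF (c # p') :* xF :^ length p'" using z Cons by simp
  also have "\<dots> = sig c :* (zF :^ length p' :* xF :^ length p') :+ E.ev zF p' :* xF :^ length p'"
    unfolding ev_Cons[OF xz(2)] using c E.ev_closed[OF xz(2) c(2)] by (simp add: FF.l_distr FF.m_assoc)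
  also have "\<dots> = emb (poly_of_const c) :+ emb ([\<one>, \<zero>] .* r)"
    unfolding r(2) pow_cancel[OF xz(2,1,4)] using c r(1) emb_ev[of "[\<one>, \<zero>] .* r"] by (simp add: sig_def)
  also have "\<dots> = emb (poly_of_const c .+ [\<one>, \<zero>] .* r)" using c r(1) by simp
  finally have e: "poly_of_const c .+ [\<one>, \<zero>] .* r = []" using emb_zero_iff[of "poly_of_const c .+ [\<one>, \<zero>] .* r"] c(1) r(1) by (metis PC.hom_closed UP.a_closed UP.m_closed X_carrier)
  interpret H: ring_hom_ring A R "\<lambda>p. eval p \<zero>" by (rule eval_poly_hom) simp
  have "eval (poly_of_const c .+ [\<one>, \<zero>] .* r) \<zero> = eval (poly_of_const c) \<zero> \<oplus> eval ([\<one>, \<zero>] .* r) \<zero>"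
    by (rule H.hom_add) (use c r in auto)
  then have "c = \<zero>" using e eval_X_mult[OF r(1)] c by (simp add: poly_of_const_eq)
  then show ?thesis using c by simp
qed simp

text \<open>Coordinates at infinity: with \<open>z = 1/x\<close> and \<open>yI = y/x^2\<close> the
  curve becomes \<open>yI^2 = z (1 + a z^2 + b z^3)\<close>. \<open>hI\<close> is the second factor,
  which takes the value 1 at \<open>z = 0\<close>.\<close>

definition yI where "yI = yF :* (zF :* zF)"

definition hI where "hI = oP .+ [\<one>, \<zero>] .* ([\<one>, \<zero>] .* (poly_of_const a .+ poly_of_const b .* [\<one>, \<zero>]))"

definition fI where "fI = [\<one>, \<zero>] .* hI"

lemma fI_carrier [simp]: "hI \<in> kX" "fI \<in> kX" by (simp_all add: hI_def fI_def)

lemma (in cring) weierstrass_at_infinity: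
  assumes c: "x \<in> carrier R" "z \<in> carrier R" "\<alpha> \<in> carrier R" "\<beta> \<in> carrier R" "y \<in> carrier R"
    and xz: "x \<otimes> z = \<one>" and y: "y \<otimes> y = x [^] (3::nat) \<oplus> \<alpha> \<otimes> x \<oplus> \<beta>"
  shows "(y \<otimes> (z \<otimes> z)) \<otimes> (y \<otimes> (z \<otimes> z)) = z \<otimes> (\<one> \<oplus> z \<otimes> (z \<otimes> (\<alpha> \<oplus> \<beta> \<otimes> z)))"
proof -
  \<comment> \<open>The two sides differ only through \<open>(xz)^3 - 1\<close> and
    \<open>xz - 1\<close>; \<open>?G\<close> collects the cofactors of
    \<open>xz - 1\<close>.\<close>
  let ?G = "z \<otimes> ((x \<otimes> z) \<otimes> (x \<otimes> z) \<oplus> x \<otimes> z \<oplus> \<one>) \<oplus> \<alpha> \<otimes> (z \<otimes> (z \<otimes> z))"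
  let ?L = "(x [^] (3::nat) \<oplus> \<alpha> \<otimes> x \<oplus> \<beta>) \<otimes> ((z \<otimes> z) \<otimes> (z \<otimes> z))"
  let ?R = "z \<otimes> (\<one> \<oplus> z \<otimes> (z \<otimes> (\<alpha> \<oplus> \<beta> \<otimes> z)))"
  define l where "l = [x, z, \<alpha>, \<beta>]"
  have ic: "in_carrier l" using c by (simp add: l_def in_carrier_def)
  have vs: "x = Ipolex l (Var 0)" "z = Ipolex l (Var 1)" "\<alpha> = Ipolex l (Var 2)" "\<beta> = Ipolex l (Var 3)" by (simp_all add: l_def)
  have "?L \<ominus> ?R \<ominus> (x \<otimes> z \<ominus> \<one>) \<otimes> ?G = \<zero>" by (simp only: vs reify[where l = l]) (rule norm_eq[OF ic], code_simp)
  then have "?L \<ominus> ?R = (x \<otimes> z \<ominus> \<one>) \<otimes> ?G" using c by (subst (asm) r_right_minus_eq) auto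
  also have "x \<otimes> z \<ominus> \<one> = \<zero>" unfolding xz by (simp add: a_minus_def r_neg)
  finally have "?L = ?R" using c by (subst r_right_minus_eq[symmetric]) auto
  moreover have "(y \<otimes> (z \<otimes> z)) \<otimes> (y \<otimes> (z \<otimes> z)) = (y \<otimes> y) \<otimes> ((z \<otimes> z) \<otimes> (z \<otimes> z))" using c by (simp add: m_ac)
  ultimately show ?thesis unfolding y by simp
qed

lemma quad_ext_infinity: "quad_ext F A (E.ev zF) yI fI"
proof -
  interpret H: ring_hom_ring A F "E.ev zF" by (rule E.ev_hom) simp
  show ?thesis
  proof (intro quad_ext.intro quad_ext_axioms.intro FF.field_axioms UP.domain_axioms fI_carrier(2) FF.two_unit)
    show "E.ev zF \<in> ring_hom A F" by (rule H.homh)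
    show "yI \<in> carrier F" by (simp add: yI_def)
    have "yF :* yF = xF :^ (3::nat) :+ sig a :* xF :+ sig b"
      using FF.y_sq emb_ev[OF fcub_carrier] by (simp add: E.ev_def FF.a_assoc numeral_eq_Suc)
    then show "yI :* yI = E.ev zF fI"
      unfolding yI_def by (subst FF.weierstrass_at_infinity[of xF zF "sig a" "sig b"]) (simp_all add: fI_def hI_def ev_const)
  next
    fix z0 assume z0: "z0 \<in> carrier F"
    obtain u v w where uvw: "u \<in> kX" "v \<in> kX" "w \<in> kX" "w \<noteq> []" "z0 :* emb w = emb u :+ emb v :* yF"
      using FF.rep[OF z0] by auto
    \<comment> \<open>Any exponent above the three degrees works; this one lets the same power of
      \<open>1/x\<close> turn all three polynomials in \<open>x\<close> into polynomials in
      \<open>1/x\<close>.\<close>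
    define n where "n = length u + length v + length w"
    have ex: "\<exists>r\<in>kX. emb p :* zF :^ n = E.ev zF r" if p: "p \<in> kX" "length p \<le> n" for p
    proof -
      obtain r where "r \<in> kX" "E.ev xF p :* zF :^ n = E.ev zF ([\<one>, \<zero>] .* r)"
        using ev_reverse[OF xz(1-3) poly_set_carrier[OF p(1)] p(2)] by blast
      then show ?thesis using emb_ev[OF p(1)] UP.m_closed[OF X_carrier] by metis
    qed
    obtain u' where u': "u' \<in> kX" "emb u :* zF :^ n = E.ev zF u'" using ex[OF uvw(1)] by (auto simp: n_def)
    obtain v' where v': "v' \<in> kX" "emb v :* zF :^ n = E.ev zF v'" using ex[OF uvw(2)] by (auto simp: n_def)
    obtain w' where w': "w' \<in> kX" "emb w :* zF :^ n = E.ev zF w'" using ex[OF uvw(3)] by (auto simp: n_def)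
    \<comment> \<open>The two extra factors \<open>1/x\<close> pay for the passage from
      \<open>yF\<close> to \<open>yI = yF / x^2\<close>.\<close>
    let ?XX = "[\<one>, \<zero>] .* [\<one>, \<zero>]"
    have zp: "zF :^ n \<in> carrier F" "zF :^ n \<noteq> zF0" by auto
    have ec: "emb u \<in> carrier F" "emb v \<in> carrier F" "emb w \<in> carrier F" using uvw by auto
    have "z0 :* E.ev zF (w' .* ?XX) = (z0 :* emb w) :* (zF :^ n :* (zF :* zF))"
      using w'(1) z0 zp ec by (simp add: w'(2) [symmetric] FF.m_assoc)
    also have "\<dots> = (emb u :* zF :^ n) :* (zF :* zF) :+ (emb v :* zF :^ n) :* yI"
      unfolding uvw(5) yI_def using zp ec by (simp add: FF.l_distr FF.r_distr FF.m_ac)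
    also have "\<dots> = E.ev zF (u' .* ?XX) :+ E.ev zF v' :* yI" using u' v' by simp
    finally have "z0 :* E.ev zF (w' .* ?XX) = E.ev zF (u' .* ?XX) :+ E.ev zF v' :* yI" .
    moreover have "w' .* ?XX \<noteq> zP"
    proof
      assume "w' .* ?XX = zP"
      then have "w' = zP" using UP.integral[of w' ?XX] w'(1) XX_nz by auto
      then have "emb w :* zF :^ n = zF0" using w' by (simp add: E.ev_def)
      then have "emb w = zF0" using FF.integral[OF _ ec(3) zp(1)] zp by auto
      then show False using uvw emb_zero_iff by simp
    qed
    ultimately show "\<exists>u\<in>kX. \<exists>v\<in>kX. \<exists>w\<in>kX. w \<noteq> zP \<and>
        z0 :* E.ev zF w = E.ev zF u :+ E.ev zF v :* yI"
      using u'(1) v'(1) w'(1) UP.m_closed X_carrier by meson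
  next
    fix u v assume uv: "u \<in> kX" "v \<in> kX" and z: "E.ev zF u :+ E.ev zF v :* yI = zF0"
    define n where "n = length u + length v"
    have ex: "\<exists>r\<in>kX. E.ev zF p :* xF :^ n = emb r" if p: "p \<in> kX" "length p \<le> n" for p
    proof -
      obtain r where "r \<in> kX" "E.ev zF p :* xF :^ n = E.ev xF ([\<one>, \<zero>] .* r)"
        using ev_reverse[OF xz(2,1,4) poly_set_carrier[OF p(1)] p(2)] by blast
      then show ?thesis using emb_ev UP.m_closed[OF X_carrier] by metis
    qed
    obtain u' where u': "u' \<in> kX" "E.ev zF u :* xF :^ n = emb u'" using ex[OF uv(1)] by (auto simp: n_def)
    obtain v' where v': "v' \<in> kX" "E.ev zF v :* xF :^ n = emb v'" using ex[OF uv(2)] by (auto simp: n_def)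
    let ?XX = "[\<one>, \<zero>] .* [\<one>, \<zero>]"
    have xp: "xF :^ n \<in> carrier F" "xF :^ n \<noteq> zF0" by auto
    have ec: "E.ev zF u \<in> carrier F" "E.ev zF v \<in> carrier F" using uv by auto
    have yy: "yI :* (xF :* xF) = yF"
    proof -
      have "yI :* (xF :* xF) = yF :* ((zF :* xF) :* (zF :* xF))"
        unfolding yI_def by (simp add: FF.m_ac del: xz(3,4))
      then show ?thesis by simp
    qed
    have yIc: "yI \<in> carrier F" by (simp add: yI_def)
    have "emb (u' .* ?XX) :+ emb v' :* yF = (E.ev zF u :+ E.ev zF v :* yI) :* (xF :^ n :* (xF :* xF))"
      using u'(1) v'(1) ec xp yIc by (simp add: u'(2) [symmetric] v'(2) [symmetric] yy [symmetric] xF_def [symmetric] FF.l_distr FF.r_distr FF.m_ac)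
    then have "emb (u' .* ?XX) :+ emb v' :* yF = zF0" unfolding z using xp by simp
    then have "u' .* ?XX = zP" "v' = zP" using FF.indep[of "u' .* ?XX" v'] u' v' by auto
    then have "u' = zP" using UP.integral[of u' ?XX] u'(1) XX_nz by auto
    then have "E.ev zF u = zF0" "E.ev zF v = zF0"
      using u' v' \<open>v' = zP\<close> FF.integral[OF _ ec(1) xp(1)] FF.integral[OF _ ec(2) xp(1)] xp emb_zero_iff by auto
    then show "u = zP \<and> v = zP" using ev_zF_zero uv by simp
  qed
qed

lemma X_MIrr: "[\<one>, \<zero>] \<in> MIrr" by (rule linear_MIrr) simp

lemma fI_squarefree: "\<not> ([\<one>, \<zero>] .* [\<one>, \<zero>]) .| fI"
proof
  assume "([\<one>, \<zero>] .* [\<one>, \<zero>]) .| fI"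
  then obtain h where h: "h \<in> kX" "fI = [\<one>, \<zero>] .* [\<one>, \<zero>] .* h" by (auto simp: factor_def)
  then have "[\<one>, \<zero>] .* hI = [\<one>, \<zero>] .* ([\<one>, \<zero>] .* h)" by (simp add: fI_def UP.m_assoc)
  then have e: "hI = [\<one>, \<zero>] .* h" using h by (subst (asm) UP.m_lcancel) auto
  interpret H: ring_hom_ring A R "\<lambda>p. eval p \<zero>" by (rule eval_poly_hom) simp
  have "eval hI \<zero> = \<one>" unfolding hI_def
    by (subst H.hom_add) (simp_all add: eval_X_mult)
  moreover have "eval hI \<zero> = \<zero>" unfolding e using eval_X_mult h by simp
  ultimately show False by simp
qed

lemma quad_place_infinity: "quad_place F A (E.ev zF) yI fI [\<one>, \<zero>] length (red 1)"
  using quad_place_poly[OF quad_ext_infinity X_MIrr fI_squarefree] by simp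

end

section \<open>Places of the function field\<close>

context curve_field begin

definition lying_over :: "'a list \<Rightarrow> ('a list list set \<times> 'a list list set) set set set" where
  "lying_over P = {W. valuation_ring F C W \<and> emb ` kX \<subseteq> W \<and> emb P \<in> FF.nonunits W}"

definition sroots :: "'a list \<Rightarrow> 'a list set" where
  "sroots P = {s \<in> red (degree P). P .| (s .* s .- fcub)}"

lemma finite_sroots: "finite (sroots P)"
  using card_red[OF finite_carrier, of "degree P"] by (auto simp: sroots_def)

lemma card_C_gt_1: "card C > 1" using C_card(2) order_gt_1[OF finite_carrier] by simp

text \<open>Split and ramified primes are treated together: the valuation rings correspond to the
  square roots of the cubic modulo \<open>P\<close>, of which there are two or one, and the residue
  field is that of \<open>P\<close>.\<close>

lemma over_split:
  assumes P: "P \<in> MIrr" and s: "sroots P \<noteq> {}"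
  shows "card (lying_over P) = card (sroots P)" "finite (lying_over P)"
    and "W \<in> lying_over P \<Longrightarrow> place_degree F C (FF.nonunits W) = degree P"
proof -
  interpret Q: quad_place F A emb yF fcub P length "red (degree P)" by (rule quad_place_finite[OF P])
  have sr: "sroots P = {s \<in> red (degree P). Q.D (s .* s .- fcub)}" by (simp add: sroots_def Q.D_def)
  have eq: "lying_over P = Q.Vsplit ` sroots P"
  proof (intro equalityI subsetI)
    fix W assume W: "W \<in> lying_over P"
    obtain s where "s \<in> kX" "Q.D (s .* s .- fcub)" using s sr red_carrier by blast
    then show "W \<in> Q.Vsplit ` sroots P" using Q.above_split[of C W s] W unfolding lying_over_def sr by blast
  next
    fix W assume "W \<in> Q.Vsplit ` sroots P"
    then obtain s where "s \<in> kX" "Q.D (s .* s .- fcub)" "W = Q.Vsplit s" using sr red_carrier by blast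
    then show "W \<in> lying_over P" using Q.Vsplit_valuation[OF C_emb, of s] by (simp add: lying_over_def)
  qed
  show "card (lying_over P) = card (sroots P)" unfolding eq sr by (rule card_image[OF Q.inj_Vsplit])
  show "finite (lying_over P)" unfolding eq using finite_sroots by simp
  assume "W \<in> lying_over P"
  then obtain s where s': "s \<in> sroots P" "W = Q.Vsplit s" unfolding eq by (rule imageE) blast
  then have s: "s \<in> kX" "Q.D (s .* s .- fcub)" "W = Q.Vsplit s" unfolding sr using red_carrier by auto
  have "card (carrier (F\<lparr>carrier := W\<rparr> Quot FF.nonunits W)) = card C ^ degree P"
    using Q.card_residue_split[OF C_emb s(1,2)] s(3) card_red[OF finite_carrier] C_card by simp
  then show "place_degree F C (FF.nonunits W) = degree P"
    using FF.place_degree_by_card[OF _ C_subfield C_card(1) card_C_gt_1] \<open>W \<in> lying_over P\<close> by (simp add: lying_over_def)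
qed

lemma over_inert:
  assumes P: "P \<in> MIrr" and s: "sroots P = {}"
  shows "card (lying_over P) = 1" "finite (lying_over P)"
    and "W \<in> lying_over P \<Longrightarrow> place_degree F C (FF.nonunits W) = 2 * degree P"
proof -
  interpret Q: quad_place F A emb yF fcub P length "red (degree P)" by (rule quad_place_finite[OF P])
  have nr: "\<not> Q.D (s .* s .- fcub)" if sc: "s \<in> kX" for s
  proof
    assume d: "Q.D (s .* s .- fcub)"
    obtain t where t: "t \<in> red (degree P)" "Q.D (s .- t)" using Q.T0_ex[OF sc] by (auto simp: Q.D_def)
    have "Q.D (t .* t .- fcub)" by (rule Q.D_sq_cong[OF sc red_carrier[OF t(1)] t(2) d])
    then show False using s t(1) by (auto simp: sroots_def Q.D_def)
  qed
  have eq: "lying_over P = {Q.Vinert}"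
  proof -
    have u: "W = Q.Vinert" if "W \<in> lying_over P" for W
      by (rule Q.above_inert[of C]) (use that nr in \<open>auto simp: lying_over_def\<close>)
    have "valuation_ring F C Q.Vinert" by (rule Q.Vinert_valuation(1)[OF C_emb]) (rule nr)
    moreover have "emb ` kX \<subseteq> Q.Vinert" by (rule Q.Vinert_valuation(2)[OF C_emb]) (rule nr)
    moreover have "emb P \<in> FF.nonunits Q.Vinert" by (rule Q.Vinert_valuation(3)[OF C_emb]) (rule nr)
    ultimately have "Q.Vinert \<in> lying_over P" unfolding lying_over_def mem_Collect_eq by (intro conjI)
    then show ?thesis using u by blast
  qed
  then show "card (lying_over P) = 1" "finite (lying_over P)" by auto
  assume "W \<in> lying_over P"
  then have W: "W = Q.Vinert" using eq by simp
  have "card (carrier (F\<lparr>carrier := W\<rparr> Quot FF.nonunits W)) = card C ^ (2 * degree P)"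
    using Q.card_residue_inert[OF C_emb nr] W card_red[OF finite_carrier] C_card by (simp add: power_mult [symmetric] mult.commute)
  then show "place_degree F C (FF.nonunits W) = 2 * degree P"
    using FF.place_degree_by_card[OF _ C_subfield C_card(1) card_C_gt_1] \<open>W \<in> lying_over P\<close> by (simp add: lying_over_def)
qed

lemma ev_in_subring:
  assumes W: "subring W F" "C \<subseteq> W" "t \<in> W" and p: "set p \<subseteq> carrier R" shows "E.ev t p \<in> W"
proof -
  have tc: "t \<in> carrier F" using subringE(1)[OF W(1)] W(3) by auto
  have pw: "t :^ (n::nat) \<in> W" for n by (induction n) (use W subringE(3,6)[OF W(1)] in auto)
  show ?thesis using p
  proof (induction p)
    case Nil
    then show ?case using subringE(2)[OF W(1)] by (simp add: E.ev_def)
  next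
    case (Cons c p)
    then have "sig c \<in> W" using W(2) C_eq by auto
    then show ?case unfolding ev_Cons[OF tc] using Cons pw subringE(6,7)[OF W(1)] by simp
  qed
qed

text \<open>If \<open>x\<close> is outside the ring then \<open>1/x\<close> is a nonunit. In the
  chart at infinity the prime \<open>X\<close> divides \<open>fI\<close> exactly once, so 0 is the
  only square root modulo \<open>X\<close>: the prime ramifies and carries a single rational
  place.\<close>

lemma infinite_place:
  obtains V where "{W. valuation_ring F C W \<and> xF \<notin> W} = {V}" "place_degree F C (FF.nonunits V) = 1"
proof -
  interpret Q: quad_place F A "E.ev zF" yI fI "[\<one>, \<zero>]" length "red 1" by (rule quad_place_infinity)
  interpret H: ring_hom_ring A F "E.ev zF" by (rule E.ev_hom) simp
  have C_ev: "C \<subseteq> E.ev zF ` kX"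
  proof
    fix c assume "c \<in> C"
    then obtain r where "r \<in> carrier R" "c = E.ev zF (poly_of_const r)" using C_eq ev_const[OF xz(2)] by auto
    then show "c \<in> E.ev zF ` kX" by auto
  qed
  have nil: "[] \<in> kX" "[] \<in> red 1" using UP.zero_closed by (auto simp: red_def)
  have f: "fI = [\<one>, \<zero>] .* hI" by (rule fI_def)
  have "[] .* [] = []" using UP.r_null[OF nil(1)] by simp
  moreover have "Q.D fI" unfolding f by (rule Q.DI) simp
  ultimately have D0: "Q.D ([] .* [] .- fI)" using Q.D_minus[of "[]" fI] Q.D_zero nil by simp
  have zi: "inv\<^bsub>F\<^esub> zF = xF" by (simp add: zF_def FF.nonzero_inverse_inverse_eq)
  have uniq: "s = []" if "s \<in> red 1" "Q.D (s .* s .- fI)" for s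
  proof -
    have sc: "s \<in> kX" using red_carrier[OF that(1)] .
    have "Q.D (s .* s) \<longleftrightarrow> Q.D fI" by (rule Q.D_cong) (use sc that in auto)
    then have "Q.D s" using Q.D_prime[OF sc sc] Q.DI[of hI] f by auto
    then have "[\<one>, \<zero>] .| s" by (simp add: Q.D_def)
    moreover have "[\<one>, \<zero>] \<in> mons 1" using MIrrD(1)[OF X_MIrr] by (simp add: mons_def)
    ultimately show ?thesis using red_zero that(1) by blast
  qed
  let ?V = "Q.Vsplit []"
  note V = Q.Vsplit_valuation[OF C_ev nil(1) D0]
  have zN: "zF \<in> FF.nonunits ?V" using V(3) by simp
  have "xF \<notin> ?V" using zN zi by (auto simp: FF.nonunits_def)
  moreover have "W = ?V" if W: "valuation_ring F C W" "xF \<notin> W" for W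
  proof -
    note WD = FF.valuation_ringD[OF W(1)]
    have zW: "zF \<in> W" using WD(5)[OF xz(1) xz(5)] W(2) by (simp add: zF_def)
    then have zN: "zF \<in> FF.nonunits W" using W(2) zi by (simp add: FF.nonunits_def)
    have "E.ev zF ` kX \<subseteq> W" using ev_in_subring[OF WD(1,2) zW] poly_set_carrier by auto
    moreover have "E.ev zF [\<one>, \<zero>] \<in> FF.nonunits W" using zN by simp
    ultimately obtain s where "s \<in> red 1" "Q.D (s .* s .- fI)" "W = Q.Vsplit s"
      using Q.above_split[OF W(1) _ _ nil(1) D0] by blast
    then show ?thesis using uniq by blast
  qed
  ultimately have "{W. valuation_ring F C W \<and> xF \<notin> W} = {?V}" using V(1) by blast
  moreover have "card (carrier (F\<lparr>carrier := ?V\<rparr> Quot FF.nonunits ?V)) = card C ^ 1"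
    using Q.card_residue_split[OF C_ev nil(1) D0] card_red[OF finite_carrier, of 1] C_card by simp
  then have "place_degree F C (FF.nonunits ?V) = 1" by (rule FF.place_degree_by_card[OF V(1) C_subfield C_card(1) card_C_gt_1])
  ultimately show ?thesis by (rule that)
qed

lemma nonconstant_MIrr_factor:
  assumes u: "u \<in> kX" "u \<noteq> []" "degree u > 0"
  obtains P w where "P \<in> MIrr" "w \<in> kX" "w \<noteq> []" "u = P .* w" "length w < length u"
proof -
  have h: "hd u \<in> carrier R" "hd u \<noteq> \<zero>" using u by (auto simp: poly_carrier_iff)
  let ?k = "poly_of_const (inv (hd u))" and ?h = "poly_of_const (hd u)"
  have i: "inv (hd u) \<in> carrier R" "inv (hd u) \<noteq> \<zero>" using h by (auto simp: nonzero_imp_inverse_nonzero)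
  have k: "?k \<in> kX" "?k = [inv (hd u)]" using PC.hom_closed[OF i(1)] i by (simp_all add: poly_of_const_eq)
  let ?g = "?k .* u"
  have d: "degree ?g = degree u" "hd ?g = \<one>" "?g \<noteq> []"
    using poly_degree_mult[OF k(1) u(1) _ u(2)] k(2) h by auto
  then have gM: "?g \<in> Mon" using k u by (simp add: Mon_def)
  obtain P where P: "P \<in> MIrr" "P .| ?g" using Mon_has_MIrr_divisor[OF gM] d(1) u(3) by metis
  obtain c where c: "c \<in> kX" "?g = P .* c" using P(2) by (auto simp: factor_def)
  have "u = (?h .* ?k) .* u"
  proof -
    have "?h .* ?k = oP" using PC.hom_mult[OF h(1) i(1)] h by simp
    then show ?thesis using u by simp
  qed
  also have "\<dots> = ?h .* (P .* c)" unfolding c(2) [symmetric] using h i u by (simp add: UP.m_assoc)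
  also have "\<dots> = P .* (?h .* c)" using h c(1) MIrrD(2)[OF P(1)] by (simp add: UP.m_lcomm)
  finally have e: "u = P .* (?h .* c)" .
  have wc: "?h .* c \<in> kX" using h c by simp
  have wn: "?h .* c \<noteq> []" using e u(2) UP.r_null[OF MIrrD(2)[OF P(1)]] by auto
  have "degree u = degree P + degree (?h .* c)" using poly_degree_mult(1)[OF MIrrD(2)[OF P(1)] wc MIrrD(5)[OF P(1)] wn] e by simp
  then have "length (?h .* c) < length u" using MIrrD(3)[OF P(1)] wn u(2) by (cases u; cases "?h .* c") auto
  then show ?thesis using that P(1) wc wn e by blast
qed

text \<open>If no irreducible polynomial were a nonunit, all nonzero polynomials would be units of
  \<open>W\<close>. As \<open>W\<close> also contains \<open>yF\<close>, it would be the whole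
  function field.\<close>

lemma finite_place_over:
  assumes W: "valuation_ring F C W" and x: "xF \<in> W" shows "\<exists>P\<in>MIrr. W \<in> lying_over P"
proof (rule ccontr)
  note WD = FF.valuation_ringD[OF W]
  have AW: "emb ` kX \<subseteq> W" using ev_in_subring[OF WD(1,2) x] poly_set_carrier emb_ev by auto
  assume "\<not> ?thesis"
  then have no: "emb P \<notin> FF.nonunits W" if "P \<in> MIrr" for P using that W AW by (auto simp: lying_over_def)
  have all: "emb u \<notin> FF.nonunits W" if "u \<in> kX" "u \<noteq> []" for u
    using that
  proof (induction "length u" arbitrary: u rule: less_induct)
    case less
    show ?case
    proof (cases "degree u > 0")
      case True
      then obtain P w where h: "P \<in> MIrr" "w \<in> kX" "w \<noteq> []" "u = P .* w" "length w < length u"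
        using nonconstant_MIrr_factor less.prems by metis
      have "emb u = emb P :* emb w" using h MIrrD(2)[OF h(1)] by simp
      moreover have "emb P \<in> W" "emb w \<in> W" using AW MIrrD(2)[OF h(1)] h by auto
      ultimately show ?thesis using FF.nonunits_prime[OF W, of "emb P" "emb w"] no[OF h(1)] less.hyps[OF h(5,2,3)] by auto
    next
      case False
      then obtain c where c: "u = [c]" using less.prems by (cases u) auto
      then have cc: "c \<in> carrier R" "c \<noteq> \<zero>" using less.prems by (auto simp: poly_carrier_iff)
      have s: "emb u = sig c" using c cc by (simp add: sig_def poly_of_const_eq)
      have i: "sig (inv c) \<in> W" using WD(2) C_eq cc by auto
      show ?thesis
      proof
        assume "emb u \<in> FF.nonunits W"
        then have "sig (inv c) :* sig c \<in> FF.nonunits W" using FF.nonunits_closed(3)[OF W i] s by simp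
        moreover have "sig (inv c) :* sig c = oF" using E.S.hom_mult[of "inv c" c] cc by simp
        ultimately show False using FF.nonunits_ideal(2)[OF W] by simp
      qed
    qed
  qed
  have yW: "yF \<in> W" using FF.valuation_ring_sqrt[OF W FF.y] AW fcub_carrier unfolding FF.y_sq by blast
  have "z \<in> W" if z: "z \<in> carrier F" for z
  proof -
    obtain u v w where uvw: "u \<in> kX" "v \<in> kX" "w \<in> kX" "w \<noteq> []" "z :* emb w = emb u :+ emb v :* yF"
      using FF.rep[OF z] by auto
    have wn: "emb w \<noteq> zF0" "emb w \<in> carrier F" using emb_zero_iff uvw by auto
    have "inv\<^bsub>F\<^esub> emb w \<in> W" using all[OF uvw(3,4)] AW uvw wn by (auto simp: FF.nonunits_def)
    moreover have "emb u :+ emb v :* yF \<in> W" using subsetD[OF AW imageI] uvw yW subringE(6,7)[OF WD(1)] by simp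
    ultimately have "(z :* emb w) :* inv\<^bsub>F\<^esub> emb w \<in> W" unfolding uvw(5) using subringE(6)[OF WD(1)] by blast
    then show ?thesis using z wn by (simp add: FF.m_assoc)
  qed
  then show False using WD(3,4) by blast
qed

lemma over_disjoint:
  assumes "P \<in> MIrr" "P' \<in> MIrr" "W \<in> lying_over P" "W \<in> lying_over P'" shows "P = P'"
proof -
  interpret Q: quad_place F A emb yF fcub P length "red (degree P)" by (rule quad_place_finite[OF assms(1)])
  have "Q.D P'" using Q.above_\<pi>(3)[of C W P'] assms MIrrD(2)[OF assms(2)] by (simp add: lying_over_def)
  then show ?thesis using MIrr_divides_eq assms by (simp add: Q.D_def)
qed

lemma over_xF: "W \<in> lying_over P \<Longrightarrow> xF \<in> W" by (auto simp: lying_over_def xF_def)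

lemma over_places:
  assumes P: "P \<in> MIrr"
  shows "finite (FF.nonunits ` lying_over P)" "card (FF.nonunits ` lying_over P) = (if sroots P = {} then 1 else card (sroots P))"
    and "v \<in> FF.nonunits ` lying_over P \<Longrightarrow> place_degree F C v = (if sroots P = {} then 2 * degree P else degree P)"
proof -
  have "inj_on FF.nonunits (lying_over P)" by (rule inj_onI) (use FF.nonunits_inj in \<open>auto simp: lying_over_def\<close>)
  then have "card (FF.nonunits ` lying_over P) = card (lying_over P)" by (rule card_image)
  then show "finite (FF.nonunits ` lying_over P)" "card (FF.nonunits ` lying_over P) = (if sroots P = {} then 1 else card (sroots P))"
    using over_split[OF P] over_inert[OF P] by (cases "sroots P = {}"; auto)+
  assume "v \<in> FF.nonunits ` lying_over P"
  then show "place_degree F C v = (if sroots P = {} then 2 * degree P else degree P)"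
    using over_split(3)[OF P] over_inert(3)[OF P] by auto
qed

text \<open>Membership of \<open>xF\<close> separates the place at infinity from the others, and
  each of the others lies over exactly one irreducible polynomial.\<close>

theorem places_classification:
  obtains v where "places F C = insert v (\<Union>P\<in>MIrr. FF.nonunits ` lying_over P)" "place_degree F C v = 1"
    "v \<notin> (\<Union>P\<in>MIrr. FF.nonunits ` lying_over P)"
    "\<And>P P'. P \<in> MIrr \<Longrightarrow> P' \<in> MIrr \<Longrightarrow> P \<noteq> P' \<Longrightarrow> FF.nonunits ` lying_over P \<inter> FF.nonunits ` lying_over P' = {}"
proof -
  obtain V where V: "{W. valuation_ring F C W \<and> xF \<notin> W} = {V}" "place_degree F C (FF.nonunits V) = 1" by (rule infinite_place) blast
  have Vv: "valuation_ring F C V" "xF \<notin> V" using V(1) by auto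
  have ov: "valuation_ring F C W" if "W \<in> lying_over P" for W P using that by (simp add: lying_over_def)
  have "{W. valuation_ring F C W} = insert V (\<Union>P\<in>MIrr. lying_over P)"
  proof (intro equalityI subsetI)
    fix W assume "W \<in> {W. valuation_ring F C W}"
    then show "W \<in> insert V (\<Union>P\<in>MIrr. lying_over P)"
      using finite_place_over[of W] V(1) by (cases "xF \<in> W") auto
  qed (use ov Vv in auto)
  then have pl: "places F C = insert (FF.nonunits V) (\<Union>P\<in>MIrr. FF.nonunits ` lying_over P)"
    unfolding FF.places_eq by (simp only: image_insert image_UN)
  have nv: "FF.nonunits V \<notin> (\<Union>P\<in>MIrr. FF.nonunits ` lying_over P)"
    using FF.nonunits_inj[OF Vv(1) ov] over_xF Vv(2) by blast
  have dj: "FF.nonunits ` lying_over P \<inter> FF.nonunits ` lying_over P' = {}" if "P \<in> MIrr" "P' \<in> MIrr" "P \<noteq> P'" for P P'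
    using FF.nonunits_inj[OF ov ov] over_disjoint[OF that(1,2)] that(3) by blast
  show ?thesis by (rule that[OF pl V(2) nv dj])
qed

end

section \<open>Residue fields of number fields\<close>

lemma (in cring) add_pow_eq_of_integer: "x \<in> carrier R \<Longrightarrow> add_pow R (n::nat) x = \<guillemotleft>int n\<guillemotright> \<otimes> x"
  by (induction n) (simp_all add: l_distr a_comm)

lemma (in cring) add_pow_int_one: "add_pow R (i::int) \<one> = \<guillemotleft>i\<guillemotright>"
proof (cases i)
  case (nonneg n)
  then show ?thesis using add_pow_eq_of_integer[of \<one> n] by (simp add: add_pow_int_ge)
next
  case (neg n)
  then have "add_pow R i \<one> = \<ominus> add_pow R (nat (- i)) \<one>" by (intro add_pow_int_lt) simp
  also have "\<dots> = \<ominus> \<guillemotleft>- i\<guillemotright>" using add_pow_eq_of_integer[of \<one> "nat (- i)"] neg by simp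
  finally show ?thesis by simp
qed

abbreviation (in ring) icomb :: "int list \<Rightarrow> 'a list \<Rightarrow> 'a" where
  "icomb ms xs \<equiv> combine (map (\<lambda>i. \<guillemotleft>i\<guillemotright>) ms) xs"

lemma (in cring) icomb_closed: "set xs \<subseteq> carrier R \<Longrightarrow> icomb ms xs \<in> carrier R"
  by (rule combine_in_carrier) auto

lemma (in cring) icomb_scale:
  "set xs \<subseteq> carrier R \<Longrightarrow> \<guillemotleft>c\<guillemotright> \<otimes> icomb ms xs = icomb (map ((*) c) ms) xs"
proof (induction ms arbitrary: xs)
  case (Cons m ms)
  then show ?case using icomb_closed by (cases xs) (auto simp: r_distr m_assoc)
qed simp

lemma (in cring) icomb_mod:
  assumes "\<guillemotleft>l\<guillemotright> = \<zero>" shows "icomb (map (\<lambda>i. i mod l) ms) xs = icomb ms xs"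
proof -
  have "\<guillemotleft>i mod l\<guillemotright> = \<guillemotleft>i\<guillemotright>" for i
  proof -
    have "\<guillemotleft>i\<guillemotright> = \<guillemotleft>i mod l + l * (i div l)\<guillemotright>" by simp
    also have "\<dots> = \<guillemotleft>i mod l\<guillemotright>" unfolding of_int_add of_int_mult assms by simp
    finally show ?thesis by simp
  qed
  then show ?thesis by (simp add: comp_def)
qed

text \<open>The argument that a space in which any \<open>n + 1\<close> vectors are dependent is spanned by at most \<open>n\<close> of them,
  for the prime field of characteristic \<open>l\<close>.\<close>

lemma (in domain) finite_by_relations:
  assumes l: "normalization_semidom_class.prime l" "\<guillemotleft>l\<guillemotright> = \<zero>"
    and rel: "\<And>xs. set xs \<subseteq> carrier R \<Longrightarrow> length xs = Suc n \<Longrightarrow>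
      \<exists>ms. length ms = Suc n \<and> icomb ms xs = \<zero> \<and> (\<exists>m\<in>set ms. \<not> l dvd m)"
  shows "finite (carrier R)"
proof -
  \<comment> \<open>Independence over the field with \<open>l\<close> elements, phrased with integer
    coefficients so that relations can be imported from characteristic 0.\<close>
  define ind where "ind xs \<longleftrightarrow> set xs \<subseteq> carrier R \<and>
    (\<forall>ms. length ms = length xs \<longrightarrow> icomb ms xs = \<zero> \<longrightarrow> (\<forall>m\<in>set ms. l dvd m))" for xs
  have ind_tl: "ind xs" if h: "ind (x # xs)" for x xs
  proof -
    have c: "x \<in> carrier R" "set xs \<subseteq> carrier R" using h by (auto simp: ind_def)
    have "\<forall>m\<in>set ms. l dvd m" if "length ms = length xs" "icomb ms xs = \<zero>" for ms
    proof -
      have "icomb (0 # ms) (x # xs) = \<zero>" using c that icomb_closed by simp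
      moreover have "length (0 # ms) = length (x # xs)" using that by simp
      ultimately have "\<forall>m\<in>set (0 # ms). l dvd m" using h unfolding ind_def by blast
      then show ?thesis by simp
    qed
    then show ?thesis using c by (simp add: ind_def)
  qed
  have bound: "length xs \<le> n" if "ind xs" for xs
  proof (rule ccontr)
    assume "\<not> length xs \<le> n"
    then have "\<exists>ys. ind ys \<and> length ys = Suc n" using that
    proof (induction xs)
      case (Cons x xs)
      then show ?case using ind_tl[of x xs] by (cases "length xs = n") auto
    qed simp
    then show False using rel unfolding ind_def by metis
  qed
  have "ind []" by (simp add: ind_def)
  \<comment> \<open>A longest independent list; adjoining any further element creates a
    relation.\<close>
  then obtain xs where xs: "ind xs" "\<And>ys. ind ys \<Longrightarrow> length ys \<le> length xs"
    using ex_has_greatest_nat[of ind "[]" length "Suc n"] bound by (metis le_imp_less_Suc)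
  have xc: "set xs \<subseteq> carrier R" using xs by (simp add: ind_def)
  let ?M = "{ms. set ms \<subseteq> {0..<l} \<and> length ms = length xs}"
  have "carrier R \<subseteq> (\<lambda>ms. icomb ms xs) ` ?M"
  proof
    fix z assume z: "z \<in> carrier R"
    have "\<not> ind (z # xs)" using xs(2)[of "z # xs"] by auto
    then obtain ms' where ms': "length ms' = Suc (length xs)" "icomb ms' (z # xs) = \<zero>" "\<exists>m\<in>set ms'. \<not> l dvd m"
      using z xc by (auto simp: ind_def)
    then obtain m ms where ms: "ms' = m # ms" "length ms = length xs" by (cases ms') auto
    have e: "\<guillemotleft>m\<guillemotright> \<otimes> z \<oplus> icomb ms xs = \<zero>" using ms' ms by simp
    have cc: "icomb ms xs \<in> carrier R" by (rule icomb_closed[OF xc])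
    have "\<not> l dvd m"
    proof
      assume d: "l dvd m"
      then have "\<guillemotleft>m\<guillemotright> = \<zero>" using l(2) by (auto elim!: dvdE)
      then have "icomb ms xs = \<zero>" using e z cc by simp
      then show False using xs(1) ms ms'(3) d unfolding ind_def by auto
    qed
    \<comment> \<open>The coefficient of the new element cannot be divisible by \<open>l\<close>, so
      Bezout inverts it modulo \<open>l\<close>. The relation can then be solved for
      \<open>z\<close>, with coefficients reduced to finitely many values.\<close>
    then have "coprime m l" using l(1) by (metis coprime_commute prime_imp_coprime)
    then obtain m' v where m': "m' * m + v * l = 1" using bezout_int[of m l] by auto
    have mm: "\<guillemotleft>m' * m\<guillemotright> = \<one>"
    proof -
      have "\<guillemotleft>m' * m\<guillemotright> = \<guillemotleft>1 - v * l\<guillemotright>" using m' by (metis add_diff_cancel_right')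
      also have "\<dots> = \<one>" unfolding of_int_diff of_int_mult l(2) by (simp add: a_minus_def)
      finally show ?thesis .
    qed
    have "\<guillemotleft>m'\<guillemotright> \<otimes> (\<guillemotleft>m\<guillemotright> \<otimes> z \<oplus> icomb ms xs) = \<guillemotleft>m' * m\<guillemotright> \<otimes> z \<oplus> \<guillemotleft>m'\<guillemotright> \<otimes> icomb ms xs"
      using z cc by (simp add: r_distr m_assoc)
    then have "z \<oplus> \<guillemotleft>m'\<guillemotright> \<otimes> icomb ms xs = \<zero>" unfolding e mm using z by simp
    then have "z = \<ominus> (\<guillemotleft>m'\<guillemotright> \<otimes> icomb ms xs)" using z cc by (metis m_closed of_int_closed minus_equality a_comm minus_minus)
    also have "\<dots> = \<guillemotleft>- m'\<guillemotright> \<otimes> icomb ms xs" using cc by (simp add: l_minus)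
    also have "\<dots> = icomb (map ((*) (- m')) ms) xs" by (rule icomb_scale[OF xc])
    also have "\<dots> = icomb (map (\<lambda>i. i mod l) (map ((*) (- m')) ms)) xs" by (rule icomb_mod[OF l(2), symmetric])
    finally have "z = icomb (map (\<lambda>i. i mod l) (map ((*) (- m')) ms)) xs" .
    moreover have "map (\<lambda>i. i mod l) (map ((*) (- m')) ms) \<in> ?M" using ms l(1) prime_gt_0_int by auto
    ultimately show "z \<in> (\<lambda>ms. icomb ms xs) ` ?M" by blast
  qed
  moreover have "finite ?M" by (rule finite_lists_length_eq) simp
  ultimately show ?thesis by (meson finite_imageI finite_subset)
qed

lemma (in domain) exists_prime_characteristic:
  assumes "n > 0" "\<guillemotleft>n\<guillemotright> = \<zero>" shows "\<exists>l. normalization_semidom_class.prime l \<and> \<guillemotleft>l::int\<guillemotright> = \<zero>"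
  using assms
proof (induction "nat n" arbitrary: n rule: less_induct)
  case less
  show ?case
  proof (cases "n = 1")
    case True
    then show ?thesis using less by simp
  next
    case False
    then obtain l where l: "normalization_semidom_class.prime l" "l dvd n" using prime_divisor_exists[of n] less.prems by auto
    then obtain m where m: "n = l * m" by auto
    have "\<guillemotleft>l\<guillemotright> = \<zero> \<or> \<guillemotleft>m\<guillemotright> = \<zero>" using integral[of "\<guillemotleft>l\<guillemotright>" "\<guillemotleft>m\<guillemotright>"] less.prems m by simp
    moreover have "m > 0" "m < n" using m less.prems prime_gt_1_int[OF l(1)] by (auto simp: zero_less_mult_iff)
    ultimately show ?thesis using l less.hyps[of m] by auto
  qed
qed

lemma abs_le_sum_list_abs: "(m::int) \<in> set ms \<Longrightarrow> \<bar>m\<bar> \<le> sum_list (map abs ms)"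
proof (induction ms)
  case (Cons a ms)
  have "0 \<le> sum_list (map abs ms)" for ms :: "int list" by (induction ms) auto
  from this[of ms] show ?case using Cons by auto
qed simp

locale char_zero_field = field R for R (structure) +
  assumes char0: "n \<noteq> 0 \<Longrightarrow> \<guillemotleft>n::int\<guillemotright> \<noteq> \<zero>"
begin

lemma prime_field_fraction:
  "h \<in> generate_field R {} \<Longrightarrow> \<exists>d m. d \<noteq> 0 \<and> \<guillemotleft>d::int\<guillemotright> \<otimes> h = \<guillemotleft>m\<guillemotright>"
proof (induction rule: generate_field.induct)
  case one
  have "\<guillemotleft>1\<guillemotright> \<otimes> \<one> = \<guillemotleft>1\<guillemotright>" by simp
  then show ?case by (metis zero_neq_one)
next
  case (a_inv h)
  then have c: "h \<in> carrier R" using generate_field_in_carrier[of "{}"] by simp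
  obtain d m where dm: "d \<noteq> 0" "\<guillemotleft>d::int\<guillemotright> \<otimes> h = \<guillemotleft>m\<guillemotright>" using a_inv by blast
  have "\<guillemotleft>d\<guillemotright> \<otimes> \<ominus> h = \<guillemotleft>- m\<guillemotright>" using c dm by (simp add: r_minus)
  then show ?case using dm by blast
next
  case (m_inv h)
  then have c: "h \<in> carrier R" using generate_field_in_carrier[of "{}"] by simp
  obtain d m where dm: "d \<noteq> 0" "\<guillemotleft>d::int\<guillemotright> \<otimes> h = \<guillemotleft>m\<guillemotright>" using m_inv by blast
  have "m \<noteq> 0" using dm c m_inv(2) char0[of d] integral[of "\<guillemotleft>d\<guillemotright>" h] by auto
  moreover have "\<guillemotleft>m\<guillemotright> \<otimes> inv h = \<guillemotleft>d\<guillemotright>" unfolding dm(2) [symmetric] using c m_inv(2) by (simp add: m_assoc)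
  ultimately show ?case by blast
next
  case (eng_add h1 h2)
  then have c: "h1 \<in> carrier R" "h2 \<in> carrier R" using generate_field_in_carrier[of "{}"] by auto
  obtain d m d' m' where dm: "d \<noteq> 0" "\<guillemotleft>d::int\<guillemotright> \<otimes> h1 = \<guillemotleft>m\<guillemotright>" "d' \<noteq> 0" "\<guillemotleft>d'::int\<guillemotright> \<otimes> h2 = \<guillemotleft>m'\<guillemotright>" using eng_add by blast
  have "\<guillemotleft>d * d'\<guillemotright> \<otimes> (h1 \<oplus> h2) = \<guillemotleft>d'\<guillemotright> \<otimes> (\<guillemotleft>d\<guillemotright> \<otimes> h1) \<oplus> \<guillemotleft>d\<guillemotright> \<otimes> (\<guillemotleft>d'\<guillemotright> \<otimes> h2)"
    using c by (simp add: r_distr m_ac)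
  also have "\<dots> = \<guillemotleft>d' * m + d * m'\<guillemotright>" unfolding dm by simp
  finally show ?case using dm by (metis mult_eq_0_iff)
next
  case (eng_mult h1 h2)
  then have c: "h1 \<in> carrier R" "h2 \<in> carrier R" using generate_field_in_carrier[of "{}"] by auto
  obtain d m d' m' where dm: "d \<noteq> 0" "\<guillemotleft>d::int\<guillemotright> \<otimes> h1 = \<guillemotleft>m\<guillemotright>" "d' \<noteq> 0" "\<guillemotleft>d'::int\<guillemotright> \<otimes> h2 = \<guillemotleft>m'\<guillemotright>" using eng_mult by blast
  have "\<guillemotleft>d * d'\<guillemotright> \<otimes> (h1 \<otimes> h2) = (\<guillemotleft>d\<guillemotright> \<otimes> h1) \<otimes> (\<guillemotleft>d'\<guillemotright> \<otimes> h2)" using c by (simp add: m_ac)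
  also have "\<dots> = \<guillemotleft>m * m'\<guillemotright>" unfolding dm by simp
  finally show ?case using dm by (metis mult_eq_0_iff)
qed simp

lemma clear_denominators:
  assumes "set Ks \<subseteq> generate_field R {}"
  shows "\<exists>d ms. d \<noteq> 0 \<and> map (\<lambda>k. \<guillemotleft>d::int\<guillemotright> \<otimes> k) Ks = map (\<lambda>i. \<guillemotleft>i\<guillemotright>) ms"
  using assms
proof (induction Ks)
  case Nil
  then show ?case by (intro exI[of _ 1] exI[of _ "[]"]) simp
next
  case (Cons k Ks)
  then obtain d ms where dm: "d \<noteq> 0" "map (\<lambda>k. \<guillemotleft>d::int\<guillemotright> \<otimes> k) Ks = map (\<lambda>i. \<guillemotleft>i\<guillemotright>) ms" by auto
  have gc: "x \<in> carrier R" if "x \<in> generate_field R {}" for x using generate_field_in_carrier[of "{}"] that by simp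
  have kc: "k \<in> carrier R" "set Ks \<subseteq> carrier R" using Cons.prems gc by auto
  obtain d' m' where dm': "d' \<noteq> 0" "\<guillemotleft>d'::int\<guillemotright> \<otimes> k = \<guillemotleft>m'\<guillemotright>" using prime_field_fraction[of k] Cons.prems by (metis list.set_intros(1) subsetD)
  have "map (\<lambda>k. \<guillemotleft>d' * d\<guillemotright> \<otimes> k) Ks = map (\<lambda>x. \<guillemotleft>d'\<guillemotright> \<otimes> x) (map (\<lambda>k. \<guillemotleft>d\<guillemotright> \<otimes> k) Ks)"
    using kc by (auto simp: m_assoc)
  also have "\<dots> = map (\<lambda>i. \<guillemotleft>i\<guillemotright>) (map ((*) d') ms)" unfolding dm(2) by simp
  finally have "map (\<lambda>k. \<guillemotleft>d' * d\<guillemotright> \<otimes> k) Ks = map (\<lambda>i. \<guillemotleft>i\<guillemotright>) (map ((*) d') ms)" .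
  moreover have "\<guillemotleft>d' * d\<guillemotright> \<otimes> k = \<guillemotleft>d * m'\<guillemotright>" using kc by (simp add: dm'(2) [symmetric] m_ac)
  ultimately have "map (\<lambda>k. \<guillemotleft>d' * d\<guillemotright> \<otimes> k) (k # Ks) = map (\<lambda>i. \<guillemotleft>i\<guillemotright>) (d * m' # map ((*) d') ms)" by simp
  then show ?case using dm dm' by (metis mult_eq_0_iff)
qed

text \<open>While \<open>l\<close> divides all coefficients it can be cancelled, because the field
  has characteristic 0. The sum of the absolute values drops each time, so this ends.\<close>

lemma primitive_relation:
  assumes l: "normalization_semidom_class.prime l" and us: "set us \<subseteq> carrier R" and r: "icomb ms us = \<zero>" "length ms = length us" "\<not> set ms \<subseteq> {0}"
  shows "\<exists>ms. icomb ms us = \<zero> \<and> length ms = length us \<and> (\<exists>m\<in>set ms. \<not> l dvd m)"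
  using r
proof (induction "nat (sum_list (map abs ms))" arbitrary: ms rule: less_induct)
  case less
  show ?case
  proof (cases "\<exists>m\<in>set ms. \<not> l dvd m")
    case False
    let ?ms = "map (\<lambda>m. m div l) ms"
    have ms: "ms = map ((*) l) ?ms" using False by (auto intro!: nth_equalityI)
    have l1: "l > 1" using prime_gt_1_int[OF l] .
    have "\<guillemotleft>l\<guillemotright> \<otimes> icomb ?ms us = \<zero>" using icomb_scale[OF us, of l ?ms] less.prems(1) ms by metis
    from integral[OF this of_int_closed icomb_closed[OF us]] have "icomb ?ms us = \<zero>" using char0[of l] l1 by (metis less_irrefl less_trans zero_less_one)
    moreover have nz: "\<not> set ?ms \<subseteq> {0}"
    proof
      assume "set ?ms \<subseteq> {0}"
      then have "set (map ((*) l) ?ms) \<subseteq> {0}" by auto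
      then show False using less.prems(3) ms by metis
    qed
    moreover have "sum_list (map abs ms) = l * sum_list (map abs ?ms)"
    proof -
      have "sum_list (map abs ms) = sum_list (map abs (map ((*) l) ?ms))" using ms by metis
      also have "\<dots> = l * sum_list (map abs ?ms)" using l1 by (simp add: comp_def abs_mult sum_list_const_mult)
      finally show ?thesis .
    qed
    moreover have "sum_list (map abs ?ms) > 0"
    proof -
      obtain m where "m \<in> set ?ms" "m \<noteq> 0" using nz by auto
      have "\<bar>m\<bar> \<le> sum_list (map abs ?ms)" using \<open>m \<in> set ?ms\<close> by (rule abs_le_sum_list_abs)
      then show ?thesis using \<open>m \<noteq> 0\<close> by linarith
    qed
    ultimately show ?thesis using less.hyps[of ?ms] less.prems(2) l1 by auto
  qed (use less in blast)
qed

text \<open>More vectors than the dimension give a relation over the prime field; clearing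
  denominators makes it integral, and it can be made primitive at \<open>l\<close>. Only then does
  it stay nontrivial modulo \<open>l\<close>.\<close>

lemma integer_relation:
  assumes l: "normalization_semidom_class.prime l" and d: "dimension n (generate_field R {}) (carrier R)"
    and us: "set us \<subseteq> carrier R" "length us = Suc n"
  shows "\<exists>ms. length ms = Suc n \<and> icomb ms us = \<zero> \<and> (\<exists>m\<in>set ms. \<not> l dvd m)"
proof -
  let ?Q = "generate_field R {}"
  have Q: "subfield ?Q R" by (rule generate_field_is_subfield) simp
  have Qc: "?Q \<subseteq> carrier R" by (rule generate_field_incl) simp
  have "\<not> independent ?Q us" using independent_length_le_dimension[OF Q d, of us] us by auto
  then obtain Ks where Ks: "set Ks \<subseteq> ?Q" "combine Ks us = \<zero>" "\<not> set (take (length us) Ks) \<subseteq> {\<zero>}"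
    using trivial_combine_imp_independent[OF Q us(1)] by blast
  \<comment> \<open>\<open>combine\<close> accepts lists of different lengths. Truncation and
    padding by zeros give exactly one coefficient per vector.\<close>
  let ?Ks = "take (length us) Ks @ replicate (length us - length Ks) \<zero>"
  have "combine ?Ks us = combine (take (length us) Ks) us" using combine_append_zero us Ks Qc by (metis combine_append_replicate order_trans set_take_subset)
  then have c: "combine ?Ks us = \<zero>" using Ks(2) combine_take by metis
  have len: "length ?Ks = length us" by simp
  have sQ: "set ?Ks \<subseteq> ?Q" using Ks(1) zero_in_generate set_take_subset[of "length us" Ks] by (auto simp: subset_iff)
  obtain e ms where em: "e \<noteq> 0" "map (\<lambda>k. \<guillemotleft>e::int\<guillemotright> \<otimes> k) ?Ks = map (\<lambda>i. \<guillemotleft>i\<guillemotright>) ms" using clear_denominators[OF sQ] by blast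
  have "icomb ms us = \<guillemotleft>e\<guillemotright> \<otimes> combine ?Ks us"
    unfolding em(2) [symmetric] by (rule combine_r_distr[OF subset_trans[OF sQ Qc] us(1) of_int_closed, symmetric])
  then have z: "icomb ms us = \<zero>" using c by simp
  have lm: "length ms = length us" using em(2) len by (metis length_map)
  have "\<not> set ms \<subseteq> {0}"
  proof
    assume "set ms \<subseteq> {0}"
    then have "set (map (\<lambda>i. \<guillemotleft>i\<guillemotright>) ms) \<subseteq> {\<zero>}" by auto
    then have sub: "set (map (\<lambda>k. \<guillemotleft>e\<guillemotright> \<otimes> k) ?Ks) \<subseteq> {\<zero>}" by (simp only: em(2))
    have "\<guillemotleft>e\<guillemotright> \<otimes> k = \<zero>" if "k \<in> set ?Ks" for k
    proof -
      have "\<guillemotleft>e\<guillemotright> \<otimes> k \<in> set (map (\<lambda>k. \<guillemotleft>e\<guillemotright> \<otimes> k) ?Ks)" unfolding set_map using that by (rule imageI)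
      then show ?thesis using sub by blast
    qed
    then have "k = \<zero>" if "k \<in> set ?Ks" for k using that integral[of "\<guillemotleft>e\<guillemotright>" k] char0[OF em(1)] sQ Qc by (meson of_int_closed subsetD)
    then show False using Ks(3) by auto
  qed
  from primitive_relation[OF l us(1) z lm this] show ?thesis using us(2) by auto
qed

end

locale number_field_prime =
  fixes K :: "('a, 'm) ring_scheme" and p :: "'a set"
  assumes K: "number_field K" and p: "primeideal p (ring_of_integers K)" and p_nz: "p \<noteq> {\<zero>\<^bsub>K\<^esub>}"
begin

abbreviation "\<O> \<equiv> ring_of_integers K"
abbreviation "k \<equiv> residue_field K p"

sublocale K: char_zero_field K
proof -
  interpret field K using K by (simp add: number_field_def)
  show "char_zero_field K"
  proof
    fix n :: int assume n: "n \<noteq> 0"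
    have "\<guillemotleft>int m\<guillemotright>\<^bsub>K\<^esub> \<noteq> \<zero>\<^bsub>K\<^esub>" if "m > 0" for m
    proof -
      have "add_pow K m \<one>\<^bsub>K\<^esub> \<noteq> \<zero>\<^bsub>K\<^esub>" using K that unfolding number_field_def by blast
      then show ?thesis using add_pow_eq_of_integer[OF one_closed, of m] by simp
    qed
    from this[of "nat \<bar>n\<bar>"] n have "\<guillemotleft>\<bar>n\<bar>\<guillemotright>\<^bsub>K\<^esub> \<noteq> \<zero>\<^bsub>K\<^esub>" by simp
    then show "\<guillemotleft>n\<guillemotright>\<^bsub>K\<^esub> \<noteq> \<zero>\<^bsub>K\<^esub>" by (auto simp: abs_if split: if_splits)
  qed
qed

sublocale p: primeideal p \<O> by (rule p)

sublocale k: domain k unfolding residue_field_def by (rule p.quotient_is_domain)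

lemma O_sel: "\<one>\<^bsub>\<O>\<^esub> = \<one>\<^bsub>K\<^esub>" "\<zero>\<^bsub>\<O>\<^esub> = \<zero>\<^bsub>K\<^esub>" "x \<otimes>\<^bsub>\<O>\<^esub> y = x \<otimes>\<^bsub>K\<^esub> y" "x \<oplus>\<^bsub>\<O>\<^esub> y = x \<oplus>\<^bsub>K\<^esub> y"
  by (simp_all add: ring_of_integers_def)

lemma O_carrier: "x \<in> carrier \<O> \<longleftrightarrow> x \<in> carrier K \<and> integral_element K x" by (simp add: ring_of_integers_def)

lemma inc: "ring_hom_ring \<O> K (\<lambda>x. x)"
  by (rule ring_hom_ringI2[OF p.ring_axioms K.ring_axioms]) (auto intro!: ring_hom_memI simp: O_carrier O_sel)

sublocale red: ring_hom_ring \<O> k "reduce K p"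
proof -
  have "reduce K p = (+>\<^bsub>\<O>\<^esub>) p" by (simp add: fun_eq_iff reduce_def)
  then show "ring_hom_ring \<O> k (reduce K p)" unfolding residue_field_def using p.rcos_ring_hom_ring by simp
qed

lemma reduce_zero_iff: "x \<in> carrier \<O> \<Longrightarrow> reduce K p x = \<zero>\<^bsub>k\<^esub> \<longleftrightarrow> x \<in> p"
  unfolding reduce_def residue_field_def by (rule p.rcos_zero_iff)

lemma of_integer_O: "\<guillemotleft>n\<guillemotright>\<^bsub>\<O>\<^esub> = \<guillemotleft>n\<guillemotright>\<^bsub>K\<^esub>" using ring_hom_ring.hom_of_integer[OF inc] .

lemma integer_range: "c \<in> range (\<lambda>n::int. add_pow K n \<one>\<^bsub>K\<^esub>) \<Longrightarrow> \<exists>n. c = \<guillemotleft>n\<guillemotright>\<^bsub>\<O>\<^esub>"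
  using K.add_pow_int_one of_integer_O by auto

text \<open>Coefficients are listed with the constant term last, and the induction strips vanishing
  constant terms by dividing by \<open>x\<close>. The first nonzero one is minus a multiple of
  \<open>x\<close>.\<close>

lemma integral_constant_term:
  assumes "x \<in> carrier \<O>" "x \<noteq> \<zero>\<^bsub>K\<^esub>" "f \<noteq> []" "hd f = \<one>\<^bsub>K\<^esub>" "\<And>c. c \<in> set f \<Longrightarrow> \<exists>n. c = \<guillemotleft>n\<guillemotright>\<^bsub>\<O>\<^esub>" "K.eval f x = \<zero>\<^bsub>K\<^esub>"
  shows "\<exists>n w. n \<noteq> 0 \<and> w \<in> carrier \<O> \<and> \<guillemotleft>n\<guillemotright>\<^bsub>\<O>\<^esub> = \<ominus>\<^bsub>\<O>\<^esub> (w \<otimes>\<^bsub>\<O>\<^esub> x)"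
  using assms(3-6)
proof (induction f rule: rev_induct)
  case (snoc c g)
  have xc: "x \<in> carrier K" using assms(1) O_carrier by simp
  have sc: "set (g @ [c]) \<subseteq> carrier \<O>" using snoc.prems(3) p.of_int_closed by (metis subsetI)
  then have gO: "set g \<subseteq> carrier \<O>" and gK: "set g \<subseteq> carrier K" and cK: "c \<in> carrier K" "c \<in> carrier \<O>" using O_carrier by auto
  have w: "p.eval g x \<in> carrier \<O>" by (rule p.eval_in_carrier[OF gO assms(1)])
  have we: "p.eval g x = K.eval g x" using ring_hom_ring.eval_hom'[OF inc assms(1) gO] by simp
  have e: "K.eval g x \<otimes>\<^bsub>K\<^esub> x \<oplus>\<^bsub>K\<^esub> c = \<zero>\<^bsub>K\<^esub>" using snoc.prems(4) K.eval_append_aux[OF gK cK(1) xc] by simp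
  have wK: "K.eval g x \<in> carrier K" using w we O_carrier by simp
  obtain n where n: "c = \<guillemotleft>n\<guillemotright>\<^bsub>\<O>\<^esub>" using snoc.prems(3)[of c] by auto
  show ?case
  proof (cases "n = 0")
    case True
    then have c0: "c = \<zero>\<^bsub>K\<^esub>" using n of_integer_O[of 0] by simp
    then have "K.eval g x = \<zero>\<^bsub>K\<^esub>" using e wK xc assms(2) K.integral[of "K.eval g x" x] by auto
    moreover have "g \<noteq> []" using snoc.prems(2) c0 by auto
    ultimately show ?thesis using snoc by auto
  next
    case False
    have "c \<oplus>\<^bsub>\<O>\<^esub> p.eval g x \<otimes>\<^bsub>\<O>\<^esub> x = \<zero>\<^bsub>\<O>\<^esub>" using e we wK xc cK by (simp add: K.a_comm O_sel)
    then have "c = \<ominus>\<^bsub>\<O>\<^esub> (p.eval g x \<otimes>\<^bsub>\<O>\<^esub> x)" by (rule p.minus_equality[symmetric, OF _ p.m_closed[OF w assms(1)] cK(2)])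
    then show ?thesis using False w n by metis
  qed
qed simp

text \<open>A nonzero element of \<open>p\<close> has an integral equation with nonzero constant
  term, and this integer is a multiple of the element.\<close>

lemma integer_in_p: "\<exists>n > 0. \<guillemotleft>n::int\<guillemotright>\<^bsub>k\<^esub> = \<zero>\<^bsub>k\<^esub>"
proof -
  obtain x where x: "x \<in> p" "x \<noteq> \<zero>\<^bsub>K\<^esub>"
    using p_nz additive_subgroup.zero_closed[OF p.additive_subgroup_axioms] by (auto simp: O_sel)
  have xO: "x \<in> carrier \<O>" using x p.a_subset by auto
  then obtain f where f: "f \<noteq> []" "hd f = \<one>\<^bsub>K\<^esub>" "set f \<subseteq> range (\<lambda>n::int. add_pow K n \<one>\<^bsub>K\<^esub>)" "K.eval f x = \<zero>\<^bsub>K\<^esub>"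
    unfolding O_carrier integral_element_def by blast
  have fc: "\<exists>n. c = \<guillemotleft>n\<guillemotright>\<^bsub>\<O>\<^esub>" if "c \<in> set f" for c by (rule integer_range[OF subsetD[OF f(3) that]])
  obtain n w where n: "n \<noteq> 0" "w \<in> carrier \<O>" "\<guillemotleft>n\<guillemotright>\<^bsub>\<O>\<^esub> = \<ominus>\<^bsub>\<O>\<^esub> (w \<otimes>\<^bsub>\<O>\<^esub> x)"
    using integral_constant_term[OF xO x(2) f(1,2) fc f(4)] by blast
  have "w \<otimes>\<^bsub>\<O>\<^esub> x \<in> p" using p.I_l_closed x n by blast
  then have "reduce K p (w \<otimes>\<^bsub>\<O>\<^esub> x) = \<zero>\<^bsub>k\<^esub>" using reduce_zero_iff n xO p.m_closed by blast
  moreover have wx: "w \<otimes>\<^bsub>\<O>\<^esub> x \<in> carrier \<O>" using n xO by (rule_tac p.m_closed)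
  ultimately have "reduce K p \<guillemotleft>n\<guillemotright>\<^bsub>\<O>\<^esub> = \<zero>\<^bsub>k\<^esub>" unfolding n(3) by (simp)
  then have "\<guillemotleft>n\<guillemotright>\<^bsub>k\<^esub> = \<zero>\<^bsub>k\<^esub>" using red.hom_of_integer by simp
  then have "\<guillemotleft>\<bar>n\<bar>\<guillemotright>\<^bsub>k\<^esub> = \<zero>\<^bsub>k\<^esub>" by (simp add: abs_if)
  then show ?thesis using n(1) by (intro exI[of _ "\<bar>n\<bar>"]) simp
qed

text \<open>With \<open>n\<close> the degree of the number field, any \<open>n + 1\<close> residue
  classes lift to integers of the field. These satisfy an integer relation that is primitive at the
  residue characteristic, and its reduction is a nontrivial relation between the classes.\<close>

theorem finite_residue_field: "finite (carrier k)"
proof -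
  obtain l :: int where l: "normalization_semidom_class.prime l" "\<guillemotleft>l\<guillemotright>\<^bsub>k\<^esub> = \<zero>\<^bsub>k\<^esub>" using integer_in_p k.exists_prime_characteristic by blast
  obtain n where d: "K.dimension n (generate_field K {}) (carrier K)"
    using K unfolding number_field_def by (auto elim: K.finite_dimensionE')
  show ?thesis
  proof (rule k.finite_by_relations[OF l, of n])
    fix xs assume xs: "set xs \<subseteq> carrier k" "length xs = Suc n"
    have "\<exists>y\<in>carrier \<O>. x = reduce K p y" if "x \<in> carrier k" for x
      using that p.rcosE[of x] unfolding residue_field_def reduce_def by metis
    then obtain g where g: "\<And>x. x \<in> carrier k \<Longrightarrow> g x \<in> carrier \<O> \<and> x = reduce K p (g x)" by metis
    let ?ys = "map g xs"
    have ys: "set ?ys \<subseteq> carrier \<O>" "map (reduce K p) ?ys = xs" using g xs(1) by (auto intro!: map_idI)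
    then have "set ?ys \<subseteq> carrier K" using O_carrier by auto
    then obtain ms where ms: "length ms = Suc n" "K.icomb ms ?ys = \<zero>\<^bsub>K\<^esub>" "\<exists>m\<in>set ms. \<not> l dvd m"
      using K.integer_relation[OF l(1) d, of ?ys] xs(2) by auto
    have ic: "set (map (\<lambda>i. \<guillemotleft>i\<guillemotright>\<^bsub>\<O>\<^esub>) ms) \<subseteq> carrier \<O>" by auto
    have "p.icomb ms ?ys = \<zero>\<^bsub>\<O>\<^esub>" using ring_hom_ring.combine_hom[OF inc ic ys(1)] ms(2) by (simp add: comp_def of_integer_O O_sel)
    then have "reduce K p (p.icomb ms ?ys) = \<zero>\<^bsub>k\<^esub>" by (simp)
    then have "k.icomb ms xs = \<zero>\<^bsub>k\<^esub>" using red.combine_hom[OF ic ys(1)] ys(2) by (simp add: comp_def red.hom_of_integer)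
    then show "\<exists>ms. length ms = Suc n \<and> k.icomb ms xs = \<zero>\<^bsub>k\<^esub> \<and> (\<exists>m\<in>set ms. \<not> l dvd m)" using ms by blast
  qed
qed

text \<open>The discriminant is \<open>-16 (4a^3 + 27b^2)\<close>. The factor 16 makes the residue
  characteristic odd, and the other factor becomes the nonvanishing condition on the reduced
  curve.\<close>

theorem curve_field_residue:
  assumes ab: "a \<in> carrier \<O>" "b \<in> carrier \<O>" and d: "\<not> PIdl\<^bsub>\<O>\<^esub> (discriminant \<O> a b) \<subseteq> p"
  shows "curve_field k (reduce K p a) (reduce K p b)"
proof -
  interpret F: field k by (rule k.finite_domain_is_field[OF finite_residue_field])
  let ?X = "\<lambda>S a b. \<guillemotleft>4\<guillemotright>\<^bsub>S\<^esub> \<otimes>\<^bsub>S\<^esub> a [^]\<^bsub>S\<^esub> (3::nat) \<oplus>\<^bsub>S\<^esub> \<guillemotleft>27\<guillemotright>\<^bsub>S\<^esub> \<otimes>\<^bsub>S\<^esub> b [^]\<^bsub>S\<^esub> (2::nat)"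
  have XO: "?X \<O> a b \<in> carrier \<O>" using ab by (intro p.a_closed p.m_closed p.of_int_closed p.nat_pow_closed)
  have disc: "discriminant \<O> a b = \<ominus>\<^bsub>\<O>\<^esub> (\<guillemotleft>16\<guillemotright>\<^bsub>\<O>\<^esub> \<otimes>\<^bsub>\<O>\<^esub> ?X \<O> a b)"
    unfolding discriminant_def using ab XO
    by (simp only: p.add_pow_eq_of_integer p.nat_pow_closed of_nat_numeral)
  have "discriminant \<O> a b \<notin> p" using d p.cgenideal_minimal[OF p.ideal_axioms] by blast
  moreover have "discriminant \<O> a b \<in> carrier \<O>" unfolding disc using XO by (intro p.a_inv_closed p.m_closed p.of_int_closed)
  ultimately have "reduce K p (discriminant \<O> a b) \<noteq> \<zero>\<^bsub>k\<^esub>" using reduce_zero_iff by blast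
  moreover have "reduce K p (discriminant \<O> a b) = \<ominus>\<^bsub>k\<^esub> (\<guillemotleft>16\<guillemotright>\<^bsub>k\<^esub> \<otimes>\<^bsub>k\<^esub> ?X k (reduce K p a) (reduce K p b))"
    unfolding disc using ab by (simp add: red.hom_of_integer red.hom_nat_pow)
  ultimately have nz: "\<guillemotleft>16\<guillemotright>\<^bsub>k\<^esub> \<otimes>\<^bsub>k\<^esub> ?X k (reduce K p a) (reduce K p b) \<noteq> \<zero>\<^bsub>k\<^esub>" by auto
  have abk: "reduce K p a \<in> carrier k" "reduce K p b \<in> carrier k" using ab by auto
  have X: "?X k (reduce K p a) (reduce K p b) \<noteq> \<zero>\<^bsub>k\<^esub>" using nz k.r_null[OF k.of_int_closed] by metis
  have "?X k (reduce K p a) (reduce K p b) \<in> carrier k" using abk by (intro k.a_closed k.m_closed k.of_int_closed k.nat_pow_closed)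
  then have "\<guillemotleft>16\<guillemotright>\<^bsub>k\<^esub> \<noteq> \<zero>\<^bsub>k\<^esub>" using nz k.l_null by metis
  moreover have "\<guillemotleft>16\<guillemotright>\<^bsub>k\<^esub> = \<guillemotleft>2\<guillemotright>\<^bsub>k\<^esub> \<otimes>\<^bsub>k\<^esub> \<guillemotleft>8\<guillemotright>\<^bsub>k\<^esub>" using k.of_int_mult[of 2 8] by simp
  ultimately have "\<guillemotleft>2\<guillemotright>\<^bsub>k\<^esub> \<noteq> \<zero>\<^bsub>k\<^esub>" by auto
  then have two: "\<one>\<^bsub>k\<^esub> \<oplus>\<^bsub>k\<^esub> \<one>\<^bsub>k\<^esub> \<noteq> \<zero>\<^bsub>k\<^esub>" by (simp add: k.of_int_2)
  show ?thesis
    by (intro curve_field.intro curve_field_axioms.intro odd_finite_field.intro odd_finite_field_axioms.intro field_polys.intro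
        F.field_axioms finite_residue_field two X abk)
qed

end

section \<open>The Euler product\<close>

text \<open>The Schur-Cohn criterion in degree 2. A nonreal root has squared modulus
  \<open>\<beta>\<close>; for real roots the polynomial is shown to be positive outside the open
  interval from -1 to 1.\<close>

lemma stable_quadratic_root:
  fixes z :: complex
  assumes z: "z ^ 2 + of_real \<alpha> * z + of_real \<beta> = 0" and b: "0 < \<beta>" "\<beta> < 1" and a: "\<bar>\<alpha>\<bar> < 1 + \<beta>"
  shows "norm z < 1"
proof -
  define x y where "x = Re z" and "y = Im z"
  have re: "x\<^sup>2 - y\<^sup>2 + \<alpha> * x + \<beta> = 0" and im: "2 * (y * x) + \<alpha> * y = 0"
    using z by (auto simp: complex_eq_iff x_def y_def power2_eq_square)
  have "x\<^sup>2 + y\<^sup>2 < 1"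
  proof (cases "y = 0")
    case True
    then have e: "x\<^sup>2 + \<alpha> * x + \<beta> = 0" using re by simp
    have "x < 1"
    proof (rule ccontr)
      assume "\<not> x < 1"
      \<comment> \<open>Expanding the first product gives
        \<open>x^2 + \<beta> \<ge> (1 + \<beta>) x\<close>, so the quadratic is at least
        \<open>(1 + \<beta> + \<alpha>) x\<close>, which is positive.\<close>
      then have "(x - 1) * (x - \<beta>) \<ge> 0" "(1 + \<beta> + \<alpha>) * x > 0" using a b by (auto intro!: mult_nonneg_nonneg mult_pos_pos)
      then show False using e by (simp add: algebra_simps power2_eq_square)
    qed
    moreover have "x > -1"
    proof (rule ccontr)
      assume "\<not> x > -1"
      then have "(- x - 1) * (- x - \<beta>) \<ge> 0" "(1 + \<beta> - \<alpha>) * x < 0" using a b by (auto intro!: mult_nonneg_nonneg mult_pos_neg)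
      then show False using e by (simp add: algebra_simps power2_eq_square)
    qed
    ultimately have "\<bar>x\<bar> < 1" by simp
    then show ?thesis using True by (simp add: abs_square_less_1)
  next
    case False
    have "(2 * x + \<alpha>) * y = 0" using im by (simp add: algebra_simps)
    then have "\<alpha> = - 2 * x" using False by simp
    then have "x\<^sup>2 + y\<^sup>2 = \<beta>" using re by (simp add: power2_eq_square)
    then show ?thesis using b by simp
  qed
  then show ?thesis unfolding cmod_def x_def y_def by simp
qed

lemma l1_bound_geometric:
  fixes c :: "'a::{real_normed_field,banach}"
  assumes "norm c < 1" shows "l1_bound (Abs_fps (\<lambda>n. c ^ n)) (1 / (1 - norm c))"
  unfolding l1_bound_def
proof
  fix N
  have "(\<Sum>n<N. norm (Abs_fps (\<lambda>n. c ^ n) $ n)) = (\<Sum>n<N. norm c ^ n)" by (simp add: norm_power)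
  also have "\<dots> = (1 - norm c ^ N) / (1 - norm c)" using assms by (simp add: sum_gp_strict)
  also have "\<dots> \<le> 1 / (1 - norm c)" using assms by (intro divide_right_mono) auto
  finally show "(\<Sum>n<N. norm (Abs_fps (\<lambda>n. c ^ n) $ n)) \<le> 1 / (1 - norm c)" .
qed

lemma geometric_fps: "Abs_fps (\<lambda>n. c ^ n) * (1 - fps_const c * fps_X) = (1 :: 'a::field fps)"
proof (rule fps_ext)
  fix n
  have "Abs_fps (\<lambda>n. c ^ n) * (1 - fps_const c * fps_X) = Abs_fps (\<lambda>n. c ^ n) - fps_const c * (fps_X * Abs_fps (\<lambda>n. c ^ n))"
    by (simp add: algebra_simps)
  then show "(Abs_fps (\<lambda>n. c ^ n) * (1 - fps_const c * fps_X)) $ n = 1 $ n" by (cases n) simp_all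
qed

text \<open>Over the complex numbers the quadratic is \<open>(1 - zX)(1 - wX)\<close> with
  \<open>z\<close> and \<open>w\<close> in the open unit disc. Its inverse is a product of two
  summable geometric series, and passing to complex coefficients preserves absolute values.\<close>

lemma inverse_quadratic_l1:
  fixes \<alpha> \<beta> :: real
  assumes b: "0 < \<beta>" "\<beta> < 1" and a: "\<bar>\<alpha>\<bar> < 1 + \<beta>"
  shows "\<exists>B. l1_bound (inverse (1 + fps_const \<alpha> * fps_X + fps_const \<beta> * fps_X ^ 2)) B"
proof -
  let ?L = "1 + fps_const \<alpha> * fps_X + fps_const \<beta> * fps_X ^ 2"
  define s where "s = csqrt (of_real (\<alpha>\<^sup>2 - 4 * \<beta>))"
  define z w where "z = (- of_real \<alpha> + s) / 2" and "w = (- of_real \<alpha> - s) / 2"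
  have s2: "s\<^sup>2 = of_real \<alpha> ^ 2 - 4 * of_real \<beta>" by (simp add: s_def)
  have "z * w = (of_real \<alpha> ^ 2 - s\<^sup>2) / 4" by (simp add: z_def w_def field_simps power2_eq_square)
  then have zw: "z + w = - of_real \<alpha>" "z * w = of_real \<beta>" unfolding s2 by (simp_all add: z_def w_def field_simps)
  have "z ^ 2 + - (z + w) * z + z * w = 0" "w ^ 2 + - (z + w) * w + z * w = 0"
    by (simp_all add: algebra_simps power2_eq_square)
  then have "z ^ 2 + of_real \<alpha> * z + of_real \<beta> = 0" "w ^ 2 + of_real \<alpha> * w + of_real \<beta> = 0"
    unfolding zw by simp_all
  then have n: "norm z < 1" "norm w < 1" using stable_quadratic_root[OF _ b a] by auto
  let ?c = "\<lambda>f :: real fps. Abs_fps (\<lambda>n. complex_of_real (f $ n))"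
  have cm: "?c (f * g) = ?c f * ?c g" for f g by (rule fps_ext) (simp add: fps_mult_nth)
  have "?c (inverse ?L) * ?c ?L = ?c 1" unfolding cm [symmetric] by (simp add: inverse_mult_eq_1)
  also have "?c 1 = 1" by (rule fps_ext) simp
  also have "?c ?L = (1 - fps_const z * fps_X) * (1 - fps_const w * fps_X)"
  proof -
    have "(1 - fps_const z * fps_X) * (1 - fps_const w * fps_X) = 1 - fps_const (z + w) * fps_X + fps_const (z * w) * fps_X ^ 2"
      by (simp add: algebra_simps power2_eq_square fps_const_add [symmetric] fps_const_mult [symmetric] del: fps_const_add fps_const_mult)
    also have "\<dots> = 1 - fps_const (- complex_of_real \<alpha>) * fps_X + fps_const (complex_of_real \<beta>) * fps_X ^ 2" unfolding zw ..
    also have "\<dots> = ?c ?L" by (rule fps_ext) (auto simp: fps_X_power_nth)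
    finally show ?thesis ..
  qed
  finally have e: "?c (inverse ?L) * ((1 - fps_const z * fps_X) * (1 - fps_const w * fps_X)) = 1" .
  have "?c (inverse ?L) = ?c (inverse ?L) * ((Abs_fps (\<lambda>n. z ^ n) * (1 - fps_const z * fps_X)) * (Abs_fps (\<lambda>n. w ^ n) * (1 - fps_const w * fps_X)))"
    by (simp only: geometric_fps) simp
  also have "\<dots> = ?c (inverse ?L) * ((1 - fps_const z * fps_X) * (1 - fps_const w * fps_X)) * (Abs_fps (\<lambda>n. z ^ n) * Abs_fps (\<lambda>n. w ^ n))"
    by (simp only: mult_ac)
  also have "\<dots> = Abs_fps (\<lambda>n. z ^ n) * Abs_fps (\<lambda>n. w ^ n)" by (simp only: e) simp
  finally have "l1_bound (?c (inverse ?L)) (1 / (1 - norm z) * (1 / (1 - norm w)))"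
    using l1_bound_mult[OF l1_bound_geometric[OF n(1)] l1_bound_geometric[OF n(2)]] by simp
  then show ?thesis by (auto simp: l1_bound_def)
qed

lemma prod_one_minus_high_monomials:
  fixes f :: "real fps"
  assumes "finite E" "\<And>x. x \<in> E \<Longrightarrow> n < e x"
  shows "(f * (\<Prod>x\<in>E. 1 - fps_const (c x) * fps_X ^ e x)) $ n = f $ n"
  using assms
proof (induction E arbitrary: f rule: finite_induct)
  case (insert x E)
  let ?g = "\<Prod>x\<in>E. 1 - fps_const (c x) * fps_X ^ e x"
  have "f * (\<Prod>x\<in>insert x E. 1 - fps_const (c x) * fps_X ^ e x) = f * ?g - fps_X ^ e x * (fps_const (c x) * (f * ?g))"
    using insert.hyps by (simp add: algebra_simps)
  then have "(f * (\<Prod>x\<in>insert x E. 1 - fps_const (c x) * fps_X ^ e x)) $ n = (f * ?g) $ n"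
    using insert.prems[of x] by (simp add: fps_X_power_mult_nth)
  then show ?case using insert by simp
qed simp

text \<open>The polynomial \<open>L\<close> at \<open>u/q\<close>, with \<open>t\<close> in the
  place of the trace term: number of points minus \<open>1 + q\<close>.\<close>

definition Lser :: "real \<Rightarrow> real \<Rightarrow> real fps" where
  "Lser q t = 1 + fps_const (t / q) * fps_X + fps_const (1 / q) * fps_X ^ 2"

text \<open>Multiplied by \<open>1 - X\<close> this will be the Euler product over all places,
  rescaled so that the zero of interest is at 1.\<close>

definition Hser :: "real \<Rightarrow> real \<Rightarrow> real fps" where
  "Hser q t = (1 - fps_const (1 / q) * fps_X) * inverse (Lser q t)"

context
  fixes q t :: real
  assumes q_gt_1: "q > 1" and abs_t: "\<bar>t\<bar> \<le> q"
begin

lemma l1_linear: "l1_bound (1 - fps_const (1 / q) * fps_X) (1 + 1 / q)"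
proof -
  have "1 - fps_const (1 / q) * fps_X = 1 + fps_const (- (1 / q)) * fps_X ^ 1" by (simp flip: fps_const_neg)
  moreover have "norm (- (1 / q)) = 1 / q" using q_gt_1 by simp
  ultimately show ?thesis using l1_bound_add[OF l1_bound_one l1_bound_monomial[of "- (1 / q)" 1]] by (simp only:)
qed

lemma Hser_l1: "\<exists>B. l1_bound (Hser q t) B"
proof -
  have "\<bar>t / q\<bar> \<le> 1" using abs_t q_gt_1 by (simp add: abs_divide)
  moreover have "0 < 1 / q" "1 / q < 1" using q_gt_1 by simp_all
  ultimately have "0 < 1 / q" "1 / q < 1" "\<bar>t / q\<bar> < 1 + 1 / q" by linarith+
  from inverse_quadratic_l1[OF this] obtain B where "l1_bound (inverse (Lser q t)) B" unfolding Lser_def by blast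
  then show ?thesis unfolding Hser_def using l1_bound_mult[OF l1_linear] by blast
qed

text \<open>The inverse is \<open>L\<close> over \<open>(1 - u)(1 - u/q)\<close>. All of it has
  summable coefficients except \<open>1/(1 - u)\<close>, whose coefficients are constantly
  1.\<close>

lemma inverse_Hser_bounded: "\<exists>K. \<forall>n. inverse ((1 - fps_X) * Hser q t) $ n \<le> K"
proof -
  let ?l = "1 - fps_const (1 / q) * fps_X ^ 1"
  have geo: "inverse (1 - fps_X) = Abs_fps (\<lambda>n. 1 :: real)"
  proof -
    have "(1 - fps_X) * Abs_fps (\<lambda>n. 1 :: real) = 1" using geometric_fps[of "1 :: real"] by (simp add: mult.commute)
    then show ?thesis by (rule fps_inverse_unique)
  qed
  have "inverse ((1 - fps_X) * Hser q t) = inverse (1 - fps_X) * (inverse ?l * inverse (inverse (Lser q t)))"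
    by (simp add: Hser_def fps_inverse_mult)
  also have "inverse (inverse (Lser q t)) = (Lser q t)" by (rule fps_inverse_idempotent) (simp add: Lser_def)
  finally have e: "inverse ((1 - fps_X) * Hser q t) = (inverse ?l * (Lser q t)) * Abs_fps (\<lambda>n. 1)" unfolding geo by (simp only: mult_ac)
  have "l1_bound (Lser q t) (1 + norm (t / q) + norm (1 / q))"
    unfolding Lser_def using l1_bound_add[OF l1_bound_add[OF l1_bound_one l1_bound_monomial[of "t / q" 1]] l1_bound_monomial[of "1 / q" 2]] by simp
  moreover have "l1_bound (inverse ?l) (1 / (1 - 1 / q))" using q_gt_1 by (intro inverse_one_minus_monomial) auto
  ultimately obtain B where B: "l1_bound (inverse ?l * (Lser q t)) B" using l1_bound_mult by blast
  have "norm (inverse ((1 - fps_X) * Hser q t) $ n) \<le> B * 1" for n unfolding e by (rule norm_mult_nth_le[OF B]) simp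
  then have "inverse ((1 - fps_X) * Hser q t) $ n \<le> B" for n using abs_le_D1[of "inverse ((1 - fps_X) * Hser q t) $ n" B] by simp
  then show ?thesis by blast
qed

text \<open>The linear coefficient of the Euler product records the number of places of degree
  1.\<close>

lemma Hser_nth_1: "((1 - fps_X) * Hser q t) $ 1 = - 1 - 1 / q - t / q"
proof -
  have "inverse (Lser q t) $ 0 = 1" "Lser q t $ 0 = 1" by (simp_all add: Lser_def)
  moreover have "(inverse (Lser q t) * Lser q t) $ 1 = 0" by (simp add: Lser_def inverse_mult_eq_1)
  ultimately have "inverse (Lser q t) $ 1 = - (Lser q t $ 1)" by (simp add: fps_mult_nth_1)
  also have "Lser q t $ 1 = t / q" by (simp add: Lser_def fps_X_power_nth)
  finally have "inverse (Lser q t) $ 1 = - (t / q)" .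
  then show ?thesis using \<open>inverse (Lser q t) $ 0 = 1\<close> by (simp add: Hser_def fps_mult_nth_1)
qed

end

lemma one_minus_X_power_nth_1:
  "((1 - fps_const c * fps_X) ^ m :: real fps) $ 1 = - (real m * c)"
proof -
  have "((1 - fps_const c * fps_X) ^ m :: real fps) $ 1 = - (real m * c) \<and> ((1 - fps_const c * fps_X) ^ m :: real fps) $ 0 = 1"
    by (induction m) (auto simp: fps_mult_nth_1 algebra_simps)
  then show ?thesis ..
qed

lemma solve_num_points:
  fixes q t m :: real
  assumes "q > 1" "- 1 - 1 / q - t / q = - (m / q)" shows "m = 1 + q + t"
proof -
  have "m / q = (1 + q + t) / q" using assms by (simp add: add_divide_distrib)
  then show ?thesis using assms(1) by simp
qed

lemma unique_least_nonempty:
  fixes d :: "'p \<Rightarrow> nat"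
  shows "D \<noteq> {#} \<and> (\<exists>!p. p \<in># D \<and> (\<forall>r. r \<in># D \<longrightarrow> d p \<le> d r))
    \<longleftrightarrow> (\<exists>!p. p \<in># D \<and> (\<forall>r\<in>#D. d p \<le> d r))"
  by (auto simp: Ball_def)

section \<open>Points, places and the Euler product of the curve\<close>

context curve_field begin

abbreviation "q \<equiv> real (order R)"

text \<open>Minus the trace of Frobenius: each \<open>x\<close> carries
  \<open>1 + quad (cub x)\<close> affine points.\<close>

definition trace_sum :: real where "trace_sum = (\<Sum>x\<in>carrier R. quad (cub x))"

lemma card_ec_points: "real (card (ec_points R a b)) = 1 + q + trace_sum"
proof -
  let ?S = "{(x, y). x \<in> carrier R \<and> y \<in> carrier R \<and> y [^] (2::nat) = x [^] (3::nat) \<oplus> a \<otimes> x \<oplus> b}"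
  have eq: "?S = (SIGMA x:carrier R. {y \<in> carrier R. y \<otimes> y = cub x})"
    by (auto simp: cub_def numeral_eq_Suc)
  have fin: "finite ?S" unfolding eq using finite_carrier by auto
  have "card (ec_points R a b) = Suc (card (Some ` ?S))"
    unfolding ec_points_def using fin by (subst card_insert_disjoint) auto
  also have "card (Some ` ?S) = card ?S" by (rule card_image) simp
  finally have "real (card (ec_points R a b)) = 1 + real (card ?S)" by simp
  also have "real (card ?S) = (\<Sum>x\<in>carrier R. real (card {y \<in> carrier R. y \<otimes> y = cub x}))"
    unfolding eq using finite_carrier by (subst card_SigmaI) auto
  also have "\<dots> = (\<Sum>x\<in>carrier R. 1 + quad (cub x))" by (rule sum.cong) (simp_all add: card_sqrt)
  finally show ?thesis by (simp add: sum.distrib order_def trace_sum_def)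
qed

lemma q_gt_1: "q > 1" using order_gt_1[OF finite_carrier] by simp

lemma abs_trace_sum: "\<bar>trace_sum\<bar> \<le> q"
proof -
  have "\<bar>trace_sum\<bar> \<le> (\<Sum>x\<in>carrier R. \<bar>quad (cub x)\<bar>)" unfolding trace_sum_def by (rule sum_abs)
  also have "\<dots> \<le> (\<Sum>x\<in>carrier R. 1)" by (rule sum_mono) (simp add: qc_def)
  finally show ?thesis by (simp add: order_def)
qed

abbreviation "Lfps \<equiv> Lser q trace_sum"

abbreviation "Hfps \<equiv> Hser q trace_sum"

abbreviation "plc P \<equiv> FF.nonunits ` lying_over P"

abbreviation "fac v \<equiv> 1 - fps_const (1 / q ^ place_degree F C v) * fps_X ^ place_degree F C v"

lemma card_plc_le: assumes P: "P \<in> MIrr" shows "card (plc P) \<le> 2"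
proof -
  obtain \<chi> :: "'a list \<Rightarrow> real" where "\<forall>P\<in>MIrr. real (card (sroots P)) = 1 + \<chi> P" "\<forall>g. \<chi> g \<in> {-1, 0, 1}"
    using exists_quadratic_character unfolding sroots_def by blast
  then have "real (card (sroots P)) = 1 + \<chi> P" "\<chi> P \<le> 1" using P by (auto dest: spec[of _ P])
  then have "real (card (sroots P)) \<le> 2" by linarith
  then show ?thesis using over_places(2)[OF P] by simp
qed

text \<open>With \<open>y\<close> the term of degree \<open>d = degree P\<close>, the local factor
  is \<open>1 - y^2\<close> in the inert, \<open>1 - y\<close> in the ramified and
  \<open>(1 - y)^2\<close> in the split case. These are the values of
  \<open>(1 - y)(1 - \<chi> y)\<close> at -1, 0 and 1.\<close>

lemma prod_fac_plc:
  assumes P: "P \<in> MIrr" and ch: "real (card (sroots P)) = 1 + \<chi>" "\<chi> \<in> {-1, 0, 1}"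
  shows "(\<Prod>v\<in>plc P. fac v) = (1 - fps_const (1 / q ^ degree P) * fps_X ^ degree P)
      * (1 - fps_const (\<chi> / q ^ degree P) * fps_X ^ degree P)"
proof -
  let ?d = "degree P"
  let ?y = "fps_const (1 / q ^ ?d) * fps_X ^ ?d"
  show ?thesis
  proof (cases "sroots P = {}")
    case True
    then have ch1: "\<chi> = -1" using ch by simp
    have "(\<Prod>v\<in>plc P. fac v) = (\<Prod>v\<in>plc P. 1 - fps_const (1 / q ^ (2 * ?d)) * fps_X ^ (2 * ?d))"
      by (rule prod.cong) (use over_places(3)[OF P] True in auto)
    also have "\<dots> = 1 - fps_const (1 / q ^ (2 * ?d)) * fps_X ^ (2 * ?d)" using over_places(2)[OF P] True by simp
    also have "fps_const (1 / q ^ (2 * ?d)) * fps_X ^ (2 * ?d) = ?y * ?y"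
    proof -
      have "fps_const (1 / q ^ (2 * ?d)) = fps_const (1 / q ^ ?d) * fps_const (1 / q ^ ?d)" by (simp add: mult_2 power_add)
      moreover have "fps_X ^ (2 * ?d) = fps_X ^ ?d * (fps_X ^ ?d :: real fps)" by (simp only: mult_2 power_add)
      ultimately show ?thesis by (simp only: mult_ac)
    qed
    also have "1 - ?y * ?y = (1 - ?y) * (1 + ?y)" by (simp only: ring_distribs) simp
    also have "1 + ?y = 1 - fps_const (\<chi> / q ^ ?d) * fps_X ^ ?d" unfolding ch1 by (simp flip: fps_const_neg)
    finally show ?thesis .
  next
    case False
    then have "card (sroots P) > 0" using finite_sroots by (simp add: card_gt_0_iff)
    then have "\<chi> = 0 \<or> \<chi> = 1" using ch by auto
    have "(\<Prod>v\<in>plc P. fac v) = (\<Prod>v\<in>plc P. 1 - ?y)"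
      by (rule prod.cong) (use over_places(3)[OF P] False in auto)
    also have "\<dots> = (1 - ?y) ^ card (sroots P)" using over_places(2)[OF P] False by simp
    finally have e: "(\<Prod>v\<in>plc P. fac v) = (1 - ?y) ^ card (sroots P)" .
    from \<open>\<chi> = 0 \<or> \<chi> = 1\<close> show ?thesis
    proof
      assume "\<chi> = 0"
      then have "card (sroots P) = 1" using ch by simp
      then show ?thesis unfolding e using \<open>\<chi> = 0\<close> by simp
    next
      assume "\<chi> = 1"
      then have "card (sroots P) = 2" using ch by simp
      then show ?thesis unfolding e using \<open>\<chi> = 1\<close> by (simp add: Power.power2_eq_square)
    qed
  qed
qed

text \<open>The factor in front belongs to the place at infinity. The two local factors at each
  \<open>P\<close> assemble into two inverse series: the trivial weight gives
  \<open>1/(1 - u)\<close>, as the \<open>q^n\<close> monic polynomials of degree \<open>n\<close>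
  each weigh \<open>1/q^n\<close>, and the character gives \<open>Lser\<close>.\<close>

lemma euler_product_nth:
  assumes n: "n \<le> N"
  shows "((1 - fps_const (1 / q) * fps_X) * (\<Prod>P\<in>irrs_le N. \<Prod>v\<in>plc P. fac v)) $ n = ((1 - fps_X) * Hfps) $ n"
proof -
  obtain \<chi> :: "'a list \<Rightarrow> real" where ch: "\<chi> [\<one>] = 1"
    "\<And>g h. g \<in> Mon \<Longrightarrow> h \<in> Mon \<Longrightarrow> \<chi> (g .* h) = \<chi> g * \<chi> h"
    "\<And>P. P \<in> MIrr \<Longrightarrow> real (card (sroots P)) = 1 + \<chi> P"
    "(\<Sum>g\<in>mons 1. \<chi> g) = trace_sum" "(\<Sum>g\<in>mons 2. \<chi> g) = q" "\<And>n. n \<ge> 3 \<Longrightarrow> (\<Sum>g\<in>mons n. \<chi> g) = 0"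
    "\<And>g. \<chi> g \<in> {-1, 0, 1}"
    using exists_quadratic_character unfolding sroots_def trace_sum_def by blast
  let ?Y = "irrs_le N"
  define w1 where "w1 g = 1 / q ^ degree g" for g :: "'a list"
  define w2 where "w2 g = \<chi> g / q ^ degree g" for g
  have Y: "finite ?Y" "?Y \<subseteq> MIrr" using finite_irrs_le[OF finite_carrier] by (auto simp: irrs_le_def)
  have m: "w1 (p .* r) = w1 p * w1 r" "w2 (p .* r) = w2 p * w2 r" if "p \<in> Mon" "r \<in> Mon" for p r
    using Mon_degree_mult[OF that] ch(2)[OF that] by (simp_all add: w1_def w2_def power_add)
  note z1 = zeta_fps_euler[OF finite_carrier _ m(1) Y] and z2 = zeta_fps_euler[OF finite_carrier _ m(2) Y]
  let ?P1 = "\<Prod>P\<in>?Y. 1 - fps_const (w1 P) * fps_X ^ degree P" and ?P2 = "\<Prod>P\<in>?Y. 1 - fps_const (w2 P) * fps_X ^ degree P"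
  have e1: "zeta_fps w1 ?Y * ?P1 = 1" by (rule z1) (simp_all add: w1_def)
  have e2: "zeta_fps w2 ?Y * ?P2 = 1" by (rule z2) (simp_all add: w2_def ch)
  have sm: "sum w (gmon ?Y i) = sum w (mons i)" if "i \<le> n" for w :: "'a list \<Rightarrow> real" and i using gmon_irrs_le[of i N] that n by simp
  have c1: "zeta_fps w1 ?Y $ i = 1" if "i \<le> n" for i
  proof -
    have "sum w1 (mons i) = (\<Sum>g\<in>mons i. 1 / q ^ i)" by (rule sum.cong) (auto simp: w1_def mons_def)
    then show ?thesis using sm[OF that] card_mons[OF finite_carrier, of i] q_gt_1 by (simp add: zeta_fps_def)
  qed
  have c2: "zeta_fps w2 ?Y $ i = Lfps $ i" if "i \<le> n" for i
  proof -
    have "sum w2 (mons i) = (\<Sum>g\<in>mons i. \<chi> g) / q ^ i"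
      unfolding sum_divide_distrib by (rule sum.cong) (auto simp: w2_def mons_def)
    then have e: "zeta_fps w2 ?Y $ i = (\<Sum>g\<in>mons i. \<chi> g) / q ^ i" using sm[OF that] by (simp add: zeta_fps_def)
    have "mons 0 = {[\<one>]}" by (auto simp: mons_eq)
    consider "i = 0" | "i = 1" | "i = 2" | "i \<ge> 3" by linarith
    then show ?thesis
    proof cases
      case 1
      then show ?thesis unfolding e using ch(1) \<open>mons 0 = {[\<one>]}\<close> by (simp add: Lser_def)
    next
      case 2
      then show ?thesis unfolding e using ch(4) by (simp add: Lser_def fps_X_power_nth)
    next
      case 3
      then show ?thesis unfolding e using ch(5) q_gt_1 by (simp add: Lser_def fps_X_power_nth Power.power2_eq_square)
    next
      case 4
      then show ?thesis unfolding e using ch(6) by (simp add: Lser_def fps_X_power_nth)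
    qed
  qed
  have "(\<Prod>P\<in>?Y. \<Prod>v\<in>plc P. fac v) = (\<Prod>P\<in>?Y. (1 - fps_const (w1 P) * fps_X ^ degree P) * (1 - fps_const (w2 P) * fps_X ^ degree P))"
    by (rule prod.cong[OF refl]) (use prod_fac_plc[OF _ ch(3) ch(7)] Y(2) in \<open>auto simp: w1_def w2_def\<close>)
  also have "\<dots> = ?P1 * ?P2" by (rule prod.distrib)
  finally have pp: "(\<Prod>P\<in>?Y. \<Prod>v\<in>plc P. fac v) = ?P1 * ?P2" .
  have z0: "zeta_fps w1 ?Y $ 0 = 1" "zeta_fps w2 ?Y $ 0 = 1" using c1[of 0] c2[of 0] by (simp_all add: Lser_def)
  have i1: "?P1 = inverse (zeta_fps w1 ?Y)" "?P2 = inverse (zeta_fps w2 ?Y)"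
    using fps_inverse_unique[OF e1] fps_inverse_unique[OF e2] by (simp_all only:)
  have geo: "inverse (Abs_fps (\<lambda>n. 1 :: real)) = 1 - fps_X"
  proof -
    have "Abs_fps (\<lambda>n. 1 :: real) * (1 - fps_X) = 1" using geometric_fps[of "1 :: real"] by simp
    then show ?thesis by (rule fps_inverse_unique)
  qed
  have "((1 - fps_const (1 / q) * fps_X) * (?P1 * ?P2)) $ n
      = ((1 - fps_const (1 / q) * fps_X) * (inverse (Abs_fps (\<lambda>n. 1)) * inverse Lfps)) $ n"
    unfolding i1
  proof (intro fps_mult_nth_cong refl)
    fix i j assume "i \<le> n" "j \<le> i"
    show "inverse (zeta_fps w1 ?Y) $ j = inverse (Abs_fps (\<lambda>n. 1)) $ j"
      by (rule fps_inverse_nth_cong) (use z0 c1 \<open>i \<le> n\<close> \<open>j \<le> i\<close> in auto)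
    show "inverse (zeta_fps w2 ?Y) $ j = inverse Lfps $ j"
      by (rule fps_inverse_nth_cong) (use z0 c2 \<open>i \<le> n\<close> \<open>j \<le> i\<close> in \<open>auto simp: Lser_def\<close>)
  qed
  then show ?thesis unfolding pp geo Hser_def by (simp only: mult_ac)
qed

theorem sum_distinguishable_function_field:
  "(\<lambda>n. \<Sum>D | D \<in> distinguishable_divisors F C \<and> 2 \<le> div_degree F C D \<and> div_degree F C D \<le> n.
      real_of_int (div_moebius D) / real (div_norm F C D)) \<longlonglongrightarrow> real (card (ec_points R a b)) / q - 1"
proof -
  obtain v where v: "places F C = insert v (\<Union>P\<in>MIrr. plc P)" "place_degree F C v = 1" "v \<notin> (\<Union>P\<in>MIrr. plc P)"
    and dj: "\<And>P P'. P \<in> MIrr \<Longrightarrow> P' \<in> MIrr \<Longrightarrow> P \<noteq> P' \<Longrightarrow> plc P \<inter> plc P' = {}"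
    using places_classification by metis
  let ?deg = "place_degree F C"
  \<comment> \<open>\<open>S N\<close> contains all places of degree at most \<open>N\<close>. Inert
    irreducibles also bring in places of degree up to \<open>2N\<close>, but factors of degree above
    \<open>N\<close> do not change the coefficients up to \<open>N\<close>.\<close>
  define S where "S N = insert v (\<Union>P\<in>irrs_le N. plc P)" for N
  have Sfin: "finite (S N)" for N
    unfolding S_def using finite_irrs_le[OF finite_carrier, of N] over_places(1) by (auto simp: irrs_le_def)
  have Spl: "S N \<subseteq> places F C" for N unfolding S_def v(1) by (auto simp: irrs_le_def)
  have deg_ge: "degree P \<le> ?deg w" if "P \<in> MIrr" "w \<in> plc P" for P w using over_places(3)[OF that] by auto
  have Sle: "{w \<in> places F C. ?deg w \<le> N} \<subseteq> S N" for N
  proof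
    fix w assume "w \<in> {w \<in> places F C. ?deg w \<le> N}"
    then have w: "w \<in> places F C" "?deg w \<le> N" by auto
    show "w \<in> S N"
    proof (cases "w = v")
      case False
      then obtain P where P: "P \<in> MIrr" "w \<in> plc P" using w(1) unfolding v(1) by blast
      then have "P \<in> irrs_le N" using deg_ge[OF P] w(2) unfolding irrs_le_def by simp
      then show ?thesis using P(2) unfolding S_def by blast
    qed (simp add: S_def)
  qed
  interpret G: graded_primes "places F C" ?deg q
  proof
    show "?deg w > 0" if wp: "w \<in> places F C" for w
    proof (cases "w = v")
      case False
      then obtain P where P: "P \<in> MIrr" "w \<in> plc P" using wp unfolding v(1) by blast
      then show ?thesis using deg_ge[OF P] MIrrD(3)[OF P(1)] by linarith
    qed (simp add: v(2))
    show "finite {w \<in> places F C. ?deg w = d}" for d by (rule finite_subset[OF _ Sfin[of d]]) (use Sle[of d] in auto)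
  qed (rule q_gt_1)
  \<comment> \<open>The constant is \<open>1 + 2 + 4\<close>: the place at infinity, at most two
    places over each irreducible of degree \<open>d\<close>, and the places over irreducibles of
    degree \<open>d/2\<close>, where halving the degree doubles the contribution.\<close>
  have num: "real (G.num d) / q ^ d \<le> 7 / real d" if d: "d > 0" for d
  proof -
    let ?I = "\<lambda>e. {P \<in> MIrr. degree P = e}"
    let ?U = "\<lambda>e. \<Union>P\<in>?I e. plc P"
    have fI: "finite (?I e)" for e by (rule finite_subset[OF _ finite_irrs_le[OF finite_carrier, of e]]) (auto simp: irrs_le_def)
    have cU: "finite (?U e)" "card (?U e) \<le> 2 * card (?I e)" for e
    proof -
      show "finite (?U e)" using fI over_places(1) by auto
      have "card (?U e) \<le> (\<Sum>P\<in>?I e. card (plc P))" using fI by (rule card_UN_le)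
      also have "\<dots> \<le> (\<Sum>P\<in>?I e. 2)" by (rule sum_mono) (use card_plc_le in auto)
      finally show "card (?U e) \<le> 2 * card (?I e)" by simp
    qed
    have sub: "{w \<in> places F C. ?deg w = d} \<subseteq> (if d = 1 then {v} else {}) \<union> ?U d \<union> (if even d then ?U (d div 2) else {})"
    proof
      fix w assume "w \<in> {w \<in> places F C. ?deg w = d}"
      then have w: "w \<in> places F C" "?deg w = d" by auto
      show "w \<in> (if d = 1 then {v} else {}) \<union> ?U d \<union> (if even d then ?U (d div 2) else {})"
      proof (cases "w = v")
        case False
        then obtain P where P: "P \<in> MIrr" "w \<in> plc P" using w(1) unfolding v(1) by blast
        have "d = (if sroots P = {} then 2 * degree P else degree P)" using over_places(3)[OF P] w(2) by simp
        then show ?thesis using P by (cases "sroots P = {}") auto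
      qed (use w v(2) in auto)
    qed
    have "G.num d \<le> card ((if d = 1 then {v} else {}) \<union> ?U d \<union> (if even d then ?U (d div 2) else {}))"
      unfolding G.num_def by (rule card_mono[OF _ sub]) (use cU(1) in auto)
    also have "\<dots> \<le> (if d = 1 then 1 else 0) + 2 * card (?I d) + (if even d then 2 * card (?I (d div 2)) else 0)"
      by (intro order_trans[OF card_Un_le] add_mono) (use cU(2) in auto)
    finally have le: "G.num d \<le> (if d = 1 then 1 else 0) + 2 * card (?I d) + (if even d then 2 * card (?I (d div 2)) else 0)" .
    have b1: "real (card (?I e)) * real e \<le> q ^ e" if "e > 0" for e
      using of_nat_le_iff[where 'a = real, THEN iffD2, OF card_MIrr[OF that]] by (simp only: semiring_1_class.of_nat_mult semiring_1_class.of_nat_power)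
    have q1: "1 \<le> q ^ d" using q_gt_1 by simp
    have t1: "(if d = 1 then 1 else 0) * real d \<le> 1" by simp
    have t3: "(if even d then 2 * real (card (?I (d div 2))) else 0) * real d \<le> 4 * q ^ d"
    proof (cases "even d")
      case True
      then obtain e where e: "d = 2 * e" by auto
      have "2 * real (card (?I e)) * real d = 4 * (real (card (?I e)) * real e)" by (simp add: e)
      also have "\<dots> \<le> 4 * q ^ e" using b1[of e] d e by simp
      also have "q ^ e \<le> q ^ d" using q_gt_1 e by (intro power_increasing) auto
      finally show ?thesis using e by simp
    qed (use q1 in simp)
    have "real (G.num d) * real d \<le> ((if d = 1 then 1 else 0) + 2 * real (card (?I d)) + (if even d then 2 * real (card (?I (d div 2))) else 0)) * real d"
      using le by (intro mult_right_mono) (auto simp flip: of_nat_le_iff split: if_splits)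
    also have "\<dots> \<le> 7 * q ^ d" using t1 t3 b1[OF d] q1 unfolding distrib_right by linarith
    finally show ?thesis using d q_gt_1 by (simp add: field_simps)
  qed
  have M: "((1 - fps_X) * Hfps) $ n = (\<Prod>d\<in>{1..N}. G.factor d) $ n" if n: "n \<le> N" for n N
  proof -
    let ?T = "{w \<in> places F C. 0 < ?deg w \<and> ?deg w \<le> N}"
    have T: "?T \<subseteq> S N" using Sle by auto
    let ?U = "\<Union>P\<in>irrs_le N. plc P"
    have eT: "(\<Prod>d\<in>{1..N}. G.factor d) = (\<Prod>w\<in>?T. fac w)"
      using G.prod_factor_eq[of 0 N] by (simp add: atLeastSucAtMost_greaterThanAtMost [symmetric])
    have "finite (S N - ?T)" using Sfin by simp
    moreover have "n < ?deg w" if "w \<in> S N - ?T" for w using that Spl[of N] G.deg_pos[of w] n by (auto simp: not_le)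
    ultimately have eS: "((\<Prod>w\<in>?T. fac w) * (\<Prod>w\<in>S N - ?T. fac w)) $ n = (\<Prod>w\<in>?T. fac w) $ n"
      by (rule prod_one_minus_high_monomials)
    have "v \<notin> ?U" using v(3) by (auto simp: irrs_le_def)
    moreover have "finite ?U" using Sfin[of N] by (simp add: S_def)
    ultimately have eU: "(\<Prod>w\<in>S N. fac w) = fac v * (\<Prod>w\<in>?U. fac w)" unfolding S_def by (rule prod.insert[rotated])
    have eP: "(\<Prod>w\<in>?U. fac w) = (\<Prod>P\<in>irrs_le N. \<Prod>w\<in>plc P. fac w)"
      by (rule prod.UNION_disjoint[OF finite_irrs_le[OF finite_carrier]]) (use over_places(1) dj in \<open>auto simp: irrs_le_def\<close>)
    have eD: "(\<Prod>w\<in>?T. fac w) * (\<Prod>w\<in>S N - ?T. fac w) = (\<Prod>w\<in>S N. fac w)"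
      by (subst mult.commute) (rule prod.subset_diff[OF T Sfin, symmetric])
    have ev: "fac v = 1 - fps_const (1 / q) * fps_X" unfolding v(2) by simp
    show ?thesis unfolding eT eS [symmetric] eD eU eP ev by (rule euler_product_nth[OF n, symmetric])
  qed
  \<comment> \<open>Places of degree 1 are counted by comparing linear coefficients of the Euler
    product, and the count agrees with the point count because both equal
    \<open>1 + q + trace_sum\<close>.\<close>
  have "real (G.num 1) = real (card (ec_points R a b))"
  proof -
    have "((1 - fps_X) * Hfps) $ 1 = G.factor 1 $ 1" using M[of 1 1] by simp
    also have "\<dots> = - (real (G.num 1) / q)"
      unfolding G.factor_def using one_minus_X_power_nth_1[of "1 / q" "G.num 1"] by simp
    also have "((1 - fps_X) * Hfps) $ 1 = - 1 - 1 / q - trace_sum / q" by (rule Hser_nth_1[OF q_gt_1 abs_trace_sum])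
    finally have "real (G.num 1) = 1 + q + trace_sum" by (rule solve_num_points[OF q_gt_1])
    then show ?thesis using card_ec_points by simp
  qed
  moreover obtain B where B: "l1_bound Hfps B" using Hser_l1[OF q_gt_1 abs_trace_sum] by blast
  moreover obtain K where K: "\<And>n. inverse ((1 - fps_X) * Hfps) $ n \<le> K" using inverse_Hser_bounded[OF q_gt_1 abs_trace_sum] by blast
  have lim: "(\<lambda>n. \<Sum>D | set_mset D \<subseteq> places F C \<and> G.uniquely_least (set_mset D) \<and> 2 \<le> G.mdeg D \<and> G.mdeg D \<le> n.
           real_of_int (div_moebius D) / q ^ G.mdeg D) \<longlonglongrightarrow> real (G.num 1) / q - 1"
    by (rule G.sum_distinguishable_tendsto[OF num B K M])
  have md: "G.mdeg D = div_degree F C D" for D by (simp add: G.mdeg_def div_degree_def)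
  have dd: "D \<in> distinguishable_divisors F C \<longleftrightarrow> set_mset D \<subseteq> places F C \<and> G.uniquely_least (set_mset D)" for D
    unfolding distinguishable_divisors_def effective_divisors_def distinguishable_def G.uniquely_least_def
      mem_Collect_eq unique_least_nonempty ..
  have nm: "real (div_norm F C D) = q ^ div_degree F C D" for D by (simp add: div_norm_def C_card)
  show ?thesis using lim \<open>real (G.num 1) = real (card (ec_points R a b))\<close> unfolding dd nm md conj_assoc by simp
qed

end

text \<open>\<open>lim\<close> of a divergent sequence is an unspecified value, so convergence is
  asserted along with the formula.\<close>

theorem theorem6p1:
  fixes K :: "('a, 'm) ring_scheme" and A B a b :: 'a and p :: "'a set" and ap :: int
  defines "k \<equiv> residue_field K p"
  defines "q \<equiv> order k"
  defines "F \<equiv> function_field k (reduce K p a) (reduce K p b)"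
  defines "C \<equiv> constant_field k (reduce K p a) (reduce K p b)"
  assumes "number_field K"
    and "elliptic_curve K A B"
    and "integral_model K A B a b"
    and "good_prime K a b p"
    and "int (card (ec_points k (reduce K p a) (reduce K p b))) = 1 - ap + int q"
  defines "S \<equiv> (\<lambda>n::nat. \<Sum>D | D \<in> distinguishable_divisors F C \<and>
                              2 \<le> div_degree F C D \<and> div_degree F C D \<le> n.
                            real_of_int (div_moebius D) / real (div_norm F C D))"
  shows "convergent S \<and> real_of_int ap = 1 - real q * lim S"
proof -
  interpret N: number_field_prime K p
    using \<open>number_field K\<close> \<open>good_prime K a b p\<close> by (intro number_field_prime.intro) (auto simp: good_prime_def)
  have cf: "curve_field k (reduce K p a) (reduce K p b)"
    unfolding k_def using \<open>integral_model K A B a b\<close> \<open>good_prime K a b p\<close>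
    by (intro N.curve_field_residue) (auto simp: integral_model_def good_prime_def)
  let ?N = "real (card (ec_points k (reduce K p a) (reduce K p b)))"
  have lim: "S \<longlonglongrightarrow> ?N / real q - 1"
    unfolding S_def F_def C_def q_def by (rule curve_field.sum_distinguishable_function_field[OF cf])
  have q: "real q > 1" unfolding q_def by (rule curve_field.q_gt_1[OF cf])
  have "?N = real_of_int (1 - ap + int q)"
    using \<open>int (card (ec_points k (reduce K p a) (reduce K p b))) = 1 - ap + int q\<close> by (metis of_int_of_nat_eq)
  then have "real_of_int ap = 1 - real q * (?N / real q - 1)" using q by (simp add: right_diff_distrib)
  then show ?thesis using lim by (auto simp: convergent_def limI)
qed


end
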